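(* Let $n\geq 1$ and let $M\subset \mathbb{C}^{n+1}$ be a connected real-analytic hypersurface whose Levi form is nondegenerate at some point of $M$. Then for every point $p\in M$ there exists an integer $k=k(M,p)$ such that germs at $p$ of local real-analytic CR automorphisms of $M$ are uniquely determined by their $k$-jets at $p$; that is, if $H_1,H_2\in \mathrm{Aut}(M,p)$ have the same $k$-jet at $p$, then $H_1=H_2$ as germs at $p$.
   Context: For a real-analytic hypersurface $M\subset\mathbb{C}^{n+1}$ and $p\in M$, $\mathrm{Aut}(M,p)$ denotes the group of germs at $p$ of real-analytic CR automorphisms of $M$ fixing $p$ or, equivalently, the group of germs at $p$ of biholomorphisms of $\mathbb{C}^{n+1}$ that fix $p$ and send the germ of $M$ at $p$ into itself. The $k$-jet at $p$ of a germ of a holomorphic map is its Taylor polynomial of order $k$ at $p$. *)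

theory Defs
  imports "HOL-Analysis.Analysis"
begin

text \<open>
  Complex Euclidean space is \<^typ>\<open>complex ^ 'n\<close>; it is used both as a complex vector space
  (scalar multiplication \<open>*s\<close>) and as the underlying real Euclidean space.
\<close>

text \<open>
  Local expansion into a power series in the real coordinates \<open>(x - a) \<bullet> b\<close>, indexed by the
  multi-indices \<open>\<alpha> : Basis \<rightarrow> nat\<close>; \<open>has_sum\<close> is unconditional (hence absolute) convergence.
\<close>

definition real_analytic_at :: "('a::euclidean_space \<Rightarrow> real) \<Rightarrow> 'a \<Rightarrow> bool" where
  "real_analytic_at f a \<longleftrightarrow>
     (\<exists>c :: ('a \<Rightarrow> nat) \<Rightarrow> real. \<exists>r>0. \<forall>x\<in>ball a r.
        ((\<lambda>\<alpha>. c \<alpha> * (\<Prod>b\<in>Basis. ((x - a) \<bullet> b) ^ \<alpha> b)) has_sum f x)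
          (Basis \<rightarrow>\<^sub>E (UNIV :: nat set)))"

definition real_analytic_on :: "('a::euclidean_space \<Rightarrow> real) \<Rightarrow> 'a set \<Rightarrow> bool" where
  "real_analytic_on f U \<longleftrightarrow> (\<forall>a\<in>U. real_analytic_at f a)"

definition local_defining_function ::
    "(complex ^ 'n) set \<Rightarrow> complex ^ 'n \<Rightarrow> (complex ^ 'n) set \<Rightarrow> (complex ^ 'n \<Rightarrow> real) \<Rightarrow> bool" where
  "local_defining_function M p U \<rho> \<longleftrightarrow>
     open U \<and> p \<in> U \<and> real_analytic_on \<rho> U \<and>
     (\<forall>z\<in>U. frechet_derivative \<rho> (at z) \<noteq> (\<lambda>v. 0)) \<and>
     M \<inter> U = {z\<in>U. \<rho> z = 0}"

definition real_analytic_hypersurface :: "(complex ^ 'n) set \<Rightarrow> bool" where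
  "real_analytic_hypersurface M \<longleftrightarrow> (\<forall>p\<in>M. \<exists>U \<rho>. local_defining_function M p U \<rho>)"

text \<open>
  With \<open>z\<^sub>j = x\<^sub>j + i y\<^sub>j\<close>: the operators \<open>\<partial>/\<partial>z\<^sub>j = (\<partial>/\<partial>x\<^sub>j - i \<partial>/\<partial>y\<^sub>j) / 2\<close> and
  \<open>\<partial>/\<partial>(cnj z\<^sub>j) = (\<partial>/\<partial>x\<^sub>j + i \<partial>/\<partial>y\<^sub>j) / 2\<close>.
\<close>

definition wirtinger :: "'n \<Rightarrow> (complex ^ 'n \<Rightarrow> complex) \<Rightarrow> complex ^ 'n \<Rightarrow> complex" where
  "wirtinger j f z =
     (frechet_derivative f (at z) (axis j 1) - \<i> * frechet_derivative f (at z) (axis j \<i>)) / 2"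

definition wirtinger_bar :: "'n \<Rightarrow> (complex ^ 'n \<Rightarrow> complex) \<Rightarrow> complex ^ 'n \<Rightarrow> complex" where
  "wirtinger_bar j f z =
     (frechet_derivative f (at z) (axis j 1) + \<i> * frechet_derivative f (at z) (axis j \<i>)) / 2"

text \<open>The space of (1,0) tangent vectors at \<open>p\<close> of the level set of \<open>\<rho>\<close>.\<close>

definition holomorphic_tangent_space ::
    "(complex ^ 'n \<Rightarrow> real) \<Rightarrow> complex ^ 'n \<Rightarrow> (complex ^ 'n) set" where
  "holomorphic_tangent_space \<rho> p =
     {v. (\<Sum>j\<in>UNIV. wirtinger j (\<lambda>z. of_real (\<rho> z)) p * v $ j) = 0}"

definition levi_form ::
    "(complex ^ 'n \<Rightarrow> real) \<Rightarrow> complex ^ 'n \<Rightarrow> complex ^ 'n \<Rightarrow> complex ^ 'n \<Rightarrow> complex" where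
  "levi_form \<rho> p v w =
     (\<Sum>j\<in>UNIV. \<Sum>k\<in>UNIV.
        wirtinger j (wirtinger_bar k (\<lambda>z. of_real (\<rho> z))) p * v $ j * cnj (w $ k))"

text \<open>
  Another choice of defining function multiplies the Levi form at \<open>p\<close> by a nonzero real number
  and does not change the tangent space, so the choice of \<open>\<rho>\<close> does not matter below.
\<close>

definition levi_nondegenerate_at :: "(complex ^ 'n) set \<Rightarrow> complex ^ 'n \<Rightarrow> bool" where
  "levi_nondegenerate_at M p \<longleftrightarrow>
     (\<exists>U \<rho>. local_defining_function M p U \<rho> \<and>
        (\<forall>v\<in>holomorphic_tangent_space \<rho> p.
           (\<forall>w\<in>holomorphic_tangent_space \<rho> p. levi_form \<rho> p v w = 0) \<longrightarrow> v = 0))"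

definition holomorphic_map_on ::
    "(complex ^ 'n \<Rightarrow> complex ^ 'm) \<Rightarrow> (complex ^ 'n) set \<Rightarrow> bool" where
  "holomorphic_map_on F U \<longleftrightarrow>
     open U \<and>
     (\<forall>z\<in>U. \<exists>D. (F has_derivative D) (at z) \<and> (\<forall>c v. D (c *s v) = c *s D v))"

definition biholomorphic_near :: "(complex ^ 'n \<Rightarrow> complex ^ 'n) \<Rightarrow> complex ^ 'n \<Rightarrow> bool" where
  "biholomorphic_near H p \<longleftrightarrow>
     (\<exists>U G. p \<in> U \<and> holomorphic_map_on H U \<and> holomorphic_map_on G (H ` U) \<and>
        (\<forall>z\<in>U. G (H z) = z))"

text \<open>
  Germs at \<open>p\<close> are handled through representatives, which are arbitrary away from \<open>p\<close>; equality
  of the germs represented by two functions is the relation \<open>germ_eq\<close>.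
\<close>

definition germ_eq :: "'a::topological_space \<Rightarrow> ('a \<Rightarrow> 'b) \<Rightarrow> ('a \<Rightarrow> 'b) \<Rightarrow> bool" where
  "germ_eq p F G \<longleftrightarrow> (\<forall>\<^sub>F z in nhds p. F z = G z)"

definition Aut :: "(complex ^ 'n) set \<Rightarrow> complex ^ 'n \<Rightarrow> (complex ^ 'n \<Rightarrow> complex ^ 'n) set" where
  "Aut M p = {H. biholomorphic_near H p \<and> H p = p \<and> (\<forall>\<^sub>F z in nhds p. z \<in> M \<longrightarrow> H z \<in> M)}"

text \<open>
  The Taylor polynomial of order \<open>k\<close> at \<open>p\<close>, in its symmetric form: the homogeneous part of
  degree \<open>m\<close> is \<open>1/m!\<close> times the sum, over all sequences \<open>j\<^sub>1, \<dots>, j\<^sub>m\<close> of coordinate indices, of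
  \<open>\<partial>\<^sup>mF/\<partial>z\<^bsub>j\<^sub>1\<^esub>\<dots>\<partial>z\<^bsub>j\<^sub>m\<^esub> (p) (z - p)\<^bsub>j\<^sub>1\<^esub> \<dots> (z - p)\<^bsub>j\<^sub>m\<^esub>\<close>; collecting equal monomials
  gives the usual coefficients \<open>\<partial>\<^sup>\<alpha>F(p)/\<alpha>!\<close>. On holomorphic functions \<^const>\<open>wirtinger\<close> is the
  complex partial derivative.
\<close>

definition jet ::
    "nat \<Rightarrow> complex ^ 'n \<Rightarrow> (complex ^ 'n \<Rightarrow> complex ^ 'm) \<Rightarrow> complex ^ 'n \<Rightarrow> complex ^ 'm" where
  "jet k p F z =
     (\<chi> i. \<Sum>m\<le>k. (\<Sum>js\<in>{js :: 'n list. length js = m}.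
              foldr wirtinger js (\<lambda>x. F x $ i) p * (\<Prod>j\<leftarrow>js. (z - p) $ j)) / fact m)"

end

theory Submission
  imports Defs "HOL-Complex_Analysis.Complex_Analysis"
begin

text \<open>
  If no jet order suffices at \<open>p\<close>, then quotients of pairs of automorphisms with equal jets
  give automorphisms \<open>H\<^sub>s \<noteq> id\<close> agreeing with the identity to an order \<open>N\<^sub>s\<close> that tends to
  infinity. Expanding \<open>\<rho> \<circ> H\<^sub>s = 0\<close> on \<open>M\<close>, the components of \<open>X = H\<^sub>s - id\<close> solve the linear
  equation of infinitesimal CR automorphisms on \<open>M\<close> up to an error of order \<open>2 N\<^sub>s\<close>. Commutators
  of the CR vector fields turn that equation into a finite closed linear system for \<open>X\<close> and some
  of its tangential derivatives, except that the Levi determinant \<open>\<Delta>\<close>, which may vanish at \<open>p\<close>,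
  stays in front of the derivatives. Restricted to formal power series along one tangential vector
  field \<open>W\<close>, it is a singular linear system \<open>\<Delta>\<^sup>m u' = A u + e\<close> whose coefficients do not depend
  on \<open>s\<close>; such a system has approximate solutions of only boundedly many orders. A generic \<open>W\<close>
  works by Baire's theorem, because \<open>\<Delta>\<close> is not flat along \<open>M\<close> at \<open>p\<close>: otherwise it would vanish
  on \<open>M\<close> near \<open>p\<close> by analyticity, and then near every point of the connected \<open>M\<close>.
\<close>

unbundle no vec_syntax

section \<open>Approximate solutions of singular linear differential systems\<close>

text \<open>Where \<Delta> vanishes, zero initial data do not force a zero solution:
  \<open>t u' = k u\<close> has the solution \<open>t^k\<close>. No single order can be excluded in
  advance, so the jet order comes out of a contradiction; what is excluded is an infinite supply of
  orders for one and the same system. Two features make this possible. The coefficients come from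
  \<rho> alone and are therefore common to all s. And what is neglected is quadratic in X, so the
  gap between the order of X and the order of the error tends to infinity and outlasts every fixed
  loss caused by differentiating or by cancelling powers of \<Delta>. Formal series keep exact track
  of such losses and allow \<Delta> to be cancelled although it is no unit. X and its conjugate Y
  are treated as independent unknowns: the first is killed by all antiholomorphic derivatives, the
  second by all holomorphic ones, and the one equation between them suffices to close the system.
  Errors that vanish on M form an ideal which every tangential W restricts to zero, so they never
  need to be estimated.\<close>

definition flat :: "nat \<Rightarrow> complex fps \<Rightarrow> bool" where
  "flat K f \<longleftrightarrow> (\<forall>n<K. f $ n = 0)"

lemma flat_mono: "flat K f \<Longrightarrow> L \<le> K \<Longrightarrow> flat L f"
  by (auto simp: flat_def)

lemma flat_0 [simp]: "flat K 0"
  by (simp add: flat_def)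

lemma flat_diff: "flat K f \<Longrightarrow> flat K g \<Longrightarrow> flat K (f - g)"
  by (simp add: flat_def)

lemma flat_sum: "(\<And>i. i \<in> I \<Longrightarrow> flat K (f i)) \<Longrightarrow> flat K (sum f I)"
  by (simp add: flat_def fps_sum_nth)

lemma flat_mult: "flat K f \<Longrightarrow> flat K (a * f)"
  by (auto simp: flat_def fps_mult_nth intro!: sum.neutral)

lemma flat_iff: "flat K f \<longleftrightarrow> f = 0 \<or> K \<le> subdegree f"
proof
  assume "flat K f"
  then show "f = 0 \<or> K \<le> subdegree f"
    unfolding flat_def by (metis not_le nth_subdegree_nonzero)
next
  assume *: "f = 0 \<or> K \<le> subdegree f"
  show "flat K f"
    unfolding flat_def
  proof (intro allI impI)
    fix n assume "n < K"
    with * have "f = 0 \<or> n < subdegree f" by linarith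
    then show "fps_nth f n = 0" using nth_less_subdegree_zero[of n f] by (metis fps_zero_nth)
  qed
qed

lemma flat_cancel: "f \<noteq> 0 \<Longrightarrow> flat (K + subdegree f) (f * g) \<Longrightarrow> flat K g"
  unfolding flat_iff using subdegree_mult[of f g] by fastforce

lemma flat_X_deriv: "flat K f \<Longrightarrow> flat K (fps_X * fps_deriv f)"
  by (auto simp: flat_def)

lemma flat_X_power: "flat (K + n) (fps_X ^ n * f) \<longleftrightarrow> flat K f"
proof
  assume *: "flat (K + n) (fps_X ^ n * f)"
  show "flat K f"
    unfolding flat_def
  proof (intro allI impI)
    fix m assume "m < K"
    then have "(fps_X ^ n * f) $ (m + n) = 0" using * by (simp only: flat_def add_less_cancel_right)
    then show "f $ m = 0" by (simp only: fps_X_power_mult_nth) simp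
  qed
next
  assume *: "flat K f"
  show "flat (K + n) (fps_X ^ n * f)"
    unfolding flat_def fps_X_power_mult_nth
  proof (intro allI impI)
    fix m assume "m < K + n"
    then have "\<not> m < n \<Longrightarrow> m - n < K" by linarith
    then show "(if m < n then 0 else f $ (m - n)) = 0" using * unfolding flat_def by presburger
  qed
qed

lemma flat_imp_shift: "flat n f \<Longrightarrow> fps_X ^ n * fps_shift n f = f"
  by (rule fps_ext) (simp add: flat_def fps_X_power_mult_nth)

text \<open>Look at the coefficient whose index is the sum of the two subdegrees: there the bracket
  is \<open>subdegree b + \<kappa> - \<nu> - subdegree a\<close> times the product of the leading
  coefficients. The gap between \<nu> and \<kappa> makes this integer positive, so the leading terms
  cannot cancel.\<close>

lemma flat_bracket:
  fixes a b :: "complex fps" and \<nu> \<kappa> :: nat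
  assumes "a \<noteq> 0" "\<kappa> > \<nu> + subdegree a"
    and fl: "flat K (a * (fps_X * fps_deriv b - of_nat \<nu> * b) - (fps_X * fps_deriv a - of_nat \<kappa> * a) * b)"
  shows "flat (K - subdegree a) b"
proof (rule ccontr)
  assume "\<not> flat (K - subdegree a) b"
  then have b0: "b \<noteq> 0" and p: "subdegree b < K - subdegree a"
    unfolding flat_iff by auto
  define p o' where "p = subdegree b" and "o' = subdegree a"
  have mon: "(f * g) $ (subdegree f + m) = f $ subdegree f * g $ m" if "\<forall>j<m. g $ j = 0" for f g :: "complex fps" and m
  proof -
    have "(f * g) $ (subdegree f + m) = (\<Sum>i=0..subdegree f + m. f $ i * g $ (subdegree f + m - i))"
      by (rule fps_mult_nth)
    also have "\<dots> = (\<Sum>i\<in>{subdegree f}. f $ i * g $ (subdegree f + m - i))"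
    proof (rule sum.mono_neutral_right)
      show "\<forall>i\<in>{0..subdegree f + m} - {subdegree f}. f $ i * g $ (subdegree f + m - i) = 0"
      proof
        fix i assume i: "i \<in> {0..subdegree f + m} - {subdegree f}"
        show "f $ i * g $ (subdegree f + m - i) = 0"
        proof (cases "i < subdegree f")
          case True then show ?thesis by (simp only: nth_less_subdegree_zero mult_zero_left)
        next
          case False
          then have "subdegree f + m - i < m" using i by auto
          then show ?thesis using that by (simp only: mult_zero_right)
        qed
      qed
    qed auto
    finally show ?thesis by simp
  qed
  have bz: "\<forall>j<p. b $ j = 0" and az: "\<forall>j<o'. a $ j = 0"
    unfolding p_def o'_def using nth_less_subdegree_zero by blast+
  have c1: "(a * (fps_X * fps_deriv b - of_nat \<nu> * b)) $ (o' + p) = a $ o' * ((of_nat p - of_nat \<nu>) * b $ p)"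
  proof -
    have "(fps_X * fps_deriv b - of_nat \<nu> * b) $ j = (of_nat j - of_nat \<nu>) * b $ j" for j
      by (cases j) (auto simp: algebra_simps simp flip: fps_of_nat)
    then show ?thesis using mon[of p "fps_X * fps_deriv b - of_nat \<nu> * b" a] bz by (simp add: o'_def)
  qed
  have c2: "(b * (fps_X * fps_deriv a - of_nat \<kappa> * a)) $ (p + o') = b $ p * ((of_nat o' - of_nat \<kappa>) * a $ o')"
  proof -
    have "(fps_X * fps_deriv a - of_nat \<kappa> * a) $ j = (of_nat j - of_nat \<kappa>) * a $ j" for j
      by (cases j) (auto simp: algebra_simps simp flip: fps_of_nat)
    then show ?thesis using mon[of o' "fps_X * fps_deriv a - of_nat \<kappa> * a" b] az by (simp add: p_def)
  qed
  have "o' + p < K" using p by (simp add: p_def o'_def)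
  then have "(a * (fps_X * fps_deriv b - of_nat \<nu> * b)) $ (o' + p)
      - (b * (fps_X * fps_deriv a - of_nat \<kappa> * a)) $ (p + o') = 0"
    using fl by (simp add: flat_def mult.commute add.commute)
  then have "(of_nat (p + \<kappa>) - of_nat (\<nu> + o')) * (a $ o' * b $ p) = (0::complex)"
    unfolding c1 c2 by (simp add: algebra_simps)
  moreover have "of_nat (p + \<kappa>) - of_nat (\<nu> + o') \<noteq> (0::complex)"
    using assms(2) by (simp only: o'_def right_minus_eq of_nat_eq_iff)
  moreover have "a $ o' \<noteq> 0" "b $ p \<noteq> 0" using b0 assms(1) by (auto simp: p_def o'_def)
  ultimately show False by simp
qed

text \<open>Fraction-free Gaussian elimination: a coordinate g is cleared by cross-multiplying with
  a pivot s0, the induction treats the remaining coordinates, and the coefficient of s0 is then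
  chosen so that g cancels as well.\<close>

lemma idom_dependent:
  fixes v :: "'s \<Rightarrow> 'g \<Rightarrow> 'r::idom"
  assumes "finite G" "finite S" "card G < card S"
  shows "\<exists>c. (\<exists>s\<in>S. c s \<noteq> 0) \<and> (\<forall>g\<in>G. (\<Sum>s\<in>S. c s * v s g) = 0)"
  using assms
proof (induction G arbitrary: S v rule: finite_induct)
  case empty
  then show ?case by (intro exI[of _ "\<lambda>_. 1"]) (auto simp: card_gt_0_iff)
next
  case (insert g G)
  show ?case
  proof (cases "\<forall>s\<in>S. v s g = 0")
    case True
    have "card G < card S" using insert by simp
    from insert.IH[OF insert.prems(1) this, of v] obtain c where
      "\<exists>s\<in>S. c s \<noteq> 0" "\<forall>g\<in>G. (\<Sum>s\<in>S. c s * v s g) = 0" by blast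
    with True show ?thesis by (intro exI[of _ c]) auto
  next
    case False
    then obtain s0 where s0: "s0 \<in> S" "v s0 g \<noteq> 0" by blast
    define S' where "S' = S - {s0}"
    have S': "finite S'" "card G < card S'" "S = insert s0 S'" "s0 \<notin> S'"
      using insert s0 by (auto simp: S'_def)
    from insert.IH[OF S'(1,2), of "\<lambda>s h. v s0 g * v s h - v s g * v s0 h"] obtain c where
      c: "\<exists>s\<in>S'. c s \<noteq> 0" "\<forall>h\<in>G. (\<Sum>s\<in>S'. c s * (v s0 g * v s h - v s g * v s0 h)) = 0" by blast
    define d where "d s = (if s = s0 then - (\<Sum>s\<in>S'. c s * v s g) else c s * v s0 g)" for s
    have sm: "(\<Sum>s\<in>S. d s * v s h) = (\<Sum>s\<in>S'. c s * (v s0 g * v s h - v s g * v s0 h))" for h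
    proof -
      have "(\<Sum>s\<in>S. d s * v s h) = d s0 * v s0 h + (\<Sum>s\<in>S'. d s * v s h)"
        using S' by simp
      also have "(\<Sum>s\<in>S'. d s * v s h) = (\<Sum>s\<in>S'. c s * v s0 g * v s h)"
        using S'(4) by (intro sum.cong) (auto simp: d_def)
      finally show ?thesis
        by (simp add: d_def algebra_simps sum_subtractf sum_distrib_left)
    qed
    show ?thesis
    proof (intro exI[of _ d] conjI ballI)
      obtain s where "s \<in> S'" "c s \<noteq> 0" using c by blast
      then show "\<exists>s\<in>S. d s \<noteq> 0" using S' s0 by (intro bexI[of _ s]) (auto simp: d_def)
    next
      fix h assume "h \<in> insert g G"
      then show "(\<Sum>s\<in>S. d s * v s h) = 0"
        unfolding sm using c(2) by (auto simp: mult.commute)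
    qed
  qed
qed

text \<open>
  A maximal number of the normalised solutions \<open>v\<^sub>s = u\<^sub>s / t\<^bsup>\<nu> s\<^esup>\<close> is independent with a
  uniformly bounded loss of order. One more solution then satisfies an approximate relation;
  differentiating it by \<open>t d/dt\<close> and comparing with the relation itself contradicts independence,
  because the exponents \<open>\<nu> s\<close> are far apart.
\<close>

lemma no_flat_solution_sequence:
  fixes u e :: "nat \<Rightarrow> 'g \<Rightarrow> complex fps" and A :: "'g \<Rightarrow> 'g \<Rightarrow> complex fps"
    and \<nu> B :: "nat \<Rightarrow> nat"
  assumes G: "finite G" and \<delta>: "\<And>g. g \<in> G \<Longrightarrow> \<delta> g \<noteq> 0"
    and eq: "\<And>s g. g \<in> G \<Longrightarrow> \<delta> g * fps_deriv (u s g) = (\<Sum>g'\<in>G. A g g' * u s g') + e s g"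
    and low: "\<And>s g. g \<in> G \<Longrightarrow> flat (\<nu> s) (u s g)"
    and nz: "\<And>s. \<exists>g\<in>G. u s g $ \<nu> s \<noteq> 0"
    and e: "\<And>s g. g \<in> G \<Longrightarrow> flat (\<nu> s + B s) (e s g)"
    and \<nu>: "filterlim \<nu> at_top sequentially" and B: "filterlim B at_top sequentially"
  shows False
proof -
  define v where "v s g = fps_shift (\<nu> s) (u s g)" for s g
  have uv: "u s g = fps_X ^ \<nu> s * v s g" if "g \<in> G" for s g
    using flat_imp_shift[OF low[OF that]] by (simp add: v_def)
  have v0: "\<exists>g\<in>G. v s g $ 0 \<noteq> 0" for s
    using nz[of s] by (simp add: v_def)
  \<comment> \<open>The equation for u divided by t^(\<nu> s), written with the Euler operator t
    d/dt, which turns the division into the extra term \<nu> s times v.\<close>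
  have eqv: "flat (B s) (\<delta> g * (of_nat (\<nu> s) * v s g + fps_X * fps_deriv (v s g)) - fps_X * (\<Sum>g'\<in>G. A g g' * v s g'))"
    if g: "g \<in> G" for s g
  proof -
    have d: "fps_X * fps_deriv (fps_X ^ n * f) = fps_X ^ n * (of_nat n * f + fps_X * fps_deriv f)" for n and f :: "complex fps"
      by (induction n) (simp_all add: algebra_simps)
    have "fps_X ^ \<nu> s * (\<delta> g * (of_nat (\<nu> s) * v s g + fps_X * fps_deriv (v s g)) - fps_X * (\<Sum>g'\<in>G. A g g' * v s g'))
      = fps_X * (\<delta> g * fps_deriv (u s g)) - fps_X * (\<Sum>g'\<in>G. A g g' * u s g')"
    proof -
      have "fps_X * (\<delta> g * fps_deriv (u s g)) = \<delta> g * (fps_X * fps_deriv (u s g))" by (simp add: mult_ac)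
      also have "\<dots> = \<delta> g * (fps_X ^ \<nu> s * (of_nat (\<nu> s) * v s g + fps_X * fps_deriv (v s g)))"
        by (simp only: uv[OF g] d)
      finally have 1: "fps_X * (\<delta> g * fps_deriv (u s g)) = \<dots>" .
      have 2: "fps_X * (\<Sum>g'\<in>G. A g g' * u s g') = fps_X ^ \<nu> s * (fps_X * (\<Sum>g'\<in>G. A g g' * v s g'))"
        by (simp add: uv sum_distrib_left mult_ac)
      show ?thesis unfolding 1 2 by (simp add: algebra_simps)
    qed
    also have "\<dots> = fps_X * e s g" using eq[OF g, of s] by (simp add: algebra_simps)
    finally show ?thesis
      using flat_X_power[of "B s" "\<nu> s"] flat_mult[OF e[OF g, of s], of fps_X]
      by (metis add.commute)
  qed
  \<comment> \<open>Independence with loss C: an approximate relation of order K + C forces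
    coefficients of order K. As K is arbitrary, exact independence is included.\<close>
  define ind where "ind C S \<longleftrightarrow> (\<forall>c K. (\<forall>g\<in>G. flat (K + C) (\<Sum>s\<in>S. c s * v s g)) \<longrightarrow> (\<forall>s\<in>S. flat K (c s)))" for C S
  \<comment> \<open>One loss C has to serve arbitrarily late families of size r; J is quantified
    after C for this reason.\<close>
  define good where "good r \<longleftrightarrow> (\<exists>C. \<forall>J. \<exists>S. finite S \<and> card S = r \<and> (\<forall>s\<in>S. J \<le> s) \<and> ind C S)" for r
  have "good 0"
    unfolding good_def by (intro exI[of _ 0] allI exI[of _ "{}"]) (auto simp: ind_def)
  have ub: "r \<le> card G" if r: "good r" for r
  proof (rule ccontr)
    assume "\<not> r \<le> card G"
    obtain C S where S: "finite S" "card S = r" "ind C S" using r unfolding good_def by meson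
    from idom_dependent[OF G S(1)] obtain c where c: "\<exists>s\<in>S. c s \<noteq> 0" "\<forall>g\<in>G. (\<Sum>s\<in>S. c s * v s g) = 0"
      using \<open>\<not> r \<le> card G\<close> S(2) by (metis not_le)
    then have "\<forall>s\<in>S. flat K (c s)" for K using S(3) by (simp add: ind_def)
    then show False using c(1) by (metis flat_def fps_ext fps_zero_nth lessI)
  qed
  have "\<exists>r. good r \<and> \<not> good (Suc r)"
  proof (rule ccontr)
    assume "\<nexists>r. good r \<and> \<not> good (Suc r)"
    then have "good r" for r using \<open>good 0\<close> by (induction r) auto
    then show False using ub[of "Suc (card G)"] by simp
  qed
  then obtain r where r: "good r" "\<not> good (Suc r)" by blast
  obtain C0 where C0: "\<And>J. \<exists>S. finite S \<and> card S = r \<and> (\<forall>s\<in>S. J \<le> s) \<and> ind C0 S"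
    using r(1) unfolding good_def by meson
  define m where "m = (\<Sum>g\<in>G. subdegree (\<delta> g))"
  have m: "subdegree (\<delta> g) \<le> m" if "g \<in> G" for g
    unfolding m_def using that G by (intro member_le_sum) auto
  \<comment> \<open>m pays for cancelling \<delta> g, the last C0 for using the independence of S,
    and C0 + 1 is the order then left for the brackets: one more than the subdegree that the
    coefficient of s0 can have.\<close>
  define C where "C = m + (C0 + 1 + C0)"
  obtain J1 where J1: "\<And>S. finite S \<Longrightarrow> card S = Suc r \<Longrightarrow> (\<forall>s\<in>S. J1 \<le> s) \<Longrightarrow> \<not> ind C S"
  proof -
    from r(2) have "\<not> (\<forall>J. \<exists>S. finite S \<and> card S = Suc r \<and> (\<forall>s\<in>S. J \<le> s) \<and> ind C S)"
      unfolding good_def by simp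
    with that show thesis by meson
  qed
  obtain J2 where J2: "\<And>s. s \<ge> J2 \<Longrightarrow> B s \<ge> C"
    using B by (auto simp: filterlim_at_top eventually_sequentially)
  obtain S where S: "finite S" "card S = r" "\<forall>s\<in>S. max J1 J2 \<le> s" "ind C0 S" using C0 by blast
  \<comment> \<open>The additional index s0 is taken so late that \<nu> s0 exceeds every exponent in
    S by more than C0, as \<open>flat_bracket\<close> requires.\<close>
  obtain J3 where J3: "\<And>s. s \<ge> J3 \<Longrightarrow> \<nu> s \<ge> Suc ((\<Sum>t\<in>S. \<nu> t) + C0)"
    using \<nu> unfolding filterlim_at_top eventually_sequentially by meson
  define s0 where "s0 = max (max J1 J2) J3"
  have \<nu>0: "\<nu> s0 > \<nu> s + C0" if "s \<in> S" for s
  proof -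
    have "\<nu> s \<le> (\<Sum>t\<in>S. \<nu> t)" using that S(1) by (intro member_le_sum) auto
    then show ?thesis using J3[of s0] by (simp add: s0_def)
  qed
  have s0S: "s0 \<notin> S" using \<nu>0 by fastforce
  define S' where "S' = insert s0 S"
  have S': "finite S'" "card S' = Suc r" "\<forall>s\<in>S'. J1 \<le> s" "\<forall>s\<in>S'. B s \<ge> C"
    using S s0S J2 by (auto simp: S'_def s0_def)
  from J1[OF S'(1-3)] obtain c0 K s1 where c0: "\<forall>g\<in>G. flat (K + C) (\<Sum>s\<in>S'. c0 s * v s g)"
    "s1 \<in> S'" "\<not> flat K (c0 s1)" unfolding ind_def by meson
  \<comment> \<open>The relation is divided by the largest power t^\<mu> common to its coefficients.
    Afterwards some coefficient has a nonzero constant term, and \<mu> < K leaves a relation of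
    order C + 1.\<close>
  define P where "P n \<longleftrightarrow> (\<exists>s\<in>S'. c0 s $ n \<noteq> 0)" for n
  define \<mu> where "\<mu> = (LEAST n. P n)"
  obtain k where k: "k < K" "P k" using c0 by (auto simp: flat_def P_def)
  have P\<mu>: "P \<mu>" unfolding \<mu>_def by (rule LeastI[of P, OF k(2)])
  have \<mu>K: "\<mu> < K" unfolding \<mu>_def by (rule le_less_trans[OF Least_le[of P, OF k(2)] k(1)])
  have fl\<mu>: "flat \<mu> (c0 s)" if "s \<in> S'" for s
  proof -
    have "\<not> P n" if "n < \<mu>" for n using that unfolding \<mu>_def by (rule not_less_Least)
    then show ?thesis using that unfolding flat_def P_def by blast
  qed
  define c where "c s = fps_shift \<mu> (c0 s)" for s
  have cc: "c0 s = fps_X ^ \<mu> * c s" if "s \<in> S'" for s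
    using flat_imp_shift[OF fl\<mu>[OF that]] by (simp add: c_def)
  have c1: "\<exists>s\<in>S'. c s $ 0 \<noteq> 0" using P\<mu> by (simp add: c_def P_def)
  define R where "R g = (\<Sum>s\<in>S'. c s * v s g)" for g
  have R: "flat (Suc C) (R g)" if "g \<in> G" for g
  proof -
    have "flat (K + C) (fps_X ^ \<mu> * R g)"
      using c0(1) that by (simp add: R_def sum_distrib_left cc mult.assoc)
    then have "flat (Suc C + \<mu>) (fps_X ^ \<mu> * R g)" by (rule flat_mono) (use \<mu>K in simp)
    then show ?thesis by (simp only: flat_X_power)
  qed
  have RS: "R g = c s0 * v s0 g + (\<Sum>s\<in>S. c s * v s g)" for g
    using S(1) s0S by (simp add: R_def S'_def)
  \<comment> \<open>Otherwise the part of the relation over S would still have order 1 + C0, all its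
    coefficients would vanish at 0, and so would that of s0, against the normalisation.\<close>
  have o: "\<not> flat (Suc C0) (c s0)"
  proof
    assume fl: "flat (Suc C0) (c s0)"
    have "flat (1 + C0) (\<Sum>s\<in>S. c s * v s g)" if "g \<in> G" for g
    proof -
      have "flat (Suc C0) (R g - v s0 g * c s0)"
        by (rule flat_diff, rule flat_mono[OF R[OF that]]) (simp_all add: C_def flat_mult fl)
      then show ?thesis by (simp add: RS mult.commute)
    qed
    then have "\<forall>s\<in>S. flat 1 (c s)" using S(4) unfolding ind_def by blast
    moreover have "c s0 $ 0 = 0" using fl by (simp add: flat_def)
    ultimately show False using c1 by (auto simp: S'_def flat_def)
  qed
  then have cs0: "c s0 \<noteq> 0" "subdegree (c s0) \<le> C0" by (auto simp: flat_iff)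
  \<comment> \<open>The coefficients of the relation obtained by applying t d/dt and eliminating the
    derivatives of v through the equation; the terms with A recombine to the original
    relation.\<close>
  define q where "q s = fps_X * fps_deriv (c s) - of_nat (\<nu> s) * c s" for s
  have gen: "d * (x * d1 * v1 + c1 * (x * d2)) = d * ((x * d1 - n * c1) * v1) + c1 * (d * (n * v1 + x * d2) - x * a) + x * (c1 * a)"
    for d x d1 v1 c1 d2 n a :: "complex fps" by algebra
  have gen2: "x = y - z - w" if "y = x + z + w" for x y z w :: "complex fps" using that by simp
  have gen3: "(c2 * q1 - q2 * c1) * v1 = c2 * (q1 * v1) - q2 * (c1 * v1)" for c2 q1 q2 c1 v1 :: "complex fps" by algebra
  have Q: "flat (C - m) (\<Sum>s\<in>S'. q s * v s g)" if g: "g \<in> G" for g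
  proof -
    define err where "err s = \<delta> g * (of_nat (\<nu> s) * v s g + fps_X * fps_deriv (v s g)) - fps_X * (\<Sum>g'\<in>G. A g g' * v s g')" for s
    have 1: "fps_X * fps_deriv (R g) = (\<Sum>s\<in>S'. fps_X * fps_deriv (c s) * v s g + c s * (fps_X * fps_deriv (v s g)))"
      unfolding R_def fps_deriv_sum sum_distrib_left fps_deriv_mult
      by (intro sum.cong refl) (simp add: algebra_simps)
    have 2: "\<delta> g * (fps_X * fps_deriv (R g)) = (\<Sum>s\<in>S'. \<delta> g * (q s * v s g) + c s * err s + fps_X * (c s * (\<Sum>g'\<in>G. A g g' * v s g')))"
      unfolding 1 sum_distrib_left[of "\<delta> g"] q_def err_def by (intro sum.cong refl gen)
    have 3: "(\<Sum>s\<in>S'. c s * (\<Sum>g'\<in>G. A g g' * v s g')) = (\<Sum>g'\<in>G. A g g' * R g')"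
      unfolding R_def sum_distrib_left by (subst sum.swap) (simp only: mult_ac)
    have "\<delta> g * (\<Sum>s\<in>S'. q s * v s g) = \<delta> g * (fps_X * fps_deriv (R g)) - (\<Sum>s\<in>S'. c s * err s)
      - fps_X * (\<Sum>g'\<in>G. A g g' * R g')"
      unfolding 3[symmetric] by (rule gen2) (simp only: 2 sum.distrib sum_distrib_left[symmetric])
    moreover have "flat C \<dots>"
    proof (rule flat_diff, rule flat_diff)
      show "flat C (\<delta> g * (fps_X * fps_deriv (R g)))"
        by (rule flat_mult, rule flat_X_deriv, rule flat_mono[OF R[OF g]]) simp
      show "flat C (\<Sum>s\<in>S'. c s * err s)"
        unfolding err_def by (rule flat_sum, rule flat_mult, rule flat_mono[OF eqv[OF g]]) (use S'(4) in blast)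
      show "flat C (fps_X * (\<Sum>g'\<in>G. A g g' * R g'))"
        by (rule flat_mult, rule flat_sum, rule flat_mult, rule flat_mono[OF R]) auto
    qed
    ultimately have "flat C (\<delta> g * (\<Sum>s\<in>S'. q s * v s g))" by simp
    then have "flat (C - subdegree (\<delta> g) + subdegree (\<delta> g)) (\<delta> g * (\<Sum>s\<in>S'. q s * v s g))"
      by (rule flat_mono) (use m[OF g] in \<open>simp add: C_def\<close>)
    from flat_cancel[OF \<delta>[OF g] this] show ?thesis by (rule flat_mono) (use m[OF g] in simp)
  qed
  \<comment> \<open>Eliminating s0 between the relation and the derived one leaves coefficients of
    exactly the bracket shape.\<close>
  have "flat (C0 + 1 + C0) (\<Sum>s\<in>S. (c s0 * q s - q s0 * c s) * v s g)" if g: "g \<in> G" for g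
  proof -
    have 1: "(\<Sum>s\<in>S'. q s * v s g) = q s0 * v s0 g + (\<Sum>s\<in>S. q s * v s g)"
      using S(1) s0S by (simp add: S'_def)
    have 2: "(\<Sum>s\<in>S. (c s0 * q s - q s0 * c s) * v s g) = c s0 * (\<Sum>s\<in>S. q s * v s g) - q s0 * (\<Sum>s\<in>S. c s * v s g)"
      unfolding sum_distrib_left sum_subtractf[symmetric] by (intro sum.cong refl gen3)
    have "(\<Sum>s\<in>S. (c s0 * q s - q s0 * c s) * v s g) = c s0 * (\<Sum>s\<in>S'. q s * v s g) - q s0 * R g"
      unfolding 1 2 RS by algebra
    moreover have "flat (C0 + 1 + C0) \<dots>"
    proof (rule flat_diff)
      show "flat (C0 + 1 + C0) (c s0 * (\<Sum>s\<in>S'. q s * v s g))"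
        using Q[OF g] by (intro flat_mult) (simp add: C_def)
      show "flat (C0 + 1 + C0) (q s0 * R g)"
        by (rule flat_mult, rule flat_mono[OF R[OF g]]) (simp add: C_def)
    qed
    ultimately show ?thesis by simp
  qed
  then have "\<forall>s\<in>S. flat (C0 + 1) (c s0 * q s - q s0 * c s)"
    using S(4)[unfolded ind_def, rule_format, of "C0 + 1" "\<lambda>s. c s0 * q s - q s0 * c s"] by blast
  then have br: "flat (C0 + 1 - subdegree (c s0)) (c s)" if "s \<in> S" for s
    using that \<nu>0[OF that] cs0 unfolding q_def
    by (intro flat_bracket[where \<nu> = "\<nu> s" and \<kappa> = "\<nu> s0" and a = "c s0"]) simp_all
  have f1: "flat 1 (c s)" if "s \<in> S" for s
    by (rule flat_mono[OF br[OF that]]) (use cs0(2) in simp)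
  then have "c s0 $ 0 \<noteq> 0" using c1 by (auto simp: S'_def flat_def)
  moreover obtain g where g: "g \<in> G" "v s0 g $ 0 \<noteq> 0" using v0 by blast
  moreover have "flat 1 (c s0 * v s0 g)"
  proof -
    have "flat 1 (R g - (\<Sum>s\<in>S. v s g * c s))"
    proof (rule flat_diff)
      show "flat 1 (R g)" by (rule flat_mono[OF R[OF g(1)]]) simp
      show "flat 1 (\<Sum>s\<in>S. v s g * c s)" by (rule flat_sum, rule flat_mult, rule f1)
    qed
    then show ?thesis by (simp add: RS mult.commute)
  qed
  ultimately show False unfolding flat_def by (metis fps_mult_nth_0 mult_eq_0_iff zero_less_one)
qed

section \<open>Hurwitz series\<close>

text \<open>The Leibniz rule: if a and b list the iterated derivatives of two functions along words,
  this lists those of the product. Distributing one letter at a time avoids binomial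
  coefficients.\<close>

fun hmul :: "('x list \<Rightarrow> complex) \<Rightarrow> ('x list \<Rightarrow> complex) \<Rightarrow> 'x list \<Rightarrow> complex" where
  "hmul a b [] = a [] * b []"
| "hmul a b (x # w) = hmul (\<lambda>u. a (x # u)) b w + hmul a (\<lambda>u. b (x # u)) w"

lemma hmul_add_left: "hmul (\<lambda>u. a u + b u) c w = hmul a c w + hmul b c w"
proof (induction w arbitrary: a b c)
  case (Cons x w)
  show ?case by (simp only: hmul.simps Cons.IH add_ac)
qed (simp add: algebra_simps)

lemma hmul_commute: "hmul a b w = hmul b a w"
proof (induction w arbitrary: a b)
  case (Cons x w)
  show ?case unfolding hmul.simps by (subst (1 2) Cons.IH) (rule add.commute)
qed simp

lemma hmul_add_right: "hmul c (\<lambda>u. a u + b u) w = hmul c a w + hmul c b w"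
  unfolding hmul_commute[of c] by (rule hmul_add_left)

lemma hmul_zero: "hmul (\<lambda>u. 0) b w = 0"
proof (induction w arbitrary: b)
  case (Cons x w)
  show ?case by (simp only: hmul.simps Cons.IH add_0)
qed simp

lemma hmul_one: "hmul (\<lambda>u. if u = [] then 1 else 0) b w = b w"
proof (induction w arbitrary: b)
  case (Cons x w)
  have "(\<lambda>u. if x # u = [] then 1 else 0) = (\<lambda>u. 0 :: complex)" by (simp add: fun_eq_iff)
  then show ?case by (simp only: hmul.simps Cons.IH hmul_zero add_0)
qed simp

lemma hmul_assoc: "hmul (hmul a b) c w = hmul a (hmul b c) w"
proof (induction w arbitrary: a b c)
  case (Cons x w)
  show ?case by (simp only: hmul.simps hmul_add_left hmul_add_right Cons.IH add.assoc)
qed simp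

text \<open>If the first letters x and y differ, the tails are rearranged by induction until the
  words read \<open>x # y # t\<close> and \<open>y # x # t\<close>; there the symmetry of a and b
  allows the swap.\<close>

lemma hmul_permute:
  assumes "\<forall>u v. mset u = mset v \<longrightarrow> a u = a v" "\<forall>u v. mset u = mset v \<longrightarrow> b u = b v" "mset u = mset v"
  shows "hmul a b u = hmul a b v"
  using assms
proof (induction "length u" arbitrary: a b u v)
  case 0
  then have "u = []" "v = []" by (metis length_0_conv, metis length_0_conv size_mset)
  then show ?case by (simp only:)
next
  case (Suc n)
  have sh: "\<forall>u v. mset u = mset v \<longrightarrow> f (x # u) = f (x # v)"
    if "\<forall>u v. mset u = mset v \<longrightarrow> f u = f v" for f :: "'a list \<Rightarrow> complex" and x
    using that by (metis mset.simps(2))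
  have step: "hmul a b (x # t) = hmul a b (x # t')" if "length t = n" "mset t = mset t'" for x t t'
  proof -
    have "hmul (\<lambda>u. a (x # u)) b t = hmul (\<lambda>u. a (x # u)) b t'"
      by (rule Suc.hyps(1)[OF that(1)[symmetric] sh[OF Suc.prems(1)] Suc.prems(2) that(2)])
    moreover have "hmul a (\<lambda>u. b (x # u)) t = hmul a (\<lambda>u. b (x # u)) t'"
      by (rule Suc.hyps(1)[OF that(1)[symmetric] Suc.prems(1) sh[OF Suc.prems(2)] that(2)])
    ultimately show ?thesis by (simp only: hmul.simps)
  qed
  obtain x u' where u: "u = x # u'" "length u' = n" using Suc.hyps(2) by (metis length_Suc_conv)
  obtain y v' where v: "v = y # v'" "length v' = n"
    using Suc.hyps(2) Suc.prems(3) by (metis length_Suc_conv size_mset)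
  show ?case
  proof (cases "x = y")
    case True
    then have "mset u' = mset v'" using Suc.prems(3) u v by simp
    then show ?thesis using step[OF u(2)] u v True by blast
  next
    case False
    then obtain M where M: "mset u' = add_mset y M" "mset v' = add_mset x M"
      using Suc.prems(3) u v by (auto simp: add_eq_conv_ex)
    obtain t where t: "mset t = M" using ex_mset by blast
    have a: "a (x # y # z) = a (y # x # z)" and b: "b (x # y # z) = b (y # x # z)" for z
      by (rule Suc.prems(1)[rule_format] Suc.prems(2)[rule_format], simp)+
    have "hmul a b u = hmul a b (x # y # t)"
      unfolding u(1) by (rule step[OF u(2)]) (simp add: M t)
    also have "\<dots> = hmul a b (y # x # t)" by (simp only: hmul.simps a b add_ac)
    also have "\<dots> = hmul a b v"
    proof -
      have "mset (x # t) = mset v'" by (simp add: M t)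
      moreover from this have "length (x # t) = n" using v(2) by (metis size_mset)
      ultimately show ?thesis unfolding v(1) by (rule step[rotated])
    qed
    finally show ?thesis .
  qed
qed

text \<open>Formal power series encoded by the values of their iterated partial derivatives at the
  base point rather than by multi-indexed coefficients. Differentiation becomes a shift of words
  without factorials, and invariance under permutation says that partial derivatives
  commute.\<close>

typedef 'x hser = "{a :: 'x list \<Rightarrow> complex. \<forall>u v. mset u = mset v \<longrightarrow> a u = a v}"
  morphisms coef Hser
  by (rule exI[of _ "\<lambda>_. 0"]) simp

setup_lifting type_definition_hser

lift_definition cst :: "complex \<Rightarrow> 'x hser" is "\<lambda>c u. if u = [] then c else 0"
  by auto

lift_definition dd :: "'x \<Rightarrow> 'x hser \<Rightarrow> 'x hser" is "\<lambda>x a w. a (x # w)"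
  by simp

instantiation hser :: (type) comm_ring_1
begin
lift_definition zero_hser :: "'a hser" is "\<lambda>_. 0" by simp
lift_definition one_hser :: "'a hser" is "\<lambda>u. if u = [] then 1 else 0" by auto
lift_definition plus_hser :: "'a hser \<Rightarrow> 'a hser \<Rightarrow> 'a hser" is "\<lambda>a b u. a u + b u" by metis
lift_definition minus_hser :: "'a hser \<Rightarrow> 'a hser \<Rightarrow> 'a hser" is "\<lambda>a b u. a u - b u" by metis
lift_definition uminus_hser :: "'a hser \<Rightarrow> 'a hser" is "\<lambda>a u. - a u" by metis
lift_definition times_hser :: "'a hser \<Rightarrow> 'a hser \<Rightarrow> 'a hser" is hmul
  using hmul_permute by blast
instance
proof
  fix a b c :: "'a hser"
  note [simp] = zero_hser.rep_eq plus_hser.rep_eq minus_hser.rep_eq uminus_hser.rep_eq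
  have eqI: "x = y" if "\<And>w. coef x w = coef y w" for x y :: "'a hser"
    using that by (metis coef_inject ext)
  show "a * b * c = a * (b * c)"
    by (rule eqI) (simp only: times_hser.rep_eq hmul_assoc)
  show "a * b = b * a"
    by (rule eqI) (simp only: times_hser.rep_eq hmul_commute[of "coef a"])
  show "1 * a = a"
    by (rule eqI) (simp only: times_hser.rep_eq one_hser.rep_eq hmul_one)
  show "(a + b) * c = a * c + b * c"
    by (rule eqI) (simp only: times_hser.rep_eq plus_hser.rep_eq hmul_add_left)
  show "(0 :: 'a hser) \<noteq> 1"
  proof
    assume "(0 :: 'a hser) = 1"
    then have "coef (0 :: 'a hser) [] = coef 1 []" by (simp only:)
    then show False by (simp add: one_hser.rep_eq)
  qed
  show "a + b + c = a + (b + c)" "a + b = b + a" "0 + a = a" "- a + a = 0" "a - b = a + - b"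
    by (rule eqI, simp add: add_ac)+
qed
end

lemma hser_eqI: "(\<And>w. coef a w = coef b w) \<Longrightarrow> a = b"
  by (metis coef_inject ext)

lemma coef_0 [simp]: "coef 0 w = 0"
  and coef_add: "coef (a + b) w = coef a w + coef b w"
  and coef_diff: "coef (a - b) w = coef a w - coef b w"
  and coef_uminus: "coef (- a) w = - coef a w"
  and coef_mult: "coef (a * b) w = hmul (coef a) (coef b) w"
  and coef_cst: "coef (cst c) w = (if w = [] then c else 0)"
  and coef_1: "coef 1 w = (if w = [] then 1 else 0)"
  and coef_dd: "coef (dd x a) w = coef a (x # w)"
  by (simp_all only: zero_hser.rep_eq plus_hser.rep_eq minus_hser.rep_eq uminus_hser.rep_eq
      times_hser.rep_eq cst.rep_eq one_hser.rep_eq dd.rep_eq)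

lemma coef_permute: "mset u = mset v \<Longrightarrow> coef a u = coef a v"
  using coef[of a] by blast

section \<open>Derivations of commutative rings\<close>

definition derivation :: "('r::comm_ring_1 \<Rightarrow> 'r) \<Rightarrow> bool" where
  "derivation D \<longleftrightarrow> (\<forall>a b. D (a + b) = D a + D b) \<and> (\<forall>a b. D (a * b) = D a * b + a * D b)"

lemma derivation_add: "derivation D \<Longrightarrow> D (a + b) = D a + D b"
  and derivation_mult: "derivation D \<Longrightarrow> D (a * b) = D a * b + a * D b"
  by (simp_all add: derivation_def)

lemma derivation_0: "derivation D \<Longrightarrow> D 0 = 0"
  by (metis add_cancel_right_left add_0 derivation_add)

lemma derivation_minus: "derivation D \<Longrightarrow> D (- a) = - D a"
  by (metis add.inverse_unique derivation_0 derivation_add right_minus)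

lemma derivation_diff: "derivation D \<Longrightarrow> D (a - b) = D a - D b"
  using derivation_add[of D a "- b"] derivation_minus[of D b] by simp

lemma derivation_sum: "derivation D \<Longrightarrow> D (sum f I) = (\<Sum>i\<in>I. D (f i))"
  by (induction I rule: infinite_finite_induct) (simp_all add: derivation_0 derivation_add)

lemma derivation_1: "derivation D \<Longrightarrow> D 1 = 0"
  using derivation_mult[of D 1 1] by simp

lemma derivationI_comb:
  assumes "\<And>i. i \<in> I \<Longrightarrow> derivation (D i)"
  shows "derivation (\<lambda>a. \<Sum>i\<in>I. c i * D i a)"
  unfolding derivation_def
proof (intro conjI allI)
  fix a b
  show "(\<Sum>i\<in>I. c i * D i (a + b)) = (\<Sum>i\<in>I. c i * D i a) + (\<Sum>i\<in>I. c i * D i b)"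
    using assms by (simp add: derivation_add sum.distrib[symmetric] algebra_simps)
  have "(\<Sum>i\<in>I. c i * D i (a * b)) = (\<Sum>i\<in>I. c i * D i a * b + a * (c i * D i b))"
    using assms by (intro sum.cong refl) (simp add: derivation_mult algebra_simps)
  then show "(\<Sum>i\<in>I. c i * D i (a * b)) = (\<Sum>i\<in>I. c i * D i a) * b + a * (\<Sum>i\<in>I. c i * D i b)"
    by (simp add: sum.distrib sum_distrib_left sum_distrib_right)
qed

lemma derivation_dd: "derivation (dd x)"
proof -
  have e: "(\<lambda>u. coef a (x # u)) = coef (dd x a)" for a :: "'a hser" and x
    by (simp add: coef_dd fun_eq_iff)
  show ?thesis
    unfolding derivation_def
    by (intro conjI allI hser_eqI) (simp_all only: coef_add coef_dd coef_mult hmul.simps e)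
qed

lemma dd_commute: "dd x (dd y a) = dd y (dd x a)"
  by (rule hser_eqI) (simp only: coef_dd, rule coef_permute, simp add: add_mset_commute)

lemma dd_cst: "dd x (cst c) = 0"
  by (rule hser_eqI) (simp add: coef_dd coef_cst)

lemma coef_sum: "coef (sum f I) w = (\<Sum>i\<in>I. coef (f i) w)"
  by (induction I rule: infinite_finite_induct) (simp_all add: coef_add)

lemma cst_1: "cst 1 = 1"
  by (rule hser_eqI) (simp add: coef_1 coef_cst)

lemma cst_add: "cst c + cst d = cst (c + d)"
  by (rule hser_eqI) (simp add: coef_add coef_cst)

lemma cst_mult: "cst c * cst d = cst (c * d)"
proof (rule hser_eqI)
  fix w :: "'a list"
  show "coef (cst c * cst d) w = coef (cst (c * d)) w"
  proof (cases w)
    case (Cons x w')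
    have z: "(\<lambda>u. coef (cst e) (x # u)) = (\<lambda>u. 0)" for e by (simp add: coef_cst fun_eq_iff)
    show ?thesis unfolding Cons coef_mult hmul.simps z
      by (subst (2) hmul_commute) (simp add: hmul_zero coef_cst)
  qed (simp add: coef_mult coef_cst)
qed

lemma of_nat_hser: "of_nat n = (cst (of_nat n) :: 'x hser)"
proof (induction n)
  case 0
  show ?case by (rule hser_eqI) (simp add: coef_cst)
qed (simp add: cst_1[symmetric] cst_add)

section \<open>Order of vanishing and restriction to integral curves\<close>

definition van :: "nat \<Rightarrow> 'x hser \<Rightarrow> bool" where
  "van K a \<longleftrightarrow> (\<forall>w. length w < K \<longrightarrow> coef a w = 0)"

lemma van_mono: "van K a \<Longrightarrow> L \<le> K \<Longrightarrow> van L a"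
  by (auto simp: van_def)

lemma van_0 [simp]: "van 0 a" by (simp add: van_def)

lemma van_zero [simp]: "van K 0" by (simp add: van_def)

lemma van_add: "van K a \<Longrightarrow> van K b \<Longrightarrow> van K (a + b)"
  by (simp add: van_def coef_add)

lemma van_diff: "van K a \<Longrightarrow> van K b \<Longrightarrow> van K (a - b)"
  by (simp add: van_def coef_diff)

lemma van_sum: "(\<And>i. i \<in> I \<Longrightarrow> van K (f i)) \<Longrightarrow> van K (sum f I)"
  by (simp add: van_def coef_sum)

lemma van_Suc: "van (Suc K) a \<longleftrightarrow> coef a [] = 0 \<and> (\<forall>x. van K (dd x a))"
proof
  assume *: "coef a [] = 0 \<and> (\<forall>x. van K (dd x a))"
  show "van (Suc K) a"
    unfolding van_def
  proof (intro allI impI)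
    fix w :: "'a list" assume "length w < Suc K"
    then show "coef a w = 0" using * by (cases w) (auto simp: van_def coef_dd)
  qed
qed (auto simp: van_def coef_dd)

lemma van_dd: "van K a \<Longrightarrow> van (K - 1) (dd x a)"
  by (cases K) (auto simp: van_Suc)

lemma hmul_vanish:
  assumes "\<And>u. length u < i \<Longrightarrow> a u = 0" "\<And>u. length u < j \<Longrightarrow> b u = 0" "length w < i + j"
  shows "hmul a b w = 0"
  using assms
proof (induction w arbitrary: a b i j)
  case Nil
  then show ?case by (cases i) auto
next
  case (Cons x w)
  have "hmul (\<lambda>u. a (x # u)) b w = 0"
    by (rule Cons.IH[of "i - 1" _ j]) (use Cons.prems in auto)
  moreover have "hmul a (\<lambda>u. b (x # u)) w = 0"
    by (rule Cons.IH[of i _ "j - 1"]) (use Cons.prems in auto)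
  ultimately show ?case by simp
qed

lemma van_mult: "van i a \<Longrightarrow> van j b \<Longrightarrow> van (i + j) (a * b)"
  unfolding van_def coef_mult by (intro allI impI hmul_vanish[of i _ j]) auto

lemma van_mult_left: "van i a \<Longrightarrow> van i (b * a)"
  using van_mult[OF van_0, of i a b] by simp

text \<open>For a derivation W this is the Taylor series of a along the formal integral curve of W
  through the base point. It is a ring homomorphism that turns W into d/dt, and so converts a linear
  system along W into one for power series in one variable.\<close>

definition lie :: "('x hser \<Rightarrow> 'x hser) \<Rightarrow> 'x hser \<Rightarrow> complex fps" where
  "lie W a = Abs_fps (\<lambda>n. coef ((W ^^ n) a) [] / fact n)"

lemma lie_nth: "fps_nth (lie W a) n = coef ((W ^^ n) a) [] / fact n"
  by (simp add: lie_def)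

lemma lie_deriv: "fps_deriv (lie W a) = lie W (W a)"
proof (rule fps_ext)
  fix n
  have "of_nat (Suc n) * (c / fact (Suc n)) = c / (fact n :: complex)" for c
    by (simp only: fact_Suc of_nat_mult times_divide_eq_right of_nat_fact) (simp del: of_nat_Suc)
  then show "fps_nth (fps_deriv (lie W a)) n = fps_nth (lie W (W a)) n"
    by (simp only: fps_deriv_nth lie_nth Suc_eq_plus1[symmetric] funpow_Suc_right o_apply)
qed

lemma funpow_add_hom:
  fixes W :: "'r::comm_ring_1 \<Rightarrow> 'r" and n :: nat
  assumes "\<And>a b. W (a + b) = W a + W b"
  shows "(W ^^ n) (a + b) = (W ^^ n) a + (W ^^ n) b"
  by (induction n) (simp_all add: assms)

lemma lie_add: "derivation W \<Longrightarrow> lie W (a + b) = lie W a + lie W b"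
  by (rule fps_ext) (simp add: lie_nth funpow_add_hom[OF derivation_add] coef_add add_divide_distrib)

text \<open>Both sides have the same constant term, and their derivatives expand by the same product
  rule; the coefficient at n + 1 follows from those at n because n + 1 is invertible in the complex
  numbers.\<close>

lemma lie_mult:
  assumes W: "derivation W"
  shows "lie W (a * b) = lie W a * lie W b"
proof (rule fps_ext)
  fix n
  show "fps_nth (lie W (a * b)) n = fps_nth (lie W a * lie W b) n"
  proof (induction n arbitrary: a b)
    case 0
    then show ?case by (simp add: lie_nth coef_mult)
  next
    case (Suc n)
    have "of_nat (Suc n) * fps_nth (lie W (a * b)) (Suc n) = fps_nth (fps_deriv (lie W (a * b))) n"
      by (simp only: fps_deriv_nth Suc_eq_plus1)
    also have "\<dots> = fps_nth (lie W (W a * b) + lie W (a * W b)) n"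
      by (simp only: lie_deriv derivation_mult[OF W] lie_add[OF W])
    also have "\<dots> = fps_nth (lie W (W a) * lie W b + lie W a * lie W (W b)) n"
      by (simp only: fps_add_nth Suc)
    also have "\<dots> = fps_nth (fps_deriv (lie W a * lie W b)) n"
      by (simp only: fps_deriv_mult lie_deriv add.commute)
    also have "\<dots> = of_nat (Suc n) * fps_nth (lie W a * lie W b) (Suc n)"
      by (simp only: fps_deriv_nth Suc_eq_plus1)
    finally show ?case by (simp only: mult_cancel_left of_nat_eq_0_iff) simp
  qed
qed

lemma lie_0: "derivation W \<Longrightarrow> lie W 0 = 0"
  using lie_add[of W 0 0] by simp

lemma lie_sum: "derivation W \<Longrightarrow> lie W (sum f I) = (\<Sum>i\<in>I. lie W (f i))"
  by (induction I rule: infinite_finite_induct) (simp_all add: lie_0 lie_add)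

lemma lie_power: "derivation W \<Longrightarrow> lie W (a ^ Suc n) = lie W a ^ Suc n"
  by (induction n) (simp_all add: lie_mult)

lemma flat_lie_van:
  assumes "\<And>K a. van K a \<Longrightarrow> van (K - 1) (W a)" "van K a"
  shows "flat K (lie W a)"
proof -
  have "van (K - n) ((W ^^ n) a)" for n
  proof (induction n)
    case (Suc n)
    show ?case using assms(1)[OF Suc] by simp
  qed (use assms(2) in simp)
  then have "coef ((W ^^ n) a) [] = 0" if "n < K" for n
    using that by (metis van_def list.size(3) zero_less_diff)
  then show ?thesis by (simp add: flat_def lie_nth)
qed

section \<open>A finite closed system for approximate infinitesimal automorphisms\<close>

text \<open>Sequences over s that are expressible through G modulo errors, up to division by
  \<Delta>. The scalars in \<open>scale\<close> are constant in s, which is why one linear system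
  serves all s; \<open>cancel\<close> divides by \<Delta> although it need not be a unit.\<close>

inductive_set cl :: "('s \<Rightarrow> 'r::comm_ring_1) set \<Rightarrow> 'r \<Rightarrow> ('s \<Rightarrow> 'r) set \<Rightarrow> ('s \<Rightarrow> 'r) set"
  for E \<Delta> G where
  base: "g \<in> G \<Longrightarrow> g \<in> cl E \<Delta> G"
| err: "e \<in> E \<Longrightarrow> e \<in> cl E \<Delta> G"
| add: "f \<in> cl E \<Delta> G \<Longrightarrow> g \<in> cl E \<Delta> G \<Longrightarrow> (\<lambda>s. f s + g s) \<in> cl E \<Delta> G"
| scale: "f \<in> cl E \<Delta> G \<Longrightarrow> (\<lambda>s. a * f s) \<in> cl E \<Delta> G"
| cancel: "(\<lambda>s. \<Delta> * f s) \<in> cl E \<Delta> G \<Longrightarrow> f \<in> cl E \<Delta> G"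

lemma cl_minus: "f \<in> cl E \<Delta> G \<Longrightarrow> (\<lambda>s. - f s) \<in> cl E \<Delta> G"
  using cl.scale[of f E \<Delta> G "- 1"] by simp

lemma cl_diff: "f \<in> cl E \<Delta> G \<Longrightarrow> g \<in> cl E \<Delta> G \<Longrightarrow> (\<lambda>s. f s - g s) \<in> cl E \<Delta> G"
  using cl.add[OF _ cl_minus, of f E \<Delta> G g] by simp

lemma cl_subset:
  assumes G: "G \<subseteq> cl E \<Delta> G'" and f: "f \<in> cl E \<Delta> G"
  shows "f \<in> cl E \<Delta> G'"
  using f
proof (induction rule: cl.induct)
  case (base g)
  then show ?case using G by blast
qed (auto intro: cl.err cl.add cl.scale cl.cancel)

definition err_space :: "('s \<Rightarrow> 'r::comm_ring_1) set \<Rightarrow> bool" where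
  "err_space E \<longleftrightarrow> (\<lambda>s. 0) \<in> E \<and> (\<forall>f\<in>E. \<forall>g\<in>E. (\<lambda>s. f s + g s) \<in> E) \<and> (\<forall>a. \<forall>f\<in>E. (\<lambda>s. a * f s) \<in> E)"

lemma cl_zero: "err_space E \<Longrightarrow> (\<lambda>s. 0) \<in> cl E \<Delta> G"
  by (rule cl.err) (simp add: err_space_def)

lemma err_scale: "err_space E \<Longrightarrow> f \<in> E \<Longrightarrow> (\<lambda>s. a * f s) \<in> E"
  by (simp add: err_space_def)

lemma cl_sum:
  assumes "err_space E" "\<And>i. i \<in> I \<Longrightarrow> f i \<in> cl E \<Delta> G"
  shows "(\<lambda>s. \<Sum>i\<in>I. f i s) \<in> cl E \<Delta> G"
  using assms(2)
proof (induction I rule: infinite_finite_induct)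
  case (insert i I)
  then show ?case using cl.add[of "f i" E \<Delta> G "\<lambda>s. \<Sum>i\<in>I. f i s"] by simp
qed (simp_all add: cl_zero[OF assms(1)])

text \<open>Scaling and cancelling produce D of a scalar times the undifferentiated f. Hence the
  target span has to contain G itself besides the derivatives of its elements.\<close>

lemma cl_derivation:
  assumes D: "derivation D" and E: "\<And>e. e \<in> E \<Longrightarrow> (\<lambda>s. D (e s)) \<in> E"
    and G: "\<And>g. g \<in> G \<Longrightarrow> (\<lambda>s. D (g s)) \<in> cl E \<Delta> G'" "G \<subseteq> cl E \<Delta> G'"
    and f: "f \<in> cl E \<Delta> G"
  shows "(\<lambda>s. D (f s)) \<in> cl E \<Delta> G'"
  using f
proof (induction rule: cl.induct)
  case (base g)
  then show ?case by (rule G(1))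
next
  case (err e)
  then show ?case using E cl.err by blast
next
  case (add f g)
  then show ?case using cl.add[OF add.IH] by (simp add: derivation_add[OF D])
next
  case (scale f a)
  have "f \<in> cl E \<Delta> G'" by (rule cl_subset[OF G(2) scale.hyps])
  from cl.add[OF cl.scale[OF this, of "D a"] cl.scale[OF scale.IH, of a]]
  show ?case by (simp add: derivation_mult[OF D])
next
  case (cancel f)
  have "f \<in> cl E \<Delta> G'" by (rule cl_subset[OF G(2) cl.cancel[OF cancel.hyps]])
  from cl_diff[OF cancel.IH cl.scale[OF this, of "D \<Delta>"]]
  have "(\<lambda>s. \<Delta> * D (f s)) \<in> cl E \<Delta> G'" by (simp add: derivation_mult[OF D])
  then show ?case by (rule cl.cancel)
qed

text \<open>Clearing denominators: all cancellations are collected into one power of \<Delta>. The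
  exponent and the coefficients depend on f but not on s.\<close>

lemma cl_normal_form:
  assumes G: "finite G" and E: "err_space E" and f: "f \<in> cl E \<Delta> G"
  shows "\<exists>m c e. e \<in> E \<and> (\<forall>s. \<Delta> ^ m * f s = (\<Sum>g\<in>G. c g * g s) + e s)"
  using f
proof (induction rule: cl.induct)
  case (base g)
  have "\<forall>s. \<Delta> ^ 0 * g s = (\<Sum>h\<in>G. (if h = g then 1 else 0) * h s) + 0"
    using G base by (simp add: if_distrib[of "\<lambda>x. x * _"] sum.delta cong: if_cong)
  moreover have "(\<lambda>s. 0) \<in> E" using E by (simp add: err_space_def)
  ultimately show ?case by meson
next
  case (err e)
  have "\<forall>s. \<Delta> ^ 0 * e s = (\<Sum>h\<in>G. 0 * h s) + e s" by simp
  with err show ?case by meson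
next
  case (add f g)
  obtain m c e where 1: "e \<in> E" "\<And>s. \<Delta> ^ m * f s = (\<Sum>g\<in>G. c g * g s) + e s" using add.IH(1) by blast
  obtain m' c' e' where 2: "e' \<in> E" "\<And>s. \<Delta> ^ m' * g s = (\<Sum>g\<in>G. c' g * g s) + e' s" using add.IH(2) by blast
  have "\<Delta> ^ (m + m') * (f s + g s) = (\<Sum>g\<in>G. (\<Delta> ^ m' * c g + \<Delta> ^ m * c' g) * g s) + (\<Delta> ^ m' * e s + \<Delta> ^ m * e' s)" for s
  proof -
    have "\<Delta> ^ (m + m') * (f s + g s) = \<Delta> ^ m' * (\<Delta> ^ m * f s) + \<Delta> ^ m * (\<Delta> ^ m' * g s)"
      by (simp add: power_add algebra_simps)
    then show ?thesis unfolding 1 2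
      by (simp add: algebra_simps sum.distrib sum_distrib_left)
  qed
  moreover have "(\<lambda>s. \<Delta> ^ m' * e s + \<Delta> ^ m * e' s) \<in> E"
    using E 1(1) 2(1) unfolding err_space_def by simp
  ultimately show ?case
    by (intro exI[of _ "m + m'"] exI[of _ "\<lambda>g. \<Delta> ^ m' * c g + \<Delta> ^ m * c' g"] exI[of _ "\<lambda>s. \<Delta> ^ m' * e s + \<Delta> ^ m * e' s"]) simp
next
  case (scale f a)
  obtain m c e where 1: "e \<in> E" "\<And>s. \<Delta> ^ m * f s = (\<Sum>g\<in>G. c g * g s) + e s" using scale.IH by blast
  have "\<Delta> ^ m * (a * f s) = (\<Sum>g\<in>G. (a * c g) * g s) + a * e s" for s
    using arg_cong[OF 1(2)[of s], of "\<lambda>x. a * x"] by (simp add: algebra_simps sum_distrib_left)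
  moreover have "(\<lambda>s. a * e s) \<in> E" using E 1(1) unfolding err_space_def by simp
  ultimately show ?case
    by (intro exI[of _ m] exI[of _ "\<lambda>g. a * c g"] exI[of _ "\<lambda>s. a * e s"]) simp
next
  case (cancel f)
  obtain m c e where 1: "e \<in> E" "\<And>s. \<Delta> ^ m * (\<Delta> * f s) = (\<Sum>g\<in>G. c g * g s) + e s" using cancel.IH by blast
  then have "\<forall>s. \<Delta> ^ Suc m * f s = (\<Sum>g\<in>G. c g * g s) + e s" by (simp add: mult_ac)
  with 1(1) show ?case by meson
qed

text \<open>The second-order terms cancel because the constant-coefficient parts commute, so only
  derivatives of \<alpha> and \<beta> survive.\<close>

lemma derivation_commutator:
  assumes "derivation A" "derivation B" "derivation C" "derivation D"
    and "\<And>f. C (A f) = A (C f)" "\<And>f. C (B f) = B (C f)" "\<And>f. D (A f) = A (D f)" "\<And>f. D (B f) = B (D f)"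
    and P: "\<And>f. P f = A f - \<alpha> * B f" and Q: "\<And>f. Q f = C f - \<beta> * D f"
  shows "P (Q f) - Q (P f) = Q \<alpha> * B f - P \<beta> * D f"
proof -
  have 1: "P (Q f) = A (C f) - (A \<beta> * D f + \<beta> * A (D f)) - \<alpha> * (B (C f) - (B \<beta> * D f + \<beta> * B (D f)))"
    unfolding P Q derivation_diff[OF assms(1)] derivation_diff[OF assms(2)] derivation_mult[OF assms(1)] derivation_mult[OF assms(2)] ..
  have 2: "Q (P f) = A (C f) - (C \<alpha> * B f + \<alpha> * B (C f)) - \<beta> * (A (D f) - (D \<alpha> * B f + \<alpha> * B (D f)))"
    unfolding P Q derivation_diff[OF assms(3)] derivation_diff[OF assms(4)] derivation_mult[OF assms(3)] derivation_mult[OF assms(4)] assms(5-8) ..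
  show ?thesis unfolding 1 2 P[of \<beta>] Q[of \<alpha>] by (simp add: algebra_simps)
qed

lemma derivation_comb2:
  assumes "derivation A" "derivation B"
  shows "derivation (\<lambda>f. A f - \<alpha> * B f)"
  unfolding derivation_def
  by (simp add: derivation_add[OF assms(1)] derivation_add[OF assms(2)] derivation_mult[OF assms(1)]
      derivation_mult[OF assms(2)] algebra_simps)

text \<open>An abstract differential ring, so that the calculus can be applied to jets.
  \<open>iw\<close> and \<open>it\<close> invert the two w-derivatives of \<rho>. The parameter p is
  a second coordinate index and not a base point; \<open>half\<close> and \<open>third\<close>
  invert the multiplicities that arise when indices coincide with p.\<close>

locale cr_operators =
  fixes dz db :: "'n::finite \<Rightarrow> 'r::comm_ring_1 \<Rightarrow> 'r" and \<rho> iw it half third :: 'r and w p :: 'n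
  assumes dz: "\<And>j. derivation (dz j)" and db: "\<And>j. derivation (db j)"
    and zz: "\<And>j k f. dz j (dz k f) = dz k (dz j f)"
    and zb: "\<And>j k f. dz j (db k f) = db k (dz j f)"
    and bb: "\<And>j k f. db j (db k f) = db k (db j f)"
    and iw: "dz w \<rho> * iw = 1" and it: "db w \<rho> * it = 1"
    and half: "half * 2 = 1" and third: "third * 3 = 1" and pw: "p \<noteq> w"
begin

text \<open>L j and Lb k are the CR fields of the level sets of \<rho>, normalised so that the index
  w can be kept: L w and Lb w are zero. T completes them to a frame of the complexified tangent
  space, and h is the Levi matrix in this frame, the commutator of L j and Lb k being h j k
  T.\<close>

definition "a j = dz j \<rho> * iw"
definition "b k = db k \<rho> * it"
definition "kap = db w \<rho> * iw"
definition "L j f = dz j f - a j * dz w f"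
definition "Lb k f = db k f - b k * db w f"
definition "T f = db w f - kap * dz w f"
definition "h j k = - L j (b k)"

lemma L: "derivation (L j)" and Lb: "derivation (Lb j)" and T: "derivation T"
  unfolding L_def[abs_def] Lb_def[abs_def] T_def[abs_def] by (rule derivation_comb2[OF dz dz] derivation_comb2[OF db db] derivation_comb2[OF db dz])+

lemma L_rho: "L j \<rho> = 0" and Lb_rho: "Lb j \<rho> = 0" and T_rho: "T \<rho> = 0"
proof -
  have "L j \<rho> = dz j \<rho> * (1 - dz w \<rho> * iw)" unfolding L_def a_def by (simp add: algebra_simps)
  then show "L j \<rho> = 0" by (simp add: iw)
  have "Lb j \<rho> = db j \<rho> * (1 - db w \<rho> * it)" unfolding Lb_def b_def by (simp add: algebra_simps)
  then show "Lb j \<rho> = 0" by (simp add: it)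
  have "T \<rho> = db w \<rho> * (1 - dz w \<rho> * iw)" unfolding T_def kap_def by (simp add: algebra_simps)
  then show "T \<rho> = 0" by (simp add: iw)
qed

lemmas L0 = derivation_0[OF L] and Lb0 = derivation_0[OF Lb] and T0 = derivation_0[OF T]
lemmas L_simps = derivation_add[OF L] derivation_mult[OF L] derivation_minus[OF L] derivation_diff[OF L] L0
lemmas T_simps = derivation_add[OF T] derivation_mult[OF T] derivation_minus[OF T] derivation_diff[OF T] T0

lemma dzw_cancel: "c * dz w \<rho> = 0 \<Longrightarrow> c = 0"
  by (metis iw mult.assoc mult.right_neutral mult_zero_left)

text \<open>The commutator is a multiple of \<open>dz w\<close>. It kills \<rho>, as both fields do,
  and the w-derivative of \<rho> is a unit, so the multiple is zero.\<close>

lemma L_commute: "L j (L k f) = L k (L j f)"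
proof -
  have c: "L j (L k f) - L k (L j f) = L k (a j) * dz w f - L j (a k) * dz w f" for f
    by (rule derivation_commutator[of "dz j" "dz w" "dz k" "dz w"]) (simp_all add: dz zz L_def)
  have "(L k (a j) - L j (a k)) * dz w \<rho> = 0"
    using c[of \<rho>] unfolding L_rho L0 by (simp add: algebra_simps)
  then have "L k (a j) = L j (a k)" using dzw_cancel by fastforce
  then show ?thesis using c[of f] by simp
qed

lemma LT_commute: "L j (T f) = T (L j f)"
proof -
  have c: "L j (T f) - T (L j f) = T (a j) * dz w f - L j kap * dz w f" for f
    by (rule derivation_commutator[of "dz j" "dz w" "db w" "dz w"]) (simp_all add: dz db zz zb L_def T_def)
  have "(T (a j) - L j kap) * dz w \<rho> = 0"
    using c[of \<rho>] unfolding L_rho T_rho L0 T0 by (simp add: algebra_simps)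
  then have "T (a j) = L j kap" using dzw_cancel by fastforce
  then show ?thesis using c[of f] by simp
qed

text \<open>Evaluation at \<rho> again: this commutator has components along \<open>dz w\<close> and
  \<open>db w\<close>, and the fact that it kills \<rho> fixes their ratio to that of T.\<close>

lemma Lb_a: "Lb k (a j) = - (h j k * kap)"
  and Lb_L: "Lb k (L j f) = L j (Lb k f) - h j k * T f"
proof -
  have c: "L j (Lb k f) - Lb k (L j f) = Lb k (a j) * dz w f - L j (b k) * db w f" for f
    by (rule derivation_commutator[of "dz j" "dz w" "db k" "db w"]) (simp_all add: dz db zz zb bb L_def Lb_def)
  have e: "Lb k (a j) * dz w \<rho> = - (h j k * db w \<rho>)"
    using c[of \<rho>] unfolding L_rho Lb_rho L0 Lb0 h_def by (simp add: algebra_simps)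
  have "Lb k (a j) = Lb k (a j) * dz w \<rho> * iw" by (simp add: iw mult.assoc)
  also have "\<dots> = - (h j k * kap)" unfolding e kap_def by (simp add: algebra_simps)
  finally show 1: "Lb k (a j) = - (h j k * kap)" .
  show "Lb k (L j f) = L j (Lb k f) - h j k * T f"
    using c[of f] unfolding 1 T_def h_def by (simp add: algebra_simps)
qed

lemma Lb_T: "Lb k (T f) = T (Lb k f) + T (b k) * T f"
proof -
  have c: "Lb k (T f) - T (Lb k f) = T (b k) * db w f - Lb k kap * dz w f" for f
    by (rule derivation_commutator[of "db k" "db w" "db w" "dz w"]) (simp_all add: dz db zb bb Lb_def T_def)
  have e: "Lb k kap * dz w \<rho> = T (b k) * db w \<rho>"
    using c[of \<rho>] unfolding Lb_rho T_rho Lb0 T0 by (simp add: algebra_simps)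
  have "Lb k kap = Lb k kap * dz w \<rho> * iw" by (simp add: iw mult.assoc)
  also have "\<dots> = T (b k) * db w \<rho> * iw" by (simp only: e)
  also have "\<dots> = T (b k) * kap" by (simp only: kap_def mult.assoc)
  finally have k: "Lb k kap = T (b k) * kap" .
  have "Lb k (T f) = T (Lb k f) + (T (b k) * db w f - Lb k kap * dz w f)"
    unfolding c[of f, symmetric] by simp
  also have "T (b k) * db w f - Lb k kap * dz w f = T (b k) * T f"
    unfolding k T_def[of f] by (simp add: algebra_simps)
  finally show ?thesis .
qed

lemma b_w: "b w = 1" and a_w: "a w = 1"
  by (simp_all add: b_def a_def it iw)

text \<open>Lb is moved to the right until it meets x. Passing an L leaves a multiple of T in its
  place, so the leading terms trade one L for one T; the others differentiate h and carry fewer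
  derivatives of x.\<close>

lemma Lb3:
  assumes "\<And>k. Lb k x = 0"
  shows "Lb k (L i x) = - (h i k * T x)"
    and "Lb k (L j (L l x)) = - (L j (h l k) * T x + h l k * T (L j x) + h j k * T (L l x))"
    and "Lb k (L i (L j (L l x))) = - (h i k * T (L j (L l x)) + h l k * T (L i (L j x)) + h j k * T (L i (L l x)))
      - (L i (L j (h l k)) * T x + L j (h l k) * T (L i x) + L i (h l k) * T (L j x) + L i (h j k) * T (L l x))"
proof -
  show 1: "Lb k (L i x) = - (h i k * T x)" for i by (simp add: Lb_L assms L0)
  show 2: "Lb k (L j (L l x)) = - (L j (h l k) * T x + h l k * T (L j x) + h j k * T (L l x))" for j l
    unfolding Lb_L[of k j "L l x"] 1 by (simp add: L_simps LT_commute algebra_simps)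
  show "Lb k (L i (L j (L l x))) = - (h i k * T (L j (L l x)) + h l k * T (L i (L j x)) + h j k * T (L i (L l x)))
      - (L i (L j (h l k)) * T x + L j (h l k) * T (L i x) + L i (h l k) * T (L j x) + L i (h j k) * T (L l x))"
    unfolding Lb_L[of k i "L j (L l x)"] 2 by (simp add: L_simps LT_commute algebra_simps)
qed

lemma LbT3:
  assumes "\<And>k. Lb k x = 0"
  shows "Lb k (T (L j x)) = - (T (h j k) * T x + h j k * T (T x)) + T (b k) * T (L j x)"
    and "Lb k (T (L j (L l x))) = - (h l k * T (T (L j x)) + h j k * T (T (L l x)))
      - (T (L j (h l k)) * T x + L j (h l k) * T (T x) + T (h l k) * T (L j x) + T (h j k) * T (L l x))
      + T (b k) * T (L j (L l x))"
    and "Lb k (T (T (L j x))) = - (h j k * T (T (T x)))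
      - (T (T (h j k)) * T x + T (h j k) * T (T x) + T (h j k) * T (T x))
      + T (T (b k)) * T (L j x) + T (b k) * T (T (L j x)) + T (b k) * T (T (L j x))"
proof -
  show 1: "Lb k (T (L j x)) = - (T (h j k) * T x + h j k * T (T x)) + T (b k) * T (L j x)"
    unfolding Lb_T Lb3[OF assms] by (simp add: T_simps algebra_simps)
  show "Lb k (T (L j (L l x))) = - (h l k * T (T (L j x)) + h j k * T (T (L l x)))
      - (T (L j (h l k)) * T x + L j (h l k) * T (T x) + T (h l k) * T (L j x) + T (h j k) * T (L l x))
      + T (b k) * T (L j (L l x))"
    unfolding Lb_T Lb3[OF assms] by (simp add: T_simps algebra_simps)
  show "Lb k (T (T (L j x))) = - (h j k * T (T (T x)))
      - (T (T (h j k)) * T x + T (h j k) * T (T x) + T (h j k) * T (T x))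
      + T (T (b k)) * T (L j x) + T (b k) * T (T (L j x)) + T (b k) * T (T (L j x))"
    unfolding Lb_T[of k "T (L j x)"] 1 by (simp add: T_simps algebra_simps)
qed

text \<open>
  Applying \<open>L\<close> to the equation writes \<open>Y\<close> through \<open>X, L X\<close>, and applying \<open>Lb\<close> writes \<open>X\<close>
  through \<open>Y, Lb Y, T Y\<close>. The latter span is stable under \<open>L\<close>, so all iterated \<open>L\<close>-derivatives of
  \<open>X\<close> stay in the system; since \<open>Lb X = 0\<close> and \<open>[L j, Lb k] = h j k T\<close>, applying \<open>Lb\<close> to them
  trades \<open>L\<close>'s for \<open>T\<close>'s, at the price of a factor \<open>\<Delta>\<close>.
\<close>

theorem closed_system:
  fixes X Y :: "'n \<Rightarrow> 's \<Rightarrow> 'r"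
  assumes E: "err_space E"
    and EL: "\<And>j e. e \<in> E \<Longrightarrow> (\<lambda>s. L j (e s)) \<in> E"
    and ELb: "\<And>j e. e \<in> E \<Longrightarrow> (\<lambda>s. Lb j (e s)) \<in> E"
    and ET: "\<And>e. e \<in> E \<Longrightarrow> (\<lambda>s. T (e s)) \<in> E"
    and X: "\<And>k i s. db k (X i s) = 0" and Y: "\<And>k i s. dz k (Y i s) = 0"
    and XY: "(\<lambda>s. \<Sum>i\<in>UNIV. dz i \<rho> * X i s + db i \<rho> * Y i s) \<in> E"
    and adj: "\<And>c i. c \<noteq> w \<Longrightarrow> (\<Sum>j\<in>UNIV. \<kappa> c j * h j i) = (if i = c then \<Delta> else 0)"
    and adj': "\<And>c i. c \<noteq> w \<Longrightarrow> (\<Sum>k\<in>UNIV. h i k * \<kappa>' k c) = (if i = c then \<Delta> else 0)"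
    and G: "G = (\<Union>i. {X i, (\<lambda>s. T (X i s)), (\<lambda>s. T (T (X i s)))})
      \<union> (\<Union>i. \<Union>j. {(\<lambda>s. L j (X i s)), (\<lambda>s. T (L j (X i s)))})"
    and f: "f \<in> cl E \<Delta> G"
  shows "(\<lambda>s. L j (f s)) \<in> cl E \<Delta> G" "(\<lambda>s. Lb j (f s)) \<in> cl E \<Delta> G" "(\<lambda>s. T (f s)) \<in> cl E \<Delta> G"
proof -
  define V where "V = cl E \<Delta> G"
  have LbX: "Lb k (X i s) = 0" for k i s by (simp add: Lb_def X)
  have LY: "L k (Y i s) = 0" for k i s by (simp add: L_def Y)
  note intros = cl.add cl_diff cl_minus cl.scale
  have VX: "X i \<in> V" "(\<lambda>s. T (X i s)) \<in> V" "(\<lambda>s. T (T (X i s))) \<in> V"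
    "(\<lambda>s. L k (X i s)) \<in> V" "(\<lambda>s. T (L k (X i s))) \<in> V" for i k
    unfolding V_def G by (intro cl.base, blast)+
  \<comment> \<open>Contraction with the adjugate isolates \<Delta> times F at one index, and
    \<open>cl.cancel\<close> removes \<Delta>. The index w is excluded because row w of h is
    zero.\<close>
  have pick1: "F p' \<in> cl E \<Delta> H" if "\<And>k. (\<lambda>s. \<Sum>c\<in>UNIV. h c k * F c s) \<in> cl E \<Delta> H" "p' \<noteq> w" for F H p'
  proof -
    have "(\<lambda>s. \<Sum>k\<in>UNIV. \<kappa>' k p' * (\<Sum>c\<in>UNIV. h c k * F c s)) \<in> cl E \<Delta> H"
      by (intro cl_sum[OF E] cl.scale that(1))
    also have "(\<lambda>s. \<Sum>k\<in>UNIV. \<kappa>' k p' * (\<Sum>c\<in>UNIV. h c k * F c s)) = (\<lambda>s. \<Delta> * F p' s)"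
    proof
      fix s
      have "(\<Sum>k\<in>UNIV. \<kappa>' k p' * (\<Sum>c\<in>UNIV. h c k * F c s)) = (\<Sum>c\<in>UNIV. (\<Sum>k\<in>UNIV. h c k * \<kappa>' k p') * F c s)"
        unfolding sum_distrib_left sum_distrib_right by (subst sum.swap) (simp only: mult_ac)
      also have "\<dots> = \<Delta> * F p' s" unfolding adj'[OF that(2)]
        by (simp add: if_distrib[of "\<lambda>x. x * _"] cong: if_cong)
      finally show "(\<Sum>k\<in>UNIV. \<kappa>' k p' * (\<Sum>c\<in>UNIV. h c k * F c s)) = \<Delta> * F p' s" .
    qed
    finally show ?thesis by (rule cl.cancel)
  qed
  have pick2: "F p' \<in> cl E \<Delta> H" if "\<And>j. (\<lambda>s. \<Sum>c\<in>UNIV. h j c * F c s) \<in> cl E \<Delta> H" "p' \<noteq> w" for F H p'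
  proof -
    have "(\<lambda>s. \<Sum>j\<in>UNIV. \<kappa> p' j * (\<Sum>c\<in>UNIV. h j c * F c s)) \<in> cl E \<Delta> H"
      by (intro cl_sum[OF E] cl.scale that(1))
    also have "(\<lambda>s. \<Sum>j\<in>UNIV. \<kappa> p' j * (\<Sum>c\<in>UNIV. h j c * F c s)) = (\<lambda>s. \<Delta> * F p' s)"
    proof
      fix s
      have "(\<Sum>j\<in>UNIV. \<kappa> p' j * (\<Sum>c\<in>UNIV. h j c * F c s)) = (\<Sum>c\<in>UNIV. (\<Sum>j\<in>UNIV. \<kappa> p' j * h j c) * F c s)"
        unfolding sum_distrib_left sum_distrib_right by (subst sum.swap) (simp only: mult_ac)
      also have "\<dots> = \<Delta> * F p' s" unfolding adj[OF that(2)]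
        by (simp add: if_distrib[of "\<lambda>x. x * _"] cong: if_cong)
      finally show "(\<Sum>j\<in>UNIV. \<kappa> p' j * (\<Sum>c\<in>UNIV. h j c * F c s)) = \<Delta> * F p' s" .
    qed
    finally show ?thesis by (rule cl.cancel)
  qed
  \<comment> \<open>The choice of G is dictated by this: Lb turns the one L in a generator into a T,
    so nothing beyond two T's arises.\<close>
  have VLb: "(\<lambda>s. Lb k (f s)) \<in> V" if "f \<in> V" for f k
    unfolding V_def
  proof (rule cl_derivation[OF Lb ELb _ _ that[unfolded V_def]])
    fix g assume "g \<in> G"
    then consider i where "g = X i" | i where "g = (\<lambda>s. T (X i s))" | i where "g = (\<lambda>s. T (T (X i s)))"
      | i j where "g = (\<lambda>s. L j (X i s))" | i j where "g = (\<lambda>s. T (L j (X i s)))"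
      unfolding G by blast
    then show "(\<lambda>s. Lb k (g s)) \<in> cl E \<Delta> G"
    proof cases
      case (1 i)
      then show ?thesis using cl_zero[OF E] by (simp add: LbX)
    next
      case (2 i)
      then show ?thesis by (simp only: Lb_T LbX T0 add_0) (intro intros VX[unfolded V_def])
    next
      case (3 i)
      then show ?thesis by (simp only: Lb_T LbX T_simps add_0) (intro intros VX[unfolded V_def])
    next
      case (4 i j)
      then show ?thesis by (simp only: Lb3[OF LbX]) (intro intros VX[unfolded V_def])
    next
      case (5 i j)
      then show ?thesis by (simp only: LbT3[OF LbX]) (intro intros VX[unfolded V_def])
    qed
  qed (auto intro: cl.base)
  define G0 where "G0 = (\<Union>i. {X i}) \<union> (\<Union>i. \<Union>j. {(\<lambda>s. L j (X i s))})"
  have G0: "X i \<in> cl E \<Delta> G0" "(\<lambda>s. L k (X i s)) \<in> cl E \<Delta> G0" for i k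
    unfolding G0_def by (intro cl.base, blast)+
  have G0V: "G0 \<subseteq> V" using VX unfolding G0_def by blast
  \<comment> \<open>L k kills every Y i. In the equation normalised by \<open>it\<close> it
    therefore differentiates only their coefficients b i, and L k (b i) is - h k i.\<close>
  have Ysum: "(\<lambda>s. \<Sum>i\<in>UNIV. h k i * Y i s) \<in> cl E \<Delta> G0" for k
  proof -
    have "(\<lambda>s. it * (\<Sum>i\<in>UNIV. dz i \<rho> * X i s + db i \<rho> * Y i s)) \<in> E"
      by (rule err_scale[OF E XY])
    from EL[OF this, of k] have 1: "(\<lambda>s. L k (it * (\<Sum>i\<in>UNIV. dz i \<rho> * X i s + db i \<rho> * Y i s))) \<in> cl E \<Delta> G0"
      by (rule cl.err)
    have 2: "(\<lambda>s. \<Sum>i\<in>UNIV. L k (it * dz i \<rho>) * X i s + it * dz i \<rho> * L k (X i s)) \<in> cl E \<Delta> G0"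
      by (intro cl_sum[OF E] intros G0)
    have "(\<Sum>i\<in>UNIV. L k (it * dz i \<rho>) * X i s + it * dz i \<rho> * L k (X i s)) - L k (it * (\<Sum>i\<in>UNIV. dz i \<rho> * X i s + db i \<rho> * Y i s))
      = (\<Sum>i\<in>UNIV. h k i * Y i s)" for s
    proof -
      have "L k (it * (\<Sum>i\<in>UNIV. dz i \<rho> * X i s + db i \<rho> * Y i s)) = L k (\<Sum>i\<in>UNIV. it * dz i \<rho> * X i s + b i * Y i s)"
        by (simp add: sum_distrib_left b_def algebra_simps)
      also have "\<dots> = (\<Sum>i\<in>UNIV. L k (it * dz i \<rho>) * X i s + it * dz i \<rho> * L k (X i s) + L k (b i) * Y i s)"
        unfolding derivation_sum[OF L] derivation_add[OF L] derivation_mult[OF L, of k "it * dz _ \<rho>"] derivation_mult[OF L, of k "b _"] LY by simp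
      finally show ?thesis by (simp add: sum_subtractf[symmetric] h_def)
    qed
    with cl_diff[OF 2 1] show ?thesis by simp
  qed
  have Y0: "Y i \<in> cl E \<Delta> G0" for i
  proof (cases "i = w")
    case False
    show ?thesis by (rule pick2[OF Ysum False])
  next
    \<comment> \<open>The matrix h carries no information on Y w, which is read off the
      undifferentiated equation, where its coefficient is b w = 1.\<close>
    case True
    have "(\<lambda>s. it * (\<Sum>i\<in>UNIV. dz i \<rho> * X i s + db i \<rho> * Y i s)) \<in> E"
      by (rule err_scale[OF E XY])
    then have 1: "(\<lambda>s. it * (\<Sum>i\<in>UNIV. dz i \<rho> * X i s + db i \<rho> * Y i s)) \<in> cl E \<Delta> G0" by (rule cl.err)
    have 2: "(\<lambda>s. \<Sum>i\<in>UNIV. it * dz i \<rho> * X i s) \<in> cl E \<Delta> G0" by (intro cl_sum[OF E] intros G0)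
    have 3: "(\<lambda>s. \<Sum>i\<in>UNIV-{w}. b i * Y i s) \<in> cl E \<Delta> G0"
      by (intro cl_sum[OF E] cl.scale pick2[OF Ysum]) auto
    have "it * (\<Sum>i\<in>UNIV. dz i \<rho> * X i s + db i \<rho> * Y i s) - (\<Sum>i\<in>UNIV. it * dz i \<rho> * X i s) - (\<Sum>i\<in>UNIV-{w}. b i * Y i s) = Y w s" for s
    proof -
      have "it * (\<Sum>i\<in>UNIV. dz i \<rho> * X i s + db i \<rho> * Y i s) = (\<Sum>i\<in>UNIV. it * dz i \<rho> * X i s) + (\<Sum>i\<in>UNIV. b i * Y i s)"
        by (simp add: sum_distrib_left b_def algebra_simps sum.distrib)
      moreover have "(\<Sum>i\<in>UNIV. b i * Y i s) = Y w s + (\<Sum>i\<in>UNIV-{w}. b i * Y i s)"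
        by (subst sum.remove[of _ w]) (simp_all add: b_w)
      ultimately show ?thesis by simp
    qed
    with cl_diff[OF cl_diff[OF 1 2] 3] show ?thesis by (simp add: True)
  qed
  have VY: "Y i \<in> V" for i using Y0 G0V unfolding V_def by (rule cl_subset[rotated])
  have VTY: "(\<lambda>s. T (Y i s)) \<in> V" for i
    unfolding V_def
  proof (rule cl_derivation[OF T ET _ _ Y0])
    show "G0 \<subseteq> cl E \<Delta> G" using G0V by (simp add: V_def)
    fix g assume "g \<in> G0"
    then show "(\<lambda>s. T (g s)) \<in> cl E \<Delta> G"
      using VX unfolding V_def G0_def by fastforce
  qed
  \<comment> \<open>A second set of generators for X. Its span is stable under L because L kills Y
    and T Y and sends Lb Y to h T Y; once X lies in it, all iterated L-derivatives of X do.\<close>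
  define Q where "Q = (\<Union>i. {Y i, (\<lambda>s. T (Y i s))}) \<union> (\<Union>i. \<Union>k. {(\<lambda>s. Lb k (Y i s))})"
  have Q: "Y i \<in> cl E \<Delta> Q" "(\<lambda>s. T (Y i s)) \<in> cl E \<Delta> Q" "(\<lambda>s. Lb k (Y i s)) \<in> cl E \<Delta> Q" for i k
    unfolding Q_def by (intro cl.base, blast)+
  have QV: "Q \<subseteq> V" using VY VTY VLb[OF VY] unfolding Q_def by blast
  have QL: "(\<lambda>s. L k (f s)) \<in> cl E \<Delta> Q" if "f \<in> cl E \<Delta> Q" for f k
  proof (rule cl_derivation[OF L EL _ _ that])
    fix g assume "g \<in> Q"
    then consider i where "g = Y i" | i where "g = (\<lambda>s. T (Y i s))" | i j where "g = (\<lambda>s. Lb j (Y i s))"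
      unfolding Q_def by blast
    then show "(\<lambda>s. L k (g s)) \<in> cl E \<Delta> Q"
    proof cases
      case (3 i j)
      have "L k (Lb j (Y i s)) = h k j * T (Y i s)" for s
        using Lb_L[of j k "Y i s"] by (simp add: LY Lb0)
      then show ?thesis using 3 cl.scale[OF Q(2), of "h k j" i] by simp
    qed (use cl_zero[OF E] in \<open>simp_all add: LY LT_commute T0\<close>)
  qed (auto intro: cl.base)
  have Xsum: "(\<lambda>s. \<Sum>i\<in>UNIV. h i k * X i s) \<in> cl E \<Delta> Q" for k
  proof -
    have "(\<lambda>s. iw * (\<Sum>i\<in>UNIV. dz i \<rho> * X i s + db i \<rho> * Y i s)) \<in> E"
      by (rule err_scale[OF E XY])
    from ELb[OF this, of k] have 1: "(\<lambda>s. Lb k (iw * (\<Sum>i\<in>UNIV. dz i \<rho> * X i s + db i \<rho> * Y i s))) \<in> cl E \<Delta> Q"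
      by (rule cl.err)
    have 2: "(\<lambda>s. \<Sum>i\<in>UNIV. Lb k (iw * db i \<rho>) * Y i s + iw * db i \<rho> * Lb k (Y i s)) \<in> cl E \<Delta> Q"
      by (intro cl_sum[OF E] intros Q)
    \<comment> \<open>The factor \<open>it * dz w \<rho>\<close> is the inverse of
      \<open>kap\<close>, which enters through Lb k (a i) = - h i k kap.\<close>
    have 3: "(it * dz w \<rho>) * ((\<Sum>i\<in>UNIV. Lb k (iw * db i \<rho>) * Y i s + iw * db i \<rho> * Lb k (Y i s)) - Lb k (iw * (\<Sum>i\<in>UNIV. dz i \<rho> * X i s + db i \<rho> * Y i s)))
      = (\<Sum>i\<in>UNIV. h i k * X i s)" for s
    proof -
      have "Lb k (iw * (\<Sum>i\<in>UNIV. dz i \<rho> * X i s + db i \<rho> * Y i s)) = Lb k (\<Sum>i\<in>UNIV. iw * db i \<rho> * Y i s + a i * X i s)"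
        by (simp add: sum_distrib_left a_def algebra_simps)
      also have "\<dots> = (\<Sum>i\<in>UNIV. Lb k (iw * db i \<rho>) * Y i s + iw * db i \<rho> * Lb k (Y i s) + Lb k (a i) * X i s)"
        unfolding derivation_sum[OF Lb] derivation_add[OF Lb] derivation_mult[OF Lb, of k "iw * db _ \<rho>"] derivation_mult[OF Lb, of k "a _"] LbX by simp
      finally have 4: "(\<Sum>i\<in>UNIV. Lb k (iw * db i \<rho>) * Y i s + iw * db i \<rho> * Lb k (Y i s)) - Lb k (iw * (\<Sum>i\<in>UNIV. dz i \<rho> * X i s + db i \<rho> * Y i s))
        = (\<Sum>i\<in>UNIV. kap * (h i k * X i s))" by (simp add: sum_subtractf[symmetric] Lb_a algebra_simps)
      have 5: "it * dz w \<rho> * kap = 1"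
      proof -
        have "it * dz w \<rho> * kap = (dz w \<rho> * iw) * (db w \<rho> * it)" unfolding kap_def by (simp only: mult_ac)
        then show ?thesis by (simp add: iw it)
      qed
      show ?thesis
        unfolding 4 sum_distrib_left[symmetric] mult.assoc[of "it * dz w \<rho>" kap, symmetric] 5 by simp
    qed
    show ?thesis using cl.scale[OF cl_diff[OF 2 1], of "it * dz w \<rho>"] unfolding 3 .
  qed
  have XQ: "X i \<in> cl E \<Delta> Q" for i
  proof (cases "i = w")
    case False
    show ?thesis by (rule pick1[OF Xsum False])
  next
    case True
    have "(\<lambda>s. iw * (\<Sum>i\<in>UNIV. dz i \<rho> * X i s + db i \<rho> * Y i s)) \<in> E"
      by (rule err_scale[OF E XY])
    then have 1: "(\<lambda>s. iw * (\<Sum>i\<in>UNIV. dz i \<rho> * X i s + db i \<rho> * Y i s)) \<in> cl E \<Delta> Q" by (rule cl.err)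
    have 2: "(\<lambda>s. \<Sum>i\<in>UNIV. iw * db i \<rho> * Y i s) \<in> cl E \<Delta> Q" by (intro cl_sum[OF E] intros Q)
    have 3: "(\<lambda>s. \<Sum>i\<in>UNIV-{w}. a i * X i s) \<in> cl E \<Delta> Q"
      by (intro cl_sum[OF E] cl.scale pick1[OF Xsum]) auto
    have "iw * (\<Sum>i\<in>UNIV. dz i \<rho> * X i s + db i \<rho> * Y i s) - (\<Sum>i\<in>UNIV. iw * db i \<rho> * Y i s) - (\<Sum>i\<in>UNIV-{w}. a i * X i s) = X w s" for s
    proof -
      have "iw * (\<Sum>i\<in>UNIV. dz i \<rho> * X i s + db i \<rho> * Y i s) = (\<Sum>i\<in>UNIV. iw * db i \<rho> * Y i s) + (\<Sum>i\<in>UNIV. a i * X i s)"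
        by (simp add: sum_distrib_left a_def algebra_simps sum.distrib)
      moreover have "(\<Sum>i\<in>UNIV. a i * X i s) = X w s + (\<Sum>i\<in>UNIV-{w}. a i * X i s)"
        by (subst sum.remove[of _ w]) (simp_all add: a_w)
      ultimately show ?thesis by simp
    qed
    with cl_diff[OF cl_diff[OF 1 2] 3] show ?thesis by (simp add: True)
  qed
  have QsubV: "f \<in> V" if "f \<in> cl E \<Delta> Q" for f
    using QV that unfolding V_def by (rule cl_subset)
  have LLX: "(\<lambda>s. L j (L k (X i s))) \<in> V" for i j k
    by (rule QsubV, intro QL XQ)
  have LLLX: "(\<lambda>s. L j (L k (L l (X i s)))) \<in> V" for i j k l
    by (rule QsubV, intro QL XQ)
  note ms = intros[of _ E \<Delta> G, folded V_def] VX LLX LLLX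
  have halfV: "f \<in> V" if "(\<lambda>s. 2 * f s) \<in> V" for f
    using ms(4)[OF that, of half] by (simp add: mult.assoc[symmetric] half)
  have thirdV: "f \<in> V" if "(\<lambda>s. 3 * f s) \<in> V" for f
    using ms(4)[OF that, of third] by (simp add: mult.assoc[symmetric] third)
  have dl: "(\<Sum>c\<in>UNIV. h c k * (if c = q then f c else 0)) = h q k * f q" for k q and f :: "'n \<Rightarrow> 'r"
    by (simp add: if_distrib[of "\<lambda>x. _ * x"] cong: if_cong)
  \<comment> \<open>Lb is applied to L p L j L l X, already known to lie in V. Up to known terms the
    result is h contracted with F, and \<open>pick1\<close> yields F p. This counts T L j L l X
    once, twice or three times according to how many of j, l equal p; hence \<open>half\<close> and
    \<open>third\<close>.\<close>
  have TLLX: "(\<lambda>s. T (L j (L l (X i s)))) \<in> V" for i j l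
  proof -
    define F where "F c s = (if c = p then T (L j (L l (X i s))) else 0) + (if c = l then T (L p (L j (X i s))) else 0)
      + (if c = j then T (L p (L l (X i s))) else 0)" for c s
    have "(\<lambda>s. \<Sum>c\<in>UNIV. h c k * F c s) \<in> V" for k
    proof -
      have "(\<lambda>s. - Lb k (L p (L j (L l (X i s)))) - (L p (L j (h l k)) * T (X i s) + L j (h l k) * T (L p (X i s)) + L p (h l k) * T (L j (X i s)) + L p (h j k) * T (L l (X i s)))) \<in> V"
        by (intro ms VLb)
      also have "(\<lambda>s. - Lb k (L p (L j (L l (X i s)))) - (L p (L j (h l k)) * T (X i s) + L j (h l k) * T (L p (X i s)) + L p (h l k) * T (L j (X i s)) + L p (h j k) * T (L l (X i s))))
        = (\<lambda>s. \<Sum>c\<in>UNIV. h c k * F c s)"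
        unfolding F_def distrib_left sum.distrib dl Lb3(3)[OF LbX] by (simp add: algebra_simps)
      finally show ?thesis .
    qed
    then have Fp: "F p \<in> V" unfolding V_def using pw by (rule pick1)
    consider "p = l" "p = j" | "p = l" "p \<noteq> j" | "p \<noteq> l" "p = j" | "p \<noteq> l" "p \<noteq> j" by blast
    then show ?thesis
    proof cases
      case 1
      have "F p = (\<lambda>s. 3 * T (L j (L l (X i s))))" unfolding F_def using 1 by (simp add: fun_eq_iff)
      with Fp thirdV show ?thesis by simp
    next
      case 2
      have "F p = (\<lambda>s. 2 * T (L j (L l (X i s))))" unfolding F_def using 2 L_commute[of p j] by (simp add: fun_eq_iff)
      with Fp halfV show ?thesis by simp
    next
      case 3
      have "F p = (\<lambda>s. 2 * T (L j (L l (X i s))))" unfolding F_def using 3 by (simp add: fun_eq_iff)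
      with Fp halfV show ?thesis by simp
    next
      case 4
      have "F p = (\<lambda>s. T (L j (L l (X i s))))" unfolding F_def using 4 by (simp add: fun_eq_iff)
      with Fp show ?thesis by simp
    qed
  qed
  \<comment> \<open>The same device with one more T: Lb acts on T L p L l X, and for the third power
    of T on T T L p X.\<close>
  have TTLX: "(\<lambda>s. T (T (L l (X i s)))) \<in> V" for i l
  proof -
    define F where "F c s = (if c = l then T (T (L p (X i s))) else 0) + (if c = p then T (T (L l (X i s))) else 0)" for c s
    have "(\<lambda>s. \<Sum>c\<in>UNIV. h c k * F c s) \<in> V" for k
    proof -
      have "(\<lambda>s. T (b k) * T (L p (L l (X i s))) - Lb k (T (L p (L l (X i s)))) - (T (L p (h l k)) * T (X i s) + L p (h l k) * T (T (X i s)) + T (h l k) * T (L p (X i s)) + T (h p k) * T (L l (X i s)))) \<in> V"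
        by (intro ms VLb TLLX)
      also have "(\<lambda>s. T (b k) * T (L p (L l (X i s))) - Lb k (T (L p (L l (X i s)))) - (T (L p (h l k)) * T (X i s) + L p (h l k) * T (T (X i s)) + T (h l k) * T (L p (X i s)) + T (h p k) * T (L l (X i s))))
        = (\<lambda>s. \<Sum>c\<in>UNIV. h c k * F c s)"
        unfolding F_def distrib_left sum.distrib dl LbT3(2)[OF LbX] by (simp add: algebra_simps)
      finally show ?thesis .
    qed
    then have Fp: "F p \<in> V" unfolding V_def using pw by (rule pick1)
    show ?thesis
    proof (cases "p = l")
      case True
      have "F p = (\<lambda>s. 2 * T (T (L l (X i s))))" unfolding F_def using True by (simp add: fun_eq_iff)
      with Fp halfV show ?thesis by simp
    next
      case False
      have "F p = (\<lambda>s. T (T (L l (X i s))))" unfolding F_def using False by (simp add: fun_eq_iff)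
      with Fp show ?thesis by simp
    qed
  qed
  have TTTX: "(\<lambda>s. T (T (T (X i s)))) \<in> V" for i
  proof -
    define F where "F c s = (if c = p then T (T (T (X i s))) else 0)" for c s
    have "(\<lambda>s. \<Sum>c\<in>UNIV. h c k * F c s) \<in> V" for k
    proof -
      have "(\<lambda>s. T (T (b k)) * T (L p (X i s)) + T (b k) * T (T (L p (X i s))) + T (b k) * T (T (L p (X i s))) - Lb k (T (T (L p (X i s))))
        - (T (T (h p k)) * T (X i s) + T (h p k) * T (T (X i s)) + T (h p k) * T (T (X i s)))) \<in> V"
        by (intro ms VLb TTLX)
      also have "(\<lambda>s. T (T (b k)) * T (L p (X i s)) + T (b k) * T (T (L p (X i s))) + T (b k) * T (T (L p (X i s))) - Lb k (T (T (L p (X i s))))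
        - (T (T (h p k)) * T (X i s) + T (h p k) * T (T (X i s)) + T (h p k) * T (T (X i s))))
        = (\<lambda>s. \<Sum>c\<in>UNIV. h c k * F c s)"
        unfolding F_def dl LbT3(3)[OF LbX] by (simp add: algebra_simps)
      finally show ?thesis .
    qed
    then have "F p \<in> V" unfolding V_def using pw by (rule pick1)
    moreover have "F p = (\<lambda>s. T (T (T (X i s))))" by (simp add: F_def fun_eq_iff)
    ultimately show ?thesis by simp
  qed
  have gens: "\<exists>i j. g \<in> {X i, (\<lambda>s. T (X i s)), (\<lambda>s. T (T (X i s))), (\<lambda>s. L j (X i s)), (\<lambda>s. T (L j (X i s)))}" if "g \<in> G" for g
    using that unfolding G by blast
  show "(\<lambda>s. Lb j (f s)) \<in> cl E \<Delta> G" using VLb f unfolding V_def by blast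
  show "(\<lambda>s. L j (f s)) \<in> cl E \<Delta> G"
  proof (rule cl_derivation[OF L EL _ _ f])
    fix g assume "g \<in> G"
    from gens[OF this] show "(\<lambda>s. L j (g s)) \<in> cl E \<Delta> G"
      using VX LLX TLLX TTLX unfolding V_def by (auto simp: LT_commute)
  qed (auto intro: cl.base)
  show "(\<lambda>s. T (f s)) \<in> cl E \<Delta> G"
  proof (rule cl_derivation[OF T ET _ _ f])
    fix g assume "g \<in> G"
    from gens[OF this] show "(\<lambda>s. T (g s)) \<in> cl E \<Delta> G"
      using VX TTLX TTTX unfolding V_def by auto
  qed (auto intro: cl.base)
qed

text \<open>Writing \<open>dz j\<close> through L j, and \<open>db j\<close> through Lb j and T,
  leaves a surplus multiple of \<open>dz w\<close>, which D \<rho> = 0 forces to vanish.\<close>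

lemma tangential_decomposition:
  assumes "\<And>f. D f = (\<Sum>j\<in>UNIV. \<alpha> j * dz j f) + (\<Sum>j\<in>UNIV. \<beta> j * db j f)" "D \<rho> = 0"
  shows "D f = (\<Sum>j\<in>UNIV. \<alpha> j * L j f) + (\<Sum>j\<in>UNIV. \<beta> j * Lb j f) + (\<Sum>j\<in>UNIV. \<beta> j * b j) * T f"
proof -
  have "D \<rho> * iw = (\<Sum>j\<in>UNIV. \<alpha> j * a j) + (\<Sum>j\<in>UNIV. \<beta> j * b j) * kap"
  proof -
    have 1: "b j * kap = db j \<rho> * iw" for j
    proof -
      have "b j * kap = db j \<rho> * iw * (db w \<rho> * it)" unfolding b_def kap_def by (simp only: mult_ac)
      then show ?thesis by (simp add: it)
    qed
    show ?thesis unfolding assms(1) sum_distrib_right mult.assoc 1 distrib_right a_def ..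
  qed
  then have z: "(\<Sum>j\<in>UNIV. \<alpha> j * a j) = - ((\<Sum>j\<in>UNIV. \<beta> j * b j) * kap)"
    using assms(2) by (metis add_eq_0_iff2 mult_zero_left)
  have 2: "(\<Sum>j\<in>UNIV. \<alpha> j * L j f) = (\<Sum>j\<in>UNIV. \<alpha> j * dz j f) - (\<Sum>j\<in>UNIV. \<alpha> j * a j) * dz w f"
    unfolding L_def sum_distrib_right right_diff_distrib sum_subtractf mult.assoc ..
  have 3: "(\<Sum>j\<in>UNIV. \<beta> j * Lb j f) = (\<Sum>j\<in>UNIV. \<beta> j * db j f) - (\<Sum>j\<in>UNIV. \<beta> j * b j) * db w f"
    unfolding Lb_def sum_distrib_right right_diff_distrib sum_subtractf mult.assoc ..
  show ?thesis unfolding 2 3 z assms(1) T_def by (simp add: algebra_simps)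
qed

end

unbundle no fps_syntax
unbundle vec_syntax

section \<open>Smooth functions and their jets\<close>

definition pd :: "'n + 'n \<Rightarrow> (complex ^ 'n \<Rightarrow> complex) \<Rightarrow> complex ^ 'n \<Rightarrow> complex" where
  "pd x f = (case x of Inl j \<Rightarrow> wirtinger j f | Inr j \<Rightarrow> wirtinger_bar j f)"

definition ix :: "'n + 'n \<Rightarrow> 'n" where "ix x = (case x of Inl j \<Rightarrow> j | Inr j \<Rightarrow> j)"
definition sg :: "'n + 'n \<Rightarrow> complex" where "sg x = (case x of Inl j \<Rightarrow> - \<i> | Inr j \<Rightarrow> \<i>)"

lemma ix_sg [simp]: "ix (Inl j) = j" "ix (Inr j) = j" "sg (Inl j) = - \<i>" "sg (Inr j) = \<i>"
  by (simp_all add: ix_def sg_def)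

lemma pd_frechet: "pd x f z = (frechet_derivative f (at z) (axis (ix x) 1) + sg x * frechet_derivative f (at z) (axis (ix x) \<i>)) / 2"
  by (cases x) (simp_all add: pd_def wirtinger_def wirtinger_bar_def)

lemma pd_eq:
  assumes "(f has_derivative F) (at z)"
  shows "pd x f z = (F (axis (ix x) 1) + sg x * F (axis (ix x) \<i>)) / 2"
  using frechet_derivative_at[OF assms] by (simp add: pd_frechet)

lemma derivative_pd:
  fixes f :: "complex ^ 'n \<Rightarrow> complex"
  assumes f: "(f has_derivative F) (at z)"
  shows "F v = (\<Sum>j\<in>UNIV. v $ j * pd (Inl j) f z + cnj (v $ j) * pd (Inr j) f z)"
proof -
  have lin: "linear F" using f by (rule has_derivative_linear)
  have "v = (\<Sum>j\<in>UNIV. Re (v $ j) *\<^sub>R axis j 1 + Im (v $ j) *\<^sub>R axis j \<i>)"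
    by (simp add: vec_eq_iff axis_def if_distrib[of "\<lambda>x. _ *\<^sub>R x"] sum.distrib complex_eq_iff cong: if_cong)
  then have "F v = F (\<Sum>j\<in>UNIV. Re (v $ j) *\<^sub>R axis j 1 + Im (v $ j) *\<^sub>R axis j \<i>)" by simp
  also have "\<dots> = (\<Sum>j\<in>UNIV. Re (v $ j) *\<^sub>R F (axis j 1) + Im (v $ j) *\<^sub>R F (axis j \<i>))"
    using lin by (simp add: linear_sum linear_add linear_scale)
  also have "\<dots> = (\<Sum>j\<in>UNIV. v $ j * pd (Inl j) f z + cnj (v $ j) * pd (Inr j) f z)"
  proof (rule sum.cong[OF refl])
    fix j
    have R: "of_real (Re (v $ j)) = (v $ j + cnj (v $ j)) / 2" and I: "of_real (Im (v $ j)) = - \<i> * (v $ j - cnj (v $ j)) / 2"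
      by (simp_all add: complex_eq_iff)
    show "Re (v $ j) *\<^sub>R F (axis j 1) + Im (v $ j) *\<^sub>R F (axis j \<i>) = v $ j * pd (Inl j) f z + cnj (v $ j) * pd (Inr j) f z"
      unfolding pd_eq[OF f] ix_sg scaleR_conv_of_real R I by (simp add: field_simps)
  qed
  finally show ?thesis .
qed

text \<open>\<open>fold\<close> applies the head of a word first, so prefixing a letter means
  differentiating f itself; this agrees with the shift \<open>dd\<close>.\<close>

abbreviation pds :: "('n + 'n) list \<Rightarrow> (complex ^ 'n \<Rightarrow> complex) \<Rightarrow> complex ^ 'n \<Rightarrow> complex" where
  "pds w f \<equiv> fold pd w f"

definition smooth_on :: "(complex ^ 'n) set \<Rightarrow> (complex ^ 'n \<Rightarrow> complex) \<Rightarrow> bool" where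
  "smooth_on U f \<longleftrightarrow> (\<forall>w. \<forall>z\<in>U. pds w f differentiable (at z))"

lemma smooth_on_subset: "smooth_on U f \<Longrightarrow> V \<subseteq> U \<Longrightarrow> smooth_on V f"
  unfolding smooth_on_def by blast

lemma smooth_on_pds: "smooth_on U f \<Longrightarrow> smooth_on U (pds w f)"
  unfolding smooth_on_def by (metis fold_append o_apply)

lemma smooth_on_pd: "smooth_on U f \<Longrightarrow> smooth_on U (pd x f)"
  using smooth_on_pds[of U f "[x]"] by simp

lemma smooth_on_differentiable: "smooth_on U f \<Longrightarrow> z \<in> U \<Longrightarrow> f differentiable (at z)"
  unfolding smooth_on_def by (metis fold_Nil id_apply)

lemma smooth_on_continuous: "smooth_on U f \<Longrightarrow> continuous_on U f"
  by (meson continuous_at_imp_continuous_on differentiable_imp_continuous_within smooth_on_differentiable)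

lemma pd_cong:
  assumes "open U" "z \<in> U" "\<And>z. z \<in> U \<Longrightarrow> f z = g z"
  shows "pd x f z = pd x g z"
proof -
  have "(f has_derivative F) (at z) \<longleftrightarrow> (g has_derivative F) (at z)" for F
    using has_derivative_transform_within_open[of f F z UNIV U g] has_derivative_transform_within_open[of g F z UNIV U f] assms
    by auto
  then show ?thesis by (simp add: pd_frechet frechet_derivative_def)
qed

lemma pds_cong:
  assumes "open U" "\<And>z. z \<in> U \<Longrightarrow> f z = g z" "z \<in> U"
  shows "pds w f z = pds w g z"
  using assms(2,3)
proof (induction w arbitrary: f g z)
  case (Cons x w)
  have "pds w (pd x f) z = pds w (pd x g) z"
    by (rule Cons.IH[OF _ Cons.prems(2)]) (rule pd_cong[OF assms(1) _ Cons.prems(1)])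
  then show ?case by simp
qed simp

lemma differentiable_cong_open:
  assumes "open U" "z \<in> U" "\<And>z. z \<in> U \<Longrightarrow> f z = g z" "f differentiable (at z)"
  shows "g differentiable (at z)"
  using assms has_derivative_transform_within_open[of f _ z UNIV U g] unfolding differentiable_def by auto

lemma smooth_on_cong:
  assumes "open U" "\<And>z. z \<in> U \<Longrightarrow> f z = g z" "smooth_on U f"
  shows "smooth_on U g"
  unfolding smooth_on_def
proof (intro allI ballI)
  fix w z assume z: "z \<in> U"
  show "pds w g differentiable (at z)"
    by (rule differentiable_cong_open[OF assms(1) z pds_cong[OF assms(1,2)]])
      (use assms(3) z in \<open>auto simp: smooth_on_def\<close>)
qed

text \<open>Deals with words of derivatives once and for all: it remains to exhibit a family of
  differentiable functions that contains, up to agreement on U, the first derivatives of its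
  members.\<close>

lemma smooth_on_coinduct:
  assumes U: "open U" and f: "f \<in> R"
    and d: "\<And>f z. f \<in> R \<Longrightarrow> z \<in> U \<Longrightarrow> f differentiable (at z)"
    and s: "\<And>f x. f \<in> R \<Longrightarrow> \<exists>g\<in>R. \<forall>z\<in>U. pd x f z = g z"
  shows "smooth_on U f"
  unfolding smooth_on_def
proof (intro allI ballI)
  fix w z assume "z \<in> U"
  then show "pds w f differentiable (at z)"
    using f
  proof (induction w arbitrary: f z)
    case Nil
    then show ?case using d by simp
  next
    case (Cons x w)
    obtain g where g: "g \<in> R" "\<And>z. z \<in> U \<Longrightarrow> pd x f z = g z" using s[OF Cons.prems(2), of x] by blast
    have "pds w g differentiable (at z)" by (rule Cons.IH[OF Cons.prems(1) g(1)])
    then have "pds w (pd x f) differentiable (at z)"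
      by (rule differentiable_cong_open[OF U Cons.prems(1), rotated]) (rule pds_cong[OF U], simp_all add: g)
    then show ?case by simp
  qed
qed

lemma pd_add:
  assumes "f differentiable (at z)" "g differentiable (at z)"
  shows "pd x (\<lambda>z. f z + g z) z = pd x f z + pd x g z"
proof -
  from assms obtain F G where F: "(f has_derivative F) (at z)" and G: "(g has_derivative G) (at z)"
    unfolding differentiable_def by blast
  show ?thesis
    unfolding pd_eq[OF F] pd_eq[OF G] pd_eq[OF has_derivative_add[OF F G]] by (simp add: field_simps)
qed

lemma pd_mult:
  assumes "f differentiable (at z)" "g differentiable (at z)"
  shows "pd x (\<lambda>z. f z * g z) z = pd x f z * g z + f z * pd x g z"
proof -
  from assms obtain F G where F: "(f has_derivative F) (at z)" and G: "(g has_derivative G) (at z)"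
    unfolding differentiable_def by blast
  show ?thesis
    unfolding pd_eq[OF F] pd_eq[OF G] pd_eq[OF has_derivative_mult[OF F G]] by (simp add: field_simps)
qed

lemma pd_const: "pd x (\<lambda>z. c) z = 0"
  by (simp add: pd_frechet)

lemma pd_inverse:
  assumes "f differentiable (at z)" "f z \<noteq> 0"
  shows "pd x (\<lambda>z. inverse (f z)) z = - (pd x f z * (inverse (f z) * inverse (f z)))"
proof -
  from assms obtain F where F: "(f has_derivative F) (at z)" unfolding differentiable_def by blast
  show ?thesis
    unfolding pd_eq[OF F] pd_eq[OF Deriv.has_derivative_inverse[OF assms(2) F]]
    using assms(2) by (simp add: field_simps)
qed

definition sw :: "'n + 'n \<Rightarrow> 'n + 'n" where "sw x = (case x of Inl j \<Rightarrow> Inr j | Inr j \<Rightarrow> Inl j)"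

lemma sw_simps [simp]: "sw (Inl j) = Inr j" "sw (Inr j) = Inl j"
  by (simp_all add: sw_def)

lemma has_derivative_cnj': "(f has_derivative F) (at z) \<Longrightarrow> ((\<lambda>z. cnj (f z)) has_derivative (\<lambda>v. cnj (F v))) (at z)"
  by (rule bounded_linear.has_derivative[OF bounded_linear_cnj])

lemma pd_cnj:
  assumes "f differentiable (at z)"
  shows "pd x (\<lambda>z. cnj (f z)) z = cnj (pd (sw x) f z)"
proof -
  from assms obtain F where F: "(f has_derivative F) (at z)" unfolding differentiable_def by blast
  show ?thesis
    unfolding pd_eq[OF F] pd_eq[OF has_derivative_cnj'[OF F]] by (cases x) simp_all
qed

lemma has_derivative_coord: "((\<lambda>z. z $ j) has_derivative (\<lambda>v. v $ j)) (at (z :: complex ^ 'n))"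
  by (rule bounded_linear.has_derivative[OF bounded_linear_vec_nth has_derivative_ident])

lemma pd_coord: "pd x (\<lambda>z. z $ j) z = (if x = Inl j then 1 else 0)"
  unfolding pd_eq[OF has_derivative_coord] by (cases x) (auto simp: axis_def)

lemma smooth_on_const: "open U \<Longrightarrow> smooth_on U (\<lambda>z. c)"
proof (rule smooth_on_coinduct[where R = "range (\<lambda>c z. c)"])
  show "\<exists>g\<in>range (\<lambda>c z. c). \<forall>z\<in>U. pd x f z = g z" if "f \<in> range (\<lambda>c z. c)" for f x
    using that by (auto simp: pd_const)
qed auto

text \<open>One family for all closure properties. The derivative of an inverse or of a composite
  mixes sums, products, conjugates and composites, so these rules have to be proved by a joint
  coinduction.\<close>

inductive_set smooth_closure :: "(complex ^ 'm) set \<Rightarrow> (complex ^ 'n \<Rightarrow> complex ^ 'm) \<Rightarrow> (complex ^ 'n) set \<Rightarrow> (complex ^ 'n \<Rightarrow> complex) set"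
  for V H U where
  base: "smooth_on U f \<Longrightarrow> f \<in> smooth_closure V H U"
| comp: "smooth_on V s \<Longrightarrow> (\<lambda>z. s (H z)) \<in> smooth_closure V H U"
| add: "f \<in> smooth_closure V H U \<Longrightarrow> g \<in> smooth_closure V H U \<Longrightarrow> (\<lambda>z. f z + g z) \<in> smooth_closure V H U"
| mult: "f \<in> smooth_closure V H U \<Longrightarrow> g \<in> smooth_closure V H U \<Longrightarrow> (\<lambda>z. f z * g z) \<in> smooth_closure V H U"
| inv: "f \<in> smooth_closure V H U \<Longrightarrow> (\<And>z. z \<in> U \<Longrightarrow> f z \<noteq> 0) \<Longrightarrow> (\<lambda>z. inverse (f z)) \<in> smooth_closure V H U"
| cnj: "f \<in> smooth_closure V H U \<Longrightarrow> (\<lambda>z. cnj (f z)) \<in> smooth_closure V H U"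

lemma smooth_closure_minus: "open U \<Longrightarrow> f \<in> smooth_closure V H U \<Longrightarrow> (\<lambda>z. - f z) \<in> smooth_closure V H U"
  using smooth_closure.mult[OF smooth_closure.base[OF smooth_on_const[of U "- 1"]], of f V H] by simp

lemma smooth_closure_sum:
  "open U \<Longrightarrow> (\<And>i. i \<in> I \<Longrightarrow> f i \<in> smooth_closure V H U) \<Longrightarrow> (\<lambda>z. \<Sum>i\<in>I. f i z) \<in> smooth_closure V H U"
  by (induction I rule: infinite_finite_induct) (auto intro!: smooth_closure.add smooth_closure.base[OF smooth_on_const])

lemma pd_comp:
  fixes H :: "complex ^ 'n \<Rightarrow> complex ^ 'm"
  assumes s: "s differentiable (at (H z))" and H: "\<And>j. (\<lambda>z. H z $ j) differentiable (at z)"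
  shows "pd x (\<lambda>z. s (H z)) z = (\<Sum>j\<in>UNIV. pd (Inl j) s (H z) * pd x (\<lambda>z. H z $ j) z + pd (Inr j) s (H z) * pd x (\<lambda>z. cnj (H z $ j)) z)"
    and "(\<lambda>z. s (H z)) differentiable (at z)"
proof -
  define F where "F j = frechet_derivative (\<lambda>z. H z $ j) (at z)" for j
  have F: "((\<lambda>z. H z $ j) has_derivative F j) (at z)" for j
    using H unfolding F_def frechet_derivative_works .
  then have HF: "(H has_derivative (\<lambda>v. \<chi> j. F j v)) (at z)"
    by (subst has_derivative_componentwise_within) (auto simp: Basis_vec_def inner_axis inner_axis' inner_commute[of _ "_ :: complex"] intro!: derivative_eq_intros)
  define S where "S = frechet_derivative s (at (H z))"
  have S: "(s has_derivative S) (at (H z))" using s unfolding S_def frechet_derivative_works .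
  have c: "((\<lambda>z. s (H z)) has_derivative (\<lambda>v. S (\<chi> j. F j v))) (at z)"
    using diff_chain_at[OF HF S] by (simp add: o_def)
  then show "(\<lambda>z. s (H z)) differentiable (at z)" unfolding differentiable_def by blast
  show "pd x (\<lambda>z. s (H z)) z = (\<Sum>j\<in>UNIV. pd (Inl j) s (H z) * pd x (\<lambda>z. H z $ j) z + pd (Inr j) s (H z) * pd x (\<lambda>z. cnj (H z $ j)) z)"
    unfolding pd_eq[OF c] pd_eq[OF F] pd_eq[OF has_derivative_cnj'[OF F]] derivative_pd[OF S] sum_distrib_left sum.distrib[symmetric] sum_divide_distrib
    by (intro sum.cong refl) (simp add: field_simps)
qed

lemma smooth_closure_smooth:
  fixes H :: "complex ^ 'n \<Rightarrow> complex ^ 'm"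
  assumes U: "open U" and H: "\<And>j. smooth_on U (\<lambda>z. H z $ j)" "\<And>z. z \<in> U \<Longrightarrow> H z \<in> V"
    and f: "f \<in> smooth_closure V H U"
  shows "smooth_on U f"
proof (rule smooth_on_coinduct[OF U f])
  fix f and x :: "'n + 'n"
  assume "f \<in> smooth_closure V H U"
  then have "(\<forall>z\<in>U. f differentiable (at z)) \<and> (\<forall>x. \<exists>g\<in>smooth_closure V H U. \<forall>z\<in>U. pd x f z = g z)"
  proof (induction rule: smooth_closure.induct)
    case (base f)
    then show ?case using smooth_on_differentiable smooth_on_pd[of U f] smooth_closure.base by blast
  next
    case (comp s)
    have "(\<lambda>z. \<Sum>j\<in>UNIV. pd (Inl j) s (H z) * pd x (\<lambda>z. H z $ j) z + pd (Inr j) s (H z) * cnj (pd (sw x) (\<lambda>z. H z $ j) z)) \<in> smooth_closure V H U" for x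
      by (intro smooth_closure_sum[OF U] smooth_closure.add smooth_closure.mult smooth_closure.cnj
          smooth_closure.comp smooth_on_pd comp smooth_closure.base H(1))
    moreover have "pd x (\<lambda>z. s (H z)) z = (\<Sum>j\<in>UNIV. pd (Inl j) s (H z) * pd x (\<lambda>z. H z $ j) z + pd (Inr j) s (H z) * cnj (pd (sw x) (\<lambda>z. H z $ j) z))"
      and "(\<lambda>z. s (H z)) differentiable (at z)" if "z \<in> U" for z x
      using pd_comp[OF smooth_on_differentiable[OF comp H(2)[OF that]] smooth_on_differentiable[OF H(1) that]]
        pd_cnj[OF smooth_on_differentiable[OF H(1) that]] by simp_all
    ultimately show ?case by (metis (no_types, lifting))
  next
    case (add f g)
    have "\<exists>g'\<in>smooth_closure V H U. \<forall>z\<in>U. pd x (\<lambda>z. f z + g z) z = g' z" for x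
    proof -
      obtain f' g' where "f' \<in> smooth_closure V H U" "g' \<in> smooth_closure V H U"
        "\<forall>z\<in>U. pd x f z = f' z" "\<forall>z\<in>U. pd x g z = g' z" using add.IH by blast
      then show ?thesis using add.IH
        by (intro bexI[of _ "\<lambda>z. f' z + g' z"]) (auto simp: pd_add intro: smooth_closure.add)
    qed
    then show ?case using add.IH by auto
  next
    case (mult f g)
    have "\<exists>g'\<in>smooth_closure V H U. \<forall>z\<in>U. pd x (\<lambda>z. f z * g z) z = g' z" for x
    proof -
      obtain f' g' where "f' \<in> smooth_closure V H U" "g' \<in> smooth_closure V H U"
        "\<forall>z\<in>U. pd x f z = f' z" "\<forall>z\<in>U. pd x g z = g' z" using mult.IH by blast
      then show ?thesis using mult.IH mult.hyps
        by (intro bexI[of _ "\<lambda>z. f' z * g z + f z * g' z"]) (auto simp: pd_mult intro: smooth_closure.add smooth_closure.mult)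
    qed
    then show ?case using mult.IH by auto
  next
    case (inv f)
    have "\<exists>g'\<in>smooth_closure V H U. \<forall>z\<in>U. pd x (\<lambda>z. inverse (f z)) z = g' z" for x
    proof -
      obtain f' where "f' \<in> smooth_closure V H U" "\<forall>z\<in>U. pd x f z = f' z" using inv.IH by blast
      then show ?thesis using inv
        by (intro bexI[of _ "\<lambda>z. - (f' z * (inverse (f z) * inverse (f z)))"] smooth_closure_minus U)
          (auto simp: pd_inverse intro!: smooth_closure.mult smooth_closure.inv)
    qed
    then show ?case using inv by (auto intro: differentiable_inverse)
  next
    case (cnj f)
    have "\<exists>g'\<in>smooth_closure V H U. \<forall>z\<in>U. pd x (\<lambda>z. cnj (f z)) z = g' z" for x
    proof -
      obtain f' where "f' \<in> smooth_closure V H U" "\<forall>z\<in>U. pd (sw x) f z = f' z" using cnj.IH by blast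
      then show ?thesis using cnj.IH
        by (intro bexI[of _ "\<lambda>z. cnj (f' z)"]) (auto simp: pd_cnj intro: smooth_closure.cnj)
    qed
    moreover have "(\<lambda>z. cnj (f z)) differentiable (at z)" if "z \<in> U" for z
      using cnj.IH that has_derivative_cnj' unfolding differentiable_def by blast
    ultimately show ?case by blast
  qed
  then show "\<And>z. z \<in> U \<Longrightarrow> f differentiable (at z)" "\<exists>g\<in>smooth_closure V H U. \<forall>z\<in>U. pd x f z = g z"
    by blast+
qed

lemma smooth_on_coord:
  fixes j :: "'n::finite"
  assumes "open U"
  shows "smooth_on U (\<lambda>z. z $ j)"
proof (rule smooth_on_coinduct[where R = "insert (\<lambda>z. z $ j) (range (\<lambda>c z. c))"])
  fix f :: "complex ^ 'n \<Rightarrow> complex" and x :: "'n + 'n"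
  assume "f \<in> insert (\<lambda>z. z $ j) (range (\<lambda>c z. c))"
  then show "\<exists>g\<in>insert (\<lambda>z. z $ j) (range (\<lambda>c z. c)). \<forall>z\<in>U. pd x f z = g z"
    by (auto simp: pd_const pd_coord)
next
  fix f :: "complex ^ 'n \<Rightarrow> complex" and z
  assume "f \<in> insert (\<lambda>z. z $ j) (range (\<lambda>c z. c))"
  then show "f differentiable (at z)"
    using has_derivative_coord[of j z] unfolding differentiable_def by (auto intro: derivative_intros)
qed (use assms in auto)

context
  fixes U :: "(complex ^ 'n) set"
  assumes U: "open U"
begin

lemma smooth_closure_id: "f \<in> smooth_closure U (\<lambda>z. z) U \<Longrightarrow> smooth_on U f"
  by (rule smooth_closure_smooth[OF U smooth_on_coord[OF U]])

lemma smooth_on_add: "smooth_on U f \<Longrightarrow> smooth_on U g \<Longrightarrow> smooth_on U (\<lambda>z. f z + g z)"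
  and smooth_on_mult: "smooth_on U f \<Longrightarrow> smooth_on U g \<Longrightarrow> smooth_on U (\<lambda>z. f z * g z)"
  and smooth_on_cnj: "smooth_on U f \<Longrightarrow> smooth_on U (\<lambda>z. cnj (f z))"
  and smooth_on_inverse: "smooth_on U f \<Longrightarrow> (\<And>z. z \<in> U \<Longrightarrow> f z \<noteq> 0) \<Longrightarrow> smooth_on U (\<lambda>z. inverse (f z))"
  by (blast intro: smooth_closure_id smooth_closure.intros)+

lemma smooth_on_minus: "smooth_on U f \<Longrightarrow> smooth_on U (\<lambda>z. - f z)"
  using smooth_on_mult[OF smooth_on_const[OF U, of "- 1"], of f] by simp

lemma smooth_on_diff: "smooth_on U f \<Longrightarrow> smooth_on U g \<Longrightarrow> smooth_on U (\<lambda>z. f z - g z)"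
  using smooth_on_add[OF _ smooth_on_minus, of f g] by simp

lemma smooth_on_sum: "(\<And>i. i \<in> I \<Longrightarrow> smooth_on U (f i)) \<Longrightarrow> smooth_on U (\<lambda>z. \<Sum>i\<in>I. f i z)"
  by (induction I rule: infinite_finite_induct) (auto intro!: smooth_on_add smooth_on_const U)

lemma smooth_on_prod: "(\<And>i. i \<in> I \<Longrightarrow> smooth_on U (f i)) \<Longrightarrow> smooth_on U (\<lambda>z. \<Prod>i\<in>I. f i z)"
  by (induction I rule: infinite_finite_induct) (auto intro!: smooth_on_mult smooth_on_const U)

end

lemma smooth_on_comp:
  fixes H :: "complex ^ 'n \<Rightarrow> complex ^ 'm"
  assumes "open U" "\<And>j. smooth_on U (\<lambda>z. H z $ j)" "\<And>z. z \<in> U \<Longrightarrow> H z \<in> V" "smooth_on V s"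
  shows "smooth_on U (\<lambda>z. s (H z))"
  by (rule smooth_closure_smooth[OF assms(1-3) smooth_closure.comp[OF assms(4)]])

lemma pds_add:
  assumes "open U" "smooth_on U f" "smooth_on U g" "z \<in> U"
  shows "pds w (\<lambda>z. f z + g z) z = pds w f z + pds w g z"
  using assms(2-4)
proof (induction w arbitrary: f g z)
  case (Cons x w)
  have "pds w (pd x (\<lambda>z. f z + g z)) z = pds w (\<lambda>z. pd x f z + pd x g z) z"
    by (rule pds_cong[OF assms(1) _ Cons.prems(3)]) (rule pd_add[OF smooth_on_differentiable[OF Cons.prems(1)] smooth_on_differentiable[OF Cons.prems(2)]]; assumption)
  also have "\<dots> = pds w (pd x f) z + pds w (pd x g) z"
    by (intro Cons.IH smooth_on_pd Cons.prems)
  finally show ?case by simp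
qed simp

lemma pds_mult:
  assumes "open U" "smooth_on U f" "smooth_on U g" "z \<in> U"
  shows "pds w (\<lambda>z. f z * g z) z = hmul (\<lambda>w. pds w f z) (\<lambda>w. pds w g z) w"
  using assms(2-4)
proof (induction w arbitrary: f g z)
  case (Cons x w)
  have "pds w (pd x (\<lambda>z. f z * g z)) z = pds w (\<lambda>z. pd x f z * g z + f z * pd x g z) z"
    by (rule pds_cong[OF assms(1) _ Cons.prems(3)]) (rule pd_mult[OF smooth_on_differentiable[OF Cons.prems(1)] smooth_on_differentiable[OF Cons.prems(2)]]; assumption)
  also have "\<dots> = pds w (\<lambda>z. pd x f z * g z) z + pds w (\<lambda>z. f z * pd x g z) z"
    by (intro pds_add[OF assms(1)] smooth_on_mult[OF assms(1)] smooth_on_pd Cons.prems)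
  also have "\<dots> = hmul (\<lambda>w. pds w (pd x f) z) (\<lambda>w. pds w g z) w + hmul (\<lambda>w. pds w f z) (\<lambda>w. pds w (pd x g) z) w"
    by (intro arg_cong2[of _ _ _ _ "(+)"] Cons.IH smooth_on_pd Cons.prems)
  finally show ?case by simp
qed simp

section \<open>Symmetry of second derivatives\<close>

text \<open>The second difference over a small parallelogram is h^2 times a mixed derivative at a
  nearby point, by two applications of the mean value theorem. Both orders of differentiation
  evaluate the same difference, and continuity at z closes the gap.\<close>

lemma schwarz_real:
  fixes \<phi> :: "'a::real_normed_vector \<Rightarrow> real"
  assumes r: "r > 0"
    and u: "\<And>y. y \<in> ball z r \<Longrightarrow> ((\<lambda>t. \<phi> (y + t *\<^sub>R u)) has_real_derivative \<phi>u y) (at 0)"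
    and v: "\<And>y. y \<in> ball z r \<Longrightarrow> ((\<lambda>t. \<phi> (y + t *\<^sub>R v)) has_real_derivative \<phi>v y) (at 0)"
    and uv: "\<And>y. y \<in> ball z r \<Longrightarrow> ((\<lambda>t. \<phi>u (y + t *\<^sub>R v)) has_real_derivative \<phi>uv y) (at 0)"
    and vu: "\<And>y. y \<in> ball z r \<Longrightarrow> ((\<lambda>t. \<phi>v (y + t *\<^sub>R u)) has_real_derivative \<phi>vu y) (at 0)"
    and c: "isCont \<phi>uv z" "isCont \<phi>vu z"
  shows "\<phi>uv z = \<phi>vu z"
proof -
  have sh: "((\<lambda>t. g (y + t *\<^sub>R e)) has_real_derivative g' (y + t *\<^sub>R e)) (at t)"
    if "\<And>y. y \<in> ball z r \<Longrightarrow> ((\<lambda>t. g (y + t *\<^sub>R e)) has_real_derivative g' y) (at 0)" "y + t *\<^sub>R e \<in> ball z r"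
    for g g' :: "'a \<Rightarrow> real" and y e t
    using that(1)[OF that(2)] DERIV_shift[of "\<lambda>t. g (y + t *\<^sub>R e)" "g' (y + t *\<^sub>R e)" 0 t]
    by (simp add: algebra_simps)
  have key: "\<exists>y. dist z y \<le> h * (norm u + norm v) \<and> \<phi> (z + h *\<^sub>R u + h *\<^sub>R v) - \<phi> (z + h *\<^sub>R u) - \<phi> (z + h *\<^sub>R v) + \<phi> z = h * h * g2 y"
    if h: "h > 0" "h * (norm u + norm v) < r"
      and g: "\<And>y. y \<in> ball z r \<Longrightarrow> ((\<lambda>t. \<phi> (y + t *\<^sub>R u)) has_real_derivative g1 y) (at 0)"
        "\<And>y. y \<in> ball z r \<Longrightarrow> ((\<lambda>t. g1 (y + t *\<^sub>R v)) has_real_derivative g2 y) (at 0)"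
    for h g1 g2 u v
  proof -
    have inb: "z + s *\<^sub>R u + t *\<^sub>R v \<in> ball z r \<and> dist z (z + s *\<^sub>R u + t *\<^sub>R v) \<le> h * (norm u + norm v)" if "0 \<le> s" "s \<le> h" "0 \<le> t" "t \<le> h" for s t
    proof -
      have "norm (s *\<^sub>R u + t *\<^sub>R v) \<le> s * norm u + t * norm v"
        using norm_triangle_ineq[of "s *\<^sub>R u" "t *\<^sub>R v"] that by simp
      also have "\<dots> \<le> h * norm u + h * norm v" using that by (intro add_mono mult_right_mono) auto
      finally have "norm (s *\<^sub>R u + t *\<^sub>R v) \<le> h * (norm u + norm v)" by (simp add: algebra_simps)
      moreover have "dist z (z + s *\<^sub>R u + t *\<^sub>R v) = norm (s *\<^sub>R u + t *\<^sub>R v)"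
        using norm_minus_cancel[of "s *\<^sub>R u + t *\<^sub>R v"] by (simp add: dist_norm algebra_simps)
      ultimately show ?thesis using h(2) by simp
    qed
    define \<psi> where "\<psi> s = \<phi> ((z + h *\<^sub>R v) + s *\<^sub>R u) - \<phi> (z + s *\<^sub>R u)" for s
    have "(\<psi> has_real_derivative g1 ((z + h *\<^sub>R v) + s *\<^sub>R u) - g1 (z + s *\<^sub>R u)) (at s)" if "0 \<le> s" "s \<le> h" for s
    proof -
      have "(z + h *\<^sub>R v) + s *\<^sub>R u \<in> ball z r" "z + s *\<^sub>R u \<in> ball z r"
        using inb[of s h] inb[of s 0] that h by (simp_all add: algebra_simps)
      then show ?thesis unfolding \<psi>_def by (intro DERIV_diff sh[OF g(1)])
    qed
    from MVT2[OF h(1) this] obtain \<xi> where \<xi>: "0 < \<xi>" "\<xi> < h" "\<psi> h - \<psi> 0 = h * (g1 ((z + h *\<^sub>R v) + \<xi> *\<^sub>R u) - g1 (z + \<xi> *\<^sub>R u))"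
      by auto
    have "((\<lambda>t. g1 ((z + \<xi> *\<^sub>R u) + t *\<^sub>R v)) has_real_derivative g2 ((z + \<xi> *\<^sub>R u) + t *\<^sub>R v)) (at t)" if "0 \<le> t" "t \<le> h" for t
      using inb[of \<xi> t] that \<xi> by (intro sh[OF g(2)]) auto
    from MVT2[OF h(1) this] obtain \<eta> where \<eta>: "0 < \<eta>" "\<eta> < h"
      "g1 ((z + \<xi> *\<^sub>R u) + h *\<^sub>R v) - g1 ((z + \<xi> *\<^sub>R u) + 0 *\<^sub>R v) = h * g2 ((z + \<xi> *\<^sub>R u) + \<eta> *\<^sub>R v)"
      by auto
    have "\<phi> (z + h *\<^sub>R u + h *\<^sub>R v) - \<phi> (z + h *\<^sub>R u) - \<phi> (z + h *\<^sub>R v) + \<phi> z = \<psi> h - \<psi> 0"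
      unfolding \<psi>_def by (simp add: algebra_simps)
    also have "\<dots> = h * h * g2 ((z + \<xi> *\<^sub>R u) + \<eta> *\<^sub>R v)"
      unfolding \<xi>(3) using \<eta>(3) by (simp add: algebra_simps)
    finally show ?thesis using inb[of \<xi> \<eta>] \<xi> \<eta> by (intro exI[of _ "(z + \<xi> *\<^sub>R u) + \<eta> *\<^sub>R v"]) auto
  qed
  have "\<bar>\<phi>uv z - \<phi>vu z\<bar> \<le> 2 * e" if "e > 0" for e
  proof -
    obtain d1 where d1: "d1 > 0" "\<And>y. dist y z < d1 \<Longrightarrow> dist (\<phi>uv y) (\<phi>uv z) < e"
      using c(1) \<open>e > 0\<close> unfolding continuous_at_eps_delta by metis
    obtain d2 where d2: "d2 > 0" "\<And>y. dist y z < d2 \<Longrightarrow> dist (\<phi>vu y) (\<phi>vu z) < e"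
      using c(2) \<open>e > 0\<close> unfolding continuous_at_eps_delta by metis
    define h where "h = min r (min d1 d2) / (2 * (norm u + norm v + 1))"
    have pos: "norm u + norm v + 1 > 0" by (simp add: add_nonneg_pos)
    have h: "h > 0" using r d1 d2 pos by (simp add: h_def)
    have "h * (norm u + norm v) < min r (min d1 d2)"
    proof -
      have "h * (norm u + norm v) \<le> h * (norm u + norm v + 1)" using h by simp
      also have "\<dots> = min r (min d1 d2) / 2" unfolding h_def using pos by (simp add: field_simps)
      also have "\<dots> < min r (min d1 d2)"
      proof -
        have "x / 2 < x" if "x > 0" for x :: real using that by simp
        then show ?thesis using r d1 d2 by (meson min_less_iff_conj)
      qed
      finally show ?thesis .
    qed
    then have hr: "h * (norm u + norm v) < r" "h * (norm v + norm u) < r" and hd: "h * (norm u + norm v) < d1" "h * (norm v + norm u) < d2"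
      by (simp_all add: add.commute)
    obtain y1 where y1: "dist z y1 \<le> h * (norm u + norm v)"
      "\<phi> (z + h *\<^sub>R u + h *\<^sub>R v) - \<phi> (z + h *\<^sub>R u) - \<phi> (z + h *\<^sub>R v) + \<phi> z = h * h * \<phi>uv y1"
      using key[OF h hr(1) u uv] by blast
    obtain y2 where y2: "dist z y2 \<le> h * (norm v + norm u)"
      "\<phi> (z + h *\<^sub>R v + h *\<^sub>R u) - \<phi> (z + h *\<^sub>R v) - \<phi> (z + h *\<^sub>R u) + \<phi> z = h * h * \<phi>vu y2"
      using key[OF h hr(2) v vu] by blast
    have "h * h * \<phi>uv y1 = h * h * \<phi>vu y2"
      unfolding y1(2)[symmetric] y2(2)[symmetric] by (simp add: algebra_simps)
    then have "\<phi>uv y1 = \<phi>vu y2" using h by simp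
    moreover have "dist (\<phi>uv y1) (\<phi>uv z) < e" using y1(1) hd by (intro d1(2)) (simp add: dist_commute)
    moreover have "dist (\<phi>vu y2) (\<phi>vu z) < e" using y2(1) hd by (intro d2(2)) (simp add: dist_commute)
    ultimately show ?thesis by (simp add: dist_real_def abs_if split: if_splits)
  qed
  from this[of "\<bar>\<phi>uv z - \<phi>vu z\<bar> / 4"] show ?thesis by fastforce
qed

definition dir :: "complex ^ 'n \<Rightarrow> (complex ^ 'n \<Rightarrow> complex) \<Rightarrow> complex ^ 'n \<Rightarrow> complex" where
  "dir v f z = (\<Sum>j\<in>UNIV. v $ j * pd (Inl j) f z + cnj (v $ j) * pd (Inr j) f z)"

lemma smooth_on_dir: "open U \<Longrightarrow> smooth_on U f \<Longrightarrow> smooth_on U (dir v f)"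
  unfolding dir_def[abs_def] by (intro smooth_on_sum smooth_on_add smooth_on_mult smooth_on_const smooth_on_pd)

lemma has_derivative_dir:
  assumes "f differentiable (at z)"
  shows "(f has_derivative (\<lambda>v. dir v f z)) (at z)"
proof -
  obtain F where F: "(f has_derivative F) (at z)" using assms unfolding differentiable_def by blast
  moreover have "F = (\<lambda>v. dir v f z)" using derivative_pd[OF F] by (simp add: dir_def fun_eq_iff)
  ultimately show ?thesis by simp
qed

lemma vector_derivative_dir:
  assumes "f differentiable (at z)"
  shows "((\<lambda>t. f (z + t *\<^sub>R v)) has_vector_derivative dir v f z) (at 0)"
proof -
  have "((\<lambda>t. z + t *\<^sub>R v) has_vector_derivative v) (at 0)"
    by (auto intro!: derivative_eq_intros)
  from vector_derivative_diff_chain_within[OF this, of f "\<lambda>v. dir v f z"] show ?thesis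
    using has_derivative_at_withinI[OF has_derivative_dir[OF assms]] by (simp add: o_def)
qed

lemma dir_commute:
  assumes U: "open U" "z \<in> U" and f: "smooth_on U f"
  shows "dir u (dir v f) z = dir v (dir u f) z"
proof -
  obtain r where r: "r > 0" "ball z r \<subseteq> U" using U open_contains_ball by blast
  have d: "g differentiable (at y)" if "y \<in> ball z r" "smooth_on U g" for g y
    using that r smooth_on_differentiable by blast
  note sm = smooth_on_dir[OF U(1)]
  have c: "isCont (dir u (dir v f)) z" for u v
    using sm[OF sm[OF f]] U by (intro differentiable_imp_continuous_within smooth_on_differentiable)
  have re: "((\<lambda>t. Re (g (y + t *\<^sub>R v))) has_real_derivative Re (dir v g y)) (at 0)"
    and im: "((\<lambda>t. Im (g (y + t *\<^sub>R v))) has_real_derivative Im (dir v g y)) (at 0)"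
    if "y \<in> ball z r" "smooth_on U g" for g y v
    using bounded_linear.has_vector_derivative[OF bounded_linear_Re vector_derivative_dir[OF d[OF that]], of v]
      bounded_linear.has_vector_derivative[OF bounded_linear_Im vector_derivative_dir[OF d[OF that]], of v]
    by (simp_all add: has_real_derivative_iff_has_vector_derivative)
  have "Re (dir v (dir u f) z) = Re (dir u (dir v f) z)"
    by (rule schwarz_real[OF r(1), where \<phi> = "\<lambda>z. Re (f z)" and u = u and v = v and \<phi>u = "\<lambda>z. Re (dir u f z)" and \<phi>v = "\<lambda>z. Re (dir v f z)" and \<phi>uv = "\<lambda>z. Re (dir v (dir u f) z)" and \<phi>vu = "\<lambda>z. Re (dir u (dir v f) z)"])
      (rule re im f sm bounded_linear.continuous[OF bounded_linear_Re c] | assumption)+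
  moreover have "Im (dir v (dir u f) z) = Im (dir u (dir v f) z)"
    by (rule schwarz_real[OF r(1), where \<phi> = "\<lambda>z. Im (f z)" and u = u and v = v and \<phi>u = "\<lambda>z. Im (dir u f z)" and \<phi>v = "\<lambda>z. Im (dir v f z)" and \<phi>uv = "\<lambda>z. Im (dir v (dir u f) z)" and \<phi>vu = "\<lambda>z. Im (dir u (dir v f) z)"])
      (rule re im f sm bounded_linear.continuous[OF bounded_linear_Im c] | assumption)+
  ultimately show ?thesis by (simp add: complex_eq_iff)
qed

lemma pd_dir:
  assumes "f differentiable (at z)"
  shows "pd x f z = (dir (axis (ix x) 1) f z + sg x * dir (axis (ix x) \<i>) f z) / 2"
  by (rule pd_eq[OF has_derivative_dir[OF assms]])

lemma dir_cong:
  "open U \<Longrightarrow> z \<in> U \<Longrightarrow> (\<And>z. z \<in> U \<Longrightarrow> f z = g z) \<Longrightarrow> dir v f z = dir v g z"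
  unfolding dir_def by (intro sum.cong refl arg_cong2[of _ _ _ _ "(+)"] arg_cong2[of _ _ _ _ "(*)"] pd_cong) auto

lemma dir_lin:
  assumes "f differentiable (at z)" "g differentiable (at z)"
  shows "dir v (\<lambda>z. (f z + c * g z) / 2) z = (dir v f z + c * dir v g z) / 2"
proof -
  obtain F G where F: "(f has_derivative F) (at z)" and G: "(g has_derivative G) (at z)"
    using assms unfolding differentiable_def by blast
  have "((\<lambda>z. (f z + c * g z) / 2) has_derivative (\<lambda>v. (F v + c * G v) / 2)) (at z)"
    by (auto intro!: derivative_eq_intros F G)
  from pd_eq[OF this] have p: "pd x (\<lambda>z. (f z + c * g z) / 2) z = (pd x f z + c * pd x g z) / 2" for x
    unfolding pd_eq[OF F] pd_eq[OF G] by (simp add: field_simps)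
  show ?thesis
    unfolding dir_def p sum_distrib_left sum.distrib[symmetric] sum_divide_distrib
    by (intro sum.cong refl) (simp add: field_simps)
qed

text \<open>Each \<open>pd x\<close> is a complex combination of the derivatives in two real
  directions, and those commute.\<close>

lemma pd_commute:
  assumes U: "open U" "z \<in> U" and f: "smooth_on U f"
  shows "pd x (pd y f) z = pd y (pd x f) z"
proof -
  note sm = smooth_on_dir[OF U(1)]
  note df = smooth_on_differentiable
  have e: "pd x (pd y f) z = (dir (axis (ix x) 1) (dir (axis (ix y) 1) f) z + sg y * dir (axis (ix x) 1) (dir (axis (ix y) \<i>) f) z
    + sg x * (dir (axis (ix x) \<i>) (dir (axis (ix y) 1) f) z + sg y * dir (axis (ix x) \<i>) (dir (axis (ix y) \<i>) f) z)) / 4" for x y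
  proof -
    have dv: "dir v (pd y f) z = (dir v (dir (axis (ix y) 1) f) z + sg y * dir v (dir (axis (ix y) \<i>) f) z) / 2" for v
    proof -
      have "dir v (pd y f) z = dir v (\<lambda>z. (dir (axis (ix y) 1) f z + sg y * dir (axis (ix y) \<i>) f z) / 2) z"
        by (rule dir_cong[OF U]) (rule pd_dir[OF df[OF f]])
      also have "\<dots> = (dir v (dir (axis (ix y) 1) f) z + sg y * dir v (dir (axis (ix y) \<i>) f) z) / 2"
        by (intro dir_lin df[OF sm[OF f] U(2)])
      finally show ?thesis .
    qed
    show ?thesis
      unfolding pd_dir[OF df[OF smooth_on_pd[OF f] U(2)]] dv by (simp add: field_simps)
  qed
  show ?thesis
    unfolding e[of x y] e[of y x] dir_commute[OF U f, of "axis (ix y) _" "axis (ix x) _"] by (simp add: algebra_simps)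
qed

lemma mset_invariant:
  assumes c: "\<And>F x. F \<in> S \<Longrightarrow> (\<lambda>u. F (x # u)) \<in> S" and s: "\<And>F x y w. F \<in> S \<Longrightarrow> F (x # y # w) = F (y # x # w)"
    and "F \<in> S" "mset u = mset v"
  shows "F u = F v"
  using assms(3,4)
proof (induction "length u" arbitrary: F u v)
  case 0
  then have "u = []" "v = []" by (metis length_0_conv, metis length_0_conv size_mset)
  then show ?case by (simp only:)
next
  case (Suc n)
  obtain x u' where u: "u = x # u'" "length u' = n" using Suc.hyps(2) by (metis length_Suc_conv)
  obtain y v' where v: "v = y # v'" "length v' = n"
    using Suc.hyps(2) Suc.prems(2) by (metis length_Suc_conv size_mset)
  have step: "F (a # t) = F (a # t')" if "length t = n" "mset t = mset t'" for a t t'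
    by (rule Suc.hyps(1)[OF that(1)[symmetric] c[OF Suc.prems(1)] that(2)])
  show ?case
  proof (cases "x = y")
    case True
    then have "mset u' = mset v'" using Suc.prems(2) u v by simp
    then show ?thesis using step[OF u(2)] u v True by blast
  next
    case False
    then obtain M where M: "mset u' = add_mset y M" "mset v' = add_mset x M"
      using Suc.prems(2) u v by (auto simp: add_eq_conv_ex)
    obtain t where t: "mset t = M" using ex_mset by blast
    have "F u = F (x # y # t)" unfolding u(1) by (rule step[OF u(2)]) (simp add: M t)
    also have "\<dots> = F (y # x # t)" by (rule s[OF Suc.prems(1)])
    also have "\<dots> = F v"
    proof -
      have "mset (x # t) = mset v'" by (simp add: M t)
      moreover from this have "length (x # t) = n" using v(2) by (metis size_mset)
      ultimately show ?thesis unfolding v(1) by (rule step[rotated])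
    qed
    finally show ?thesis .
  qed
qed

lemma pds_permute:
  assumes U: "open U" "z \<in> U" and f: "smooth_on U f" and m: "mset u = mset v"
  shows "pds u f z = pds v f z"
proof (rule mset_invariant[where S = "{(\<lambda>w. pds w f z) | f. smooth_on U f}" and F = "\<lambda>w. pds w f z", OF _ _ _ m])
  fix F x y w assume "F \<in> {(\<lambda>w. pds w f z) | f. smooth_on U f}"
  then obtain g where g: "F = (\<lambda>w. pds w g z)" "smooth_on U g" by blast
  have "(\<lambda>u. F (x # u)) = (\<lambda>w. pds w (pd x g) z)" by (simp add: g(1))
  then show "(\<lambda>u. F (x # u)) \<in> {(\<lambda>w. pds w f z) | f. smooth_on U f}" using smooth_on_pd[OF g(2)] by blast
  show "F (x # y # w) = F (y # x # w)"
    unfolding g(1) using pds_cong[OF U(1) pd_commute[OF U(1) _ g(2)] U(2)] by simp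
qed (use f in blast)

section \<open>Jets of smooth functions\<close>

lemma cst_minus: "cst (- c) = - cst c"
  by (rule hser_eqI) (simp add: coef_uminus coef_cst)

text \<open>Meaningful only for f smooth near p, where \<open>pds_permute\<close> supplies the
  symmetry that \<open>Hser\<close> presupposes.\<close>

definition jt :: "complex ^ 'n \<Rightarrow> (complex ^ 'n \<Rightarrow> complex) \<Rightarrow> ('n + 'n) hser" where
  "jt p f = Hser (\<lambda>w. pds w f p)"

context
  fixes U :: "(complex ^ 'n) set" and p
  assumes U: "open U" "p \<in> U"
begin

lemma coef_jt:
  assumes "smooth_on U f"
  shows "coef (jt p f) w = pds w f p"
proof -
  have "(\<lambda>w. pds w f p) \<in> {a. \<forall>u v. mset u = mset v \<longrightarrow> a u = a v}"
    using pds_permute[OF U assms] by blast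
  from Hser_inverse[OF this] show ?thesis unfolding jt_def by (rule fun_cong)
qed

lemma coef_jt': "smooth_on U f \<Longrightarrow> coef (jt p f) = (\<lambda>w. pds w f p)"
  by (simp add: fun_eq_iff coef_jt)

lemma jt_cong: "smooth_on U f \<Longrightarrow> (\<And>z. z \<in> U \<Longrightarrow> f z = g z) \<Longrightarrow> jt p f = jt p g"
  unfolding jt_def using pds_cong[OF U(1) _ U(2)] by metis

lemma jt_pd: "smooth_on U f \<Longrightarrow> jt p (pd x f) = dd x (jt p f)"
  by (rule hser_eqI) (simp add: coef_jt smooth_on_pd coef_dd)

lemma jt_add: "smooth_on U f \<Longrightarrow> smooth_on U g \<Longrightarrow> jt p (\<lambda>z. f z + g z) = jt p f + jt p g"
  by (rule hser_eqI) (simp add: coef_jt smooth_on_add[OF U(1)] coef_add pds_add[OF U(1) _ _ U(2)])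

lemma jt_mult: "smooth_on U f \<Longrightarrow> smooth_on U g \<Longrightarrow> jt p (\<lambda>z. f z * g z) = jt p f * jt p g"
  by (rule hser_eqI) (simp add: coef_jt' smooth_on_mult[OF U(1)] coef_mult pds_mult[OF U(1) _ _ U(2)])

lemma jt_const: "jt p (\<lambda>z. c) = cst c"
proof (rule hser_eqI)
  fix w :: "('n + 'n) list"
  have "pds w (\<lambda>z. 0) p = (0 :: complex)" for w :: "('n + 'n) list"
  proof (induction w)
    case (Cons x w)
    have "pd x (\<lambda>z. 0) = (\<lambda>z. 0)" by (simp add: pd_const fun_eq_iff)
    then show ?case using Cons by simp
  qed simp
  moreover have "pd x (\<lambda>z. c) = (\<lambda>z. 0)" for x :: "'n + 'n" by (simp add: pd_const fun_eq_iff)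
  ultimately show "coef (jt p (\<lambda>z. c)) w = coef (cst c) w"
    by (cases w) (simp_all add: coef_jt smooth_on_const[OF U(1)] coef_cst)
qed

lemma jt_minus: "smooth_on U f \<Longrightarrow> jt p (\<lambda>z. - f z) = - jt p f"
  using jt_mult[OF smooth_on_const[OF U(1), of "- 1"], of f] by (simp add: jt_const cst_minus cst_1)

lemma jt_diff: "smooth_on U f \<Longrightarrow> smooth_on U g \<Longrightarrow> jt p (\<lambda>z. f z - g z) = jt p f - jt p g"
  using jt_add[OF _ smooth_on_minus[OF U(1)], of f g] by (simp add: jt_minus)

lemma jt_sum: "(\<And>i. i \<in> I \<Longrightarrow> smooth_on U (f i)) \<Longrightarrow> jt p (\<lambda>z. \<Sum>i\<in>I. f i z) = (\<Sum>i\<in>I. jt p (f i))"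
proof (induction I rule: infinite_finite_induct)
  case (insert i I)
  then show ?case using jt_add[of "f i" "\<lambda>z. \<Sum>i\<in>I. f i z"] smooth_on_sum[OF U(1), of I f] by simp
qed (simp_all add: jt_const, (rule hser_eqI, simp add: coef_cst)+)

end

section \<open>Cauchy estimates for real-analytic functions\<close>

abbreviation MI :: "((complex ^ 'n) \<Rightarrow> nat) set" where
  "MI \<equiv> Basis \<rightarrow>\<^sub>E UNIV"

definition tot :: "((complex ^ 'n) \<Rightarrow> nat) \<Rightarrow> nat" where
  "tot \<alpha> = (\<Sum>b\<in>Basis. \<alpha> b)"

definition mono_at :: "((complex ^ 'n) \<Rightarrow> nat) \<Rightarrow> complex ^ 'n \<Rightarrow> real" where
  "mono_at \<alpha> y = (\<Prod>b\<in>Basis. (y \<bullet> b) ^ \<alpha> b)"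

definition cube :: "complex ^ 'n \<Rightarrow> real \<Rightarrow> (complex ^ 'n) set" where
  "cube a \<delta> = {x. \<forall>b\<in>Basis. \<bar>(x - a) \<bullet> b\<bar> < \<delta>}"

lemma open_cube: "open (cube a \<delta>)"
proof -
  have "cube a \<delta> = (\<Inter>b\<in>Basis. {x. \<bar>(x - a) \<bullet> b\<bar> < \<delta>})" by (auto simp: cube_def)
  moreover have "open {x. \<bar>(x - a) \<bullet> b\<bar> < \<delta>}" for b
    by (intro open_Collect_less continuous_intros)
  ultimately show ?thesis by (simp add: open_INT)
qed

lemma convex_cube: "convex (cube a \<delta>)"
proof -
  have "cube a \<delta> = (\<Inter>b\<in>Basis. (\<lambda>x. x \<bullet> b) -` {a \<bullet> b - \<delta> <..< a \<bullet> b + \<delta>})"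
    by (auto simp: cube_def inner_diff_left abs_less_iff)
  moreover have "convex ((\<lambda>x. x \<bullet> b) -` {a \<bullet> b - \<delta> <..< a \<bullet> b + \<delta>})" for b
    by (intro convex_linear_vimage bounded_linear.linear bounded_linear_inner_left) auto
  ultimately show ?thesis by (simp add: convex_INT)
qed

lemma cube_mono: "\<delta>' \<le> \<delta> \<Longrightarrow> cube a \<delta>' \<subseteq> cube a \<delta>"
  by (auto simp: cube_def)

lemma cube_center: "\<delta> > 0 \<Longrightarrow> a \<in> cube a \<delta>"
  by (simp add: cube_def)

text \<open>S bounds the majorant series at the corner of the cube, hence f on the cube, and after
  shrinking \<delta> also its derivatives. Cubes are used because monomials are bounded coordinate
  by coordinate.\<close>

definition PS :: "complex ^ 'n \<Rightarrow> real \<Rightarrow> real \<Rightarrow> (complex ^ 'n \<Rightarrow> complex) \<Rightarrow> bool" where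
  "PS a \<delta> S f \<longleftrightarrow> (\<exists>c. (\<lambda>\<alpha>. norm (c \<alpha>) * \<delta> ^ tot \<alpha>) summable_on MI \<and> infsum (\<lambda>\<alpha>. norm (c \<alpha>) * \<delta> ^ tot \<alpha>) MI \<le> S
     \<and> (\<forall>x\<in>cube a \<delta>. ((\<lambda>\<alpha>. c \<alpha> * of_real (mono_at \<alpha> (x - a))) has_sum f x) MI))"

definition bump :: "complex ^ 'n \<Rightarrow> ((complex ^ 'n) \<Rightarrow> nat) \<Rightarrow> (complex ^ 'n) \<Rightarrow> nat" where
  "bump b \<beta> = \<beta>(b := Suc (\<beta> b))"

definition dmono :: "complex ^ 'n \<Rightarrow> ((complex ^ 'n) \<Rightarrow> nat) \<Rightarrow> complex ^ 'n \<Rightarrow> real" where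
  "dmono b \<alpha> y = real (\<alpha> b) * (y \<bullet> b) ^ (\<alpha> b - 1) * (\<Prod>j\<in>Basis - {b}. (y \<bullet> j) ^ \<alpha> j)"

lemma abs_mono_le:
  assumes "\<And>b. b \<in> Basis \<Longrightarrow> \<bar>y \<bullet> b\<bar> \<le> \<delta>"
  shows "\<bar>mono_at \<alpha> y\<bar> \<le> \<delta> ^ tot \<alpha>"
proof -
  have "\<bar>mono_at \<alpha> y\<bar> \<le> (\<Prod>b\<in>Basis. \<delta> ^ \<alpha> b)"
    unfolding mono_at_def abs_prod using assms by (intro prod_mono) (auto simp: power_abs intro!: power_mono)
  then show ?thesis by (simp add: tot_def power_sum)
qed

lemma dmono_bump:
  assumes "b \<in> Basis"
  shows "dmono b (bump b \<beta>) y = real (Suc (\<beta> b)) * mono_at \<beta> y"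
proof -
  have "mono_at \<beta> y = (y \<bullet> b) ^ \<beta> b * (\<Prod>j\<in>Basis - {b}. (y \<bullet> j) ^ \<beta> j)"
    unfolding mono_at_def using assms by (intro prod.remove) auto
  moreover have "(\<Prod>j\<in>Basis - {b}. (y \<bullet> j) ^ bump b \<beta> j) = (\<Prod>j\<in>Basis - {b}. (y \<bullet> j) ^ \<beta> j)"
    by (intro prod.cong) (auto simp: bump_def)
  ultimately show ?thesis by (simp add: dmono_def bump_def)
qed

lemma tot_bump: "b \<in> Basis \<Longrightarrow> tot (bump b \<beta>) = Suc (tot \<beta>)"
  unfolding tot_def by (simp add: sum.remove[of Basis b] bump_def)

lemma bump_image:
  assumes "b \<in> Basis"
  shows "bump b ` MI = {\<alpha> \<in> MI. \<alpha> b \<noteq> 0}" "inj_on (bump b) MI"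
proof -
  show "inj_on (bump b) MI"
    by (rule inj_onI) (metis bump_def fun_upd_idem_iff fun_upd_same fun_upd_upd nat.inject)
  show "bump b ` MI = {\<alpha> \<in> MI. \<alpha> b \<noteq> 0}"
  proof (intro equalityI subsetI)
    fix \<alpha> assume "\<alpha> \<in> bump b ` MI"
    then show "\<alpha> \<in> {\<alpha> \<in> MI. \<alpha> b \<noteq> 0}" using assms by (auto simp: bump_def PiE_def extensional_def)
  next
    fix \<alpha> assume a: "\<alpha> \<in> {\<alpha> \<in> MI. \<alpha> b \<noteq> 0}"
    have "\<alpha> = bump b (\<alpha>(b := \<alpha> b - 1))" using a by (auto simp: bump_def)
    moreover have "\<alpha>(b := \<alpha> b - 1) \<in> MI" using a assms by (auto simp: PiE_def extensional_def)
    ultimately show "\<alpha> \<in> bump b ` MI" by blast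
  qed
qed

lemma has_derivative_mono:
  "((\<lambda>x. mono_at \<alpha> (x - a)) has_derivative (\<lambda>v. \<Sum>b\<in>Basis. (v \<bullet> b) * dmono b \<alpha> (x - a))) (at x within X)"
proof -
  have "((\<lambda>x. ((x - a) \<bullet> b) ^ \<alpha> b) has_derivative (\<lambda>v. (v \<bullet> b) * (real (\<alpha> b) * ((x - a) \<bullet> b) ^ (\<alpha> b - 1)))) (at x within X)" for b
    by (auto intro!: derivative_eq_intros simp: algebra_simps)
  then have "((\<lambda>x. \<Prod>b\<in>Basis. ((x - a) \<bullet> b) ^ \<alpha> b) has_derivative
      (\<lambda>v. \<Sum>b\<in>Basis. (v \<bullet> b) * (real (\<alpha> b) * ((x - a) \<bullet> b) ^ (\<alpha> b - 1)) * (\<Prod>j\<in>Basis - {b}. ((x - a) \<bullet> j) ^ \<alpha> j))) (at x within X)"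
    by (rule has_derivative_prod)
  then show ?thesis unfolding mono_at_def dmono_def
    by (rule has_derivative_eq_rhs) (auto simp: fun_eq_iff mult_ac intro!: sum.cong)
qed

text \<open>The Cauchy estimate for a single monomial: one derivative costs the reciprocal of the
  decrease in radius.\<close>

lemma power_diff_bound:
  fixes \<delta> \<delta>' :: real
  assumes "0 \<le> \<delta>'" "\<delta>' \<le> \<delta>"
  shows "real n * \<delta>' ^ (n - 1) * (\<delta> - \<delta>') \<le> \<delta> ^ n"
proof (induction n)
  case (Suc n)
  have "real (Suc n) * \<delta>' ^ (Suc n - 1) * (\<delta> - \<delta>') = real n * \<delta>' ^ n * (\<delta> - \<delta>') + \<delta>' ^ n * (\<delta> - \<delta>')"
    by (simp add: algebra_simps)
  also have "real n * \<delta>' ^ n * (\<delta> - \<delta>') = \<delta>' * (real n * \<delta>' ^ (n - 1) * (\<delta> - \<delta>'))"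
    by (cases n) (simp_all add: mult_ac)
  also have "\<dots> + \<delta>' ^ n * (\<delta> - \<delta>') \<le> \<delta>' * \<delta> ^ n + \<delta> ^ n * (\<delta> - \<delta>')"
    using Suc assms by (intro add_mono mult_left_mono mult_right_mono power_mono) auto
  finally show ?case by (simp add: algebra_simps)
qed simp

text \<open>Termwise differentiation. The monomial estimate gives the majorant of the derived series
  on the smaller cube, and the same domination gives the uniform convergence that justifies
  differentiating term by term.\<close>

lemma PS_derivative:
  fixes f :: "complex ^ 'n \<Rightarrow> complex" and a :: "complex ^ 'n"
  assumes f: "PS a \<delta> S f" and d: "0 < \<delta>'" "\<delta>' < \<delta>"
  shows "\<exists>g. (\<forall>b\<in>Basis. PS a \<delta>' (S / (\<delta> - \<delta>')) (g b)) \<and>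
    (\<forall>x\<in>cube a \<delta>'. (f has_derivative (\<lambda>v. \<Sum>b\<in>Basis. of_real (v \<bullet> b) * g b x)) (at x))"
proof -
  obtain c where c: "(\<lambda>\<alpha>. norm (c \<alpha>) * \<delta> ^ tot \<alpha>) summable_on MI"
    "infsum (\<lambda>\<alpha>. norm (c \<alpha>) * \<delta> ^ tot \<alpha>) MI \<le> S"
    "\<And>x. x \<in> cube a \<delta> \<Longrightarrow> ((\<lambda>\<alpha>. c \<alpha> * of_real (mono_at \<alpha> (x - a))) has_sum f x) MI"
    using f unfolding PS_def by blast
  define c' where "c' b \<beta> = of_nat (Suc (\<beta> b)) * c (bump b \<beta>)" for b \<beta>
  define D where "D b \<alpha> x = c \<alpha> * of_real (dmono b \<alpha> (x - a))" for b \<alpha> x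
  have dd: "\<delta> - \<delta>' > 0" using d by simp
  have c'b: "norm (c' b \<beta>) * \<delta>' ^ tot \<beta> \<le> (norm (c (bump b \<beta>)) * \<delta> ^ tot (bump b \<beta>)) / (\<delta> - \<delta>')" if b: "b \<in> Basis" for b \<beta>
  proof -
    have "\<beta> b \<le> tot \<beta>" unfolding tot_def using b by (intro member_le_sum) auto
    then have "real (Suc (\<beta> b)) * \<delta>' ^ tot \<beta> * (\<delta> - \<delta>') \<le> real (Suc (tot \<beta>)) * \<delta>' ^ tot \<beta> * (\<delta> - \<delta>')"
      using d by (intro mult_right_mono) auto
    also have "\<dots> \<le> \<delta> ^ Suc (tot \<beta>)" using power_diff_bound[of \<delta>' \<delta> "Suc (tot \<beta>)"] d by simp
    finally have "norm (c (bump b \<beta>)) * (real (Suc (\<beta> b)) * \<delta>' ^ tot \<beta> * (\<delta> - \<delta>')) \<le> norm (c (bump b \<beta>)) * \<delta> ^ Suc (tot \<beta>)"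
      by (intro mult_left_mono) auto
    then show ?thesis using dd by (simp add: c'_def norm_mult tot_bump[OF b] field_simps del: of_nat_Suc)
  qed
  have csub: "(\<lambda>\<beta>. norm (c (bump b \<beta>)) * \<delta> ^ tot (bump b \<beta>)) summable_on MI"
    "infsum (\<lambda>\<beta>. norm (c (bump b \<beta>)) * \<delta> ^ tot (bump b \<beta>)) MI \<le> S" if b: "b \<in> Basis" for b
  proof -
    have sub: "bump b ` MI \<subseteq> MI" using bump_image(1)[OF b] by blast
    have s: "(\<lambda>\<alpha>. norm (c \<alpha>) * \<delta> ^ tot \<alpha>) summable_on bump b ` MI"
      by (rule summable_on_subset_banach[OF c(1) sub])
    show "(\<lambda>\<beta>. norm (c (bump b \<beta>)) * \<delta> ^ tot (bump b \<beta>)) summable_on MI"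
      using s unfolding summable_on_reindex[OF bump_image(2)[OF b]] by (simp add: o_def)
    have "infsum (\<lambda>\<beta>. norm (c (bump b \<beta>)) * \<delta> ^ tot (bump b \<beta>)) MI = infsum (\<lambda>\<alpha>. norm (c \<alpha>) * \<delta> ^ tot \<alpha>) (bump b ` MI)"
      unfolding infsum_reindex[OF bump_image(2)[OF b]] by (simp add: o_def)
    also have "\<dots> \<le> infsum (\<lambda>\<alpha>. norm (c \<alpha>) * \<delta> ^ tot \<alpha>) MI"
      using d by (intro infsum_mono2 s c(1) sub) auto
    finally show "infsum (\<lambda>\<beta>. norm (c (bump b \<beta>)) * \<delta> ^ tot (bump b \<beta>)) MI \<le> S" using c(2) by simp
  qed
  have c's: "(\<lambda>\<beta>. norm (c' b \<beta>) * \<delta>' ^ tot \<beta>) summable_on MI"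
    "infsum (\<lambda>\<beta>. norm (c' b \<beta>) * \<delta>' ^ tot \<beta>) MI \<le> S / (\<delta> - \<delta>')" if b: "b \<in> Basis" for b
  proof -
    have s: "(\<lambda>\<beta>. (norm (c (bump b \<beta>)) * \<delta> ^ tot (bump b \<beta>)) / (\<delta> - \<delta>')) summable_on MI"
      using summable_on_cmult_left[OF csub(1)[OF b], of "1 / (\<delta> - \<delta>')"] by simp
    show 1: "(\<lambda>\<beta>. norm (c' b \<beta>) * \<delta>' ^ tot \<beta>) summable_on MI"
      by (rule summable_on_comparison_test[OF s c'b[OF b]]) (use d in auto)
    have "infsum (\<lambda>\<beta>. norm (c' b \<beta>) * \<delta>' ^ tot \<beta>) MI \<le> infsum (\<lambda>\<beta>. (norm (c (bump b \<beta>)) * \<delta> ^ tot (bump b \<beta>)) / (\<delta> - \<delta>')) MI"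
      by (rule infsum_mono[OF 1 s c'b[OF b]])
    also have "\<dots> = infsum (\<lambda>\<beta>. norm (c (bump b \<beta>)) * \<delta> ^ tot (bump b \<beta>)) MI / (\<delta> - \<delta>')"
      using infsum_cmult_left[OF csub(1)[OF b], of "1 / (\<delta> - \<delta>')"] by simp
    also have "\<dots> \<le> S / (\<delta> - \<delta>')" using csub(2)[OF b] dd by (simp add: divide_right_mono)
    finally show "infsum (\<lambda>\<beta>. norm (c' b \<beta>) * \<delta>' ^ tot \<beta>) MI \<le> S / (\<delta> - \<delta>')" .
  qed
  define g where "g b x = infsum (\<lambda>\<beta>. c' b \<beta> * of_real (mono_at \<beta> (x - a))) MI" for b x
  have termb: "norm (c' b \<beta> * of_real (mono_at \<beta> (x - a))) \<le> norm (c' b \<beta>) * \<delta>' ^ tot \<beta>" if "x \<in> cube a \<delta>'" for b \<beta> x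
  proof -
    have "\<bar>mono_at \<beta> (x - a)\<bar> \<le> \<delta>' ^ tot \<beta>"
      using that by (intro abs_mono_le) (auto simp: cube_def intro: less_imp_le)
    then show ?thesis by (simp add: norm_mult mult_left_mono)
  qed
  have gs: "((\<lambda>\<beta>. c' b \<beta> * of_real (mono_at \<beta> (x - a))) has_sum g b x) MI" if "x \<in> cube a \<delta>'" "b \<in> Basis" for b x
  proof -
    have "(\<lambda>\<beta>. norm (c' b \<beta> * of_real (mono_at \<beta> (x - a)))) summable_on MI"
      by (rule summable_on_comparison_test[OF c's(1)[OF that(2)]]) (rule termb[OF that(1)], rule norm_ge_zero)
    then have "(\<lambda>\<beta>. c' b \<beta> * of_real (mono_at \<beta> (x - a))) summable_on MI"
      by (rule abs_summable_summable)
    then show ?thesis unfolding g_def by (rule has_sum_infsum)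
  qed
  have gPS: "PS a \<delta>' (S / (\<delta> - \<delta>')) (g b)" if "b \<in> Basis" for b
    unfolding PS_def by (rule exI[of _ "c' b"], intro conjI ballI c's[OF that] gs[OF _ that])
  have gD: "((\<lambda>\<alpha>. D b \<alpha> x) has_sum g b x) MI" if "x \<in> cube a \<delta>'" "b \<in> Basis" for b x
  proof -
    have "((\<lambda>\<beta>. D b (bump b \<beta>) x) has_sum g b x) MI"
      using gs[OF that] unfolding D_def dmono_bump[OF that(2)] c'_def by (simp add: mult_ac)
    then have "((\<lambda>\<alpha>. D b \<alpha> x) has_sum g b x) (bump b ` MI)"
      unfolding has_sum_reindex[OF bump_image(2)[OF that(2)]] by (simp add: o_def)
    then show ?thesis
      by (rule has_sum_cong_neutral[THEN iffD1, rotated -1])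
        (auto simp: bump_image(1)[OF that(2)] D_def dmono_def)
  qed
  have Db: "norm (D b \<alpha> x) \<le> norm (c \<alpha>) * \<delta> ^ tot \<alpha> / (\<delta> - \<delta>')" if x: "x \<in> cube a \<delta>'" and b: "b \<in> Basis" and \<alpha>: "\<alpha> \<in> MI" for b \<alpha> x
  proof (cases "\<alpha> b = 0")
    case True
    then show ?thesis using dd d by (simp add: D_def dmono_def)
  next
    case False
    then obtain \<beta> where \<beta>: "\<beta> \<in> MI" "\<alpha> = bump b \<beta>" using bump_image(1)[OF b] \<alpha> by blast
    have "norm (D b \<alpha> x) = norm (c' b \<beta> * of_real (mono_at \<beta> (x - a)))"
      unfolding D_def \<beta>(2) dmono_bump[OF b] c'_def by (simp add: mult_ac)
    then show ?thesis using termb[OF x, of b \<beta>] c'b[OF b, of \<beta>] \<beta>(2) by simp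
  qed
  \<comment> \<open>Enumerating the multi-indices turns unordered sums into ordinary series, to
    which the M-test and termwise differentiation apply.\<close>
  define e where "e = from_nat_into (MI :: ((complex ^ 'n) \<Rightarrow> nat) set)"
  have inf: "infinite (MI :: ((complex ^ 'n) \<Rightarrow> nat) set)"
  proof -
    obtain b :: "complex ^ 'n" where b: "b \<in> Basis" using nonempty_Basis by blast
    define h :: "nat \<Rightarrow> complex ^ 'n \<Rightarrow> nat" where "h n = (\<lambda>x\<in>Basis. n)" for n
    have "inj h"
    proof (rule injI)
      fix m n assume "h m = h n"
      then have "h m b = h n b" by simp
      then show "m = n" using b by (simp add: h_def)
    qed
    moreover have "range h \<subseteq> MI" by (auto simp: h_def)
    ultimately show ?thesis using range_inj_infinite infinite_super by blast
  qed
  have e: "bij_betw e UNIV MI"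
    unfolding e_def by (intro bij_betw_from_nat_into inf countable_PiE) auto
  have eM: "e n \<in> MI" for n using e by (auto simp: bij_betw_def)
  have sums: "(\<lambda>n. F (e n)) sums l" if "(F has_sum l) MI" for F :: "((complex ^ 'n) \<Rightarrow> nat) \<Rightarrow> complex" and l
  proof -
    have "((\<lambda>n. F (e n)) has_sum l) UNIV"
      using that unfolding has_sum_reindex_bij_betw[OF e] .
    then show ?thesis by (rule has_sum_imp_sums)
  qed
  have Msum: "summable (\<lambda>n. norm (c (e n)) * \<delta> ^ tot (e n) / (\<delta> - \<delta>'))"
  proof -
    have "((\<lambda>n. norm (c (e n)) * \<delta> ^ tot (e n)) has_sum infsum (\<lambda>\<alpha>. norm (c \<alpha>) * \<delta> ^ tot \<alpha>) MI) UNIV"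
      using has_sum_infsum[OF c(1)] unfolding has_sum_reindex_bij_betw[OF e, of "\<lambda>\<alpha>. norm (c \<alpha>) * \<delta> ^ tot \<alpha>"] .
    then show ?thesis using has_sum_imp_sums sums_summable summable_divide by blast
  qed
  have ul: "uniform_limit (cube a \<delta>') (\<lambda>n x. \<Sum>i<n. D b (e i) x) (g b) sequentially" if b: "b \<in> Basis" for b
  proof -
    have "uniform_limit (cube a \<delta>') (\<lambda>n x. \<Sum>i<n. D b (e i) x) (\<lambda>x. suminf (\<lambda>i. D b (e i) x)) sequentially"
      by (rule Weierstrass_m_test[OF Db[OF _ b eM] Msum])
    moreover have "suminf (\<lambda>i. D b (e i) x) = g b x" if "x \<in> cube a \<delta>'" for x
      using sums[OF gD[OF that b]] by (simp add: sums_iff)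
    ultimately show ?thesis by (simp cong: uniform_limit_cong')
  qed
  have "(f has_derivative (\<lambda>v. \<Sum>b\<in>Basis. of_real (v \<bullet> b) * g b x)) (at x)" if x: "x \<in> cube a \<delta>'" for x
  proof -
    have fs: "(\<lambda>n. c (e n) * of_real (mono_at (e n) (y - a))) sums f y" if "y \<in> cube a \<delta>'" for y
      using c(3) that cube_mono[of \<delta>' \<delta> a] d by (intro sums) auto
    have "\<exists>h. \<forall>y\<in>cube a \<delta>'. (\<lambda>n. c (e n) * of_real (mono_at (e n) (y - a))) sums h y \<and>
        (h has_derivative (\<lambda>v. \<Sum>b\<in>Basis. of_real (v \<bullet> b) * g b y)) (at y within cube a \<delta>')"
    proof (rule has_derivative_series[OF convex_cube])
      show "((\<lambda>y. c (e n) * of_real (mono_at (e n) (y - a))) has_derivative (\<lambda>v. \<Sum>b\<in>Basis. of_real (v \<bullet> b) * D b (e n) y)) (at y within cube a \<delta>')"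
        for n y
      proof -
        have "((\<lambda>y. c (e n) * of_real (mono_at (e n) (y - a))) has_derivative (\<lambda>v. c (e n) * of_real (\<Sum>b\<in>Basis. (v \<bullet> b) * dmono b (e n) (y - a)))) (at y within cube a \<delta>')"
          by (intro has_derivative_mult_right bounded_linear.has_derivative[OF bounded_linear_of_real has_derivative_mono])
        then show ?thesis by (rule has_derivative_eq_rhs) (simp add: D_def sum_distrib_left mult_ac fun_eq_iff)
      qed
      show "\<forall>\<^sub>F n in sequentially. \<forall>y\<in>cube a \<delta>'. \<forall>h. norm ((\<Sum>i<n. \<Sum>b\<in>Basis. of_real (h \<bullet> b) * D b (e i) y) - (\<Sum>b\<in>Basis. of_real (h \<bullet> b) * g b y)) \<le> \<epsilon> * norm h"
        if "\<epsilon> > 0" for \<epsilon>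
      proof -
        define K where "K = real (DIM(complex ^ 'n))"
        have K: "K > 0" by (simp add: K_def)
        have "\<forall>\<^sub>F n in sequentially. \<forall>b\<in>Basis. \<forall>y\<in>cube a \<delta>'. dist (\<Sum>i<n. D b (e i) y) (g b y) < \<epsilon> / K"
        proof (rule eventually_ball_finite[OF finite_Basis], rule ballI)
          fix b :: "complex ^ 'n" assume "b \<in> Basis"
          from ul[OF this] show "\<forall>\<^sub>F n in sequentially. \<forall>y\<in>cube a \<delta>'. dist (\<Sum>i<n. D b (e i) y) (g b y) < \<epsilon> / K"
            unfolding uniform_limit_iff using K that by simp
        qed
        then show ?thesis
        proof eventually_elim
          case (elim n)
          show ?case
          proof (intro ballI allI)
            fix y h assume y: "y \<in> cube a \<delta>'"
            have "(\<Sum>i<n. \<Sum>b\<in>Basis. of_real (h \<bullet> b) * D b (e i) y) - (\<Sum>b\<in>Basis. of_real (h \<bullet> b) * g b y)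
              = (\<Sum>b\<in>Basis. of_real (h \<bullet> b) * ((\<Sum>i<n. D b (e i) y) - g b y))"
              by (subst sum.swap) (simp add: sum_distrib_left right_diff_distrib sum_subtractf)
            also have "norm \<dots> \<le> (\<Sum>b\<in>(Basis :: (complex ^ 'n) set). norm h * (\<epsilon> / K))"
            proof (rule sum_norm_le)
              fix b :: "complex ^ 'n" assume b: "b \<in> Basis"
              have "norm (of_real (h \<bullet> b) * ((\<Sum>i<n. D b (e i) y) - g b y)) = \<bar>h \<bullet> b\<bar> * norm ((\<Sum>i<n. D b (e i) y) - g b y)"
                by (simp add: norm_mult)
              also have "\<dots> \<le> norm h * (\<epsilon> / K)"
                using elim b y Basis_le_norm[OF b, of h] by (intro mult_mono) (auto simp: dist_norm intro: less_imp_le)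
              finally show "norm (of_real (h \<bullet> b) * ((\<Sum>i<n. D b (e i) y) - g b y)) \<le> norm h * (\<epsilon> / K)" .
            qed
            also have "\<dots> = \<epsilon> * norm h" using K by (simp add: K_def)
            finally show "norm ((\<Sum>i<n. \<Sum>b\<in>Basis. of_real (h \<bullet> b) * D b (e i) y) - (\<Sum>b\<in>Basis. of_real (h \<bullet> b) * g b y)) \<le> \<epsilon> * norm h" .
          qed
        qed
      qed
    qed (use x fs in auto)
    then obtain h where h: "\<And>y. y \<in> cube a \<delta>' \<Longrightarrow> (\<lambda>n. c (e n) * of_real (mono_at (e n) (y - a))) sums h y"
      "(h has_derivative (\<lambda>v. \<Sum>b\<in>Basis. of_real (v \<bullet> b) * g b x)) (at x within cube a \<delta>')" using x by blast
    have hf: "h y = f y" if "y \<in> cube a \<delta>'" for y using sums_unique2[OF h(1)[OF that] fs[OF that]] .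
    have hd: "(h has_derivative (\<lambda>v. \<Sum>b\<in>Basis. of_real (v \<bullet> b) * g b x)) (at x)"
      using h(2) by (simp only: at_within_open[OF x open_cube])
    show ?thesis by (rule has_derivative_transform_within_open[OF hd open_cube x hf])
  qed
  then show ?thesis by (intro exI[of _ g] conjI ballI gPS)
qed

lemma PS_cong:
  assumes "PS a \<delta> S f" "\<And>z. z \<in> cube a \<delta> \<Longrightarrow> g z = f z"
  shows "PS a \<delta> S g"
proof -
  obtain c where c: "(\<lambda>\<alpha>. norm (c \<alpha>) * \<delta> ^ tot \<alpha>) summable_on MI" "infsum (\<lambda>\<alpha>. norm (c \<alpha>) * \<delta> ^ tot \<alpha>) MI \<le> S"
      "\<And>x. x \<in> cube a \<delta> \<Longrightarrow> ((\<lambda>\<alpha>. c \<alpha> * of_real (mono_at \<alpha> (x - a))) has_sum f x) MI"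
    using assms(1) unfolding PS_def by blast
  show ?thesis
    unfolding PS_def
  proof (intro exI[of _ c] conjI ballI c(1,2))
    fix x assume "x \<in> cube a \<delta>"
    with c(3)[OF this] assms(2)[OF this] show "((\<lambda>\<alpha>. c \<alpha> * of_real (mono_at \<alpha> (x - a))) has_sum g x) MI" by simp
  qed
qed

lemma PS_lin:
  assumes "PS a \<delta> S f" "PS a \<delta> S g" "norm k = 1" "\<delta> > 0"
  shows "PS a \<delta> S (\<lambda>z. (f z + k * g z) / 2)"
proof -
  from assms obtain c d where
    c: "(\<lambda>\<alpha>. norm (c \<alpha>) * \<delta> ^ tot \<alpha>) summable_on MI" "infsum (\<lambda>\<alpha>. norm (c \<alpha>) * \<delta> ^ tot \<alpha>) MI \<le> S"
      "\<And>x. x \<in> cube a \<delta> \<Longrightarrow> ((\<lambda>\<alpha>. c \<alpha> * of_real (mono_at \<alpha> (x - a))) has_sum f x) MI" and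
    d: "(\<lambda>\<alpha>. norm (d \<alpha>) * \<delta> ^ tot \<alpha>) summable_on MI" "infsum (\<lambda>\<alpha>. norm (d \<alpha>) * \<delta> ^ tot \<alpha>) MI \<le> S"
      "\<And>x. x \<in> cube a \<delta> \<Longrightarrow> ((\<lambda>\<alpha>. d \<alpha> * of_real (mono_at \<alpha> (x - a))) has_sum g x) MI"
    unfolding PS_def by blast
  define e where "e \<alpha> = (c \<alpha> + k * d \<alpha>) / 2" for \<alpha>
  have le: "norm (e \<alpha>) * \<delta> ^ tot \<alpha> \<le> (norm (c \<alpha>) * \<delta> ^ tot \<alpha> + norm (d \<alpha>) * \<delta> ^ tot \<alpha>) * (1 / 2)" for \<alpha>
  proof -
    have "norm (e \<alpha>) \<le> (norm (c \<alpha>) + norm (d \<alpha>)) / 2"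
      using norm_triangle_ineq[of "c \<alpha>" "k * d \<alpha>"] assms(3) by (simp add: e_def norm_divide norm_mult)
    then have "norm (e \<alpha>) * \<delta> ^ tot \<alpha> \<le> (norm (c \<alpha>) + norm (d \<alpha>)) / 2 * \<delta> ^ tot \<alpha>"
      using assms(4) by (intro mult_right_mono) auto
    then show ?thesis by (simp add: field_simps)
  qed
  note s = summable_on_add[OF c(1) d(1)]
  note s2 = summable_on_cmult_left[OF s, of "1 / 2"]
  have es: "(\<lambda>\<alpha>. norm (e \<alpha>) * \<delta> ^ tot \<alpha>) summable_on MI"
    by (rule summable_on_comparison_test[OF s2 le]) (use assms(4) in simp)
  have "infsum (\<lambda>\<alpha>. norm (e \<alpha>) * \<delta> ^ tot \<alpha>) MI \<le> infsum (\<lambda>\<alpha>. (norm (c \<alpha>) * \<delta> ^ tot \<alpha> + norm (d \<alpha>) * \<delta> ^ tot \<alpha>) * (1 / 2)) MI"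
    by (rule infsum_mono[OF es s2 le])
  also have "\<dots> = (infsum (\<lambda>\<alpha>. norm (c \<alpha>) * \<delta> ^ tot \<alpha>) MI + infsum (\<lambda>\<alpha>. norm (d \<alpha>) * \<delta> ^ tot \<alpha>) MI) * (1 / 2)"
    by (simp only: infsum_cmult_left[OF s] infsum_add[OF c(1) d(1)])
  also have "\<dots> \<le> S" using c(2) d(2) by simp
  finally have "infsum (\<lambda>\<alpha>. norm (e \<alpha>) * \<delta> ^ tot \<alpha>) MI \<le> S" .
  moreover have "((\<lambda>\<alpha>. e \<alpha> * of_real (mono_at \<alpha> (x - a))) has_sum (f x + k * g x) / 2) MI" if "x \<in> cube a \<delta>" for x
    using has_sum_cmult_right[OF has_sum_add[OF c(3)[OF that] has_sum_cmult_right[OF d(3)[OF that], of k]], of "1/2"]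
    by (simp add: e_def field_simps)
  ultimately show ?thesis unfolding PS_def using es by (intro exI[of _ e] conjI ballI)
qed

lemma PS_pd:
  fixes f :: "complex ^ 'n \<Rightarrow> complex" and a :: "complex ^ 'n"
  assumes f: "PS a \<delta> S f" and d: "0 < \<delta>'" "\<delta>' < \<delta>"
  shows "PS a \<delta>' (S / (\<delta> - \<delta>')) (pd x f)" "z \<in> cube a \<delta>' \<Longrightarrow> f differentiable (at z)"
proof -
  obtain g where g: "\<And>b. b \<in> Basis \<Longrightarrow> PS a \<delta>' (S / (\<delta> - \<delta>')) (g b)"
    "\<And>x. x \<in> cube a \<delta>' \<Longrightarrow> (f has_derivative (\<lambda>v. \<Sum>b\<in>Basis. of_real (v \<bullet> b) * g b x)) (at x)"
    using PS_derivative[OF f d] by blast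
  show "f differentiable (at z)" if "z \<in> cube a \<delta>'" using g(2)[OF that] unfolding differentiable_def by blast
  have B: "axis j 1 \<in> (Basis :: (complex ^ 'n) set)" "axis j \<i> \<in> (Basis :: (complex ^ 'n) set)" for j
    by (auto simp: Basis_vec_def Basis_complex_def)
  have s: "(\<Sum>b\<in>Basis. of_real (b0 \<bullet> b) * g b z) = g b0 z" if "b0 \<in> Basis" for b0 z
  proof -
    have "(\<Sum>b\<in>Basis. of_real (b0 \<bullet> b) * g b z) = (\<Sum>b\<in>Basis. if b = b0 then g b z else 0)"
      using that by (intro sum.cong) (auto simp: inner_Basis)
    then show ?thesis using that by simp
  qed
  have "norm (sg x) = 1" by (cases x) simp_all
  then have "PS a \<delta>' (S / (\<delta> - \<delta>')) (\<lambda>z. (g (axis (ix x) 1) z + sg x * g (axis (ix x) \<i>) z) / 2)"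
    by (intro PS_lin g(1) B d(1))
  moreover have "pd x f z = (g (axis (ix x) 1) z + sg x * g (axis (ix x) \<i>) z) / 2" if "z \<in> cube a \<delta>'" for z
    unfolding pd_eq[OF g(2)[OF that]] s[OF B(1)] s[OF B(2)] ..
  ultimately show "PS a \<delta>' (S / (\<delta> - \<delta>')) (pd x f)" by (rule PS_cong)
qed

lemma PS_word:
  assumes "PS a \<delta> S f" "0 < \<eta>" "\<eta> * real (length w) < \<delta>"
  shows "PS a (\<delta> - \<eta> * real (length w)) (S / \<eta> ^ length w) (pds w f)"
  using assms(1,3)
proof (induction w arbitrary: f \<delta> S)
  case (Cons x w)
  have l: "\<eta> * real (length w) < \<delta> - \<eta>" using Cons.prems(2) by (simp add: algebra_simps)
  moreover have "0 \<le> \<eta> * real (length w)" using assms(2) by simp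
  ultimately have "0 < \<delta> - \<eta>" by linarith
  then have "PS a (\<delta> - \<eta>) (S / \<eta>) (pd x f)"
    using PS_pd(1)[OF Cons.prems(1), of "\<delta> - \<eta>" x] assms(2) by simp
  from Cons.IH[OF this l] show ?case by (simp add: algebra_simps)
qed simp

lemma PS_bound:
  assumes "PS a \<delta> S f" "x \<in> cube a \<delta>" "\<delta> > 0"
  shows "norm (f x) \<le> S"
proof -
  obtain c where c: "(\<lambda>\<alpha>. norm (c \<alpha>) * \<delta> ^ tot \<alpha>) summable_on MI" "infsum (\<lambda>\<alpha>. norm (c \<alpha>) * \<delta> ^ tot \<alpha>) MI \<le> S"
      "((\<lambda>\<alpha>. c \<alpha> * of_real (mono_at \<alpha> (x - a))) has_sum f x) MI"
    using assms unfolding PS_def by blast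
  have t: "norm (c \<alpha> * of_real (mono_at \<alpha> (x - a))) \<le> norm (c \<alpha>) * \<delta> ^ tot \<alpha>" for \<alpha>
  proof -
    have "\<bar>mono_at \<alpha> (x - a)\<bar> \<le> \<delta> ^ tot \<alpha>"
      using assms(2) by (intro abs_mono_le) (auto simp: cube_def intro: less_imp_le)
    then show ?thesis by (simp add: norm_mult mult_left_mono)
  qed
  have s: "(\<lambda>\<alpha>. norm (c \<alpha> * of_real (mono_at \<alpha> (x - a)))) summable_on MI"
    by (rule summable_on_comparison_test[OF c(1) t]) (rule norm_ge_zero)
  have "f x = infsum (\<lambda>\<alpha>. c \<alpha> * of_real (mono_at \<alpha> (x - a))) MI" using infsumI[OF c(3)] by simp
  then have "norm (f x) \<le> infsum (\<lambda>\<alpha>. norm (c \<alpha> * of_real (mono_at \<alpha> (x - a)))) MI"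
    using norm_infsum_bound[OF s] by simp
  also have "\<dots> \<le> infsum (\<lambda>\<alpha>. norm (c \<alpha>) * \<delta> ^ tot \<alpha>) MI" by (rule infsum_mono[OF s c(1) t])
  finally show ?thesis using c(2) by simp
qed

section \<open>Factorial bounds on all derivatives\<close>

definition an_on :: "(complex ^ 'n) set \<Rightarrow> (complex ^ 'n \<Rightarrow> complex) \<Rightarrow> bool" where
  "an_on U f \<longleftrightarrow> smooth_on U f \<and> (\<exists>C\<ge>0. \<exists>R\<ge>0. \<forall>w. \<forall>z\<in>U. norm (pds w f z) \<le> C * R ^ length w * fact (length w))"

lemma an_onI:
  assumes "smooth_on U f" "C \<ge> 0" "R \<ge> 0" "\<And>w z. z \<in> U \<Longrightarrow> norm (pds w f z) \<le> C * R ^ length w * fact (length w)"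
  shows "an_on U f"
  using assms unfolding an_on_def by blast

lemma power_le_exp_fact: "x \<ge> 0 \<Longrightarrow> x ^ n \<le> exp x * fact n" for x :: real
proof -
  assume x: "x \<ge> 0"
  have "(\<Sum>k\<in>{n}. x ^ k /\<^sub>R fact k) \<le> (\<Sum>k. x ^ k /\<^sub>R fact k)"
    using x by (intro sum_le_suminf summable_exp_generic) auto
  then have "x ^ n / fact n \<le> exp x" by (simp add: exp_def divide_inverse mult.commute)
  then show ?thesis by (simp add: divide_le_eq)
qed

text \<open>A word of length n is spent in n steps of size \<delta> / (2 (n + 1)), so more than half
  of the cube survives for every n. The resulting power (n + 1)^n is at most e^(n + 1) n!.\<close>

lemma PS_an_on:
  assumes f: "PS a \<delta> S f" and \<delta>: "\<delta> > 0"
  shows "an_on (cube a (\<delta> / 2)) f"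
proof -
  have S: "S \<ge> 0" using PS_bound[OF f cube_center[OF \<delta>] \<delta>] norm_ge_zero order_trans by blast
  have key: "PS a (\<delta> - \<delta> / (2 * real (length w + 1)) * real (length w)) (S / (\<delta> / (2 * real (length w + 1))) ^ length w) (pds w f)
     \<and> \<delta> / 2 < \<delta> - \<delta> / (2 * real (length w + 1)) * real (length w)" for w
  proof -
    define n where "n = real (length w)"
    have n: "n \<ge> 0" by (simp add: n_def)
    have "\<delta> / (2 * (n + 1)) * n < \<delta> / 2" using n \<delta> by (simp add: field_simps)
    moreover from this have "\<delta> / (2 * (n + 1)) * n < \<delta>" using \<delta> by linarith
    moreover have "0 < \<delta> / (2 * (n + 1))" using n \<delta> by simp
    ultimately show ?thesis using PS_word[OF f, of "\<delta> / (2 * (n + 1))" w] by (simp add: n_def add.commute)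
  qed
  have sm: "smooth_on (cube a (\<delta> / 2)) f"
    unfolding smooth_on_def using PS_pd(2)[OF key[THEN conjunct1] _ key[THEN conjunct2]] \<delta> by simp
  have "norm (pds w f z) \<le> (S * exp 1) * (2 * exp 1 / \<delta>) ^ length w * fact (length w)" if z: "z \<in> cube a (\<delta> / 2)" for w z
  proof -
    define n where "n = length w"
    have "z \<in> cube a (\<delta> - \<delta> / (2 * real (length w + 1)) * real (length w))"
      using z cube_mono[OF less_imp_le[OF key[THEN conjunct2]]] by blast
    moreover have "0 < \<delta> - \<delta> / (2 * real (length w + 1)) * real (length w)"
      using key[of w] \<delta> by linarith
    ultimately have "norm (pds w f z) \<le> S / (\<delta> / (2 * real (n + 1))) ^ n"
      unfolding n_def by (intro PS_bound[OF key[THEN conjunct1]])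
    also have "\<dots> = S * (2 / \<delta>) ^ n * real (n + 1) ^ n"
    proof -
      have "S / (\<delta> / (2 * x)) ^ n = S * (2 / \<delta>) ^ n * x ^ n" if "x > 0" for x
        using \<delta> that by (simp add: power_divide power_mult_distrib field_simps)
      from this[of "real (n + 1)"] show ?thesis by simp
    qed
    also have "\<dots> \<le> S * (2 / \<delta>) ^ n * (exp (real (n + 1)) * fact n)"
      using S \<delta> by (intro mult_left_mono power_le_exp_fact) auto
    also have "\<dots> = (S * exp 1) * (2 * exp 1 / \<delta>) ^ n * fact n"
      by (simp add: exp_add exp_of_nat_mult[of n 1, simplified] power_divide power_mult_distrib)
    finally show ?thesis by (simp add: n_def)
  qed
  then show ?thesis unfolding an_on_def using sm S \<delta>
    by (intro conjI exI[of _ "S * exp 1"] exI[of _ "2 * exp 1 / \<delta>"]) auto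
qed

lemma real_analytic_at_imp_an_on:
  fixes \<rho> :: "complex ^ 'n \<Rightarrow> real"
  assumes "real_analytic_at \<rho> a"
  shows "\<exists>r>0. an_on (ball a r) (\<lambda>z. of_real (\<rho> z))"
proof -
  obtain c :: "(complex ^ 'n \<Rightarrow> nat) \<Rightarrow> real" and r where r: "r > 0"
    and c: "\<And>x. x \<in> ball a r \<Longrightarrow> ((\<lambda>\<alpha>. c \<alpha> * mono_at \<alpha> (x - a)) has_sum \<rho> x) MI"
    using assms unfolding real_analytic_at_def mono_at_def by blast
  define K where "K = real (DIM(complex ^ 'n))"
  \<comment> \<open>K is the real dimension; this size keeps the closed cube inside the ball of
    convergence.\<close>
  define \<delta> where "\<delta> = r / (2 * K)"
  have K: "K > 0" by (simp add: K_def)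
  have \<delta>: "\<delta> > 0" "\<delta> * K < r" using r K by (simp_all add: \<delta>_def)
  have bound: "x \<in> ball a r" if "\<And>b. b \<in> Basis \<Longrightarrow> \<bar>(x - a) \<bullet> b\<bar> \<le> \<delta>" for x
  proof -
    have "norm (x - a) \<le> (\<Sum>b\<in>Basis. \<bar>(x - a) \<bullet> b\<bar>)" by (rule norm_le_l1)
    also have "\<dots> \<le> (\<Sum>b\<in>(Basis :: (complex ^ 'n) set). \<delta>)" by (rule sum_mono[OF that])
    also have "\<dots> < r" using \<delta> by (simp add: K_def mult.commute)
    finally show ?thesis by (simp add: dist_norm norm_minus_commute)
  qed
  \<comment> \<open>The corner of the closed cube, at which every monomial is a pure power of
    \<delta>: unconditional convergence there is summability of the majorant.\<close>
  define x0 where "x0 = a + (\<Sum>b\<in>Basis. \<delta> *\<^sub>R b)"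
  have x0: "(x0 - a) \<bullet> b = \<delta>" if "b \<in> Basis" for b
    using that by (simp add: x0_def inner_sum_left inner_Basis if_distrib[of "\<lambda>x. \<delta> * x"] cong: if_cong)
  have "((\<lambda>\<alpha>. c \<alpha> * mono_at \<alpha> (x0 - a)) has_sum \<rho> x0) MI"
    using x0 \<delta> by (intro c bound) auto
  moreover have m0: "mono_at \<alpha> (x0 - a) = \<delta> ^ tot \<alpha>" for \<alpha>
    unfolding mono_at_def tot_def using x0 by (simp add: power_sum)
  ultimately have "(\<lambda>\<alpha>. c \<alpha> * \<delta> ^ tot \<alpha>) summable_on MI"
    by (metis (mono_tags, lifting) has_sum_imp_summable summable_on_cong)
  then have "(\<lambda>\<alpha>. \<bar>c \<alpha> * \<delta> ^ tot \<alpha>\<bar>) summable_on MI"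
    using summable_on_iff_abs_summable_on_real[of "\<lambda>\<alpha>. c \<alpha> * \<delta> ^ tot \<alpha>" MI] by simp
  then have s: "(\<lambda>\<alpha>. norm (of_real (c \<alpha>) :: complex) * \<delta> ^ tot \<alpha>) summable_on MI"
    using \<delta>(1) by (simp add: abs_mult)
  have "((\<lambda>\<alpha>. of_real (c \<alpha>) * of_real (mono_at \<alpha> (x - a))) has_sum (of_real (\<rho> x) :: complex)) MI" if "x \<in> cube a \<delta>" for x
  proof -
    have "x \<in> ball a r" using that by (intro bound) (auto simp: cube_def intro: less_imp_le)
    from has_sum_of_real[OF c[OF this]] show ?thesis by simp
  qed
  then have "PS a \<delta> (infsum (\<lambda>\<alpha>. norm (of_real (c \<alpha>) :: complex) * \<delta> ^ tot \<alpha>) MI) (\<lambda>z. of_real (\<rho> z))"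
    unfolding PS_def using s by (intro exI[of _ "\<lambda>\<alpha>. of_real (c \<alpha>)"]) auto
  from PS_an_on[OF this \<delta>(1)] have an: "an_on (cube a (\<delta> / 2)) (\<lambda>z. of_real (\<rho> z))" .
  have "ball a (\<delta> / 2) \<subseteq> cube a (\<delta> / 2)"
  proof
    fix x assume x: "x \<in> ball a (\<delta> / 2)"
    show "x \<in> cube a (\<delta> / 2)"
      unfolding cube_def
    proof (intro CollectI ballI)
      fix b :: "complex ^ 'n" assume "b \<in> Basis"
      then have "\<bar>(x - a) \<bullet> b\<bar> \<le> norm (x - a)" by (rule Basis_le_norm)
      then show "\<bar>(x - a) \<bullet> b\<bar> < \<delta> / 2" using x by (simp add: dist_norm norm_minus_commute)
    qed
  qed
  with an have "an_on (ball a (\<delta> / 2)) (\<lambda>z. of_real (\<rho> z))"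
    unfolding an_on_def by (meson smooth_on_subset subset_iff)
  then show ?thesis using \<delta>(1) by (intro exI[of _ "\<delta> / 2"]) simp
qed

lemma an_on_subset: "an_on U f \<Longrightarrow> V \<subseteq> U \<Longrightarrow> an_on V f"
  unfolding an_on_def by (meson smooth_on_subset subset_iff)

text \<open>The factorial quotient is the exact value of the Leibniz sum of (m + k)! (n - m + i)!, a
  Vandermonde convolution. Hence it reproduces itself under the recursion of \<open>hmul\<close>,
  which raises k or i by one.\<close>

lemma hmul_bound:
  assumes "\<And>u. norm (a u) \<le> A * R ^ length u * fact (length u + k)"
    and "\<And>u. norm (b u) \<le> B * R ^ length u * fact (length u + i)"
  shows "norm (hmul a b w) \<le> A * B * R ^ length w * (fact k * fact i * fact (length w + k + i + 1) / fact (k + i + 1))"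
  using assms
proof (induction w arbitrary: a b A B k i)
  case Nil
  have "norm (hmul a b []) \<le> (A * fact k) * (B * fact i)"
    unfolding hmul.simps norm_mult using Nil(1)[of "[]"] Nil(2)[of "[]"]
    by (intro mult_mono) (auto intro: order_trans[OF norm_ge_zero])
  then show ?case by (simp add: mult_ac)
next
  case (Cons x w)
  have 1: "norm (hmul (\<lambda>u. a (x # u)) b w) \<le> (A * R) * B * R ^ length w * (fact (Suc k) * fact i * fact (length w + Suc k + i + 1) / fact (Suc k + i + 1))"
    by (rule Cons.IH[OF _ Cons.prems(2)]) (use Cons.prems(1)[of "x # _"] in \<open>simp add: mult_ac\<close>)
  have 2: "norm (hmul a (\<lambda>u. b (x # u)) w) \<le> A * (B * R) * R ^ length w * (fact k * fact (Suc i) * fact (length w + k + Suc i + 1) / fact (k + Suc i + 1))"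
    by (rule Cons.IH[OF Cons.prems(1)]) (use Cons.prems(2)[of "x # _"] in \<open>simp add: mult_ac\<close>)
  define F D where "F = (fact (length w + k + i + 2) :: real)" and "D = (fact (k + i + 2) :: real)"
  have e: "fact (Suc k) = (real k + 1) * fact k" "fact (Suc i) = (real i + 1) * fact i"
    by (simp_all add: algebra_simps)
  have "norm (hmul a b (x # w)) \<le> (A * R) * B * R ^ length w * (fact (Suc k) * fact i * F / D)
     + A * (B * R) * R ^ length w * (fact k * fact (Suc i) * F / D)"
    using norm_triangle_mono[OF 1 2] by (simp only: F_def D_def hmul.simps) (simp del: fact_Suc)
  also have "\<dots> = A * B * R ^ Suc (length w) * (fact k * fact i * F) * ((real k + real i + 2) / D)"
    unfolding e by (simp add: add_divide_distrib algebra_simps)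
  also have "(real k + real i + 2) / D = 1 / (fact (k + i + 1) :: real)"
  proof -
    have "D = (real k + real i + 2) * fact (k + i + 1)"
      unfolding D_def using fact_Suc[of "k + i + 1", where 'a = real] by (simp del: fact_Suc add: algebra_simps)
    then show ?thesis by simp
  qed
  finally show ?case by (simp add: F_def del: fact_Suc)
qed

lemma coef_const: "open U \<Longrightarrow> z \<in> U \<Longrightarrow> pds w (\<lambda>z. c) z = (if w = [] then c else 0)"
  by (metis coef_cst coef_jt jt_const smooth_on_const)

lemma an_on_const: "open U \<Longrightarrow> an_on U (\<lambda>z. c)"
  unfolding an_on_def
  by (intro conjI smooth_on_const exI[of _ "norm c"] exI[of _ 1]) (auto simp: coef_const)

lemma an_on_common:
  assumes "an_on U f" "an_on U g"
  obtains A B R where "A \<ge> 0" "B \<ge> 0" "R \<ge> 0"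
    "\<And>w z. z \<in> U \<Longrightarrow> norm (pds w f z) \<le> A * R ^ length w * fact (length w)"
    "\<And>w z. z \<in> U \<Longrightarrow> norm (pds w g z) \<le> B * R ^ length w * fact (length w)"
proof -
  obtain A R1 where 1: "A \<ge> 0" "R1 \<ge> 0" "\<And>w z. z \<in> U \<Longrightarrow> norm (pds w f z) \<le> A * R1 ^ length w * fact (length w)"
    using assms(1) unfolding an_on_def by blast
  obtain B R2 where 2: "B \<ge> 0" "R2 \<ge> 0" "\<And>w z. z \<in> U \<Longrightarrow> norm (pds w g z) \<le> B * R2 ^ length w * fact (length w)"
    using assms(2) unfolding an_on_def by blast
  have m: "A * R1 ^ n * fact n \<le> A * max R1 R2 ^ n * fact n" "B * R2 ^ n * fact n \<le> B * max R1 R2 ^ n * fact n" for n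
    using 1 2 by (intro mult_right_mono mult_left_mono power_mono; simp)+
  show thesis
  proof (rule that[of A B "max R1 R2"])
    show "norm (pds w f z) \<le> A * max R1 R2 ^ length w * fact (length w)" if "z \<in> U" for w z
      by (rule order_trans[OF 1(3)[OF that] m(1)])
    show "norm (pds w g z) \<le> B * max R1 R2 ^ length w * fact (length w)" if "z \<in> U" for w z
      by (rule order_trans[OF 2(3)[OF that] m(2)])
  qed (use 1 2 in simp_all)
qed

lemma an_on_smooth: "an_on U f \<Longrightarrow> smooth_on U f"
  by (simp add: an_on_def)

context
  fixes U :: "(complex ^ 'n) set"
  assumes U: "open U"
begin

lemma an_on_add:
  assumes f: "an_on U f" and g: "an_on U g"
  shows "an_on U (\<lambda>z. f z + g z)"
proof -
  obtain A B R where b: "A \<ge> 0" "B \<ge> 0" "R \<ge> 0"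
    "\<And>w z. z \<in> U \<Longrightarrow> norm (pds w f z) \<le> A * R ^ length w * fact (length w)"
    "\<And>w z. z \<in> U \<Longrightarrow> norm (pds w g z) \<le> B * R ^ length w * fact (length w)"
    using an_on_common[OF f g] by blast
  have "norm (pds w (\<lambda>z. f z + g z) z) \<le> (A + B) * R ^ length w * fact (length w)" if "z \<in> U" for w z
    using norm_triangle_mono[OF b(4)[OF that] b(5)[OF that], of w w]
    by (simp add: pds_add[OF U an_on_smooth[OF f] an_on_smooth[OF g] that] algebra_simps)
  from an_onI[OF smooth_on_add[OF U an_on_smooth[OF f] an_on_smooth[OF g]] _ b(3) this]
  show ?thesis using b(1,2) by simp
qed

lemma an_on_mult:
  assumes f: "an_on U f" and g: "an_on U g"
  shows "an_on U (\<lambda>z. f z * g z)"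
proof -
  obtain A B R where b: "A \<ge> 0" "B \<ge> 0" "R \<ge> 0"
    "\<And>w z. z \<in> U \<Longrightarrow> norm (pds w f z) \<le> A * R ^ length w * fact (length w)"
    "\<And>w z. z \<in> U \<Longrightarrow> norm (pds w g z) \<le> B * R ^ length w * fact (length w)"
    using an_on_common[OF f g] by blast
  have "norm (pds w (\<lambda>z. f z * g z) z) \<le> (A * B) * (2 * R) ^ length w * fact (length w)" if "z \<in> U" for w z
  proof -
    have "norm (pds w (\<lambda>z. f z * g z) z) \<le> A * B * R ^ length w * (fact 0 * fact 0 * fact (length w + 0 + 0 + 1) / fact (0 + 0 + 1))"
      unfolding pds_mult[OF U an_on_smooth[OF f] an_on_smooth[OF g] that]
      by (rule hmul_bound) (use b(4,5)[OF that] in simp_all)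
    also have "\<dots> = A * B * R ^ length w * (real (length w + 1) * fact (length w))" by simp
    also have "\<dots> \<le> A * B * R ^ length w * (2 ^ length w * fact (length w))"
    proof -
      have "Suc n \<le> 2 ^ n" for n :: nat by (induction n) auto
      then have "real (Suc n) \<le> 2 ^ n" for n by (metis of_nat_le_iff of_nat_numeral of_nat_power)
      then show ?thesis using b by (intro mult_left_mono mult_right_mono) (auto simp del: of_nat_Suc)
    qed
    finally show ?thesis by (simp add: power_mult_distrib mult_ac)
  qed
  from an_onI[OF smooth_on_mult[OF U an_on_smooth[OF f] an_on_smooth[OF g]] _ _ this]
  show ?thesis using b(1-3) by simp
qed

lemma an_on_pd:
  assumes f: "an_on U f"
  shows "an_on U (pd x f)"
proof -
  obtain A R where b: "A \<ge> 0" "R \<ge> 0"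
    "\<And>w z. z \<in> U \<Longrightarrow> norm (pds w f z) \<le> A * R ^ length w * fact (length w)"
    using f unfolding an_on_def by blast
  have "norm (pds w (pd x f) z) \<le> (A * R) * (2 * R) ^ length w * fact (length w)" if "z \<in> U" for w z
  proof -
    have "norm (pds w (pd x f) z) \<le> A * R * R ^ length w * (real (length w + 1) * fact (length w))"
      using b(3)[OF that, of "x # w"] by (simp add: algebra_simps)
    also have "\<dots> \<le> A * R * R ^ length w * (2 ^ length w * fact (length w))"
    proof -
      have "Suc n \<le> 2 ^ n" for n :: nat by (induction n) auto
      then have "real (Suc n) \<le> 2 ^ n" for n by (metis of_nat_le_iff of_nat_numeral of_nat_power)
      then show ?thesis using b by (intro mult_left_mono mult_right_mono) (auto simp del: of_nat_Suc)
    qed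
    finally show ?thesis by (simp add: power_mult_distrib mult_ac)
  qed
  from an_onI[OF smooth_on_pd[OF an_on_smooth[OF f]] _ _ this]
  show ?thesis using b(1,2) by simp
qed

lemma an_on_minus: "an_on U f \<Longrightarrow> an_on U (\<lambda>z. - f z)"
  using an_on_mult[OF an_on_const[OF U, of "- 1"], of f] by simp

lemma an_on_diff: "an_on U f \<Longrightarrow> an_on U g \<Longrightarrow> an_on U (\<lambda>z. f z - g z)"
  using an_on_add[OF _ an_on_minus, of f g] by simp

lemma an_on_sum: "(\<And>i. i \<in> I \<Longrightarrow> an_on U (f i)) \<Longrightarrow> an_on U (\<lambda>z. \<Sum>i\<in>I. f i z)"
  by (induction I rule: infinite_finite_induct) (auto intro!: an_on_add an_on_const U)

lemma an_on_prod: "(\<And>i. i \<in> I \<Longrightarrow> an_on U (f i)) \<Longrightarrow> an_on U (\<lambda>z. \<Prod>i\<in>I. f i z)"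
  by (induction I rule: infinite_finite_induct) (auto intro!: an_on_mult an_on_const U)

lemma pds_sum:
  "(\<And>i. i \<in> I \<Longrightarrow> smooth_on U (f i)) \<Longrightarrow> z \<in> U \<Longrightarrow> pds w (\<lambda>z. \<Sum>i\<in>I. f i z) z = (\<Sum>i\<in>I. pds w (f i) z)"
proof (induction I rule: infinite_finite_induct)
  case (insert i I)
  then show ?case using pds_add[OF U, of "f i" "\<lambda>z. \<Sum>i\<in>I. f i z" z w] smooth_on_sum[OF U, of I f] by simp
qed (simp_all add: coef_const[OF U])

text \<open>The crude growth of \<open>W\<^sup>m f\<close>: the bound \<open>(n + 2m)! / m!\<close> at words of length \<open>n\<close> is stable
  under one more application of \<open>W\<close>, and at \<open>n = 0\<close> it is geometric times \<open>m!\<close>.\<close>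

lemma vector_field_iterates_bound:
  fixes \<omega> :: "('n + 'n) \<Rightarrow> complex ^ 'n \<Rightarrow> complex"
  assumes \<omega>: "\<And>x. smooth_on U (\<omega> x)" and f: "smooth_on U f" and R: "R \<ge> 0"
    and b\<omega>: "\<And>x w z. z \<in> U \<Longrightarrow> norm (pds w (\<omega> x) z) \<le> A * R ^ length w * fact (length w)"
    and bf: "\<And>w z. z \<in> U \<Longrightarrow> norm (pds w f z) \<le> C * R ^ length w * fact (length w)"
    and W: "\<And>g. W g = (\<lambda>z. \<Sum>x\<in>UNIV. \<omega> x z * pd x g z)"
  shows "smooth_on U ((W ^^ m) f)"
    and "z \<in> U \<Longrightarrow> norm ((W ^^ m) f z) \<le> C * (4 * real (CARD('n)) * A * R) ^ m * fact m"
proof -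
  define d where "d = real CARD('n + 'n)"
  define B where "B m = C * (d * A * R / 2) ^ m / fact m" for m :: nat
  have sm: "smooth_on U (W g)" if "smooth_on U g" for g
    unfolding W using that by (intro smooth_on_sum[OF U] smooth_on_mult[OF U] \<omega> smooth_on_pd)
  have key: "smooth_on U ((W ^^ m) f) \<and> (\<forall>w. \<forall>z\<in>U. norm (pds w ((W ^^ m) f) z) \<le> B m * R ^ length w * fact (length w + 2 * m))" for m
  proof (induction m)
    case 0
    then show ?case using f bf by (simp add: B_def)
  next
    case (Suc m)
    define g where "g = (W ^^ m) f"
    have g: "smooth_on U g" "\<And>w z. z \<in> U \<Longrightarrow> norm (pds w g z) \<le> B m * R ^ length w * fact (length w + 2 * m)"
      using Suc unfolding g_def by auto
    have "norm (pds w (W g) z) \<le> B (Suc m) * R ^ length w * fact (length w + 2 * Suc m)" if z: "z \<in> U" for w z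
    proof -
      have "norm (pds w (\<lambda>z. \<omega> x z * pd x g z) z) \<le> A * (B m * R) * R ^ length w * (fact 0 * fact (2 * m + 1) * fact (length w + 0 + (2 * m + 1) + 1) / fact (0 + (2 * m + 1) + 1))" for x
        unfolding pds_mult[OF U \<omega> smooth_on_pd[OF g(1)] z]
      proof (rule hmul_bound)
        show "norm (pds u (pd x g) z) \<le> B m * R * R ^ length u * fact (length u + (2 * m + 1))" for u
          using g(2)[OF z, of "x # u"] by (simp del: fact_Suc add: mult.assoc)
      qed (use b\<omega>[OF z] in simp)
      \<comment> \<open>\<open>hmul_bound\<close> is used with k = 0 and i = 2m + 1: the quotient
        (2m + 1)! / (2m + 2)! is the factor 1 / (2 (m + 1)) that builds up the 1 / m! in B.\<close>
      moreover have "fact 0 * fact (2 * m + 1) * fact (length w + 0 + (2 * m + 1) + 1) / fact (0 + (2 * m + 1) + 1)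
          = fact (length w + 2 * Suc m) / (2 * real (Suc m))"
      proof -
        have "fact (0 + (2 * m + 1) + 1) = (2 * real (Suc m)) * (fact (2 * m + 1) :: real)"
          using fact_Suc[of "2 * m + 1", where 'a = real] by (simp del: fact_Suc)
        moreover have "length w + 0 + (2 * m + 1) + 1 = length w + 2 * Suc m" by simp
        ultimately show ?thesis by (simp only:) (simp del: fact_Suc of_nat_Suc)
      qed
      ultimately have 1: "norm (pds w (\<lambda>z. \<omega> x z * pd x g z) z) \<le> A * (B m * R) * R ^ length w * (fact (length w + 2 * Suc m) / (2 * real (Suc m)))" for x
        by simp
      have "norm (pds w (W g) z) = norm (\<Sum>x\<in>UNIV. pds w (\<lambda>z. \<omega> x z * pd x g z) z)"
        unfolding W by (subst pds_sum) (auto intro!: smooth_on_mult[OF U] \<omega> smooth_on_pd g(1) z)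
      also have "\<dots> \<le> d * (A * (B m * R) * R ^ length w * (fact (length w + 2 * Suc m) / (2 * real (Suc m))))"
        unfolding d_def by (rule sum_norm_bound) (rule 1)
      also have "\<dots> = (d * A * R / 2 * B m / real (Suc m)) * R ^ length w * fact (length w + 2 * Suc m)"
        by (simp del: fact_Suc of_nat_Suc)
      also have "d * A * R / 2 * B m / real (Suc m) = B (Suc m)"
        by (simp add: B_def mult_ac del: of_nat_Suc)
      finally show ?thesis .
    qed
    then show ?case using sm[OF g(1)] by (simp add: g_def)
  qed
  show "smooth_on U ((W ^^ m) f)" using key by blast
  assume z: "z \<in> U"
  have "norm ((W ^^ m) f z) \<le> B m * fact (2 * m)" using key[of m] z by (metis (no_types, lifting) add_0 fold_Nil id_apply list.size(3) mult.right_neutral power_0)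
  also have "\<dots> \<le> B m * (4 ^ m * (fact m * fact m))"
  proof -
    \<comment> \<open>By the bound on the central binomial coefficient (2m)! is at most 4^m times
      the square of m!; one of the two factorials is absorbed by B.\<close>
    have fle: "real (fact (2 * m)) \<le> real (4 ^ m * (fact m * fact m))"
    proof -
      have "fact m * fact (2 * m - m) * (2 * m choose m) = fact (2 * m)" by (rule binomial_fact_lemma) simp
      moreover have "(2 * m choose m) \<le> 2 ^ (2 * m)" by (rule binomial_le_pow2)
      moreover have "fact m * fact (2 * m - m) * (2 * m choose m) \<le> (fact m * fact (2 * m - m) * 2 ^ (2 * m) :: nat)"
        by (rule mult_left_mono) (rule binomial_le_pow2, rule zero_le)
      ultimately have "fact (2 * m) \<le> (fact m * fact (2 * m - m) * 2 ^ (2 * m) :: nat)" by linarith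
      also have "\<dots> = 4 ^ m * (fact m * fact m)"
      proof -
        have "2 * m - m = m" "(2::nat) ^ (2 * m) = 4 ^ m" by (simp_all add: power_mult)
        then show ?thesis by (simp only: mult_ac)
      qed
      finally show ?thesis by (simp only: of_nat_le_iff)
    qed
    have Bm: "B m \<ge> 0"
    proof -
      have "C \<ge> 0" "A \<ge> 0" using bf[OF z, of "[]"] b\<omega>[OF z, of "[]"] by (auto intro: order_trans[OF norm_ge_zero])
      then show ?thesis using R by (simp add: B_def d_def)
    qed
    have "B m * real (fact (2 * m)) \<le> B m * real (4 ^ m * (fact m * fact m))"
      by (rule mult_left_mono[OF fle Bm])
    then show ?thesis by (simp only: of_nat_fact of_nat_mult of_nat_power of_nat_numeral)
  qed
  also have "\<dots> = C * (4 * real (CARD('n)) * A * R) ^ m * fact m"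
  proof -
    have "(d * A * R / 2) ^ m * 4 ^ m = (4 * real (CARD('n)) * A * R) ^ m"
    proof -
      have "(d * A * R / 2) ^ m * 4 ^ m = (d * A * R / 2 * 4) ^ m" by (rule power_mult_distrib[symmetric])
      also have "d * A * R / 2 * 4 = 4 * real (CARD('n)) * A * R" by (simp add: d_def)
      finally show ?thesis .
    qed
    moreover have "B m * (4 ^ m * (fact m * fact m)) = C * ((d * A * R / 2) ^ m * 4 ^ m) * fact m"
      by (simp add: B_def)
    ultimately show ?thesis by simp
  qed
  finally show "norm ((W ^^ m) f z) \<le> C * (4 * real (CARD('n)) * A * R) ^ m * fact m" .
qed

end

section \<open>Holomorphic functions of several variables\<close>

definition holo :: "(complex ^ 'n) set \<Rightarrow> (complex ^ 'n \<Rightarrow> complex) \<Rightarrow> bool" where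
  "holo U F \<longleftrightarrow> open U \<and> (\<forall>z\<in>U. \<exists>D. (F has_derivative D) (at z) \<and> (\<forall>c v. D (c *s v) = c * D v))"

lemma holo_subset: "holo U F \<Longrightarrow> open V \<Longrightarrow> V \<subseteq> U \<Longrightarrow> holo V F"
  unfolding holo_def by blast

lemma norm_vector_scalar: "norm (c *s (v :: complex ^ 'n)) = norm c * norm v"
  by (simp add: norm_vec_def norm_mult L2_set_right_distrib)

lemma vector_scalar_Re_Im: "\<xi> *s u = Re \<xi> *\<^sub>R u + Im \<xi> *\<^sub>R (\<i> *s u)"
  by (simp add: vec_eq_iff complex_eq_iff)

lemma has_derivative_line: "((\<lambda>\<xi>. z + \<xi> *s u) has_derivative (\<lambda>\<eta>. \<eta> *s (u :: complex ^ 'n))) (at \<xi>)"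
proof -
  have "((\<lambda>\<xi>. z + (Re \<xi> *\<^sub>R u + Im \<xi> *\<^sub>R (\<i> *s u))) has_derivative (\<lambda>\<eta>. Re \<eta> *\<^sub>R u + Im \<eta> *\<^sub>R (\<i> *s u))) (at \<xi>)"
    by (auto intro!: derivative_eq_intros)
  then show ?thesis by (simp only: vector_scalar_Re_Im[symmetric])
qed

lemma holo_pd:
  assumes F: "(F has_derivative D) (at z)" and D: "\<And>c v. D (c *s v) = c * D v"
  shows "pd (Inr j) F z = 0" "pd (Inl j) F z = D (axis j 1)" "D v = (\<Sum>j\<in>UNIV. v $ j * pd (Inl j) F z)"
proof -
  have a: "axis j \<i> = \<i> *s (axis j 1 :: complex ^ 'n)" for j by (simp add: vec_eq_iff axis_def)
  show 1: "pd (Inr j) F z = 0" for j unfolding pd_eq[OF F] by (simp add: a D)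
  show "pd (Inl j) F z = D (axis j 1)" unfolding pd_eq[OF F] by (simp add: a D)
  show "D v = (\<Sum>j\<in>UNIV. v $ j * pd (Inl j) F z)" using derivative_pd[OF F, of v] by (simp add: 1)
qed

lemma holo_pd_Inr: "holo U F \<Longrightarrow> z \<in> U \<Longrightarrow> pd (Inr j) F z = 0"
  unfolding holo_def using holo_pd(1) by blast

definition dirc :: "complex ^ 'n \<Rightarrow> (complex ^ 'n \<Rightarrow> complex) \<Rightarrow> complex ^ 'n \<Rightarrow> complex" where
  "dirc u F z = (\<Sum>j\<in>UNIV. u $ j * pd (Inl j) F z)"

lemma holo_has_derivative: "holo U F \<Longrightarrow> z \<in> U \<Longrightarrow> (F has_derivative (\<lambda>v. dirc v F z)) (at z)"
proof -
  assume "holo U F" "z \<in> U"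
  then obtain D where D: "(F has_derivative D) (at z)" "\<And>c v. D (c *s v) = c * D v" unfolding holo_def by blast
  then have "D = (\<lambda>v. dirc v F z)" using holo_pd(3)[OF D] by (simp add: dirc_def fun_eq_iff)
  then show ?thesis using D(1) by simp
qed

lemma dirc_scale: "dirc (c *s v) F z = c * dirc v F z"
  by (simp add: dirc_def sum_distrib_left mult_ac)

lemma slice_derivative:
  assumes "holo U F" "z + \<xi> *s u \<in> U"
  shows "((\<lambda>\<xi>. F (z + \<xi> *s u)) has_field_derivative dirc u F (z + \<xi> *s u)) (at \<xi>)"
proof -
  have "((\<lambda>\<xi>. F (z + \<xi> *s u)) has_derivative (\<lambda>\<eta>. dirc (\<eta> *s u) F (z + \<xi> *s u))) (at \<xi>)"
    using diff_chain_at[OF has_derivative_line holo_has_derivative[OF assms]] by (simp add: o_def)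
  then show ?thesis by (simp add: has_field_derivative_def dirc_scale mult.commute[of _ "dirc u F _"])
qed

lemma slice_in_ball:
  fixes u z :: "complex ^ 'n"
  shows "norm u \<le> 1 \<Longrightarrow> \<xi> \<in> ball 0 R \<Longrightarrow> z + \<xi> *s u \<in> ball z R"
  using mult_left_le[of "norm u" "norm \<xi>"] by (auto simp: dist_norm norm_vector_scalar)

lemma slice_holomorphic:
  assumes "holo U F" "ball z R \<subseteq> U" "norm u \<le> 1"
  shows "(\<lambda>\<xi>. F (z + \<xi> *s u)) holomorphic_on ball 0 R"
proof -
  have "(\<lambda>\<xi>. F (z + \<xi> *s u)) field_differentiable at \<xi>" if "\<xi> \<in> ball 0 R" for \<xi>
    using slice_derivative[OF assms(1)] slice_in_ball[OF assms(3) that] assms(2) unfolding field_differentiable_def by blast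
  then show ?thesis by (simp add: holomorphic_on_open field_differentiable_def)
qed

text \<open>Cauchy's inequality with radius R / 2 on the complex line through z in the normalised
  direction of v.\<close>

lemma dirc_bound:
  assumes F: "holo U F" "ball z R \<subseteq> U" "R > 0" and B: "\<And>y. y \<in> ball z R \<Longrightarrow> norm (F y) \<le> B"
  shows "norm (dirc v F z) \<le> (2 * B / R) * norm v"
proof (cases "v = 0")
  case True
  then show ?thesis by (simp add: dirc_def)
next
  case False
  define u where "u = (1 / of_real (norm v)) *s v"
  have u: "norm u = 1" "v = of_real (norm v) *s u"
    using False by (simp_all add: u_def norm_vector_scalar norm_divide)
  define g where "g = (\<lambda>\<xi>. F (z + \<xi> *s u))"
  have hol: "g holomorphic_on ball 0 R" unfolding g_def using slice_holomorphic[OF F(1,2)] u by simp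
  have "cball 0 (R / 2) \<subseteq> ball (0::complex) R" using F(3) by auto
  then have "norm ((deriv ^^ 1) g 0) \<le> fact 1 * B / (R / 2) ^ 1"
  proof (intro Cauchy_inequality)
    show "g holomorphic_on ball 0 (R / 2)" by (rule holomorphic_on_subset[OF hol]) (use F(3) in auto)
    show "continuous_on (cball 0 (R / 2)) g"
      by (rule continuous_on_subset[OF holomorphic_on_imp_continuous_on[OF hol]]) (use F(3) in auto)
    show "norm (g x) \<le> B" if "norm (0 - x) = R / 2" for x
      unfolding g_def using that F(3) u by (intro B slice_in_ball) auto
  qed (use F(3) in simp)
  moreover have "deriv g 0 = dirc u F z"
    unfolding g_def using slice_derivative[OF F(1), of z 0 u] F(2,3) by (intro DERIV_imp_deriv) (auto simp: subset_iff)
  ultimately have "norm (dirc u F z) \<le> 2 * B / R" by (simp add: mult.commute)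
  then have "norm (of_real (norm v) * dirc u F z) \<le> (2 * B / R) * norm v"
    using mult_right_mono[OF _ norm_ge_zero[of v]] by (simp only: norm_mult norm_of_real abs_norm_cancel mult.commute[of "norm v"])
  then show ?thesis using dirc_scale[of "of_real (norm v)" u F z] u(2) by simp
qed

text \<open>The second-order Taylor remainder; 32 is 2! times 4^2, from Cauchy's inequality on discs
  of radius R / 4.\<close>

lemma quotient_bound:
  assumes g: "g holomorphic_on ball 0 R" and R: "R > 0" and B: "\<And>\<xi>. \<xi> \<in> ball 0 R \<Longrightarrow> norm (g \<xi>) \<le> B"
    and h: "norm h < R / 4" "h \<noteq> 0"
  shows "norm ((g h - g 0) / h - deriv g 0) \<le> 32 * B / R ^ 2 * norm h"
proof -
  have op: "open (ball (0::complex) R)" by simp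
  have B0: "B \<ge> 0" using B[of 0] R by (auto intro: order_trans[OF norm_ge_zero])
  have d2: "norm ((deriv ^^ 2) g x) \<le> 32 * B / R ^ 2" if x: "x \<in> ball 0 (R / 4)" for x
  proof -
    have sub: "cball x (R / 4) \<subseteq> ball 0 R"
    proof
      fix y assume "y \<in> cball x (R / 4)"
      then have "norm y \<le> norm x + R / 4" using norm_triangle_ineq[of x "y - x"] by (simp add: dist_norm norm_minus_commute)
      then show "y \<in> ball 0 R" using x R by simp
    qed
    have "norm ((deriv ^^ 2) g x) \<le> fact 2 * B / (R / 4) ^ 2"
    proof (rule Cauchy_inequality)
      show "g holomorphic_on ball x (R / 4)" by (rule holomorphic_on_subset[OF g]) (use sub in auto)
      show "continuous_on (cball x (R / 4)) g"
        by (rule continuous_on_subset[OF holomorphic_on_imp_continuous_on[OF g] sub])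
      show "norm (g y) \<le> B" if "norm (x - y) = R / 4" for y
        using that sub by (intro B) (auto simp: dist_norm)
    qed (use R in simp)
    then show ?thesis by (simp add: power2_eq_square)
  qed
  have "norm ((deriv ^^ 0) g h - (\<Sum>i\<le>1. (deriv ^^ i) g 0 * (h - 0) ^ i / fact i)) \<le> 32 * B / R ^ 2 * norm (h - 0) ^ Suc 1 / fact 1"
  proof (rule complex_Taylor[of "ball 0 (R / 4)" 1 "\<lambda>i. (deriv ^^ i) g"])
    show "((deriv ^^ i) g has_field_derivative (deriv ^^ Suc i) g x) (at x within ball 0 (R / 4))" if "x \<in> ball 0 (R / 4)" "i \<le> 1" for i x
    proof -
      have "(deriv ^^ i) g holomorphic_on ball 0 R" by (rule holomorphic_higher_deriv[OF g op])
      then have "((deriv ^^ i) g has_field_derivative deriv ((deriv ^^ i) g) x) (at x)"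
        using that R by (intro holomorphic_derivI[of _ "ball 0 R"]) auto
      then show ?thesis by (simp add: has_field_derivative_at_within)
    qed
    show "norm ((deriv ^^ Suc 1) g x) \<le> 32 * B / R ^ 2" if "x \<in> ball 0 (R / 4)" for x
      using d2[OF that] by (simp add: numeral_2_eq_2)
  qed (use h R in auto)
  then have "norm (g h - g 0 - deriv g 0 * h) \<le> 32 * B / R ^ 2 * norm h ^ 2"
    by (simp add: power2_eq_square algebra_simps)
  moreover have "(g h - g 0) / h - deriv g 0 = (g h - g 0 - deriv g 0 * h) / h" using h by (simp add: field_simps)
  ultimately show ?thesis using h by (simp add: norm_divide divide_le_eq power2_eq_square mult.assoc)
qed

text \<open>The derivative is the limit of the difference quotients f n, which are holomorphic.
  \<open>quotient_bound\<close> makes the convergence uniform near z0, and \<open>dirc_bound\<close>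
  applied to f n - f m transfers this to the differentials; so the limit is differentiable with a
  complex linear differential.\<close>

lemma holo_pd_Inl:
  fixes F :: "complex ^ 'n \<Rightarrow> complex"
  assumes F: "holo U F"
  shows "holo U (pd (Inl j) F)"
  unfolding holo_def
proof (intro conjI ballI)
  show "open U" using F by (simp add: holo_def)
  fix z0 assume "z0 \<in> U"
  with \<open>open U\<close> obtain R where R: "R > 0" "cball z0 R \<subseteq> U" using open_contains_cball by blast
  define e :: "complex ^ 'n" where "e = axis j 1"
  have e: "norm e = 1" by (simp add: e_def norm_axis_1)
  have "continuous_on (cball z0 R) F"
    by (meson F R(2) continuous_at_imp_continuous_on has_derivative_continuous holo_has_derivative subsetD)
  then have "bounded (F ` cball z0 R)" by (intro compact_imp_bounded compact_continuous_image) auto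
  then obtain B where "\<forall>x\<in>F ` cball z0 R. norm x \<le> B" unfolding bounded_iff by blast
  then have B: "\<And>y. y \<in> cball z0 R \<Longrightarrow> norm (F y) \<le> B" by blast
  have B0: "B \<ge> 0" using B[of z0] R by (auto intro: order_trans[OF norm_ge_zero])
  \<comment> \<open>Steps of at most R / 16 keep z + h n e in the ball and satisfy the smallness
    condition (R / 2) / 4 of \<open>quotient_bound\<close>.\<close>
  define h where "h n = (of_real (R / 16 / real (n + 1)) :: complex)" for n :: nat
  have h: "h n \<noteq> 0" "norm (h n) \<le> R / 16" for n
    using R by (auto simp: h_def norm_divide field_simps simp del: of_real_divide)
  have h0: "(\<lambda>n. norm (h n)) \<longlonglongrightarrow> 0"
  proof -
    have "(\<lambda>n. R / 16 * inverse (real (Suc n))) \<longlonglongrightarrow> R / 16 * 0"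
      by (intro tendsto_mult tendsto_const LIMSEQ_inverse_real_of_nat)
    moreover have "norm (h n) = R / 16 * inverse (real (Suc n))" for n
      using R unfolding h_def norm_of_real by (simp add: field_simps)
    ultimately show ?thesis by (simp only: mult_zero_right)
  qed
  define f where "f n z = (F (z + h n *s e) - F z) / h n" for n z
  have inb: "z + h n *s e \<in> ball z0 R" if "z \<in> ball z0 (R / 2)" for z n
  proof -
    have "norm (z + h n *s e - z0) \<le> norm (z - z0) + norm (h n *s e)"
      using norm_triangle_ineq[of "z - z0" "h n *s e"] by (simp add: algebra_simps)
    also have "\<dots> < R / 2 + R / 2" using that h(2)[of n] R(1) e by (simp add: norm_vector_scalar dist_norm norm_minus_commute)
    finally show ?thesis by (simp add: dist_norm norm_minus_commute)
  qed
  have sub: "ball z0 (R / 2) \<subseteq> U" "ball z0 R \<subseteq> U" using R by auto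
  have pdF: "pd (Inl j) F z = dirc e F z" for z
    by (simp add: dirc_def e_def axis_def if_distrib[of "\<lambda>x. x * _"] cong: if_cong)
  define Df where "Df n z v = (dirc v F (z + h n *s e) - dirc v F z) / h n" for n z v
  have Df: "(f n has_derivative Df n z) (at z)" if "z \<in> ball z0 (R / 2)" for n z
  proof -
    have "((\<lambda>z. z + h n *s e) has_derivative (\<lambda>v. v)) (at z)" by (auto intro!: derivative_eq_intros)
    moreover have "z + h n *s e \<in> U" using inb[OF that] sub by blast
    ultimately have 1: "((\<lambda>z. F (z + h n *s e)) has_derivative (\<lambda>v. dirc v F (z + h n *s e))) (at z)"
      using diff_chain_at[OF _ holo_has_derivative[OF F], of "\<lambda>z. z + h n *s e" "\<lambda>v. v" z] by (simp add: o_def)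
    have 2: "(F has_derivative (\<lambda>v. dirc v F z)) (at z)" using holo_has_derivative[OF F] that sub by blast
    show ?thesis
      unfolding f_def[abs_def] Df_def[abs_def] by (rule bounded_linear.has_derivative[OF bounded_linear_divide]) (rule has_derivative_diff[OF 1 2])
  qed
  have holof: "holo (ball z0 (R / 2)) (f n)" for n
    unfolding holo_def
  proof (intro conjI ballI)
    fix z assume z: "z \<in> ball z0 (R / 2)"
    show "\<exists>D. (f n has_derivative D) (at z) \<and> (\<forall>c v. D (c *s v) = c * D v)"
      by (intro exI[of _ "Df n z"] conjI Df z) (simp add: Df_def dirc_scale right_diff_distrib)
  qed simp
  have dircf: "dirc v (f n) z = Df n z v" if "z \<in> ball z0 (R / 2)" for n z v
    using has_derivative_unique[OF holo_has_derivative[OF holof that] Df[OF that]] by (simp add: fun_eq_iff)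
  have quot: "norm (f n z - pd (Inl j) F z) \<le> 32 * B / (R / 2) ^ 2 * norm (h n)" if z: "z \<in> ball z0 (R / 2)" for n z
  proof -
    have sb: "ball z (R / 2) \<subseteq> cball z0 R"
    proof
      fix y assume "y \<in> ball z (R / 2)"
      then show "y \<in> cball z0 R" using z dist_triangle[of z0 y z] by simp
    qed
    define g where "g = (\<lambda>\<xi>. F (z + \<xi> *s e))"
    have "norm ((g (h n) - g 0) / h n - deriv g 0) \<le> 32 * B / (R / 2) ^ 2 * norm (h n)"
    proof (rule quotient_bound)
      show "g holomorphic_on ball 0 (R / 2)" unfolding g_def using sb R e by (intro slice_holomorphic[OF F]) auto
      show "norm (g \<xi>) \<le> B" if "\<xi> \<in> ball 0 (R / 2)" for \<xi>
        unfolding g_def using slice_in_ball[OF _ that, of e z] sb e by (intro B) auto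
      show "norm (h n) < R / 2 / 4" using h(2)[of n] R by linarith
    qed (use h R in auto)
    moreover have "deriv g 0 = pd (Inl j) F z"
      unfolding g_def pdF using slice_derivative[OF F, of z 0 e] z sub by (intro DERIV_imp_deriv) auto
    ultimately show ?thesis by (simp add: g_def f_def)
  qed
  define K where "K = 32 * B / (R / 2) ^ 2"
  have K: "K \<ge> 0" using B0 by (simp add: K_def)
  have cau: "norm (Df n z v - Df m z v) \<le> 8 * K * (norm (h n) + norm (h m)) / R * norm v" if z: "z \<in> ball z0 (R / 4)" for n m z v
  proof -
    have sb: "ball z (R / 4) \<subseteq> ball z0 (R / 2)"
    proof
      fix y assume "y \<in> ball z (R / 4)"
      then show "y \<in> ball z0 (R / 2)" using z dist_triangle[of z0 y z] by simp
    qed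
    have z2: "z \<in> ball z0 (R / 2)" using z R by auto
    have D: "((\<lambda>y. f n y - f m y) has_derivative (\<lambda>v. Df n y v - Df m y v)) (at y)" if "y \<in> ball z0 (R / 2)" for y
      by (intro has_derivative_diff Df that)
    have hd: "holo (ball z0 (R / 2)) (\<lambda>y. f n y - f m y)"
      unfolding holo_def
    proof (intro conjI ballI)
      fix y assume "y \<in> ball z0 (R / 2)"
      then show "\<exists>D. ((\<lambda>y. f n y - f m y) has_derivative D) (at y) \<and> (\<forall>c v. D (c *s v) = c * D v)"
        by (intro exI[of _ "\<lambda>v. Df n y v - Df m y v"] conjI D) (simp_all add: Df_def dirc_scale algebra_simps)
    qed simp
    have "norm (dirc v (\<lambda>y. f n y - f m y) z) \<le> (2 * (K * (norm (h n) + norm (h m))) / (R / 4)) * norm v"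
    proof (rule dirc_bound[OF hd sb])
      fix y assume "y \<in> ball z (R / 4)"
      then have y: "y \<in> ball z0 (R / 2)" using sb by blast
      have "norm (f n y - f m y) \<le> norm (f n y - pd (Inl j) F y) + norm (f m y - pd (Inl j) F y)"
        using norm_triangle_ineq4[of "f n y - pd (Inl j) F y" "f m y - pd (Inl j) F y"] by simp
      also have "\<dots> \<le> K * (norm (h n) + norm (h m))" using add_mono[OF quot[OF y, of n] quot[OF y, of m]] by (simp add: K_def distrib_left)
      finally show "norm (f n y - f m y) \<le> K * (norm (h n) + norm (h m))" .
    qed (use R in simp)
    moreover have "dirc v (\<lambda>y. f n y - f m y) z = Df n z v - Df m z v"
      using has_derivative_unique[OF holo_has_derivative[OF hd z2] D[OF z2]] by (simp add: fun_eq_iff)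
    ultimately show ?thesis by (simp add: field_simps)
  qed
  have conv: "convergent (\<lambda>n. Df n z v)" if z: "z \<in> ball z0 (R / 4)" for z v
  proof (rule Cauchy_convergent, rule CauchyI)
    fix \<epsilon> :: real assume "\<epsilon> > 0"
    define M where "M = 8 * K / R * norm v + 1"
    have M: "M > 0" using K R by (simp add: M_def add_nonneg_pos)
    obtain N where N: "\<And>n. n \<ge> N \<Longrightarrow> norm (h n) < \<epsilon> / (2 * M)"
    proof -
      have "\<epsilon> / (2 * M) > 0" using \<open>\<epsilon> > 0\<close> M by simp
      from order_tendstoD(2)[OF h0 this] show thesis unfolding eventually_sequentially using that by blast
    qed
    have "norm (Df m z v - Df n z v) < \<epsilon>" if "m \<ge> N" "n \<ge> N" for m n
    proof -
      have "norm (Df m z v - Df n z v) \<le> (8 * K / R * norm v) * (norm (h m) + norm (h n))"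
        using cau[OF z, of m v n] by (simp add: mult_ac)
      also have "\<dots> \<le> M * (norm (h m) + norm (h n))" by (intro mult_right_mono) (auto simp: M_def)
      also have "\<dots> < M * (\<epsilon> / (2 * M) + \<epsilon> / (2 * M))" using N[OF that(1)] N[OF that(2)] M by (intro mult_strict_left_mono add_strict_mono) auto
      also have "\<dots> = \<epsilon>" using M by (simp add: field_simps)
      finally show ?thesis .
    qed
    then show "\<exists>N. \<forall>m\<ge>N. \<forall>n\<ge>N. norm (Df m z v - Df n z v) < \<epsilon>" by blast
  qed
  define G where "G z v = lim (\<lambda>n. Df n z v)" for z v
  have G: "(\<lambda>n. Df n z v) \<longlonglongrightarrow> G z v" if "z \<in> ball z0 (R / 4)" for z v
    unfolding G_def using conv[OF that] by (simp add: convergent_LIMSEQ_iff)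
  have Gb: "norm (Df n z v - G z v) \<le> 8 * K * norm (h n) / R * norm v" if z: "z \<in> ball z0 (R / 4)" for n z v
  proof (rule LIMSEQ_le)
    show "(\<lambda>m. norm (Df n z v - Df m z v)) \<longlonglongrightarrow> norm (Df n z v - G z v)" by (intro tendsto_intros G z)
    have "(\<lambda>m. 8 * K * (norm (h n) + norm (h m)) / R * norm v) \<longlonglongrightarrow> 8 * K * (norm (h n) + 0) / R * norm v"
      using R by (intro tendsto_intros h0) auto
    then show "(\<lambda>m. 8 * K * (norm (h n) + norm (h m)) / R * norm v) \<longlonglongrightarrow> 8 * K * norm (h n) / R * norm v" by simp
  qed (use cau[OF z] in blast)
  have z0: "z0 \<in> ball z0 (R / 4)" using R by simp
  have lim: "(\<lambda>n. f n z) \<longlonglongrightarrow> pd (Inl j) F z" if "z \<in> ball z0 (R / 2)" for z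
  proof (rule LIM_zero_cancel, rule Lim_null_comparison)
    show "\<forall>\<^sub>F n in sequentially. norm (f n z - pd (Inl j) F z) \<le> K * norm (h n)"
      using quot[OF that] by (simp add: K_def)
    show "(\<lambda>n. K * norm (h n)) \<longlonglongrightarrow> 0" using tendsto_mult[OF tendsto_const h0, of K] by simp
  qed
  have "\<exists>g. \<forall>z\<in>ball z0 (R / 4). (\<lambda>n. f n z) \<longlonglongrightarrow> g z \<and> (g has_derivative G z) (at z within ball z0 (R / 4))"
  proof (rule has_derivative_sequence[where f = f and f' = Df and g' = G and S = "ball z0 (R / 4)" and ?x0.0 = z0 and l = "pd (Inl j) F z0"])
    show "(f n has_derivative Df n z) (at z within ball z0 (R / 4))" if "z \<in> ball z0 (R / 4)" for n z
      using that R by (intro has_derivative_at_withinI[OF Df]) auto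
    fix \<epsilon> :: real assume "\<epsilon> > 0"
    have "(\<lambda>n. 8 * K * norm (h n) / R) \<longlonglongrightarrow> 8 * K * 0 / R" using R by (intro tendsto_intros h0) auto
    then have "\<forall>\<^sub>F n in sequentially. 8 * K * norm (h n) / R < \<epsilon>" using \<open>\<epsilon> > 0\<close> by (simp add: order_tendsto_iff)
    then show "\<forall>\<^sub>F n in sequentially. \<forall>z\<in>ball z0 (R / 4). \<forall>v. norm (Df n z v - G z v) \<le> \<epsilon> * norm v"
    proof eventually_elim
      case (elim n)
      show ?case
      proof (intro ballI allI)
        fix z v assume "z \<in> ball z0 (R / 4)"
        then have "norm (Df n z v - G z v) \<le> 8 * K * norm (h n) / R * norm v" by (rule Gb)
        also have "\<dots> \<le> \<epsilon> * norm v" by (rule mult_right_mono[OF less_imp_le[OF elim] norm_ge_zero])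
        finally show "norm (Df n z v - G z v) \<le> \<epsilon> * norm v" .
      qed
    qed
  next
    show "(\<lambda>n. f n z0) \<longlonglongrightarrow> pd (Inl j) F z0" using R by (intro lim) simp
  qed (use z0 in auto)
  then obtain g where g: "\<And>z. z \<in> ball z0 (R / 4) \<Longrightarrow> (\<lambda>n. f n z) \<longlonglongrightarrow> g z"
    "(g has_derivative G z0) (at z0 within ball z0 (R / 4))" using z0 by blast
  have "g z = pd (Inl j) F z" if "z \<in> ball z0 (R / 4)" for z
    using LIMSEQ_unique[OF g(1)[OF that] lim] that R by auto
  moreover have "(g has_derivative G z0) (at z0)" using g(2) by (simp only: at_within_open[OF z0 open_ball])
  ultimately have "(pd (Inl j) F has_derivative G z0) (at z0)"
    using has_derivative_transform_within_open[OF _ open_ball z0] by blast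
  moreover have "G z0 (c *s v) = c * G z0 v" for c v
  proof (rule LIMSEQ_unique[OF G[OF z0]])
    have "Df n z0 (c *s v) = c * Df n z0 v" for n by (simp add: Df_def dirc_scale right_diff_distrib)
    then show "(\<lambda>n. Df n z0 (c *s v)) \<longlonglongrightarrow> c * G z0 v" by (simp add: tendsto_mult_left G[OF z0])
  qed
  ultimately show "\<exists>D. (pd (Inl j) F has_derivative D) (at z0) \<and> (\<forall>c v. D (c *s v) = c * D v)" by blast
qed

lemma holo_smooth:
  assumes "holo U F"
  shows "smooth_on U F"
proof (rule smooth_on_coinduct[where R = "{F. holo U F}"])
  have U: "open U" using assms by (simp add: holo_def)
  then show "open U" .
  show "F \<in> {F. holo U F}" using assms by simp
  have z: "holo U (\<lambda>z. 0)" unfolding holo_def using U by (auto intro!: exI[of _ "\<lambda>_. 0"])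
  fix f assume "f \<in> {F. holo U F}"
  then have f: "holo U f" by simp
  show "f differentiable (at z)" if "z \<in> U" for z
    using holo_has_derivative[OF f that] unfolding differentiable_def by blast
  show "\<exists>g\<in>{F. holo U F}. \<forall>z\<in>U. pd x f z = g z" for x
  proof (cases x)
    case (Inl j)
    then show ?thesis using holo_pd_Inl[OF f, of j] by (intro bexI[of _ "pd x f"]) auto
  next
    case (Inr j)
    then show ?thesis using holo_pd_Inr[OF f] z by (intro bexI[of _ "\<lambda>z. 0"]) auto
  qed
qed

lemma holo_comb:
  fixes G :: "'i \<Rightarrow> complex ^ 'n \<Rightarrow> complex"
  assumes "open U" "\<And>j. j \<in> I \<Longrightarrow> holo U (G j)"
  shows "holo U (\<lambda>z. \<Sum>j\<in>I. c j * G j z)"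
  unfolding holo_def
proof (intro conjI ballI assms(1))
  fix z assume z: "z \<in> U"
  have "((\<lambda>z. \<Sum>j\<in>I. c j * G j z) has_derivative (\<lambda>v. \<Sum>j\<in>I. c j * dirc v (G j) z)) (at z)"
    by (intro has_derivative_sum has_derivative_mult_right holo_has_derivative[OF assms(2) z])
  then show "\<exists>D. ((\<lambda>z. \<Sum>j\<in>I. c j * G j z) has_derivative D) (at z) \<and> (\<forall>c v. D (c *s v) = c * D v)"
    by (rule exI[of _ "\<lambda>v. \<Sum>j\<in>I. c j * dirc v (G j) z", OF conjI]) (simp add: dirc_scale sum_distrib_left mult_ac)
qed

lemma holo_dirc: "holo U F \<Longrightarrow> holo U (dirc u F)"
  unfolding dirc_def[abs_def] by (intro holo_comb holo_pd_Inl) (auto simp: holo_def)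

lemma pds_cmult:
  assumes "open U" "smooth_on U f" "z \<in> U"
  shows "pds w (\<lambda>z. c * f z) z = c * pds w f z"
  using assms(2,3)
proof (induction w arbitrary: f z)
  case (Cons x w)
  have "pds w (pd x (\<lambda>z. c * f z)) z = pds w (\<lambda>z. c * pd x f z) z"
    by (rule pds_cong[OF assms(1) _ Cons.prems(2)])
      (simp add: pd_mult[OF _ smooth_on_differentiable[OF Cons.prems(1)]] pd_const)
  then show ?case using Cons.IH[OF smooth_on_pd[OF Cons.prems(1)] Cons.prems(2)] by simp
qed simp

text \<open>Along the complex line through p and z the n-th derivative at p is an n-fold directional
  derivative of F, hence zero; the identity theorem in one variable finishes.\<close>

lemma holo_eq_0_on_ball:
  assumes F: "holo (ball p r) F" and j: "\<And>w. pds w F p = 0" and z: "z \<in> ball p r"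
  shows "F z = 0"
proof (cases "z = p")
  case True
  then show ?thesis using j[of "[]"] by simp
next
  case False
  have r: "r > 0" using z by (metis ball_eq_empty empty_iff not_le)
  have p: "p \<in> ball p r" using r by simp
  define u where "u = (1 / of_real (norm (z - p))) *s (z - p)"
  have u: "norm u = 1" using False unfolding u_def norm_vector_scalar by (simp add: norm_divide)
  have "(deriv ^^ n) (\<lambda>\<xi>. F (p + \<xi> *s u)) 0 = 0" if "holo (ball p r) F" "\<And>w. pds w F p = 0" for n F
    using that
  proof (induction n arbitrary: F)
    case 0
    then show ?case using 0(2)[of "[]"] by simp
  next
    case (Suc n)
    have d: "deriv (\<lambda>\<xi>. F (p + \<xi> *s u)) \<xi> = dirc u F (p + \<xi> *s u)" if "\<xi> \<in> ball 0 r" for \<xi>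
      using slice_derivative[OF Suc.prems(1)] slice_in_ball[OF _ that, of u p] u by (intro DERIV_imp_deriv) auto
    have dz: "pds w (dirc u F) p = 0" for w
    proof -
      have sm: "smooth_on (ball p r) (\<lambda>z. u $ j * pd (Inl j) F z)" for j
        by (intro smooth_on_mult smooth_on_const smooth_on_pd holo_smooth Suc.prems) auto
      have "pds w (dirc u F) p = (\<Sum>j\<in>UNIV. u $ j * pds w (pd (Inl j) F) p)"
        unfolding dirc_def[abs_def]
        by (simp add: pds_sum[OF open_ball sm p] pds_cmult[OF open_ball smooth_on_pd[OF holo_smooth[OF Suc.prems(1)]] p])
      also have "\<dots> = 0" using Suc.prems(2)[of "Inl _ # w"] by simp
      finally show ?thesis .
    qed
    have hol: "(\<lambda>\<xi>. G (p + \<xi> *s u)) holomorphic_on ball 0 r" if "holo (ball p r) G" for G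
      using slice_holomorphic[OF that] u by simp
    have "(deriv ^^ Suc n) (\<lambda>\<xi>. F (p + \<xi> *s u)) 0 = (deriv ^^ n) (deriv (\<lambda>\<xi>. F (p + \<xi> *s u))) 0"
      by (simp only: funpow_Suc_right o_apply)
    also have "\<dots> = (deriv ^^ n) (\<lambda>\<xi>. dirc u F (p + \<xi> *s u)) 0"
      by (rule higher_deriv_transform_within_open[OF holomorphic_deriv[OF hol[OF Suc.prems(1)] open_ball] hol[OF holo_dirc[OF Suc.prems(1)]] open_ball _ d])
        (use r in simp_all)
    also have "\<dots> = 0" by (rule Suc.IH[OF holo_dirc[OF Suc.prems(1)] dz])
    finally show ?case .
  qed
  from this[OF F j] have 0: "(deriv ^^ n) (\<lambda>\<xi>. F (p + \<xi> *s u)) 0 = 0" for n .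
  have "(\<lambda>\<xi>. F (p + \<xi> *s u)) (of_real (norm (z - p))) = 0"
  proof (rule holomorphic_fun_eq_0_on_ball[of "\<lambda>\<xi>. F (p + \<xi> *s u)" 0 r])
    show "(\<lambda>\<xi>. F (p + \<xi> *s u)) holomorphic_on ball 0 r" using slice_holomorphic[OF F] u by simp
    show "of_real (norm (z - p)) \<in> ball (0::complex) r" using z by (simp add: dist_norm norm_minus_commute)
  qed (rule 0)
  moreover have "p + of_real (norm (z - p)) *s u = z" using False by (simp add: u_def vec_eq_iff)
  ultimately show ?thesis by simp
qed

section \<open>Polarization\<close>

lemma coef_cst_mult: "coef (cst c * a) w = c * coef a w"
proof (induction w arbitrary: a)
  case Nil
  show ?case by (simp add: coef_mult coef_cst)
next
  case (Cons x w)
  have "coef (cst c * a) (x # w) = coef (dd x (cst c * a)) w" by (simp only: coef_dd)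
  also have "\<dots> = coef (cst c * dd x a) w" by (simp add: derivation_mult[OF derivation_dd] dd_cst)
  finally show ?case by (simp add: Cons coef_dd)
qed

definition dv :: "complex ^ 'n \<Rightarrow> ('n + 'n) hser \<Rightarrow> ('n + 'n) hser" where
  "dv v a = (\<Sum>j\<in>UNIV. cst (v $ j) * dd (Inl j) a)"

lemma coef_dv: "coef (dv v a) w = (\<Sum>j\<in>UNIV. v $ j * coef a (Inl j # w))"
  by (simp add: dv_def coef_sum coef_cst_mult coef_dd)

lemma dv_commute: "dv u (dv v a) = dv v (dv u a)"
proof (rule hser_eqI)
  fix w
  have "coef (dv u (dv v a)) w = (\<Sum>j\<in>UNIV. \<Sum>k\<in>UNIV. u $ j * (v $ k * coef a (Inl k # Inl j # w)))"
    by (simp add: coef_dv sum_distrib_left)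
  also have "\<dots> = (\<Sum>k\<in>UNIV. \<Sum>j\<in>UNIV. u $ j * (v $ k * coef a (Inl j # Inl k # w)))"
    by (subst sum.swap) (intro sum.cong refl arg_cong2[of _ _ _ _ "(*)"] coef_permute, simp)
  also have "\<dots> = coef (dv v (dv u a)) w"
    by (simp add: coef_dv sum_distrib_left mult_ac)
  finally show "coef (dv u (dv v a)) w = coef (dv v (dv u a)) w" .
qed

lemma dv_funpow_commute: "dv e ((dv v ^^ m) a) = (dv v ^^ m) (dv e a)"
  by (induction m) (simp_all add: dv_commute[of e])

text \<open>The power is a product of m + 1 commuting factors that depend linearly on s, and each
  contributes the same term.\<close>

lemma dv_funpow_derivative:
  "((\<lambda>s. coef ((dv (v + s *s e) ^^ Suc m) a) w) has_field_derivative of_nat (Suc m) * coef ((dv v ^^ m) (dv e a)) w) (at 0)"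
proof (induction m arbitrary: w)
  case 0
  have "((\<lambda>s. \<Sum>j\<in>UNIV. (v $ j + s * e $ j) * coef a (Inl j # w)) has_field_derivative (\<Sum>j\<in>UNIV. e $ j * coef a (Inl j # w))) (at 0)"
    by (auto intro!: derivative_eq_intros)
  then show ?case by (simp add: coef_dv)
next
  case (Suc m)
  have "((\<lambda>s. \<Sum>j\<in>UNIV. (v $ j + s * e $ j) * coef ((dv (v + s *s e) ^^ Suc m) a) (Inl j # w)) has_field_derivative
     (\<Sum>j\<in>UNIV. e $ j * coef ((dv v ^^ Suc m) a) (Inl j # w) + v $ j * (of_nat (Suc m) * coef ((dv v ^^ m) (dv e a)) (Inl j # w)))) (at 0)"
  proof (rule DERIV_sum)
    fix j
    have 1: "((\<lambda>s. v $ j + s * e $ j) has_field_derivative e $ j) (at 0)" by (auto intro!: derivative_eq_intros)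
    show "((\<lambda>s. (v $ j + s * e $ j) * coef ((dv (v + s *s e) ^^ Suc m) a) (Inl j # w)) has_field_derivative
      e $ j * coef ((dv v ^^ Suc m) a) (Inl j # w) + v $ j * (of_nat (Suc m) * coef ((dv v ^^ m) (dv e a)) (Inl j # w))) (at 0)"
      by (rule DERIV_cong[OF DERIV_mult'[OF 1 Suc]]) (simp add: add.commute del: funpow.simps of_nat_Suc)
  qed
  moreover have "(\<Sum>j\<in>UNIV. e $ j * coef ((dv v ^^ Suc m) a) (Inl j # w) + v $ j * (of_nat (Suc m) * coef ((dv v ^^ m) (dv e a)) (Inl j # w)))
    = coef (dv e ((dv v ^^ Suc m) a)) w + of_nat (Suc m) * coef (dv v ((dv v ^^ m) (dv e a))) w"
    by (simp add: coef_dv sum.distrib sum_distrib_left mult_ac del: of_nat_Suc funpow.simps)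
  moreover have "\<dots> = of_nat (Suc (Suc m)) * coef ((dv v ^^ Suc m) (dv e a)) w"
    by (simp add: dv_funpow_commute dv_commute[of e v] algebra_simps)
  ultimately show ?case by (simp only: funpow.simps(2)[of "Suc m"] o_apply coef_dv[of "v + _ *s e"] vector_add_component vector_smult_component)
qed

text \<open>The vanishing form in v is differentiated in v towards a basis vector. This replaces one
  factor \<open>dv v\<close> by a partial derivative and lowers the degree by one.\<close>

lemma polarization:
  fixes a :: "('n::finite + 'n) hser"
  assumes "\<And>v. coef ((dv v ^^ m) a) [] = 0" "length js = m"
  shows "coef a (map Inl js) = 0"
  using assms
proof (induction m arbitrary: a js)
  case 0
  then show ?case by simp
next
  case (Suc m)
  obtain j ks where js: "js = j # ks" "length ks = m" using Suc.prems(2) by (metis length_Suc_conv)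
  have "coef (dd (Inl j) a) (map Inl ks) = 0"
  proof (rule Suc.IH[OF _ js(2)])
    fix v :: "complex ^ 'n"
    have "((\<lambda>s. coef ((dv (v + s *s axis j 1) ^^ Suc m) a) []) has_field_derivative of_nat (Suc m) * coef ((dv v ^^ m) (dv (axis j 1) a)) []) (at 0)"
      by (rule dv_funpow_derivative)
    then have "((\<lambda>s. 0) has_field_derivative of_nat (Suc m) * coef ((dv v ^^ m) (dv (axis j 1) a)) []) (at (0::complex))"
      by (simp only: Suc.prems(1))
    then have "of_nat (Suc m) * coef ((dv v ^^ m) (dv (axis j 1) a)) [] = 0"
      by (rule DERIV_unique) simp
    moreover have "dv (axis j 1) a = dd (Inl j) a"
      by (rule hser_eqI) (simp add: coef_dv coef_dd axis_def if_distrib[of "\<lambda>x. x * _"] cong: if_cong)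
    ultimately show "coef ((dv v ^^ m) (dd (Inl j) a)) [] = 0" by (simp del: of_nat_Suc)
  qed
  then show ?case by (simp add: coef_dd js(1))
qed

text \<open>The sum over index sequences is the form in which \<open>jet\<close> writes the Taylor
  polynomial.\<close>

lemma coef_dv_funpow:
  fixes v :: "complex ^ ('n :: finite)"
  shows
  "coef ((dv v ^^ m) a) w = (\<Sum>js\<in>{js. length js = m}. (\<Prod>j\<leftarrow>js. v $ j) * coef a (map Inl js @ w))"
proof (induction m arbitrary: a)
  case 0
  show ?case by simp
next
  case (Suc m)
  have fin: "finite {js :: 'n list. length js = m}" using finite_lists_length_eq[of "UNIV :: 'n set" m] by simp
  have "coef ((dv v ^^ Suc m) a) w = coef ((dv v ^^ m) (dv v a)) w" by (simp only: funpow_Suc_right o_apply)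
  also have "\<dots> = (\<Sum>js\<in>{js. length js = m}. \<Sum>j\<in>UNIV. (\<Prod>j\<leftarrow>j # js. v $ j) * coef a (map Inl (j # js) @ w))"
    unfolding Suc by (intro sum.cong refl) (simp add: coef_dv sum_distrib_left mult_ac)
  also have "\<dots> = (\<Sum>(js, j)\<in>{js. length js = m} \<times> UNIV. (\<Prod>j\<leftarrow>j # js. v $ j) * coef a (map Inl (j # js) @ w))"
    using fin by (simp add: sum.cartesian_product)
  also have "\<dots> = (\<Sum>js\<in>{js. length js = Suc m}. (\<Prod>j\<leftarrow>js. v $ j) * coef a (map Inl js @ w))"
  proof (rule sum.reindex_bij_witness[of _ "\<lambda>js. (tl js, hd js)" "\<lambda>(js, j). j # js"])
    fix js :: "'n list" assume "js \<in> {js. length js = Suc m}"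
    then obtain j ks where "js = j # ks" "length ks = m" by (auto simp: length_Suc_conv)
    then show "(case (tl js, hd js) of (js, j) \<Rightarrow> j # js) = js" "(tl js, hd js) \<in> {js. length js = m} \<times> UNIV" by auto
  qed auto
  finally show ?case .
qed

lemma coef_Inr_eq_0:
  assumes "\<And>k. dd (Inr k) a = 0" "Inr k \<in> set w"
  shows "coef a w = 0"
proof -
  have "mset w = mset (Inr k # remove1 (Inr k) w)" using assms(2) by simp
  then have "coef a w = coef a (Inr k # remove1 (Inr k) w)" by (rule coef_permute)
  also have "\<dots> = coef (dd (Inr k) a) (remove1 (Inr k) w)" by (simp only: coef_dd)
  finally show ?thesis by (simp add: assms(1))
qed

lemma van_polarization:
  fixes a :: "('n::finite + 'n) hser"
  assumes "\<And>k. dd (Inr k) a = 0" "\<And>m v. m < K \<Longrightarrow> coef ((dv v ^^ m) a) [] = 0"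
  shows "van K a"
  unfolding van_def
proof (intro allI impI)
  fix w :: "('n + 'n) list" assume w: "length w < K"
  show "coef a w = 0"
  proof (cases "\<exists>k. Inr k \<in> set w")
    case True
    then show ?thesis using coef_Inr_eq_0[OF assms(1)] by blast
  next
    case False
    then have "\<forall>x\<in>set w. \<exists>j. x = Inl j" by (metis sum.exhaust)
    then have "\<exists>js. w = map Inl js" by (induction w) (auto, metis list.simps(9))
    then obtain js where js: "w = map Inl js" by blast
    show ?thesis unfolding js by (rule polarization[OF assms(2)]) (use w js in auto)
  qed
qed

section \<open>Jets of compositions\<close>

lemma sw_sw [simp]: "sw (sw x) = x"
  by (cases x) simp_all

context
  fixes U :: "(complex ^ 'n) set" and p
  assumes U: "open U" "p \<in> U"
begin

definition vn :: "nat \<Rightarrow> (complex ^ 'n \<Rightarrow> complex) \<Rightarrow> bool" where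
  "vn K f \<longleftrightarrow> smooth_on U f \<and> van K (jt p f)"

lemma vn_smooth: "vn K f \<Longrightarrow> smooth_on U f"
  by (simp add: vn_def)

lemma vn_0: "smooth_on U f \<Longrightarrow> vn 0 f"
  by (simp add: vn_def)

lemma vn_mono: "vn K f \<Longrightarrow> L \<le> K \<Longrightarrow> vn L f"
  by (auto simp: vn_def intro: van_mono)

lemma vn_cong: "vn K f \<Longrightarrow> (\<And>z. z \<in> U \<Longrightarrow> g z = f z) \<Longrightarrow> vn K g"
  unfolding vn_def using jt_cong[OF U, of f g] smooth_on_cong[OF U(1), of f g] by metis

lemma vn_add: "vn K f \<Longrightarrow> vn K g \<Longrightarrow> vn K (\<lambda>z. f z + g z)"
  by (simp add: vn_def smooth_on_add[OF U(1)] jt_add[OF U] van_add)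

lemma vn_sum: "(\<And>i. i \<in> I \<Longrightarrow> vn K (f i)) \<Longrightarrow> vn K (\<lambda>z. \<Sum>i\<in>I. f i z)"
  by (simp add: vn_def smooth_on_sum[OF U(1)] jt_sum[OF U] van_sum)

lemma vn_mult: "vn K f \<Longrightarrow> vn L g \<Longrightarrow> vn (K + L) (\<lambda>z. f z * g z)"
  by (simp add: vn_def smooth_on_mult[OF U(1)] jt_mult[OF U] van_mult)

lemma vn_mult_left: "smooth_on U g \<Longrightarrow> vn K f \<Longrightarrow> vn K (\<lambda>z. g z * f z)"
  using vn_mult[OF vn_0, of g K f] by simp

lemma vn_mult_right: "vn K f \<Longrightarrow> smooth_on U g \<Longrightarrow> vn K (\<lambda>z. f z * g z)"
  using vn_mult[OF _ vn_0, of K f g] by simp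

lemma vn_pd: "vn (Suc K) f \<Longrightarrow> vn K (pd x f)"
  by (simp add: vn_def smooth_on_pd jt_pd[OF U] van_Suc)

lemma vn_Suc: "smooth_on U f \<Longrightarrow> f p = 0 \<Longrightarrow> (\<And>x. vn K (pd x f)) \<Longrightarrow> vn (Suc K) f"
  by (simp add: vn_def van_Suc jt_pd[OF U] coef_jt[OF U])

lemma vn_at: "vn (Suc K) f \<Longrightarrow> f p = 0"
  using coef_jt[OF U, of f "[]"] by (simp add: vn_def van_Suc)

lemma vn_cnj: "vn K f \<Longrightarrow> vn K (\<lambda>z. cnj (f z))"
proof (induction K arbitrary: f)
  case 0
  then show ?case by (simp add: vn_def smooth_on_cnj[OF U(1)])
next
  case (Suc K)
  have f: "smooth_on U f" using Suc.prems by (rule vn_smooth)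
  show ?case
  proof (rule vn_Suc)
    show "smooth_on U (\<lambda>z. cnj (f z))" by (rule smooth_on_cnj[OF U(1) f])
    show "cnj (f p) = 0" using vn_at[OF Suc.prems] by simp
    fix x
    show "vn K (pd x (\<lambda>z. cnj (f z)))"
      by (rule vn_cong[OF Suc.IH[OF vn_pd[OF Suc.prems, of "sw x"]]]) (rule pd_cnj[OF smooth_on_differentiable[OF f]])
  qed
qed

lemma pd_diff: "smooth_on U f \<Longrightarrow> smooth_on U g \<Longrightarrow> z \<in> U \<Longrightarrow> pd x (\<lambda>z. f z - g z) z = pd x f z - pd x g z"
  using pd_add[of f z "\<lambda>z. - g z" x] pd_mult[of "\<lambda>z. - 1" z g x] smooth_on_differentiable[of U f z] smooth_on_differentiable[of U g z]
  by (simp add: pd_const)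

lemma pd_sum: "(\<And>i. i \<in> I \<Longrightarrow> smooth_on U (f i)) \<Longrightarrow> z \<in> U \<Longrightarrow> pd x (\<lambda>z. \<Sum>i\<in>I. f i z) z = (\<Sum>i\<in>I. pd x (f i) z)"
  using pds_sum[OF U(1), of I f z "[x]"] by simp

text \<open>By the chain rule a derivative splits into differences of \<open>pd y s\<close> along
  the two maps, which fall under the induction, and derivatives of H1 - H2, which lose one
  order.\<close>

lemma vn_comp_diff:
  fixes H1 H2 :: "complex ^ 'n \<Rightarrow> complex ^ 'm"
  assumes H: "\<And>j. smooth_on U (\<lambda>z. H1 z $ j)" "\<And>j. smooth_on U (\<lambda>z. H2 z $ j)"
    and HV: "\<And>z. z \<in> U \<Longrightarrow> H1 z \<in> V" "\<And>z. z \<in> U \<Longrightarrow> H2 z \<in> V"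
    and eq: "H1 p = H2 p" and d: "\<And>j. vn K (\<lambda>z. H1 z $ j - H2 z $ j)" and s: "smooth_on V s"
  shows "vn K (\<lambda>z. s (H1 z) - s (H2 z))"
  using d s
proof (induction K arbitrary: s)
  case 0
  then show ?case
    by (intro vn_0 smooth_on_diff[OF U(1)] smooth_on_comp[OF U(1) H(1) HV(1)] smooth_on_comp[OF U(1) H(2) HV(2)])
next
  case (Suc K)
  have sc: "smooth_on U (\<lambda>z. s (H1 z))" "smooth_on U (\<lambda>z. s (H2 z))" if "smooth_on V s" for s
    using smooth_on_comp[OF U(1) H(1) HV(1) that] smooth_on_comp[OF U(1) H(2) HV(2) that] by blast+
  note cj = smooth_on_cnj[OF U(1)]
  show ?case
  proof (rule vn_Suc)
    show "smooth_on U (\<lambda>z. s (H1 z) - s (H2 z))" by (intro smooth_on_diff[OF U(1)] sc Suc.prems(2))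
    show "s (H1 p) - s (H2 p) = 0" by (simp add: eq)
    fix x
    have IH: "vn K (\<lambda>z. pd y s (H1 z) - pd y s (H2 z))" for y
      by (rule Suc.IH) (use vn_mono[OF Suc.prems(1)] smooth_on_pd[OF Suc.prems(2)] in auto)
    have "vn K (\<lambda>z. \<Sum>j\<in>UNIV. ((pd (Inl j) s (H1 z) - pd (Inl j) s (H2 z)) * pd x (\<lambda>z. H1 z $ j) z + pd (Inl j) s (H2 z) * pd x (\<lambda>z. H1 z $ j - H2 z $ j) z)
      + ((pd (Inr j) s (H1 z) - pd (Inr j) s (H2 z)) * pd x (\<lambda>z. cnj (H1 z $ j)) z + pd (Inr j) s (H2 z) * pd x (\<lambda>z. cnj (H1 z $ j - H2 z $ j)) z))"
      by (intro vn_sum vn_add vn_mult_right[OF IH] vn_mult_left vn_pd vn_cnj smooth_on_pd cj H sc Suc.prems)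
    then show "vn K (pd x (\<lambda>z. s (H1 z) - s (H2 z)))"
    proof (rule vn_cong)
      fix z assume z: "z \<in> U"
      have c1: "pd x (\<lambda>z. s (H1 z)) z = (\<Sum>j\<in>UNIV. pd (Inl j) s (H1 z) * pd x (\<lambda>z. H1 z $ j) z + pd (Inr j) s (H1 z) * pd x (\<lambda>z. cnj (H1 z $ j)) z)"
        by (rule pd_comp(1)[OF smooth_on_differentiable[OF Suc.prems(2) HV(1)[OF z]] smooth_on_differentiable[OF H(1) z]])
      have c2: "pd x (\<lambda>z. s (H2 z)) z = (\<Sum>j\<in>UNIV. pd (Inl j) s (H2 z) * pd x (\<lambda>z. H2 z $ j) z + pd (Inr j) s (H2 z) * pd x (\<lambda>z. cnj (H2 z $ j)) z)"
        by (rule pd_comp(1)[OF smooth_on_differentiable[OF Suc.prems(2) HV(2)[OF z]] smooth_on_differentiable[OF H(2) z]])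
      have e1: "pd x (\<lambda>z. H1 z $ j - H2 z $ j) z = pd x (\<lambda>z. H1 z $ j) z - pd x (\<lambda>z. H2 z $ j) z" for j
        by (rule pd_diff[OF H z])
      have e2: "pd x (\<lambda>z. cnj (H1 z $ j - H2 z $ j)) z = pd x (\<lambda>z. cnj (H1 z $ j)) z - pd x (\<lambda>z. cnj (H2 z $ j)) z" for j
        unfolding complex_cnj_diff by (rule pd_diff[OF cj[OF H(1)] cj[OF H(2)] z])
      show "pd x (\<lambda>z. s (H1 z) - s (H2 z)) z = (\<Sum>j\<in>UNIV. ((pd (Inl j) s (H1 z) - pd (Inl j) s (H2 z)) * pd x (\<lambda>z. H1 z $ j) z + pd (Inl j) s (H2 z) * pd x (\<lambda>z. H1 z $ j - H2 z $ j) z)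
        + ((pd (Inr j) s (H1 z) - pd (Inr j) s (H2 z)) * pd x (\<lambda>z. cnj (H1 z $ j)) z + pd (Inr j) s (H2 z) * pd x (\<lambda>z. cnj (H1 z $ j - H2 z $ j)) z))"
        unfolding pd_diff[OF sc(1)[OF Suc.prems(2)] sc(2)[OF Suc.prems(2)] z] c1 c2 e1 e2 sum_subtractf[symmetric]
        by (intro sum.cong refl) (simp add: algebra_simps)
    qed
  qed
qed

text \<open>A derivative of the remainder of s is the remainder of \<open>pd x s\<close> plus
  products of a difference of \<open>pd y s\<close> between H z and z, of order N, with a first
  derivative of H - id, of order N - 1. These products have order 2 N - 1, which is what the
  induction up to 2 N allows.\<close>

lemma vn_taylor2:
  fixes H :: "complex ^ 'n \<Rightarrow> complex ^ 'n"
  assumes H: "\<And>j. smooth_on U (\<lambda>z. H z $ j)" and HV: "\<And>z. z \<in> U \<Longrightarrow> H z \<in> V" and UV: "U \<subseteq> V" and V: "open V"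
    and eq: "H p = p" and d: "\<And>j. vn N (\<lambda>z. H z $ j - z $ j)" and K: "K \<le> 2 * N" and s: "smooth_on V s"
  shows "vn K (\<lambda>z. s (H z) - s z - (\<Sum>j\<in>UNIV. pd (Inl j) s z * (H z $ j - z $ j) + pd (Inr j) s z * cnj (H z $ j - z $ j)))"
  using K s
proof (induction K arbitrary: s)
  case 0
  note sV = smooth_on_subset[OF _ UV]
  show ?case
    by (intro vn_0 smooth_on_diff[OF U(1)] smooth_on_sum[OF U(1)] smooth_on_add[OF U(1)] smooth_on_mult[OF U(1)] smooth_on_cnj[OF U(1)]
        smooth_on_comp[OF U(1) H HV] sV 0 smooth_on_pd H smooth_on_coord[OF U(1)])
next
  case (Suc K)
  note sV = smooth_on_subset[OF _ UV]
  have sc: "smooth_on U (\<lambda>z. s (H z))" if "smooth_on V s" for s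
    by (rule smooth_on_comp[OF U(1) H HV that])
  define X where "X j z = H z $ j - z $ j" for j z
  have X: "smooth_on U (X j)" "vn N (X j)" for j
    using d vn_smooth unfolding X_def[abs_def] by blast+
  note cj = smooth_on_cnj[OF U(1)]
  have N: "N \<ge> 1" using Suc.prems(1) by simp
  have Xp: "X j p = 0" for j by (simp add: X_def eq)
  define R where "R s z = s (H z) - s z - (\<Sum>j\<in>UNIV. pd (Inl j) s z * X j z + pd (Inr j) s z * cnj (X j z))" for s z
  have sR: "smooth_on U (R s)" if "smooth_on V s" for s
    unfolding R_def[abs_def]
    by (intro smooth_on_diff[OF U(1)] smooth_on_sum[OF U(1)] smooth_on_add[OF U(1)] smooth_on_mult[OF U(1)] cj sc that X
        sV[OF that] sV[OF smooth_on_pd[OF that]])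
  have "vn (Suc K) (R s)"
  proof (rule vn_Suc[OF sR[OF Suc.prems(2)]])
    show "R s p = 0" by (simp add: R_def eq Xp)
    fix x
    have IH: "vn K (R (pd x s))"
      using Suc.IH[OF _ smooth_on_pd[OF Suc.prems(2)]] Suc.prems(1) by (simp add: R_def[abs_def] X_def)
    have dN: "vn N (\<lambda>z. pd y s (H z) - pd y s z)" for y
      by (rule vn_comp_diff[where ?H2.0 = "\<lambda>z. z", OF H smooth_on_coord[OF U(1)] HV _ _ _ smooth_on_pd[OF Suc.prems(2)]])
        (use UV eq d in auto)
    have dX: "vn (N - 1) (pd x (X j))" "vn (N - 1) (pd x (\<lambda>z. cnj (X j z)))" for j
      using vn_pd[of "N - 1" "X j"] vn_pd[OF vn_cnj, of "N - 1" "X j"] X(2) N by simp_all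
    have KN: "K \<le> N + (N - 1)" using Suc.prems(1) by simp
    have "vn K (\<lambda>z. R (pd x s) z + (\<Sum>j\<in>UNIV. (pd (Inl j) s (H z) - pd (Inl j) s z) * pd x (X j) z + (pd (Inr j) s (H z) - pd (Inr j) s z) * pd x (\<lambda>z. cnj (X j z)) z))"
      by (intro vn_add IH vn_sum vn_mono[OF vn_mult[OF dN dX(1)] KN] vn_mono[OF vn_mult[OF dN dX(2)] KN])
    then show "vn K (pd x (R s))"
    proof (rule vn_cong)
      fix z assume z: "z \<in> U"
      have zV: "z \<in> V" using z UV by blast
      have Hj: "pd x (\<lambda>z. H z $ j) z = (if x = Inl j then 1 else 0) + pd x (X j) z" for j
      proof -
        have "pd x (\<lambda>z. z $ j + X j z) z = (if x = Inl j then 1 else 0) + pd x (X j) z"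
          using pd_add[OF smooth_on_differentiable[OF smooth_on_coord[OF U(1)] z] smooth_on_differentiable[OF X(1) z], of x j j] by (simp add: pd_coord)
        then show ?thesis by (simp add: X_def[abs_def])
      qed
      have Hcj: "pd x (\<lambda>z. cnj (H z $ j)) z = (if x = Inr j then 1 else 0) + pd x (\<lambda>z. cnj (X j z)) z" for j
      proof -
        have "pd x (\<lambda>z. cnj (z $ j) + cnj (X j z)) z = pd x (\<lambda>z. cnj (z $ j)) z + pd x (\<lambda>z. cnj (X j z)) z"
          by (rule pd_add[OF smooth_on_differentiable[OF cj[OF smooth_on_coord[OF U(1)]] z] smooth_on_differentiable[OF cj[OF X(1)] z]])
        moreover have "pd x (\<lambda>z. cnj (z $ j)) z = (if x = Inr j then 1 else 0)"
          using pd_cnj[OF smooth_on_differentiable[OF smooth_on_coord[OF U(1)] z], of x j] by (cases x) (auto simp: pd_coord)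
        ultimately show ?thesis by (simp add: X_def[abs_def])
      qed
      have c1: "pd x (\<lambda>z. s (H z)) z = (\<Sum>j\<in>UNIV. pd (Inl j) s (H z) * pd x (\<lambda>z. H z $ j) z + pd (Inr j) s (H z) * pd x (\<lambda>z. cnj (H z $ j)) z)"
        by (rule pd_comp(1)[OF smooth_on_differentiable[OF Suc.prems(2) HV[OF z]] smooth_on_differentiable[OF H z]])
      have del: "(\<Sum>j\<in>UNIV. pd (Inl j) s (H z) * (if x = Inl j then 1 else 0) + pd (Inr j) s (H z) * (if x = Inr j then 1 else 0)) = pd x s (H z)"
        by (cases x) (auto simp: if_distrib[of "\<lambda>x. _ * x"] cong: if_cong)
      have c1': "pd x (\<lambda>z. s (H z)) z = pd x s (H z) + (\<Sum>j\<in>UNIV. pd (Inl j) s (H z) * pd x (X j) z + pd (Inr j) s (H z) * pd x (\<lambda>z. cnj (X j z)) z)"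
        unfolding c1 Hj Hcj del[symmetric] sum.distrib[symmetric] by (intro sum.cong refl) (simp add: algebra_simps)
      have sp: "smooth_on U (pd y s)" for y by (rule sV[OF smooth_on_pd[OF Suc.prems(2)]])
      have cm: "pd x (pd y s) z = pd y (pd x s) z" for y by (rule pd_commute[OF V zV Suc.prems(2)])
      have m: "pd x (\<lambda>z. pd (Inl j) s z * X j z + pd (Inr j) s z * cnj (X j z)) z
         = (pd (Inl j) (pd x s) z * X j z + pd (Inr j) (pd x s) z * cnj (X j z)) + (pd (Inl j) s z * pd x (X j) z + pd (Inr j) s z * pd x (\<lambda>z. cnj (X j z)) z)" for j
      proof -
        note df = smooth_on_differentiable[OF _ z]
        have "pd x (\<lambda>z. pd (Inl j) s z * X j z + pd (Inr j) s z * cnj (X j z)) z = pd x (\<lambda>z. pd (Inl j) s z * X j z) z + pd x (\<lambda>z. pd (Inr j) s z * cnj (X j z)) z"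
          by (intro pd_add df smooth_on_mult[OF U(1)] sp X cj)
        also have "pd x (\<lambda>z. pd (Inl j) s z * X j z) z = pd x (pd (Inl j) s) z * X j z + pd (Inl j) s z * pd x (X j) z"
          by (intro pd_mult df sp X)
        also have "pd x (\<lambda>z. pd (Inr j) s z * cnj (X j z)) z = pd x (pd (Inr j) s) z * cnj (X j z) + pd (Inr j) s z * pd x (\<lambda>z. cnj (X j z)) z"
          by (intro pd_mult df sp X cj)
        finally show ?thesis unfolding cm by (simp add: algebra_simps)
      qed
      have sm: "smooth_on U (\<lambda>z. pd (Inl j) s z * X j z + pd (Inr j) s z * cnj (X j z))" for j
        by (intro smooth_on_add[OF U(1)] smooth_on_mult[OF U(1)] sp X cj)
      have "pd x (R s) z = pd x (\<lambda>z. s (H z)) z - pd x s z - (\<Sum>j\<in>UNIV. pd x (\<lambda>z. pd (Inl j) s z * X j z + pd (Inr j) s z * cnj (X j z)) z)"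
        unfolding R_def[abs_def] pd_diff[OF smooth_on_diff[OF U(1) sc[OF Suc.prems(2)] sV[OF Suc.prems(2)]] smooth_on_sum[OF U(1) sm] z]
          pd_diff[OF sc[OF Suc.prems(2)] sV[OF Suc.prems(2)] z] pd_sum[OF sm z] ..
      then show "pd x (R s) z = R (pd x s) z + (\<Sum>j\<in>UNIV. (pd (Inl j) s (H z) - pd (Inl j) s z) * pd x (X j) z + (pd (Inr j) s (H z) - pd (Inr j) s z) * pd x (\<lambda>z. cnj (X j z)) z)"
        unfolding c1' m R_def by (simp add: sum.distrib sum_subtractf algebra_simps)
    qed
  qed
  then show ?case by (simp add: R_def[abs_def] X_def)
qed

text \<open>On each complex line p + t v the jets are polynomials in t, and up to factorials their
  coefficients are values of powers of \<open>dv v\<close>. Comparing these and polarizing recovers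
  all partial derivatives.\<close>

lemma jet_eq_imp_vn:
  fixes F G :: "complex ^ 'n \<Rightarrow> complex ^ 'm"
  assumes F: "\<And>i. holo U (\<lambda>z. F z $ i)" and G: "\<And>i. holo U (\<lambda>z. G z $ i)" and j: "jet k p F = jet k p G"
  shows "vn (Suc k) (\<lambda>z. F z $ i - G z $ i)"
proof -
  note sF = holo_smooth[OF F] and sG = holo_smooth[OF G]
  define a where "a = jt p (\<lambda>z. F z $ i - G z $ i)"
  have aFG: "a = jt p (\<lambda>z. F z $ i) - jt p (\<lambda>z. G z $ i)" unfolding a_def by (rule jt_diff[OF U sF sG])
  have foldw: "foldr wirtinger js f = pds (map Inl (rev js)) f" for js and f :: "complex ^ 'n \<Rightarrow> complex"
    by (induction js) (simp_all add: pd_def)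
  have cf: "foldr wirtinger js f p = coef (jt p f) (map Inl js)" if "smooth_on U f" for js and f :: "complex ^ 'n \<Rightarrow> complex"
  proof -
    have "foldr wirtinger js f p = coef (jt p f) (map Inl (rev js))" unfolding foldw by (rule coef_jt[OF U that, symmetric])
    also have "\<dots> = coef (jt p f) (map Inl js)" by (rule coef_permute) (simp flip: rev_map)
    finally show ?thesis .
  qed
  have jc: "jet k p f z $ i = (\<Sum>m\<le>k. coef ((dv (z - p) ^^ m) (jt p (\<lambda>z. f z $ i))) [] / fact m)" if "smooth_on U (\<lambda>z. f z $ i)" for f :: "complex ^ 'n \<Rightarrow> complex ^ 'm" and z
    unfolding jet_def by (simp add: cf[OF that] coef_dv_funpow mult.commute del: vector_minus_component)
  have dvd: "(dv v ^^ m) (b - c) = (dv v ^^ m) b - (dv v ^^ m) c" for v m and b c :: "('n + 'n) hser"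
  proof (induction m)
    case (Suc m)
    have "dv v (x - y) = dv v x - dv v y" for x y :: "('n + 'n) hser"
      by (rule hser_eqI) (simp add: coef_dv coef_diff sum_subtractf right_diff_distrib)
    then show ?case using Suc by simp
  qed simp
  have scal: "coef ((dv (t *s v) ^^ m) a) w = t ^ m * coef ((dv v ^^ m) a) w" for t v m w
  proof (induction m arbitrary: w)
    case (Suc m)
    have "coef ((dv (t *s v) ^^ Suc m) a) w = (\<Sum>j\<in>UNIV. (t * v $ j) * (t ^ m * coef ((dv v ^^ m) a) (Inl j # w)))"
      by (simp add: coef_dv Suc)
    also have "\<dots> = t ^ Suc m * coef ((dv v ^^ Suc m) a) w" by (simp add: coef_dv sum_distrib_left mult_ac)
    finally show ?case .
  qed simp
  have "(\<Sum>m\<le>k. (coef ((dv v ^^ m) a) [] / fact m) * t ^ m) = 0" for v t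
  proof -
    have "jet k p F (p + t *s v) $ i = jet k p G (p + t *s v) $ i" using j by simp
    then have "(\<Sum>m\<le>k. coef ((dv (t *s v) ^^ m) a) [] / fact m) = 0"
      unfolding jc[OF sF] jc[OF sG] aFG dvd coef_diff by (simp add: diff_divide_distrib sum_subtractf)
    then show ?thesis unfolding scal by (simp add: mult.commute)
  qed
  then have z: "coef ((dv v ^^ m) a) [] = 0" if "m < Suc k" for v m
    using polyfun_eq_0[of "\<lambda>m. coef ((dv v ^^ m) a) [] / fact m" k] that by simp
  have "van (Suc k) a"
  proof (rule van_polarization[OF _ z])
    fix l
    have "jt p (pd (Inr l) f) = 0" if f: "holo U f" for f
    proof -
      have "jt p (pd (Inr l) f) = jt p (\<lambda>z. 0)"
        by (rule jt_cong[OF U smooth_on_pd[OF holo_smooth[OF f]]]) (rule holo_pd_Inr[OF f])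
      also have "\<dots> = 0" unfolding jt_const[OF U] by (rule hser_eqI) (simp add: coef_cst)
      finally show ?thesis .
    qed
    then show "dd (Inr l) a = 0"
      unfolding aFG derivation_diff[OF derivation_dd] using jt_pd[OF U sF] jt_pd[OF U sG] F G by (metis diff_self)
  qed
  then show ?thesis unfolding vn_def a_def using smooth_on_diff[OF U(1) sF sG] by simp
qed

end

section \<open>Functions vanishing on a hypersurface\<close>

lemma sum_UNIV_Plus:
  fixes f :: "'a::finite + 'b::finite \<Rightarrow> 'c::comm_monoid_add"
  shows "(\<Sum>x\<in>UNIV. f x) = (\<Sum>j\<in>UNIV. f (Inl j)) + (\<Sum>j\<in>UNIV. f (Inr j))"
  unfolding UNIV_Plus_UNIV[symmetric] by (subst sum.Plus) simp_all

definition xv :: "complex ^ 'n \<Rightarrow> 'n + 'n \<Rightarrow> complex" where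
  "xv v x = (case x of Inl j \<Rightarrow> v $ j | Inr j \<Rightarrow> cnj (v $ j))"

lemma xv_simps [simp]: "xv v (Inl j) = v $ j" "xv v (Inr j) = cnj (v $ j)"
  by (simp_all add: xv_def)

lemma norm_xv: "norm (xv v x) \<le> norm v"
  by (cases x) (simp_all add: Finite_Cartesian_Product.norm_nth_le)

lemma dir_xv: "dir v f z = (\<Sum>x\<in>UNIV. xv v x * pd x f z)"
  by (simp add: dir_def sum_UNIV_Plus sum.distrib)

lemma dir_add: "dir (u + v) f z = dir u f z + dir v f z"
  by (simp add: dir_def sum.distrib[symmetric] algebra_simps)

lemma dir_scaleR: "dir (c *\<^sub>R v) f z = of_real c * dir v f z"
  unfolding dir_def vector_scaleR_component sum_distrib_left
  by (intro sum.cong refl) (simp add: scaleR_conv_of_real algebra_simps)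

lemma pd_from_derivative_multiple:
  assumes "(f has_derivative F) (at q)" "(g has_derivative G) (at q)" "\<And>v. F v = c * G v"
  shows "pd x f q = c * pd x g q"
  unfolding pd_eq[OF assms(1)] pd_eq[OF assms(2)] assms(3) by (simp add: algebra_simps)

text \<open>Instead of a curve in the level set, the intermediate value theorem provides a zero of
  \<rho> at q + t V + s e with s at most \<eta> t in absolute value. There f vanishes, so F V is
  bounded by a constant times \<eta>, for every positive \<eta>.\<close>

lemma derivative_zero_on_tangent:
  fixes \<rho> :: "complex ^ 'n \<Rightarrow> real" and f :: "complex ^ 'n \<Rightarrow> complex"
  assumes W: "open W" "q \<in> W" and c: "continuous_on W \<rho>"
    and R: "(\<rho> has_derivative R) (at q)" and F: "(f has_derivative F) (at q)"
    and q: "\<rho> q = 0" and z: "\<And>z. z \<in> W \<Longrightarrow> \<rho> z = 0 \<Longrightarrow> f z = 0"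
    and e: "R e > 0" and V: "R V = 0"
  shows "F V = 0"
proof -
  have linR: "linear R" and linF: "linear F" using R F has_derivative_linear by blast+
  have fq: "f q = 0" using z W q by blast
  have key: "norm (F V) \<le> \<eta> * (R e + norm (F e))" if \<eta>: "\<eta> > 0" for \<eta>
  proof -
    \<comment> \<open>t L bounds the displacement t V + s e, and \<epsilon> makes the linearisation
      error smaller than the change \<eta> t R e of \<rho>, which produces the sign change.\<close>
    define L where "L = norm V + \<eta> * norm e + 1"
    have L: "L > 0" using \<eta> by (simp add: L_def add_nonneg_pos)
    define \<epsilon> where "\<epsilon> = \<eta> * R e / (2 * L)"
    have \<epsilon>: "\<epsilon> > 0" "\<epsilon> * L < \<eta> * R e" using \<eta> e L by (simp_all add: \<epsilon>_def)
    obtain d1 where d1: "d1 > 0" "\<And>y. norm (y - q) < d1 \<Longrightarrow> norm (\<rho> y - \<rho> q - R (y - q)) \<le> \<epsilon> * norm (y - q)"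
      using R[unfolded has_derivative_at_alt] \<epsilon>(1) by blast
    obtain d2 where d2: "d2 > 0" "\<And>y. norm (y - q) < d2 \<Longrightarrow> norm (f y - f q - F (y - q)) \<le> \<epsilon> * norm (y - q)"
      using F[unfolded has_derivative_at_alt] \<epsilon>(1) by blast
    obtain d3 where d3: "d3 > 0" "ball q d3 \<subseteq> W" using W open_contains_ball by blast
    define t where "t = min d1 (min d2 d3) / (2 * L)"
    have t: "t > 0" using d1 d2 d3 L by (simp add: t_def)
    have tL: "t * L < d1" "t * L < d2" "t * L < d3"
    proof -
      have "t * L = min d1 (min d2 d3) / 2" using L by (simp add: t_def)
      moreover have "min d1 (min d2 d3) > 0" "min d1 (min d2 d3) \<le> d1" "min d1 (min d2 d3) \<le> d2" "min d1 (min d2 d3) \<le> d3"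
        using d1(1) d2(1) d3(1) by auto
      ultimately show "t * L < d1" "t * L < d2" "t * L < d3" by linarith+
    qed
    define y where "y s = t *\<^sub>R V + s *\<^sub>R e" for s
    have ny: "norm (y s) \<le> t * L" if "\<bar>s\<bar> \<le> \<eta> * t" for s
    proof -
      have "norm (y s) \<le> t * norm V + \<bar>s\<bar> * norm e" unfolding y_def using norm_triangle_ineq[of "t *\<^sub>R V" "s *\<^sub>R e"] t by simp
      also have "\<dots> \<le> t * norm V + (\<eta> * t) * norm e" using that by (intro add_left_mono mult_right_mono) auto
      also have "\<dots> \<le> t * L" using t by (simp add: L_def algebra_simps)
      finally show ?thesis .
    qed
    have Ry: "R (y s) = s * R e" for s
      using linR V by (simp add: y_def linear_add linear_scale)
    have rb: "\<bar>\<rho> (q + y s) - s * R e\<bar> \<le> \<epsilon> * (t * L)" if "\<bar>s\<bar> \<le> \<eta> * t" for s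
    proof -
      have "\<bar>\<rho> (q + y s) - s * R e\<bar> \<le> \<epsilon> * norm (y s)"
        using d1(2)[of "q + y s"] ny[OF that] tL(1) q Ry[of s] by simp
      also have "\<dots> \<le> \<epsilon> * (t * L)" using ny[OF that] \<epsilon>(1) by (intro mult_left_mono) auto
      finally show ?thesis .
    qed
    have small: "\<epsilon> * (t * L) < \<eta> * t * R e" using \<epsilon>(2) t by (simp add: mult.commute mult.left_commute)
    have "\<exists>s\<ge>- (\<eta> * t). s \<le> \<eta> * t \<and> \<rho> (q + y s) = 0"
    proof (rule IVT')
      show "\<rho> (q + y (- (\<eta> * t))) \<le> 0" using rb[of "- (\<eta> * t)"] small \<eta> t by (simp add: abs_le_iff del: mult_le_cancel_right mult_less_cancel_right; linarith)
      show "0 \<le> \<rho> (q + y (\<eta> * t))" using rb[of "\<eta> * t"] small \<eta> t by (simp add: abs_le_iff del: mult_le_cancel_right mult_less_cancel_right; linarith)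
      show "- (\<eta> * t) \<le> \<eta> * t" using \<eta> t by simp
      have "continuous_on {- (\<eta> * t)..\<eta> * t} (\<rho> \<circ> (\<lambda>s. q + y s))"
      proof (rule continuous_on_compose)
        show "continuous_on {- (\<eta> * t)..\<eta> * t} (\<lambda>s. q + y s)" unfolding y_def by (intro continuous_intros)
        have "(\<lambda>s. q + y s) ` {- (\<eta> * t)..\<eta> * t} \<subseteq> W"
        proof
          fix x assume "x \<in> (\<lambda>s. q + y s) ` {- (\<eta> * t)..\<eta> * t}"
          then obtain s where s: "x = q + y s" "\<bar>s\<bar> \<le> \<eta> * t" by (auto simp: abs_le_iff)
          then have "x \<in> ball q d3" using ny[OF s(2)] tL(3) by (simp add: dist_norm)
          then show "x \<in> W" using d3 by blast
        qed
        then show "continuous_on ((\<lambda>s. q + y s) ` {- (\<eta> * t)..\<eta> * t}) \<rho>" by (rule continuous_on_subset[OF c])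
      qed
      then show "continuous_on {- (\<eta> * t)..\<eta> * t} (\<lambda>s. \<rho> (q + y s))" by (simp add: o_def)
    qed
    then obtain s where s: "\<bar>s\<bar> \<le> \<eta> * t" "\<rho> (q + y s) = 0" by (metis abs_le_iff minus_le_iff)
    have "q + y s \<in> W" using ny[OF s(1)] tL(3) d3 by (auto simp: dist_norm)
    then have "f (q + y s) = 0" using z s(2) by blast
    then have "norm (F (y s)) \<le> \<epsilon> * norm (y s)" using d2(2)[of "q + y s"] ny[OF s(1)] tL(2) fq by simp
    also have "\<dots> \<le> \<epsilon> * (t * L)" using ny[OF s(1)] \<epsilon>(1) by (intro mult_left_mono) auto
    finally have 1: "norm (F (y s)) \<le> \<eta> * t * R e" using small by simp
    have "t *\<^sub>R F V = F (y s) - s *\<^sub>R F e" using linF by (simp add: y_def linear_add linear_scale)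
    then have "t * norm (F V) \<le> norm (F (y s)) + \<bar>s\<bar> * norm (F e)"
      using norm_triangle_ineq4[of "F (y s)" "s *\<^sub>R F e"] t by (metis abs_of_pos norm_scaleR)
    also have "\<dots> \<le> \<eta> * t * R e + \<eta> * t * norm (F e)" using 1 s(1) by (intro add_mono mult_right_mono) auto
    finally have "t * norm (F V) \<le> t * (\<eta> * (R e + norm (F e)))" by (simp add: algebra_simps)
    then show ?thesis using t by simp
  qed
  define K where "K = R e + norm (F e)"
  have K: "K > 0" using e by (simp add: K_def add_pos_nonneg)
  show ?thesis
  proof (rule ccontr)
    assume "F V \<noteq> 0"
    then have "norm (F V) / (2 * K) > 0" using K by simp
    from key[OF this] have "norm (F V) \<le> norm (F V) / 2" using K by (simp add: K_def[symmetric])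
    then show False using \<open>F V \<noteq> 0\<close> by simp
  qed
qed

text \<open>A Lagrange multiplier: the differential of f vanishes on the kernel of that of \<rho>,
  hence is a multiple of it.\<close>

lemma pd_proportional:
  fixes \<rho> :: "complex ^ 'n \<Rightarrow> real" and f :: "complex ^ 'n \<Rightarrow> complex"
  assumes W: "open W" "q \<in> W" and r: "smooth_on W (\<lambda>z. of_real (\<rho> z))" and f: "f differentiable (at q)"
    and q: "\<rho> q = 0" and z: "\<And>z. z \<in> W \<Longrightarrow> \<rho> z = 0 \<Longrightarrow> f z = 0"
    and nz: "\<exists>x. pd x (\<lambda>z. of_real (\<rho> z)) q \<noteq> 0"
  shows "\<exists>c. \<forall>x. pd x f q = c * pd x (\<lambda>z. of_real (\<rho> z)) q"
proof -
  obtain G where G: "((\<lambda>z. complex_of_real (\<rho> z)) has_derivative G) (at q)"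
    using smooth_on_differentiable[OF r W(2)] unfolding differentiable_def by blast
  obtain F where F: "(f has_derivative F) (at q)" using f unfolding differentiable_def by blast
  define R where "R v = Re (G v)" for v
  have R: "(\<rho> has_derivative R) (at q)"
    using bounded_linear.has_derivative[OF bounded_linear_Re G] by (simp add: R_def[abs_def])
  have GR: "G v = of_real (R v)" for v
    using has_derivative_unique[OF G bounded_linear.has_derivative[OF bounded_linear_of_real R]] by (simp add: fun_eq_iff)
  have "\<exists>e. R e \<noteq> 0"
  proof (rule ccontr)
    assume "\<nexists>e. R e \<noteq> 0"
    then have "pd x (\<lambda>z. of_real (\<rho> z)) q = 0" for x unfolding pd_eq[OF G] GR by simp
    then show False using nz by blast
  qed
  then obtain e0 where e0: "R e0 \<noteq> 0" by blast
  define e where "e = (if R e0 > 0 then e0 else - e0)"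
  have lin: "linear R" "linear F" using R F has_derivative_linear by blast+
  have e: "R e > 0" using e0 lin(1) by (auto simp: e_def linear_neg)
  have cont: "continuous_on W \<rho>"
    using continuous_on_Re[OF smooth_on_continuous[OF r]] by simp
  have "F v = (F e / of_real (R e)) * G v" for v
  proof -
    have "F (v - (R v / R e) *\<^sub>R e) = 0"
      by (rule derivative_zero_on_tangent[OF W cont R F q z e]) (use e lin(1) in \<open>simp_all add: linear_diff linear_scale\<close>)
    then have "F v = (R v / R e) *\<^sub>R F e" using lin(2) by (simp add: linear_diff linear_scale)
    then show ?thesis by (simp add: GR scaleR_conv_of_real)
  qed
  from pd_from_derivative_multiple[OF F G this] show ?thesis by blast
qed

section \<open>Unique continuation along a real-analytic hypersurface\<close>

text \<open>The projection of v along e to the tangent space of the level sets of r, multiplied by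
  the e-derivative of r to avoid a division. Its coefficients are linear in v and in the first
  derivatives of r.\<close>

definition tang :: "(complex ^ 'n \<Rightarrow> complex) \<Rightarrow> complex ^ 'n \<Rightarrow> complex ^ 'n \<Rightarrow> (complex ^ 'n \<Rightarrow> complex) \<Rightarrow> complex ^ 'n \<Rightarrow> complex" where
  "tang r e v g z = dir e r z * dir v g z - dir v r z * dir e g z"

lemma has_derivative_along_curve:
  assumes "(\<gamma> has_vector_derivative v) (at t within S)" "g differentiable (at (\<gamma> t))"
  shows "((\<lambda>t. g (\<gamma> t)) has_vector_derivative dir v g (\<gamma> t)) (at t within S)"
  using vector_derivative_diff_chain_within[OF assms(1), of g "\<lambda>v. dir v g (\<gamma> t)"]
    has_derivative_at_withinI[OF has_derivative_dir[OF assms(2)]] by (simp add: o_def)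

text \<open>Integrating n times from 0 gains (t / c)^n / n! against the growth C Q^n n! of g n. What
  remains at t = 1 is C (Q / c)^n, which tends to 0.\<close>

lemma iterated_bound:
  fixes g :: "nat \<Rightarrow> real \<Rightarrow> complex"
  assumes d: "\<And>m t. 0 \<le> t \<Longrightarrow> t \<le> 1 \<Longrightarrow> (g m has_vector_derivative g (Suc m) t / \<kappa> t) (at t within {0..1})"
    and \<kappa>: "\<And>t. 0 \<le> t \<Longrightarrow> t \<le> 1 \<Longrightarrow> norm (\<kappa> t) \<ge> c" and c: "c > 0"
    and z: "\<And>m. g m 0 = 0" and b: "\<And>m t. 0 \<le> t \<Longrightarrow> t \<le> 1 \<Longrightarrow> norm (g m t) \<le> C * Q ^ m * fact m"
    and Q: "0 \<le> Q" "Q < c"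
  shows "g 0 1 = 0"
proof -
  have C: "C \<ge> 0" using b[of 0 0] by (auto intro: order_trans[OF norm_ge_zero])
  have key: "norm (g (n - k) t) \<le> C * Q ^ n * fact n * ((t / c) ^ k / fact k)" if "k \<le> n" "0 \<le> t" "t \<le> 1" for n k t
    using that
  proof (induction k arbitrary: t)
    case 0
    then show ?case using b[of t n] by simp
  next
    case (Suc k)
    define m where "m = n - Suc k"
    have m: "Suc m = n - k" using Suc.prems(1) by (simp add: m_def)
    define M where "M = C * Q ^ n * fact n"
    have M: "M \<ge> 0" using C Q by (simp add: M_def)
    show ?case
    proof (cases "t = 0")
      case True
      then show ?thesis using z by simp
    next
      case False
      define \<phi> where "\<phi> s = M * ((s / c) ^ Suc k / fact (Suc k))" for s
      have d\<phi>: "(\<phi> has_vector_derivative M * ((s / c) ^ k / fact k) / c) (at s)" for s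
      proof -
        have "(\<phi> has_real_derivative M * (real (Suc k) * (s / c) ^ k * (1 / c) / fact (Suc k))) (at s)"
          unfolding \<phi>_def using c by (auto intro!: derivative_eq_intros simp del: fact_Suc power_Suc)
        moreover have "M * (real (Suc k) * (s / c) ^ k * (1 / c) / fact (Suc k)) = M * ((s / c) ^ k / fact k) / c"
        proof -
          have "real (Suc k) * (s / c) ^ k * (1 / c) / fact (Suc k) = (real (Suc k) / real (Suc k)) * ((s / c) ^ k / fact k / c)"
            unfolding fact_Suc by (simp del: of_nat_Suc)
          then show ?thesis by (simp del: of_nat_Suc fact_Suc add: mult.assoc)
        qed
        ultimately show ?thesis by (simp only: has_real_derivative_iff_has_vector_derivative)
      qed
      have "norm (g m t - g m 0) \<le> \<phi> t - \<phi> 0"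
      proof (rule differentiable_bound_general)
        show "0 < t" using False Suc.prems by simp
        show "continuous_on {0..t} \<phi>"
          unfolding \<phi>_def using c by (intro continuous_intros) auto
        show "continuous_on {0..t} (g m)"
        proof (rule continuous_on_subset)
          show "continuous_on {0..1} (g m)" by (rule continuous_on_vector_derivative[OF d]) auto
        qed (use Suc.prems in auto)
        fix s assume s: "0 < s" "s < t"
        show "(g m has_vector_derivative g (Suc m) s / \<kappa> s) (at s)"
        proof -
          have "s \<in> interior {0..1::real}" using s Suc.prems by simp
          then have "at s within {0..1} = at s" by (rule at_within_interior)
          then show ?thesis using d[of s m] s Suc.prems by simp
        qed
        show "(\<phi> has_vector_derivative M * ((s / c) ^ k / fact k) / c) (at s)" by (rule d\<phi>)
        have "norm (g (Suc m) s) \<le> M * ((s / c) ^ k / fact k)"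
          unfolding m M_def using Suc.IH[of s] Suc.prems s by simp
        from frac_le[OF order_trans[OF norm_ge_zero this] this c \<kappa>[of s]] s Suc.prems
        have "norm (g (Suc m) s) / norm (\<kappa> s) \<le> (M * ((s / c) ^ k / fact k)) / c" by simp
        then show "norm (g (Suc m) s / \<kappa> s) \<le> M * ((s / c) ^ k / fact k) / c" by (simp add: norm_divide)
      qed
      then show ?thesis by (simp add: z \<phi>_def m_def M_def power_0_left del: fact_Suc power_Suc)
    qed
  qed
  have "norm (g 0 1) \<le> C * (Q / c) ^ n" for n
    using key[of n n 1] by (simp add: power_divide)
  moreover have "(\<lambda>n. C * (Q / c) ^ n) \<longlonglongrightarrow> C * 0"
    using Q c by (intro tendsto_mult tendsto_const LIMSEQ_power_zero) auto
  ultimately have "norm (g 0 1) \<le> 0"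
    using LIMSEQ_le_const[of "\<lambda>n. C * (Q / c) ^ n" "C * 0" "norm (g 0 1)"] by auto
  then show ?thesis by simp
qed

lemma dir_of_real:
  assumes "(\<lambda>z. complex_of_real (\<rho> z)) differentiable (at q)"
  shows "dir v (\<lambda>z. of_real (\<rho> z)) q = of_real (Re (dir v (\<lambda>z. of_real (\<rho> z)) q))"
    and "(\<rho> has_derivative (\<lambda>v. Re (dir v (\<lambda>z. of_real (\<rho> z)) q))) (at q)"
proof -
  note G = has_derivative_dir[OF assms]
  show R: "(\<rho> has_derivative (\<lambda>v. Re (dir v (\<lambda>z. of_real (\<rho> z)) q))) (at q)"
    using bounded_linear.has_derivative[OF bounded_linear_Re G] by simp
  show "dir v (\<lambda>z. of_real (\<rho> z)) q = of_real (Re (dir v (\<lambda>z. of_real (\<rho> z)) q))"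
    using has_derivative_unique[OF G bounded_linear.has_derivative[OF bounded_linear_of_real R]] by (rule fun_cong)
qed

lemma mvt_rho:
  assumes "convex B" "smooth_on B (\<lambda>z. complex_of_real (\<rho> z))" "x \<in> B" "y \<in> B"
  shows "\<exists>\<xi>\<in>closed_segment x y. \<rho> y - \<rho> x = Re (dir (y - x) (\<lambda>z. of_real (\<rho> z)) \<xi>)"
proof -
  have seg: "x + \<tau> *\<^sub>R (y - x) \<in> closed_segment x y" if "0 \<le> \<tau>" "\<tau> \<le> 1" for \<tau>
    using that by (auto simp: closed_segment_def algebra_simps intro!: exI[of _ \<tau>])
  have "((\<lambda>\<tau>. \<rho> (x + \<tau> *\<^sub>R (y - x))) has_real_derivative Re (dir (y - x) (\<lambda>z. of_real (\<rho> z)) (x + \<tau> *\<^sub>R (y - x)))) (at \<tau>)"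
    if "0 \<le> \<tau>" "\<tau> \<le> 1" for \<tau>
  proof -
    have "x + \<tau> *\<^sub>R (y - x) \<in> B" using seg[OF that] closed_segment_subset[OF assms(3,4,1)] by blast
    then have df: "(\<lambda>z. complex_of_real (\<rho> z)) differentiable (at (x + \<tau> *\<^sub>R (y - x)))"
      by (rule smooth_on_differentiable[OF assms(2)])
    have "((\<lambda>\<tau>. x + \<tau> *\<^sub>R (y - x)) has_vector_derivative (y - x)) (at \<tau>)" by (auto intro!: derivative_eq_intros)
    from bounded_linear.has_vector_derivative[OF bounded_linear_Re has_derivative_along_curve[OF this df]]
    show ?thesis by (simp add: has_real_derivative_iff_has_vector_derivative)
  qed
  from MVT2[OF zero_less_one this] obtain \<tau> where \<tau>: "0 < \<tau>" "\<tau> < 1"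
    "\<rho> (x + 1 *\<^sub>R (y - x)) - \<rho> (x + 0 *\<^sub>R (y - x)) = (1 - 0) * Re (dir (y - x) (\<lambda>z. of_real (\<rho> z)) (x + \<tau> *\<^sub>R (y - x)))"
    by auto
  then show ?thesis using seg[of \<tau>] by (intro bexI[of _ "x + \<tau> *\<^sub>R (y - x)"]) auto
qed

lemma increasing_along:
  assumes B: "convex B" and r: "smooth_on B (\<lambda>z. complex_of_real (\<rho> z))"
    and e: "\<And>z. z \<in> B \<Longrightarrow> c \<le> Re (dir e (\<lambda>z. of_real (\<rho> z)) z)"
    and s: "z + s1 *\<^sub>R e \<in> B" "z + s2 *\<^sub>R e \<in> B" "s1 \<le> s2"
  shows "\<rho> (z + s2 *\<^sub>R e) - \<rho> (z + s1 *\<^sub>R e) \<ge> c * (s2 - s1)"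
proof -
  obtain \<xi> where \<xi>: "\<xi> \<in> closed_segment (z + s1 *\<^sub>R e) (z + s2 *\<^sub>R e)"
    "\<rho> (z + s2 *\<^sub>R e) - \<rho> (z + s1 *\<^sub>R e) = Re (dir ((z + s2 *\<^sub>R e) - (z + s1 *\<^sub>R e)) (\<lambda>z. of_real (\<rho> z)) \<xi>)"
    using mvt_rho[OF B r s(1,2)] by blast
  have "\<xi> \<in> B" using \<xi>(1) closed_segment_subset[OF s(1,2) B] by blast
  moreover have "(z + s2 *\<^sub>R e) - (z + s1 *\<^sub>R e) = (s2 - s1) *\<^sub>R e" by (simp add: algebra_simps)
  then have "Re (dir ((z + s2 *\<^sub>R e) - (z + s1 *\<^sub>R e)) (\<lambda>z. of_real (\<rho> z)) \<xi>) = (s2 - s1) * Re (dir e (\<lambda>z. of_real (\<rho> z)) \<xi>)"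
    by (simp only: dir_scaleR) simp
  ultimately show ?thesis
    using \<xi>(2) s(3) e[of \<xi>] mult_right_mono[of c "Re (dir e (\<lambda>z. of_real (\<rho> z)) \<xi>)" "s2 - s1"] by (simp add: mult.commute)
qed

lemma zero_along:
  assumes B: "convex B" and r: "smooth_on B (\<lambda>z. complex_of_real (\<rho> z))"
    and e: "\<And>z. z \<in> B \<Longrightarrow> c \<le> Re (dir e (\<lambda>z. of_real (\<rho> z)) z)"
    and zB: "\<And>s. \<bar>s\<bar> \<le> \<delta> \<Longrightarrow> z + s *\<^sub>R e \<in> B" and b: "\<bar>\<rho> z\<bar> \<le> c * \<delta>" and \<delta>: "\<delta> \<ge> 0"
  shows "\<exists>s. \<bar>s\<bar> \<le> \<delta> \<and> \<rho> (z + s *\<^sub>R e) = 0"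
proof -
  have contr: "continuous_on B \<rho>" using continuous_on_Re[OF smooth_on_continuous[OF r]] by simp
  have "\<rho> (z + \<delta> *\<^sub>R e) - \<rho> z \<ge> c * \<delta>"
    using increasing_along[OF B r e zB[of 0] zB[of \<delta>]] \<delta> by simp
  moreover have "\<rho> z - \<rho> (z + (- \<delta>) *\<^sub>R e) \<ge> c * \<delta>"
    using increasing_along[OF B r e zB[of "- \<delta>"] zB[of 0]] \<delta> by simp
  ultimately have sgn: "\<rho> (z + (- \<delta>) *\<^sub>R e) \<le> 0" "0 \<le> \<rho> (z + \<delta> *\<^sub>R e)" using b by linarith+
  have "\<exists>s\<ge>- \<delta>. s \<le> \<delta> \<and> \<rho> (z + s *\<^sub>R e) = 0"
  proof (rule IVT'[where f = "\<lambda>s. \<rho> (z + s *\<^sub>R e)", OF sgn])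
    have "continuous_on {- \<delta>..\<delta>} (\<rho> \<circ> (\<lambda>s. z + s *\<^sub>R e))"
    proof (rule continuous_on_compose)
      show "continuous_on {- \<delta>..\<delta>} (\<lambda>s. z + s *\<^sub>R e)" by (intro continuous_intros)
      show "continuous_on ((\<lambda>s. z + s *\<^sub>R e) ` {- \<delta>..\<delta>}) \<rho>"
        by (rule continuous_on_subset[OF contr]) (use zB in \<open>auto simp: abs_le_iff\<close>)
    qed
    then show "continuous_on {- \<delta>..\<delta>} (\<lambda>s. \<rho> (z + s *\<^sub>R e))" by (simp add: o_def)
  qed (use \<delta> in simp)
  then show ?thesis by (metis abs_le_iff minus_le_iff)
qed

text \<open>Two zeros q0, q1 of \<rho> are joined by a curve q0 + t (q1 - q0) + s(t) e in the zero
  set. Along it d/dt is \<open>tang\<close> divided by the e-derivative of r, so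
  \<open>iterated_bound\<close> applies. That \<epsilon> is the same for all q0 is what the
  connectedness argument relies on.\<close>

lemma unique_continuation:
  fixes \<rho> :: "complex ^ 'n \<Rightarrow> real" and f :: "complex ^ 'n \<Rightarrow> complex"
  defines "r \<equiv> (\<lambda>z. complex_of_real (\<rho> z))"
  assumes r0: "r0 > 0" and anr: "an_on (ball p r0) r" and anf: "an_on (ball p r0) f"
    and e: "\<And>z. z \<in> ball p r0 \<Longrightarrow> Re (dir e r z) \<ge> c" and c: "c > 0" and p: "\<rho> p = 0"
  shows "\<exists>\<epsilon>>0. \<epsilon> \<le> r0 \<and> (\<forall>q0\<in>ball p \<epsilon>. \<forall>q1\<in>ball p \<epsilon>. \<rho> q0 = 0 \<longrightarrow> \<rho> q1 = 0 \<longrightarrow>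
    (\<forall>v n. (tang r e v ^^ n) f q0 = 0) \<longrightarrow> f q1 = 0)"
proof -
  define B where "B = ball p r0"
  have opB: "open B" and cB: "convex B" by (simp_all add: B_def)
  note sr = an_on_smooth[OF anr, folded B_def] and sf = an_on_smooth[OF anf, folded B_def]
  define N where "N = real CARD('n)"
  have N: "N > 0" by (simp add: N_def)
  obtain A1 Cf R where AR: "A1 \<ge> 0" "R \<ge> 0"
    and bA: "\<And>y w z. z \<in> B \<Longrightarrow> norm (pds w (pd y r) z) \<le> A1 * R ^ length w * fact (length w)"
    and bf: "\<And>w z. z \<in> B \<Longrightarrow> norm (pds w f z) \<le> Cf * R ^ length w * fact (length w)"
  proof -
    obtain A0 C0 R0 where 0: "A0 \<ge> 0" "C0 \<ge> 0" "R0 \<ge> 0"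
      "\<And>w z. z \<in> B \<Longrightarrow> norm (pds w r z) \<le> A0 * R0 ^ length w * fact (length w)"
      "\<And>w z. z \<in> B \<Longrightarrow> norm (pds w f z) \<le> C0 * R0 ^ length w * fact (length w)"
      using an_on_common[OF anr anf] unfolding B_def by blast
    have pw: "real (Suc n) \<le> 2 ^ n" for n
    proof -
      have "Suc n \<le> 2 ^ n" by (induction n) auto
      then show ?thesis by (metis of_nat_le_iff of_nat_numeral of_nat_power)
    qed
    show thesis
    proof (rule that[of "A0 * R0" "2 * R0" C0])
      fix y w z assume z: "z \<in> B"
      have "norm (pds w (pd y r) z) \<le> A0 * R0 * R0 ^ length w * fact (length w) * real (Suc (length w))"
        using 0(4)[OF z, of "y # w"] by (simp add: mult_ac del: of_nat_Suc)
      also have "\<dots> \<le> A0 * R0 * R0 ^ length w * fact (length w) * 2 ^ length w"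
        using 0(1,3) by (intro mult_left_mono pw) auto
      finally show "norm (pds w (pd y r) z) \<le> A0 * R0 * (2 * R0) ^ length w * fact (length w)"
        by (simp add: power_mult_distrib mult_ac)
      have "norm (pds w f z) \<le> C0 * R0 ^ length w * fact (length w)" by (rule 0(5)[OF z])
      also have "\<dots> \<le> C0 * (2 * R0) ^ length w * fact (length w)"
        using 0(2,3) by (intro mult_right_mono mult_left_mono power_mono) auto
      finally show "norm (pds w f z) \<le> C0 * (2 * R0) ^ length w * fact (length w)" .
    qed (use 0 in auto)
  qed
  define A0 where "A0 = 4 * N * norm e * A1"
  have A0: "A0 \<ge> 0" using AR N by (simp add: A0_def)
  \<comment> \<open>The coefficients of \<open>tang\<close> in coordinates. Their bounds are
    proportional to the norm of v, so nearby end points make Q small.\<close>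
  define \<omega> where "\<omega> v x z = (\<Sum>y\<in>UNIV. (xv e y * xv v x - xv v y * xv e x) * pd y r z)" for v x z
  have tangW: "tang r e v g = (\<lambda>z. \<Sum>x\<in>UNIV. \<omega> v x z * pd x g z)" for v g
  proof
    fix z
    have "(\<Sum>x\<in>UNIV. \<omega> v x z * pd x g z) = (\<Sum>x\<in>UNIV. \<Sum>y\<in>UNIV. (xv e y * pd y r z) * (xv v x * pd x g z) - (xv v y * pd y r z) * (xv e x * pd x g z))"
      unfolding \<omega>_def sum_distrib_right by (intro sum.cong refl) (simp add: algebra_simps)
    also have "\<dots> = tang r e v g z"
      unfolding tang_def dir_xv sum_subtractf sum_distrib_left[symmetric] sum_distrib_right[symmetric] ..
    finally show "tang r e v g z = (\<Sum>x\<in>UNIV. \<omega> v x z * pd x g z)" ..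
  qed
  have s\<omega>: "smooth_on B (\<omega> v x)" for v x
    unfolding \<omega>_def[abs_def] by (intro smooth_on_sum[OF opB] smooth_on_mult[OF opB] smooth_on_const opB smooth_on_pd sr)
  have b\<omega>: "norm (pds w (\<omega> v x) z) \<le> (A0 * norm v) * R ^ length w * fact (length w)" if z: "z \<in> B" for v x w z
  proof -
    have "pds w (\<omega> v x) z = (\<Sum>y\<in>UNIV. (xv e y * xv v x - xv v y * xv e x) * pds w (pd y r) z)"
      unfolding \<omega>_def[abs_def]
      by (simp add: pds_sum[OF opB _ z] smooth_on_mult[OF opB] smooth_on_const[OF opB] smooth_on_pd sr pds_cmult[OF opB smooth_on_pd[OF sr] z])
    also have "norm \<dots> \<le> real CARD('n + 'n) * (2 * norm e * norm v * (A1 * R ^ length w * fact (length w)))"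
    proof (rule sum_norm_bound)
      fix y
      have "norm (xv e y * xv v x - xv v y * xv e x) \<le> norm e * norm v + norm v * norm e"
        by (intro order_trans[OF norm_triangle_ineq4] add_mono) (simp_all add: norm_mult mult_mono norm_xv)
      then show "norm ((xv e y * xv v x - xv v y * xv e x) * pds w (pd y r) z) \<le> 2 * norm e * norm v * (A1 * R ^ length w * fact (length w))"
        unfolding norm_mult by (intro mult_mono bA z) auto
    qed
    also have "\<dots> = (A0 * norm v) * R ^ length w * fact (length w)" by (simp add: A0_def N_def)
    finally show ?thesis .
  qed
  \<comment> \<open>Displacements by at most \<delta> along e use up less than r0 / 2.\<close>
  define \<delta> where "\<delta> = r0 / (2 * (norm e + 1))"
  have ne: "norm e + 1 > 0" by (simp add: add_nonneg_pos)
  have \<delta>: "\<delta> > 0" "\<delta> * norm e < r0 / 2"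
    using r0 ne by (simp_all add: \<delta>_def field_simps)
  have pB: "p \<in> B" using r0 by (simp add: B_def)
  have contr: "continuous_on B \<rho>"
    using continuous_on_Re[OF smooth_on_continuous[OF sr]] by (simp add: r_def)
  then have "isCont \<rho> p" using opB pB by (simp add: continuous_on_eq_continuous_at)
  then obtain \<epsilon>1 where \<epsilon>1: "\<epsilon>1 > 0" "\<And>y. dist y p < \<epsilon>1 \<Longrightarrow> dist (\<rho> y) (\<rho> p) < c * \<delta>"
    unfolding continuous_at_eps_delta using c \<delta>(1) by (metis mult_pos_pos)
  \<comment> \<open>With this x0 the constant Q below is at most x0 \<epsilon>, which the bound c /
    (x0 + 1) on \<epsilon> keeps below c.\<close>
  define x0 where "x0 = 8 * N * A0 * R"
  have x0: "x0 \<ge> 0" using N A0 AR by (simp add: x0_def)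
  define \<epsilon> where "\<epsilon> = min \<epsilon>1 (min (r0 / 2) (c / (x0 + 1)))"
  have \<epsilon>: "\<epsilon> > 0" "\<epsilon> \<le> \<epsilon>1" "\<epsilon> \<le> r0 / 2" "\<epsilon> \<le> c / (x0 + 1)"
    using \<epsilon>1(1) r0 c x0 unfolding \<epsilon>_def by (simp_all only: min_less_iff_conj) (auto simp: min_def)
  show ?thesis
  proof (intro exI[of _ \<epsilon>] conjI ballI impI)
    show "\<epsilon> > 0" "\<epsilon> \<le> r0" using \<epsilon> r0 by auto
    fix q0 q1 assume q: "q0 \<in> ball p \<epsilon>" "q1 \<in> ball p \<epsilon>" "\<rho> q0 = 0" "\<rho> q1 = 0"
      and z: "\<forall>v n. (tang r e v ^^ n) f q0 = 0"
    define v where "v = q1 - q0"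
    have nv: "norm v \<le> 2 * \<epsilon>"
    proof -
      have "dist q0 q1 \<le> dist q0 p + dist p q1" by (rule dist_triangle)
      then show ?thesis using q(1,2) by (simp add: v_def dist_norm norm_minus_commute)
    qed
    define Q where "Q = 4 * N * (A0 * norm v) * R"
    have Q: "0 \<le> Q" "Q < c"
    proof -
      show "0 \<le> Q" using N A0 AR by (simp add: Q_def)
      have "Q = (4 * N * A0 * R) * norm v" by (simp add: Q_def)
      also have "\<dots> \<le> (4 * N * A0 * R) * (2 * \<epsilon>)" using nv N A0 AR by (intro mult_left_mono) auto
      also have "\<dots> = x0 * \<epsilon>" by (simp add: x0_def)
      also have "\<dots> \<le> x0 * (c / (x0 + 1))" using \<epsilon>(4) x0 by (intro mult_left_mono) auto
      also have "\<dots> < c" using x0 c by (simp add: field_simps)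
      finally show "Q < c" .
    qed
    define y where "y t = q0 + t *\<^sub>R v" for t
    have y: "y t \<in> ball p \<epsilon>" if "0 \<le> t" "t \<le> 1" for t
    proof -
      have "y t = (1 - t) *\<^sub>R q0 + t *\<^sub>R q1" by (simp add: y_def v_def algebra_simps)
      then show ?thesis using convexD_alt[OF convex_ball q(1,2) that] by simp
    qed
    have yB: "y t + s *\<^sub>R e \<in> B" if "0 \<le> t" "t \<le> 1" "\<bar>s\<bar> \<le> \<delta>" for t s
    proof -
      have "dist p (y t + s *\<^sub>R e) \<le> dist p (y t) + norm (s *\<^sub>R e)"
        using dist_triangle[of p "y t + s *\<^sub>R e" "y t"] by (simp add: dist_norm)
      also have "\<dots> < r0 / 2 + r0 / 2"
      proof (rule add_strict_mono)
        show "dist p (y t) < r0 / 2" using y[OF that(1,2)] \<epsilon>(3) by simp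
        have "\<bar>s\<bar> * norm e \<le> \<delta> * norm e" using that(3) by (intro mult_right_mono) auto
        then show "norm (s *\<^sub>R e) < r0 / 2" using \<delta>(2) by simp
      qed
      finally show ?thesis by (simp add: B_def)
    qed
    have mono: "\<rho> (y t + s2 *\<^sub>R e) - \<rho> (y t + s1 *\<^sub>R e) \<ge> c * (s2 - s1)"
      if "0 \<le> t" "t \<le> 1" "\<bar>s1\<bar> \<le> \<delta>" "\<bar>s2\<bar> \<le> \<delta>" "s1 \<le> s2" for t s1 s2
      by (rule increasing_along[OF cB sr[unfolded r_def] e[unfolded r_def, folded B_def] yB yB]) (use that in auto)
    have ex: "\<exists>s. \<bar>s\<bar> \<le> \<delta> \<and> \<rho> (y t + s *\<^sub>R e) = 0" if t: "0 \<le> t" "t \<le> 1" for t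
    proof (rule zero_along[OF cB sr[unfolded r_def] e[unfolded r_def, folded B_def] yB[OF t]])
      show "\<bar>\<rho> (y t)\<bar> \<le> c * \<delta>" using \<epsilon>1(2)[of "y t"] y[OF t] \<epsilon>(2) p by (simp add: dist_commute)
    qed (use \<delta> in auto)
    define s where "s t = (SOME s. \<bar>s\<bar> \<le> \<delta> \<and> \<rho> (y t + s *\<^sub>R e) = 0)" for t
    have s: "\<bar>s t\<bar> \<le> \<delta>" "\<rho> (y t + s t *\<^sub>R e) = 0" if "0 \<le> t" "t \<le> 1" for t
      using someI_ex[OF ex[OF that]] unfolding s_def by blast+
    \<comment> \<open>\<rho> is strictly increasing along e, so the zero is unique; at both ends it
      is s = 0, and the curve really runs from q0 to q1.\<close>
    have s_uniq: "s t = 0" if t: "0 \<le> t" "t \<le> 1" and zt: "\<rho> (y t) = 0" for t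
    proof (rule ccontr)
      assume "s t \<noteq> 0"
      then consider "s t > 0" | "s t < 0" by linarith
      then show False
      proof cases
        case 1
        from mult_pos_pos[OF c this] show False using 1 mono[OF t, of 0 "s t"] s[OF t] \<delta>(1) zt by simp
      next
        case 2
        from mult_pos_neg[OF c this] show False using 2 mono[OF t, of "s t" 0] s[OF t] \<delta>(1) zt by simp
      qed
    qed
    define \<gamma> where "\<gamma> t = y t + s t *\<^sub>R e" for t
    have \<gamma>B: "\<gamma> t \<in> B" if "0 \<le> t" "t \<le> 1" for t unfolding \<gamma>_def using yB[OF that s(1)[OF that]] .
    have \<gamma>01: "\<gamma> 0 = q0" "\<gamma> 1 = q1"
      using s_uniq[of 0] s_uniq[of 1] q by (simp_all add: \<gamma>_def y_def v_def)
    define a where "a z = Re (dir v r z)" for z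
    define b where "b z = Re (dir e r z)" for z
    have bc: "b z \<ge> c" if "z \<in> B" for z using e that by (simp add: b_def B_def)
    \<comment> \<open>The mean value theorem on a chord of the curve: the difference quotient of s
      is - a / b at an intermediate point. It gives first a Lipschitz bound, hence continuity, and
      then the derivative of s.\<close>
    have quot: "\<exists>\<xi>. \<xi> \<in> closed_segment (\<gamma> t) (\<gamma> t') \<and> (s t' - s t) * b \<xi> = - ((t' - t) * a \<xi>)"
      if t: "0 \<le> t" "t \<le> 1" "0 \<le> t'" "t' \<le> 1" for t t'
    proof -
      obtain \<xi> where \<xi>: "\<xi> \<in> closed_segment (\<gamma> t) (\<gamma> t')" "\<rho> (\<gamma> t') - \<rho> (\<gamma> t) = Re (dir (\<gamma> t' - \<gamma> t) r \<xi>)"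
        using mvt_rho[OF cB sr[unfolded r_def] \<gamma>B[OF t(1,2)] \<gamma>B[OF t(3,4)]] unfolding r_def by blast
      have "\<gamma> t' - \<gamma> t = (t' - t) *\<^sub>R v + (s t' - s t) *\<^sub>R e" by (simp add: \<gamma>_def y_def algebra_simps)
      then have "Re (dir (\<gamma> t' - \<gamma> t) r \<xi>) = (t' - t) * a \<xi> + (s t' - s t) * b \<xi>"
        by (simp only: dir_add dir_scaleR) (simp add: a_def b_def)
      moreover have "\<rho> (\<gamma> t') - \<rho> (\<gamma> t) = 0" using s(2)[OF t(1,2)] s(2)[OF t(3,4)] by (simp add: \<gamma>_def)
      ultimately show ?thesis using \<xi> by (intro exI[of _ \<xi>]) simp
    qed
    define \<xi> where "\<xi> t t' = (SOME x. x \<in> closed_segment (\<gamma> t) (\<gamma> t') \<and> (s t' - s t) * b x = - ((t' - t) * a x))" for t t'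
    have \<xi>: "\<xi> t t' \<in> closed_segment (\<gamma> t) (\<gamma> t')" "(s t' - s t) * b (\<xi> t t') = - ((t' - t) * a (\<xi> t t'))"
      if "0 \<le> t" "t \<le> 1" "0 \<le> t'" "t' \<le> 1" for t t'
      using someI_ex[OF quot[OF that]] unfolding \<xi>_def by blast+
    have \<xi>B: "\<xi> t t' \<in> B" if t: "0 \<le> t" "t \<le> 1" "0 \<le> t'" "t' \<le> 1" for t t'
      using \<xi>(1)[OF t] closed_segment_subset[OF \<gamma>B[OF t(1,2)] \<gamma>B[OF t(3,4)] cB] by blast
    define K where "K = (2 * N * norm v * A1) / c"
    have ab: "\<bar>a z\<bar> \<le> 2 * N * norm v * A1" if "z \<in> B" for z
    proof -
      have "\<bar>a z\<bar> \<le> norm (dir v r z)" unfolding a_def by (rule abs_Re_le_cmod)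
      also have "\<dots> \<le> real CARD('n + 'n) * (norm v * A1)"
        unfolding dir_xv
      proof (rule sum_norm_bound)
        fix x
        show "norm (xv v x * pd x r z) \<le> norm v * A1"
          unfolding norm_mult using bA[OF that, of "[]" x] by (intro mult_mono norm_xv) auto
      qed
      finally show ?thesis by (simp add: N_def)
    qed
    have lip: "\<bar>s t' - s t\<bar> \<le> K * \<bar>t' - t\<bar>" if t: "0 \<le> t" "t \<le> 1" "0 \<le> t'" "t' \<le> 1" for t t'
    proof -
      have "\<bar>s t' - s t\<bar> * c \<le> \<bar>s t' - s t\<bar> * b (\<xi> t t')"
        using bc[OF \<xi>B[OF t]] by (intro mult_left_mono) auto
      also have "\<dots> = \<bar>(s t' - s t) * b (\<xi> t t')\<bar>"
        using bc[OF \<xi>B[OF t]] c by (simp add: abs_mult)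
      also have "\<dots> = \<bar>t' - t\<bar> * \<bar>a (\<xi> t t')\<bar>" unfolding \<xi>(2)[OF t] by (simp add: abs_mult)
      also have "\<dots> \<le> \<bar>t' - t\<bar> * (2 * N * norm v * A1)" by (intro mult_left_mono ab \<xi>B t) auto
      finally show ?thesis using c by (simp add: K_def field_simps)
    qed
    have conts: "(s \<longlongrightarrow> s t) (at t within {0..1})" if t: "0 \<le> t" "t \<le> 1" for t
    proof (rule LIM_zero_cancel, rule Lim_null_comparison)
      show "\<forall>\<^sub>F t' in at t within {0..1}. norm (s t' - s t) \<le> K * \<bar>t' - t\<bar>"
        using lip[OF t] by (auto simp: eventually_at_filter)
      have "((\<lambda>t'. K * \<bar>t' - t\<bar>) \<longlongrightarrow> K * \<bar>t - t\<bar>) (at t within {0..1})" by (intro tendsto_intros)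
      then show "((\<lambda>t'. K * \<bar>t' - t\<bar>) \<longlongrightarrow> 0) (at t within {0..1})" by simp
    qed
    have cont\<gamma>: "(\<gamma> \<longlongrightarrow> \<gamma> t) (at t within {0..1})" if t: "0 \<le> t" "t \<le> 1" for t
      unfolding \<gamma>_def y_def by (intro tendsto_intros conts t)
    have cont\<xi>: "((\<lambda>t'. \<xi> t t') \<longlongrightarrow> \<gamma> t) (at t within {0..1})" if t: "0 \<le> t" "t \<le> 1" for t
    proof (rule LIM_zero_cancel, rule Lim_null_comparison)
      show "\<forall>\<^sub>F t' in at t within {0..1}. norm (\<xi> t t' - \<gamma> t) \<le> norm (\<gamma> t' - \<gamma> t)"
        unfolding eventually_at_filter
      proof (rule always_eventually, intro allI impI)
        fix t' assume "t' \<noteq> t" "t' \<in> {0..1}"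
        then show "norm (\<xi> t t' - \<gamma> t) \<le> norm (\<gamma> t' - \<gamma> t)"
          using segment_bound(1)[OF \<xi>(1)[OF t, of t']] by simp
      qed
      show "((\<lambda>t'. norm (\<gamma> t' - \<gamma> t)) \<longlongrightarrow> 0) (at t within {0..1})"
        using cont\<gamma>[OF t] by (simp add: tendsto_norm_zero LIM_zero)
    qed
    have isC: "isCont a (\<gamma> t)" "isCont b (\<gamma> t)" if "0 \<le> t" "t \<le> 1" for t
    proof -
      have d: "isCont (dir u r) (\<gamma> t)" for u
        using smooth_on_differentiable[OF smooth_on_dir[OF opB sr] \<gamma>B[OF that]] by (rule differentiable_imp_continuous_within)
      show "isCont a (\<gamma> t)" "isCont b (\<gamma> t)"
        unfolding a_def[abs_def] b_def[abs_def] by (rule bounded_linear.continuous[OF bounded_linear_Re d])+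
    qed
    have ds: "(s has_real_derivative - a (\<gamma> t) / b (\<gamma> t)) (at t within {0..1})" if t: "0 \<le> t" "t \<le> 1" for t
      unfolding has_field_derivative_iff
    proof (rule Lim_transform_eventually)
      have "b (\<gamma> t) \<noteq> 0" using bc[OF \<gamma>B[OF t]] c by simp
      then show "((\<lambda>t'. - a (\<xi> t t') / b (\<xi> t t')) \<longlongrightarrow> - a (\<gamma> t) / b (\<gamma> t)) (at t within {0..1})"
        by (intro tendsto_intros isCont_tendsto_compose[OF isC(1)[OF t] cont\<xi>[OF t]] isCont_tendsto_compose[OF isC(2)[OF t] cont\<xi>[OF t]])
      show "\<forall>\<^sub>F t' in at t within {0..1}. - a (\<xi> t t') / b (\<xi> t t') = (s t' - s t) / (t' - t)"
        unfolding eventually_at_filter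
      proof (rule always_eventually, intro allI impI)
        fix t' assume t': "t' \<noteq> t" "t' \<in> {0..1}"
        then have "b (\<xi> t t') \<noteq> 0" using bc[OF \<xi>B[OF t, of t']] c by simp
        then show "- a (\<xi> t t') / b (\<xi> t t') = (s t' - s t) / (t' - t)"
          using \<xi>(2)[OF t, of t'] t' by (simp add: field_simps)
      qed
    qed
    have d\<gamma>: "(\<gamma> has_vector_derivative v + (- a (\<gamma> t) / b (\<gamma> t)) *\<^sub>R e) (at t within {0..1})" if t: "0 \<le> t" "t \<le> 1" for t
      unfolding \<gamma>_def[abs_def] y_def
      by (rule has_vector_derivative_eq_rhs) (use ds[OF t] in \<open>auto intro!: derivative_eq_intros simp: \<gamma>_def y_def\<close>)
    have sg: "smooth_on B ((tang r e v ^^ m) f)" for m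
      by (rule vector_field_iterates_bound(1)[OF opB s\<omega> sf AR(2) b\<omega> bf tangW])
    have gb: "norm ((tang r e v ^^ m) f z) \<le> Cf * Q ^ m * fact m" if "z \<in> B" for m z
      using vector_field_iterates_bound(2)[OF opB s\<omega> sf AR(2) b\<omega> bf tangW that] by (simp add: Q_def N_def)
    have "(tang r e v ^^ 0) f (\<gamma> 1) = 0"
    proof (rule iterated_bound[where g = "\<lambda>m t. (tang r e v ^^ m) f (\<gamma> t)" and \<kappa> = "\<lambda>t. dir e r (\<gamma> t)" and c = c and C = Cf and Q = Q])
      fix m t assume t: "0 \<le> (t::real)" "t \<le> 1"
      define g where "g = (tang r e v ^^ m) f"
      have df: "r differentiable (at (\<gamma> t))" by (rule smooth_on_differentiable[OF sr \<gamma>B[OF t]])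
      have ra: "dir v r (\<gamma> t) = of_real (a (\<gamma> t))" "dir e r (\<gamma> t) = of_real (b (\<gamma> t))"
        unfolding a_def b_def r_def by (rule dir_of_real(1)[OF df[unfolded r_def]])+
      have bn: "b (\<gamma> t) \<noteq> 0" using bc[OF \<gamma>B[OF t]] c by simp
      have "((\<lambda>t. g (\<gamma> t)) has_vector_derivative dir (v + (- a (\<gamma> t) / b (\<gamma> t)) *\<^sub>R e) g (\<gamma> t)) (at t within {0..1})"
        unfolding g_def by (rule has_derivative_along_curve[OF d\<gamma>[OF t] smooth_on_differentiable[OF sg \<gamma>B[OF t]]])
      moreover have "dir (v + (- a (\<gamma> t) / b (\<gamma> t)) *\<^sub>R e) g (\<gamma> t) = tang r e v g (\<gamma> t) / dir e r (\<gamma> t)"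
        unfolding dir_add dir_scaleR tang_def ra using bn by (simp add: field_simps)
      ultimately show "((\<lambda>t. (tang r e v ^^ m) f (\<gamma> t)) has_vector_derivative (tang r e v ^^ Suc m) f (\<gamma> t) / dir e r (\<gamma> t)) (at t within {0..1})"
        by (simp add: g_def)
      show "c \<le> norm (dir e r (\<gamma> t))" unfolding ra using bc[OF \<gamma>B[OF t]] c by simp
      show "norm ((tang r e v ^^ m) f (\<gamma> t)) \<le> Cf * Q ^ m * fact m" by (rule gb[OF \<gamma>B[OF t]])
    next
      show "(tang r e v ^^ m) f (\<gamma> 0) = 0" for m using z by (simp add: \<gamma>01)
    qed (use c Q in auto)
    then show "f q1 = 0" by (simp add: \<gamma>01)
  qed
qed

section \<open>The Levi determinant\<close>

text \<open>The value of the Levi form at the tangent vectors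
  \<open>\<rho>\<^sub>w e\<^sub>j - \<rho>\<^sub>j e\<^sub>w\<close> and \<open>\<rho>\<^sub>w e\<^sub>k - \<rho>\<^sub>k e\<^sub>w\<close>.\<close>

definition hpol :: "(complex ^ 'n \<Rightarrow> complex) \<Rightarrow> 'n \<Rightarrow> 'n \<Rightarrow> 'n \<Rightarrow> complex ^ 'n \<Rightarrow> complex" where
  "hpol r w j k z =
     pd (Inl w) r z * (pd (Inl j) (pd (Inr k) r) z * pd (Inr w) r z - pd (Inr k) r z * pd (Inl j) (pd (Inr w) r) z)
   - pd (Inl j) r z * (pd (Inl w) (pd (Inr k) r) z * pd (Inr w) r z - pd (Inr k) r z * pd (Inl w) (pd (Inr w) r) z)"

text \<open>Row and column w of \<open>hpol\<close> vanish; the 1 at position (w, w) makes the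
  determinant equal to that of the block on the other indices.\<close>

definition lmat :: "(complex ^ 'n \<Rightarrow> complex) \<Rightarrow> 'n \<Rightarrow> complex ^ 'n \<Rightarrow> complex ^ 'n ^ 'n" where
  "lmat r w z = (\<chi> j k. hpol r w j k z + (if j = w \<and> k = w then 1 else 0))"

definition ldet :: "(complex ^ 'n \<Rightarrow> complex) \<Rightarrow> 'n \<Rightarrow> complex ^ 'n \<Rightarrow> complex" where
  "ldet r w z = det (lmat r w z)"

definition levi_nd :: "(complex ^ 'n \<Rightarrow> complex) \<Rightarrow> 'n \<Rightarrow> complex ^ 'n \<Rightarrow> bool" where
  "levi_nd r w z \<longleftrightarrow> (\<forall>x. (\<forall>k. (\<Sum>j\<in>UNIV. x j * hpol r w j k z) = 0) \<longrightarrow> (\<forall>j. j \<noteq> w \<longrightarrow> x j = 0))"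

lemma hpol_w [simp]: "hpol r w w k z = 0" "hpol r w j w z = 0"
  by (simp_all add: hpol_def algebra_simps)

lemma ldet_nonzero_iff: "ldet r w z \<noteq> 0 \<longleftrightarrow> levi_nd r w z"
proof -
  have tr: "(transpose (lmat r w z) *v x) $ k = (\<Sum>j\<in>UNIV. x $ j * hpol r w j k z) + (if k = w then x $ w else 0)" for x k
    by (simp add: matrix_vector_mult_def transpose_def lmat_def distrib_right sum.distrib mult.commute
        if_distrib[of "\<lambda>u. u * _"] if_distrib[of "\<lambda>u. _ * u"] cong: if_cong)
  have "ldet r w z \<noteq> 0 \<longleftrightarrow> invertible (transpose (lmat r w z))"
    by (simp add: invertible_det_nz det_transpose ldet_def)
  also have "\<dots> \<longleftrightarrow> (\<forall>x. transpose (lmat r w z) *v x = 0 \<longrightarrow> x = 0)"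
    by (simp add: invertible_left_inverse matrix_left_invertible_ker)
  also have "\<dots> \<longleftrightarrow> levi_nd r w z"
    unfolding levi_nd_def
  proof (intro iffI allI impI)
    fix x j assume 1: "\<forall>x. transpose (lmat r w z) *v x = 0 \<longrightarrow> x = 0" and 2: "\<forall>k. (\<Sum>j\<in>UNIV. x j * hpol r w j k z) = 0" and j: "j \<noteq> w"
    define y where "y = (\<chi> j. if j = w then 0 else x j)"
    have "(\<Sum>j\<in>UNIV. y $ j * hpol r w j k z) = (\<Sum>j\<in>UNIV. x j * hpol r w j k z)" for k
      by (intro sum.cong refl) (simp add: y_def)
    then have "transpose (lmat r w z) *v y = 0" using 2 unfolding vec_eq_iff tr by (simp add: y_def)
    then have "y = 0" using 1 by blast
    then have "y $ j = 0" by simp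
    then show "x j = 0" using j by (simp add: y_def)
  next
    fix x assume 1: "\<forall>x. (\<forall>k. (\<Sum>j\<in>UNIV. x j * hpol r w j k z) = 0) \<longrightarrow> (\<forall>j. j \<noteq> w \<longrightarrow> x j = 0)"
      and "transpose (lmat r w z) *v x = 0"
    then have 2: "(\<Sum>j\<in>UNIV. x $ j * hpol r w j k z) + (if k = w then x $ w else 0) = 0" for k
      by (simp flip: tr)
    have w: "x $ w = 0" using 2[of w] by simp
    then have "(\<Sum>j\<in>UNIV. x $ j * hpol r w j k z) = 0" for k using 2[of k] by (cases "k = w") auto
    then have "x $ j = 0" if "j \<noteq> w" for j using 1[rule_format, of "\<lambda>j. x $ j"] that by blast
    with w show "x = 0" unfolding vec_eq_iff by (metis zero_index)
  qed
  finally show ?thesis .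
qed

lemma pd_Inr_real:
  assumes "(\<lambda>z. complex_of_real (\<rho> z)) differentiable (at q)"
  shows "pd (Inr j) (\<lambda>z. of_real (\<rho> z)) q = cnj (pd (Inl j) (\<lambda>z. of_real (\<rho> z)) q)"
  using pd_cnj[OF assms, of "Inr j"] by simp

text \<open>Since u is a combination of the tangent vectors e k up to the factor a w, the second
  argument of the Levi form need only be tested on them. A tangent vector is determined by its
  entries off w.\<close>

lemma levi_nd_iff:
  fixes \<rho> :: "complex ^ 'n \<Rightarrow> real"
  defines "r \<equiv> (\<lambda>z. complex_of_real (\<rho> z))"
  assumes d: "r differentiable (at q)" and w: "pd (Inl w) r q \<noteq> 0"
  shows "(\<forall>v\<in>holomorphic_tangent_space \<rho> q. (\<forall>u\<in>holomorphic_tangent_space \<rho> q. levi_form \<rho> q v u = 0) \<longrightarrow> v = 0) \<longleftrightarrow> levi_nd r w q"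
proof -
  define HT where "HT = holomorphic_tangent_space \<rho> q"
  define a where "a j = pd (Inl j) r q" for j
  define b where "b j = pd (Inr j) r q" for j
  define R where "R j k = pd (Inl j) (pd (Inr k) r) q" for j k
  have ba: "cnj (a j) = b j" for j unfolding a_def b_def r_def by (rule pd_Inr_real[OF d[unfolded r_def], symmetric])
  have aw: "a w \<noteq> 0" "b w \<noteq> 0" using w ba[of w] by (auto simp: a_def simp flip: ba)
  have HT: "v \<in> HT \<longleftrightarrow> (\<Sum>j\<in>UNIV. a j * v $ j) = 0" for v
    by (simp add: HT_def holomorphic_tangent_space_def a_def pd_def r_def)
  have lf: "levi_form \<rho> q v u = (\<Sum>j\<in>UNIV. \<Sum>k\<in>UNIV. R j k * v $ j * cnj (u $ k))" for v u
    by (simp add: levi_form_def R_def pd_def r_def)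
  have hp: "hpol r w j k q = a w * (R j k * b w - b k * R j w) - a j * (R w k * b w - b k * R w w)" for j k
    by (simp add: hpol_def a_def b_def R_def)
  define e where "e k = (\<chi> i. (if i = k then a w else 0) - (if i = w then a k else 0))" for k
  have eHT: "e k \<in> HT" for k
    by (simp add: HT e_def right_diff_distrib sum_subtractf if_distrib[of "\<lambda>u. _ * u"] cong: if_cong)
  have le: "levi_form \<rho> q v (e k) = (\<Sum>j\<in>UNIV. v $ j * (R j k * b w - b k * R j w))" for v k
    unfolding lf
    by (intro sum.cong refl)
      (simp add: e_def right_diff_distrib sum_subtractf if_distrib[of "\<lambda>u. _ * u"] if_distrib[of cnj] ba algebra_simps cong: if_cong)
  have 1: "a w * levi_form \<rho> q v (e k) = (\<Sum>j\<in>UNIV. v $ j * hpol r w j k q)" if v: "v \<in> HT" for v k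
  proof -
    have "(\<Sum>j\<in>UNIV. v $ j * hpol r w j k q) = a w * levi_form \<rho> q v (e k) - (\<Sum>j\<in>UNIV. a j * v $ j) * (R w k * b w - b k * R w w)"
      unfolding le sum_distrib_left sum_distrib_right sum_subtractf[symmetric]
      by (intro sum.cong refl) (simp add: hp algebra_simps)
    then show ?thesis using v by (simp add: HT)
  qed
  have 2: "b w * levi_form \<rho> q v u = (\<Sum>k\<in>UNIV. cnj (u $ k) * levi_form \<rho> q v (e k))" if u: "u \<in> HT" for v u
  proof -
    have "cnj (\<Sum>j\<in>UNIV. a j * u $ j) = 0" using u by (simp add: HT)
    then have z: "(\<Sum>k\<in>UNIV. b k * cnj (u $ k)) = 0" by (simp add: ba)
    have "(\<Sum>k\<in>UNIV. cnj (u $ k) * levi_form \<rho> q v (e k)) = (\<Sum>j\<in>UNIV. \<Sum>k\<in>UNIV. b w * (R j k * v $ j * cnj (u $ k)) - v $ j * R j w * (b k * cnj (u $ k)))"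
      unfolding le sum_distrib_left by (subst sum.swap) (intro sum.cong refl, simp add: algebra_simps)
    also have "\<dots> = b w * levi_form \<rho> q v u - (\<Sum>j\<in>UNIV. v $ j * R j w * (\<Sum>k\<in>UNIV. b k * cnj (u $ k)))"
      unfolding lf sum_distrib_left sum_subtractf ..
    finally show ?thesis by (simp add: z)
  qed
  show ?thesis
    unfolding HT_def[symmetric] levi_nd_def
  proof (intro iffI allI impI ballI)
    fix x j assume L: "\<forall>v\<in>HT. (\<forall>u\<in>HT. levi_form \<rho> q v u = 0) \<longrightarrow> v = 0"
      and x: "\<forall>k. (\<Sum>j\<in>UNIV. x j * hpol r w j k q) = 0" and j: "j \<noteq> w"
    define v where "v = (\<chi> j. if j = w then - (\<Sum>i\<in>UNIV - {w}. a i * x i) / a w else x j)"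
    have "(\<Sum>j\<in>UNIV. a j * v $ j) = a w * v $ w + (\<Sum>j\<in>UNIV - {w}. a j * v $ j)" by (rule sum.remove) auto
    also have "(\<Sum>j\<in>UNIV - {w}. a j * v $ j) = (\<Sum>j\<in>UNIV - {w}. a j * x j)" by (intro sum.cong refl) (simp add: v_def)
    finally have v: "v \<in> HT" using aw by (simp add: HT v_def)
    have "(\<Sum>j\<in>UNIV. v $ j * hpol r w j k q) = (\<Sum>j\<in>UNIV. x j * hpol r w j k q)" for k
      by (intro sum.cong refl) (simp add: v_def)
    then have "levi_form \<rho> q v (e k) = 0" for k using 1[OF v, of k] x aw by simp
    then have "levi_form \<rho> q v u = 0" if "u \<in> HT" for u using 2[OF that, of v] aw by simp
    then have "v = 0" using L v by blast
    then have "v $ j = 0" by simp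
    then show "x j = 0" using j by (simp add: v_def)
  next
    fix v assume L: "\<forall>x. (\<forall>k. (\<Sum>j\<in>UNIV. x j * hpol r w j k q) = 0) \<longrightarrow> (\<forall>j. j \<noteq> w \<longrightarrow> x j = 0)"
      and v: "v \<in> HT" and z: "\<forall>u\<in>HT. levi_form \<rho> q v u = 0"
    have "(\<Sum>j\<in>UNIV. v $ j * hpol r w j k q) = 0" for k using 1[OF v, of k] z eHT by simp
    then have j: "v $ j = 0" if "j \<noteq> w" for j using L[rule_format, of "\<lambda>j. v $ j"] that by blast
    have "(\<Sum>j\<in>UNIV. a j * v $ j) = (\<Sum>j\<in>UNIV. if j = w then a w * v $ w else 0)" by (intro sum.cong refl) (simp add: j)
    then have "v $ w = 0" using v aw by (simp add: HT)
    then show "v = 0" using j unfolding vec_eq_iff by (metis zero_index)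
  qed
qed

text \<open>Instead of a factorisation of \<rho>2 by \<rho>1, only the proportionality of
  differentials along the zero set is used. Applied again to the functions f k, which vanish there,
  it compares second derivatives up to multiples of a j that cancel in \<open>hpol\<close>, and the
  entries scale by l^3.\<close>

lemma levi_nd_change:
  fixes \<rho>1 \<rho>2 :: "complex ^ 'n \<Rightarrow> real"
  defines "r1 \<equiv> (\<lambda>z. complex_of_real (\<rho>1 z))" and "r2 \<equiv> (\<lambda>z. complex_of_real (\<rho>2 z))"
  assumes W: "open W" "q \<in> W" and s: "smooth_on W r1" "smooth_on W r2"
    and Z: "\<And>z. z \<in> W \<Longrightarrow> \<rho>1 z = 0 \<Longrightarrow> \<rho>2 z = 0" and q: "\<rho>1 q = 0"
    and n1: "\<And>z. z \<in> W \<Longrightarrow> pd (Inl w) r1 z \<noteq> 0" and n2: "\<exists>x. pd x r2 q \<noteq> 0"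
  shows "pd (Inl w) r2 q \<noteq> 0" "levi_nd r2 w q \<longleftrightarrow> levi_nd r1 w q"
proof -
  have pr: "\<exists>c. \<forall>x. pd x f z = c * pd x r1 z" if "z \<in> W" "\<rho>1 z = 0" "smooth_on W f" "\<And>z. z \<in> W \<Longrightarrow> \<rho>1 z = 0 \<Longrightarrow> f z = 0" for f z
    unfolding r1_def
    by (rule pd_proportional[OF W(1) that(1) s(1)[unfolded r1_def] smooth_on_differentiable[OF that(3,1)] that(2,4)])
      (use n1[OF that(1)] in \<open>auto simp: r1_def\<close>)
  have prop2: "\<exists>c. \<forall>x. pd x r2 z = c * pd x r1 z" if "z \<in> W" "\<rho>1 z = 0" for z
    by (rule pr[OF that s(2)]) (simp add: Z r2_def)
  obtain l where l: "\<And>x. pd x r2 q = l * pd x r1 q" using prop2[OF W(2) q] by blast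
  have l0: "l \<noteq> 0" using n2 l by auto
  show "pd (Inl w) r2 q \<noteq> 0" using l0 n1[OF W(2)] by (simp add: l)
  define f where "f k z = pd (Inr w) r1 z * pd (Inr k) r2 z - pd (Inr k) r1 z * pd (Inr w) r2 z" for k z
  have sf: "smooth_on W (f k)" for k
    unfolding f_def[abs_def] by (intro smooth_on_diff smooth_on_mult smooth_on_pd W s)
  have f0: "f k z = 0" if z: "z \<in> W" "\<rho>1 z = 0" for k z
  proof -
    obtain c where "\<And>x. pd x r2 z = c * pd x r1 z" using prop2[OF z] by blast
    then show ?thesis by (simp add: f_def)
  qed
  have "\<forall>k. \<exists>c. \<forall>x. pd x (f k) q = c * pd x r1 q" using pr[OF W(2) q sf f0] by blast
  then obtain c where c: "\<And>k x. pd x (f k) q = c k * pd x r1 q" by metis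
  have "hpol r2 w j k q = l ^ 3 * hpol r1 w j k q" for j k
  proof -
    define a where "a j = pd (Inl j) r1 q" for j
    define b where "b j = pd (Inr j) r1 q" for j
    define R where "R j k = pd (Inl j) (pd (Inr k) r1) q" for j k
    define S where "S j k = pd (Inl j) (pd (Inr k) r2) q" for j k
    have dd: "pd y r1 differentiable (at q)" "pd y r2 differentiable (at q)" for y
      using s by (auto intro: smooth_on_differentiable[OF smooth_on_pd W(2)])
    have pf: "pd (Inl j) (f k) q = (R j w * (l * b k) + b w * S j k) - (R j k * (l * b w) + b k * S j w)" for j
      unfolding f_def[abs_def]
      by (subst pd_diff[OF W])
        (simp_all add: pd_mult dd smooth_on_mult W s smooth_on_pd l a_def b_def R_def S_def)
    have key: "S j k * b w - b k * S j w = c k * a j + l * (R j k * b w - b k * R j w)" for j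
      using c[of "Inl j" k] pf[of j] by (simp add: a_def algebra_simps)
    have "hpol r2 w j k q = l ^ 2 * (a w * (S j k * b w - b k * S j w) - a j * (S w k * b w - b k * S w w))"
      by (simp add: hpol_def l a_def b_def S_def algebra_simps power2_eq_square)
    also have "\<dots> = l ^ 3 * (a w * (R j k * b w - b k * R j w) - a j * (R w k * b w - b k * R w w))"
      unfolding key by (simp add: algebra_simps power2_eq_square power3_eq_cube)
    finally show ?thesis by (simp add: hpol_def a_def b_def R_def)
  qed
  then have "(\<Sum>j\<in>UNIV. x j * hpol r2 w j k q) = l ^ 3 * (\<Sum>j\<in>UNIV. x j * hpol r1 w j k q)" for x k
    by (simp add: sum_distrib_left mult_ac)
  then show "levi_nd r2 w q \<longleftrightarrow> levi_nd r1 w q" using l0 by (simp add: levi_nd_def)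
qed

section \<open>Local data of a hypersurface\<close>

lemma defining_smooth:
  assumes "local_defining_function M p U \<rho>" "z \<in> U"
  shows "\<exists>a>0. ball z a \<subseteq> U \<and> an_on (ball z a) (\<lambda>z. complex_of_real (\<rho> z))"
proof -
  have "real_analytic_at \<rho> z" "open U" using assms by (auto simp: local_defining_function_def real_analytic_on_def)
  from real_analytic_at_imp_an_on[OF this(1)] obtain a where a: "a > 0" "an_on (ball z a) (\<lambda>z. complex_of_real (\<rho> z))" by blast
  obtain b where b: "b > 0" "ball z b \<subseteq> U" using \<open>open U\<close> assms(2) open_contains_ball by blast
  show ?thesis by (intro exI[of _ "min a b"]) (use a b in \<open>auto intro: an_on_subset\<close>)
qed

lemma defining_gradient:
  assumes "local_defining_function M p U \<rho>" "z \<in> U"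
  shows "\<exists>w. pd (Inl w) (\<lambda>z. complex_of_real (\<rho> z)) z \<noteq> 0"
proof (rule ccontr)
  assume *: "\<nexists>w. pd (Inl w) (\<lambda>z. complex_of_real (\<rho> z)) z \<noteq> 0"
  obtain a where a: "a > 0" "an_on (ball z a) (\<lambda>z. complex_of_real (\<rho> z))" using defining_smooth[OF assms] by blast
  have d: "(\<lambda>z. complex_of_real (\<rho> z)) differentiable (at z)"
    by (rule smooth_on_differentiable[OF an_on_smooth[OF a(2)]]) (use a in simp)
  have "dir v (\<lambda>z. complex_of_real (\<rho> z)) z = 0" for v
    using * by (simp add: dir_def pd_Inr_real[OF d])
  then have "(\<rho> has_derivative (\<lambda>v. 0)) (at z)" using dir_of_real(2)[OF d] by simp
  from frechet_derivative_at[OF this] show False using assms by (auto simp: local_defining_function_def)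
qed

text \<open>One index w and one transversal direction e for the whole ball: the Levi determinant is
  then a single analytic function there, and M can be reached along e from nearby points.\<close>

definition ldata :: "(complex ^ 'n) set \<Rightarrow> complex ^ 'n \<Rightarrow> (complex ^ 'n \<Rightarrow> real) \<Rightarrow> 'n \<Rightarrow> complex ^ 'n \<Rightarrow> real \<Rightarrow> real \<Rightarrow> bool" where
  "ldata M p \<rho> w e c r0 \<longleftrightarrow> r0 > 0 \<and> c > 0 \<and> p \<in> M \<and> (\<exists>U. local_defining_function M p U \<rho> \<and> ball p r0 \<subseteq> U) \<and>
     an_on (ball p r0) (\<lambda>z. complex_of_real (\<rho> z)) \<and>
     (\<forall>z\<in>ball p r0. pd (Inl w) (\<lambda>z. of_real (\<rho> z)) z \<noteq> 0 \<and> c \<le> Re (dir e (\<lambda>z. of_real (\<rho> z)) z))"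

lemma ldataD:
  assumes "ldata M p \<rho> w e c r0"
  shows "r0 > 0" "c > 0" "p \<in> M" "an_on (ball p r0) (\<lambda>z. complex_of_real (\<rho> z))" "smooth_on (ball p r0) (\<lambda>z. complex_of_real (\<rho> z))"
    "\<And>z. z \<in> ball p r0 \<Longrightarrow> pd (Inl w) (\<lambda>z. of_real (\<rho> z)) z \<noteq> 0"
    "\<And>z. z \<in> ball p r0 \<Longrightarrow> c \<le> Re (dir e (\<lambda>z. of_real (\<rho> z)) z)"
    "\<And>z. z \<in> ball p r0 \<Longrightarrow> z \<in> M \<longleftrightarrow> \<rho> z = 0" "\<rho> p = 0"
proof -
  show 1: "r0 > 0" "c > 0" "p \<in> M" "an_on (ball p r0) (\<lambda>z. complex_of_real (\<rho> z))"
    "\<And>z. z \<in> ball p r0 \<Longrightarrow> pd (Inl w) (\<lambda>z. of_real (\<rho> z)) z \<noteq> 0"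
    "\<And>z. z \<in> ball p r0 \<Longrightarrow> c \<le> Re (dir e (\<lambda>z. of_real (\<rho> z)) z)"
    using assms by (auto simp: ldata_def)
  show "smooth_on (ball p r0) (\<lambda>z. complex_of_real (\<rho> z))" by (rule an_on_smooth[OF 1(4)])
  obtain U where U: "M \<inter> U = {z\<in>U. \<rho> z = 0}" "ball p r0 \<subseteq> U" using assms by (auto simp: ldata_def local_defining_function_def)
  then show *: "\<And>z. z \<in> ball p r0 \<Longrightarrow> z \<in> M \<longleftrightarrow> \<rho> z = 0" by blast
  then show "\<rho> p = 0" using 1(1,3) by simp
qed

lemma ldata_exists:
  assumes M: "real_analytic_hypersurface M" and p: "p \<in> M"
  shows "\<exists>\<rho> w e c r0. ldata M p \<rho> w e c r0"
proof -
  obtain U \<rho> where U: "local_defining_function M p U \<rho>" using M p by (auto simp: real_analytic_hypersurface_def)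
  then have pU: "p \<in> U" by (simp add: local_defining_function_def)
  obtain w where w: "pd (Inl w) (\<lambda>z. complex_of_real (\<rho> z)) p \<noteq> 0" using defining_gradient[OF U pU] by blast
  obtain a where a: "a > 0" "ball p a \<subseteq> U" "an_on (ball p a) (\<lambda>z. complex_of_real (\<rho> z))" using defining_smooth[OF U pU] by blast
  define r where "r = (\<lambda>z. complex_of_real (\<rho> z))"
  note s = an_on_smooth[OF a(3), folded r_def]
  have pa: "p \<in> ball p a" using a by simp
  have isC: "isCont f p" if "smooth_on (ball p a) f" for f
    by (rule differentiable_imp_continuous_within[OF smooth_on_differentiable[OF that pa]])
  \<comment> \<open>In this direction the derivative of r at p is twice the squared modulus of its
    w-derivative, that is 2 c; half of it is kept as a lower bound near p.\<close>
  define e where "e = axis w (cnj (pd (Inl w) r p))"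
  define c where "c = (norm (pd (Inl w) r p))\<^sup>2"
  have c: "c > 0" using w by (simp add: c_def r_def)
  have "dir e r p = (\<Sum>j\<in>UNIV. if j = w then cnj (pd (Inl w) r p) * pd (Inl w) r p + pd (Inl w) r p * cnj (pd (Inl w) r p) else 0)"
    unfolding dir_def e_def axis_def
    using pd_Inr_real[OF smooth_on_differentiable[OF s[unfolded r_def] pa], folded r_def] by (intro sum.cong refl) auto
  then have "dir e r p = of_real (2 * c)"
    unfolding c_def of_real_mult complex_norm_square by simp
  then have ec: "Re (dir e r p) = 2 * c" by simp
  have "isCont (\<lambda>z. Re (dir e r z)) p"
    by (rule bounded_linear.continuous[OF bounded_linear_Re isC[OF smooth_on_dir[OF _ s]]]) simp
  then have "\<forall>\<^sub>F z in nhds p. c < Re (dir e r z)"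
    using order_tendstoD(1)[OF iffD1[OF tendsto_at_iff_tendsto_nhds[of "\<lambda>z. Re (dir e r z)" p]], of c] c ec by (simp add: isCont_def)
  moreover have "\<forall>\<^sub>F z in nhds p. pd (Inl w) r z \<noteq> 0"
    using isC[OF smooth_on_pd[OF s], of "Inl w"] w
    unfolding isCont_def tendsto_at_iff_tendsto_nhds r_def[symmetric] by (rule tendsto_imp_eventually_ne)
  ultimately have "\<forall>\<^sub>F z in nhds p. pd (Inl w) r z \<noteq> 0 \<and> c < Re (dir e r z)" by (rule eventually_conj[rotated])
  then obtain b where b: "b > 0" "\<And>z. dist z p < b \<Longrightarrow> pd (Inl w) r z \<noteq> 0 \<and> c < Re (dir e r z)"
    unfolding eventually_nhds_metric by blast
  have "ldata M p \<rho> w e c (min a b)"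
    unfolding ldata_def r_def[symmetric]
  proof (intro conjI exI[of _ U] ballI)
    show "an_on (ball p (min a b)) r" by (rule an_on_subset[OF a(3)[folded r_def]]) auto
    fix z assume "z \<in> ball p (min a b)"
    then have "dist z p < b" by (simp add: dist_commute)
    from b(2)[OF this] show "pd (Inl w) r z \<noteq> 0" "c \<le> Re (dir e r z)" by auto
  qed (use a b c p U in auto)
  then show ?thesis by blast
qed

text \<open>\<open>levi_nondegenerate_at\<close> may be witnessed by a different defining function,
  from which \<open>levi_nd_change\<close> passes to \<rho>.\<close>

lemma ldata_ldet:
  assumes D: "ldata M p \<rho> w e c r0" and q: "q \<in> ball p r0" "q \<in> M"
  shows "levi_nondegenerate_at M q \<longleftrightarrow> ldet (\<lambda>z. complex_of_real (\<rho> z)) w q \<noteq> 0"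
proof -
  define r where "r = (\<lambda>z. complex_of_real (\<rho> z))"
  note s = ldataD(5)[OF D, folded r_def]
  show ?thesis
    unfolding ldet_nonzero_iff r_def[symmetric]
  proof
    assume nd: "levi_nd r w q"
    obtain U where U: "local_defining_function M p U \<rho>" "ball p r0 \<subseteq> U" using D by (auto simp: ldata_def)
    then have "local_defining_function M q U \<rho>" using q by (auto simp: local_defining_function_def)
    moreover have "\<forall>v\<in>holomorphic_tangent_space \<rho> q. (\<forall>u\<in>holomorphic_tangent_space \<rho> q. levi_form \<rho> q v u = 0) \<longrightarrow> v = 0"
      using levi_nd_iff[OF smooth_on_differentiable[OF s[unfolded r_def] q(1)] ldataD(6)[OF D q(1)]] nd by (simp add: r_def)
    ultimately show "levi_nondegenerate_at M q" unfolding levi_nondegenerate_at_def by blast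
  next
    assume "levi_nondegenerate_at M q"
    then obtain U \<rho>2 where U: "local_defining_function M q U \<rho>2"
      and n: "\<forall>v\<in>holomorphic_tangent_space \<rho>2 q. (\<forall>u\<in>holomorphic_tangent_space \<rho>2 q. levi_form \<rho>2 q v u = 0) \<longrightarrow> v = 0"
      unfolding levi_nondegenerate_at_def by blast
    have qU: "q \<in> U" and MU: "M \<inter> U = {z\<in>U. \<rho>2 z = 0}" using U by (simp_all add: local_defining_function_def)
    obtain a where a: "a > 0" "ball q a \<subseteq> U" "an_on (ball q a) (\<lambda>z. complex_of_real (\<rho>2 z))" using defining_smooth[OF U qU] by blast
    define W where "W = ball q a \<inter> ball p r0"
    have W: "open W" "q \<in> W" using a q by (auto simp: W_def)
    have s2: "smooth_on W (\<lambda>z. complex_of_real (\<rho>2 z))" by (rule smooth_on_subset[OF an_on_smooth[OF a(3)]]) (simp add: W_def)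
    have s1: "smooth_on W (\<lambda>z. complex_of_real (\<rho> z))" by (rule smooth_on_subset[OF s[unfolded r_def]]) (simp add: W_def)
    obtain w2 where "pd (Inl w2) (\<lambda>z. complex_of_real (\<rho>2 z)) q \<noteq> 0" using defining_gradient[OF U qU] by blast
    then have n2: "\<exists>x. pd x (\<lambda>z. complex_of_real (\<rho>2 z)) q \<noteq> 0" by blast
    have Z: "\<rho>2 z = 0" if "z \<in> W" "\<rho> z = 0" for z
      using that ldataD(8)[OF D, of z] a(2) MU by (auto simp: W_def)
    have n1: "pd (Inl w) (\<lambda>z. complex_of_real (\<rho> z)) z \<noteq> 0" if "z \<in> W" for z using ldataD(6)[OF D, of z] that by (simp add: W_def)
    have q0: "\<rho> q = 0" using ldataD(8)[OF D q(1)] q(2) by simp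
    note ch = levi_nd_change[OF W s1 s2 Z q0 n1 n2]
    have "levi_nd (\<lambda>z. complex_of_real (\<rho>2 z)) w q"
      using levi_nd_iff[OF smooth_on_differentiable[OF s2 W(2)] ch(1)] n by blast
    then show "levi_nd r w q" using ch(2) by (simp add: r_def)
  qed
qed

lemma an_on_ldet:
  assumes "open U" "an_on U r"
  shows "an_on U (ldet r w)"
proof -
  have "an_on U (\<lambda>z. lmat r w z $ j $ k)" for j k
    unfolding lmat_def hpol_def vec_lambda_beta
    by (intro an_on_add an_on_diff an_on_mult an_on_pd an_on_const assms)
  then show ?thesis
    unfolding ldet_def[abs_def] det_def by (intro an_on_sum an_on_mult an_on_prod an_on_const assms)
qed

text \<open>On the zero set the differential of a vanishing function is a multiple of that of r, and
  \<open>tang\<close> is antisymmetric in the two.\<close>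

lemma tang_iterates_vanish:
  fixes \<rho> :: "complex ^ 'n \<Rightarrow> real"
  defines "r \<equiv> (\<lambda>z. complex_of_real (\<rho> z))"
  assumes W: "open W" and r: "smooth_on W r" and w: "\<And>z. z \<in> W \<Longrightarrow> pd (Inl w) r z \<noteq> 0"
    and f: "smooth_on W f" "\<And>z. z \<in> W \<Longrightarrow> \<rho> z = 0 \<Longrightarrow> f z = 0" and q: "q \<in> W" "\<rho> q = 0"
  shows "(tang r e v ^^ n) f q = 0"
proof -
  have "smooth_on W ((tang r e v ^^ n) f) \<and> (\<forall>z\<in>W. \<rho> z = 0 \<longrightarrow> (tang r e v ^^ n) f z = 0)"
  proof (induction n)
    case (Suc n)
    define g where "g = (tang r e v ^^ n) f"
    have g: "smooth_on W g" "\<And>z. z \<in> W \<Longrightarrow> \<rho> z = 0 \<Longrightarrow> g z = 0" using Suc by (auto simp: g_def)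
    have "smooth_on W (tang r e v g)"
      unfolding tang_def[abs_def] by (intro smooth_on_diff smooth_on_mult smooth_on_dir W r g)
    moreover have "tang r e v g z = 0" if z: "z \<in> W" "\<rho> z = 0" for z
    proof -
      have "\<exists>c. \<forall>x. pd x g z = c * pd x r z"
        unfolding r_def
        by (rule pd_proportional[OF W z(1) r[unfolded r_def] smooth_on_differentiable[OF g(1) z(1)] z(2) g(2)])
          (use w[OF z(1)] in \<open>auto simp: r_def\<close>)
      then obtain c where "\<And>x. pd x g z = c * pd x r z" by blast
      then have "dir u g z = c * dir u r z" for u by (simp add: dir_xv sum_distrib_left mult_ac)
      then show ?thesis by (simp add: tang_def)
    qed
    ultimately show ?case by (simp add: g_def)
  qed (use f in simp)
  then show ?thesis using q by blast
qed

theorem ldet_not_flat: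
  assumes M: "real_analytic_hypersurface M" and conn: "connected M" and nd: "\<exists>q\<in>M. levi_nondegenerate_at M q"
    and D: "ldata M p \<rho> w e c r0"
  shows "\<exists>v n. (tang (\<lambda>z. complex_of_real (\<rho> z)) e v ^^ n) (ldet (\<lambda>z. complex_of_real (\<rho> z)) w) p \<noteq> 0"
proof (rule ccontr)
  assume flat: "\<not> ?thesis"
  \<comment> \<open>The relative interior of the degenerate set. It is formulated without the
    determinant, which exists only locally and depends on the defining function.\<close>
  define Z where "Z = {q\<in>M. \<exists>O'. open O' \<and> q \<in> O' \<and> (\<forall>z\<in>M \<inter> O'. \<not> levi_nondegenerate_at M z)}"
  have uc: "\<exists>\<epsilon>>0. \<epsilon> \<le> r0' \<and> (\<forall>q0\<in>ball q \<epsilon> \<inter> M. (\<forall>v n. (tang (\<lambda>z. complex_of_real (\<rho>' z)) e' v ^^ n) (ldet (\<lambda>z. complex_of_real (\<rho>' z)) w') q0 = 0)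
      \<longrightarrow> (\<forall>z\<in>ball q \<epsilon> \<inter> M. \<not> levi_nondegenerate_at M z))"
    if D': "ldata M q \<rho>' w' e' c' r0'" for q \<rho>' w' e' c' r0'
  proof -
    obtain \<epsilon> where \<epsilon>: "\<epsilon> > 0" "\<epsilon> \<le> r0'" and u: "\<And>q0 q1. q0 \<in> ball q \<epsilon> \<Longrightarrow> q1 \<in> ball q \<epsilon> \<Longrightarrow> \<rho>' q0 = 0 \<Longrightarrow> \<rho>' q1 = 0 \<Longrightarrow>
        \<forall>v n. (tang (\<lambda>z. complex_of_real (\<rho>' z)) e' v ^^ n) (ldet (\<lambda>z. complex_of_real (\<rho>' z)) w') q0 = 0 \<Longrightarrow> ldet (\<lambda>z. complex_of_real (\<rho>' z)) w' q1 = 0"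
      using unique_continuation[OF ldataD(1)[OF D'] ldataD(4)[OF D'] an_on_ldet[OF open_ball ldataD(4)[OF D']] ldataD(7)[OF D'] ldataD(2)[OF D'] ldataD(9)[OF D'], of w']
      by blast
    have "\<not> levi_nondegenerate_at M z" if q0: "q0 \<in> ball q \<epsilon>" "q0 \<in> M" and z: "z \<in> ball q \<epsilon>" "z \<in> M"
      and h: "\<forall>v n. (tang (\<lambda>z. complex_of_real (\<rho>' z)) e' v ^^ n) (ldet (\<lambda>z. complex_of_real (\<rho>' z)) w') q0 = 0" for q0 z
    proof -
      have b: "q0 \<in> ball q r0'" "z \<in> ball q r0'" using q0 z \<epsilon> by auto
      have "ldet (\<lambda>z. complex_of_real (\<rho>' z)) w' z = 0"
        using u[OF q0(1) z(1) _ _ h] ldataD(8)[OF D' b(1)] ldataD(8)[OF D' b(2)] q0 z by blast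
      then show ?thesis using ldata_ldet[OF D' b(2) z(2)] by blast
    qed
    then show ?thesis using \<epsilon> by blast
  qed
  have "p \<in> Z"
  proof -
    have "p \<in> M" by (rule ldataD(3)[OF D])
    with uc[OF D] flat obtain \<epsilon> where "\<epsilon> > 0" "\<forall>z\<in>ball p \<epsilon> \<inter> M. \<not> levi_nondegenerate_at M z"
      by (metis IntI centre_in_ball)
    then show ?thesis using \<open>p \<in> M\<close> unfolding Z_def by (auto intro!: exI[of _ "ball p \<epsilon>"])
  qed
  have Zo: "openin (top_of_set M) Z"
  proof (subst openin_subopen, rule ballI)
    fix q assume "q \<in> Z"
    then obtain O' where O: "open O'" "q \<in> O'" "\<forall>z\<in>M \<inter> O'. \<not> levi_nondegenerate_at M z" and q: "q \<in> M" by (auto simp: Z_def)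
    then have "M \<inter> O' \<subseteq> Z" by (auto simp: Z_def)
    then show "\<exists>T. openin (top_of_set M) T \<and> q \<in> T \<and> T \<subseteq> Z" using O q by (intro exI[of _ "M \<inter> O'"]) (auto intro: openin_open_Int)
  qed
  have Zc: "openin (top_of_set M) (M - Z)"
  proof (subst openin_subopen, rule ballI)
    fix q assume q: "q \<in> M - Z"
    then obtain \<rho>' w' e' c' r0' where D': "ldata M q \<rho>' w' e' c' r0'" using ldata_exists[OF M] by blast
    from uc[OF D'] obtain \<epsilon> where \<epsilon>: "\<epsilon> > 0" "\<epsilon> \<le> r0'" and u: "\<And>q0. q0 \<in> ball q \<epsilon> \<inter> M \<Longrightarrow>
        \<forall>v n. (tang (\<lambda>z. complex_of_real (\<rho>' z)) e' v ^^ n) (ldet (\<lambda>z. complex_of_real (\<rho>' z)) w') q0 = 0 \<Longrightarrow> \<forall>z\<in>ball q \<epsilon> \<inter> M. \<not> levi_nondegenerate_at M z"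
      by blast
    \<comment> \<open>For q0 in Z the determinant would be flat at q0, and unique continuation
      started at q0, with the radius that belongs to q, would put q into Z.\<close>
    have "M \<inter> ball q \<epsilon> \<subseteq> M - Z"
    proof
      fix q0 assume q0: "q0 \<in> M \<inter> ball q \<epsilon>"
      have "q0 \<notin> Z"
      proof
        assume "q0 \<in> Z"
        then obtain O' where O: "open O'" "q0 \<in> O'" "\<forall>z\<in>M \<inter> O'. \<not> levi_nondegenerate_at M z" by (auto simp: Z_def)
        define W where "W = O' \<inter> ball q r0'"
        have Wb: "W \<subseteq> ball q r0'" by (simp add: W_def)
        have "(tang (\<lambda>z. complex_of_real (\<rho>' z)) e' v ^^ n) (ldet (\<lambda>z. complex_of_real (\<rho>' z)) w') q0 = 0" for v n
        proof (rule tang_iterates_vanish[of W])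
          show "open W" using O by (auto simp: W_def)
          show "smooth_on W (\<lambda>z. complex_of_real (\<rho>' z))" by (rule smooth_on_subset[OF ldataD(5)[OF D'] Wb])
          show "pd (Inl w') (\<lambda>z. complex_of_real (\<rho>' z)) z \<noteq> 0" if "z \<in> W" for z using ldataD(6)[OF D'] Wb that by blast
          show "smooth_on W (ldet (\<lambda>z. complex_of_real (\<rho>' z)) w')"
            by (rule smooth_on_subset[OF an_on_smooth[OF an_on_ldet[OF open_ball ldataD(4)[OF D']]] Wb])
          show "ldet (\<lambda>z. complex_of_real (\<rho>' z)) w' z = 0" if z: "z \<in> W" "\<rho>' z = 0" for z
          proof -
            have b: "z \<in> ball q r0'" using z Wb by blast
            then have m: "z \<in> M" using ldataD(8)[OF D' b] z by blast
            then show ?thesis using ldata_ldet[OF D' b m] O(3) z by (auto simp: W_def)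
          qed
          show "q0 \<in> W" using O q0 \<epsilon> by (auto simp: W_def)
          then show "\<rho>' q0 = 0" using ldataD(8)[OF D', of q0] q0 Wb by blast
        qed
        then have "\<forall>z\<in>ball q \<epsilon> \<inter> M. \<not> levi_nondegenerate_at M z" using u q0 by blast
        then have "q \<in> Z" using q \<epsilon>(1) unfolding Z_def by (auto intro!: exI[of _ "ball q \<epsilon>"])
        then show False using q by blast
      qed
      then show "q0 \<in> M - Z" using q0 by blast
    qed
    then show "\<exists>T. openin (top_of_set M) T \<and> q \<in> T \<and> T \<subseteq> M - Z" using \<epsilon> q by (intro exI[of _ "M \<inter> ball q \<epsilon>"]) (auto intro: openin_open_Int)
  qed
  have "Z \<subseteq> M" by (auto simp: Z_def)
  then have "closedin (top_of_set M) Z" using Zc by (simp add: closedin_def)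
  then have "Z = M" using conn Zo \<open>p \<in> Z\<close> unfolding connected_clopen by blast
  then show False using nd unfolding Z_def by blast
qed

lemma cst_0: "cst 0 = 0"
  by (rule hser_eqI) (simp add: coef_cst)

section \<open>Tangential derivations of Hurwitz series\<close>

text \<open>The formal counterpart of the vector fields tangent to the level sets of a function with
  jet P.\<close>

definition tder :: "'x::finite hser \<Rightarrow> ('x hser \<Rightarrow> 'x hser) set" where
  "tder P = {D. (\<exists>\<alpha>. \<forall>a. D a = (\<Sum>x\<in>UNIV. \<alpha> x * dd x a)) \<and> D P = 0}"

lemma tder_derivation: "D \<in> tder P \<Longrightarrow> derivation D"
proof -
  assume "D \<in> tder P"
  then obtain \<alpha> where "\<And>a. D a = (\<Sum>x\<in>UNIV. \<alpha> x * dd x a)" by (auto simp: tder_def)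
  then have D: "D = (\<lambda>a. \<Sum>x\<in>UNIV. \<alpha> x * dd x a)" by blast
  show ?thesis unfolding D by (rule derivationI_comb) (rule derivation_dd)
qed

lemma tder_basic: "c * dd x P = d * dd y P \<Longrightarrow> (\<lambda>a. c * dd x a - d * dd y a) \<in> tder P"
  unfolding tder_def
  by (intro CollectI conjI exI[of _ "\<lambda>z. (if z = x then c else 0) - (if z = y then d else 0)"] allI)
    (simp_all add: left_diff_distrib sum_subtractf if_distrib[of "\<lambda>u. u * _"] cong: if_cong)

lemma tder_scale: "D \<in> tder P \<Longrightarrow> (\<lambda>a. c * D a) \<in> tder P"
  unfolding tder_def
proof (intro CollectI conjI, goal_cases)
  case 1
  then obtain \<alpha> where "\<And>a. D a = (\<Sum>x\<in>UNIV. \<alpha> x * dd x a)" by blast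
  then show ?case by (intro exI[of _ "\<lambda>x. c * \<alpha> x"]) (simp add: sum_distrib_left mult.assoc)
qed simp

lemma tder_sum:
  assumes "\<And>i. i \<in> I \<Longrightarrow> D i \<in> tder P"
  shows "(\<lambda>a. \<Sum>i\<in>I. D i a) \<in> tder P"
proof -
  have "\<forall>i\<in>I. \<exists>\<alpha>. \<forall>a. D i a = (\<Sum>x\<in>UNIV. \<alpha> x * dd x a)" using assms by (auto simp: tder_def)
  from bchoice[OF this] obtain \<alpha> where \<alpha>: "\<And>i a. i \<in> I \<Longrightarrow> D i a = (\<Sum>x\<in>UNIV. \<alpha> i x * dd x a)" by blast
  have "(\<Sum>i\<in>I. D i a) = (\<Sum>x\<in>UNIV. (\<Sum>i\<in>I. \<alpha> i x) * dd x a)" for a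
    by (simp add: \<alpha> sum_distrib_right sum.swap[of _ UNIV I])
  moreover have "(\<Sum>i\<in>I. D i P) = 0" using assms by (intro sum.neutral) (auto simp: tder_def)
  ultimately show ?thesis by (auto simp: tder_def)
qed

lemma tder_van: "D \<in> tder P \<Longrightarrow> van K a \<Longrightarrow> van (K - 1) (D a)"
proof -
  assume "D \<in> tder P" and a: "van K a"
  then obtain \<alpha> where D: "D a = (\<Sum>x\<in>UNIV. \<alpha> x * dd x a)" by (auto simp: tder_def)
  show ?thesis unfolding D by (intro van_sum van_mult_left van_dd a)
qed

text \<open>Vanishing along the hypersurface to order n, tested only by tangential derivations and
  at the base point, since a jet has no values at other points of the hypersurface.\<close>

primrec tv :: "'x::finite hser \<Rightarrow> nat \<Rightarrow> 'x hser \<Rightarrow> bool" where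
  "tv P 0 a \<longleftrightarrow> coef a [] = 0"
| "tv P (Suc n) a \<longleftrightarrow> coef a [] = 0 \<and> (\<forall>D\<in>tder P. tv P n (D a))"

lemma tv_add: "tv P n a \<Longrightarrow> tv P n b \<Longrightarrow> tv P n (a + b)"
  by (induction n arbitrary: a b) (auto simp: coef_add derivation_add[OF tder_derivation])

lemma tv_Suc: "tv P (Suc n) a \<Longrightarrow> tv P n a"
proof (induction n arbitrary: a)
  case (Suc n)
  have "tv P n (D a)" if "D \<in> tder P" for D
  proof (rule Suc.IH)
    show "tv P (Suc n) (D a)" using Suc.prems that by (subst (asm) tv.simps(2)) blast
  qed
  then show ?case using Suc.prems by simp
qed simp

lemma tv_mult: "tv P n a \<Longrightarrow> tv P n (b * a)"
proof (induction n arbitrary: a b)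
  case (Suc n)
  have "tv P n (D (b * a))" if D: "D \<in> tder P" for D
    unfolding derivation_mult[OF tder_derivation[OF D]]
  proof (rule tv_add)
    show "tv P n (D b * a)" by (rule Suc.IH[OF tv_Suc[OF Suc.prems]])
    show "tv P n (b * D a)" by (rule Suc.IH) (use Suc.prems D in simp)
  qed
  then show ?case using Suc.prems by (simp add: coef_mult)
qed (simp add: coef_mult)

lemma tv_0: "tv P n 0"
proof (induction n)
  case (Suc n)
  have "tv P n (D 0)" if "D \<in> tder P" for D
    using Suc.IH by (simp add: derivation_0[OF tder_derivation[OF that]])
  then show ?case by simp
qed simp

text \<open>When \<open>P\<close> is the jet of a defining function, this ideal contains the jets of the smooth
  functions vanishing on the hypersurface.\<close>

definition tvan :: "'x::finite hser \<Rightarrow> 'x hser set" where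
  "tvan P = {a. \<forall>n. tv P n a}"

lemma tvan_0: "0 \<in> tvan P" and tvan_add: "a \<in> tvan P \<Longrightarrow> b \<in> tvan P \<Longrightarrow> a + b \<in> tvan P"
  and tvan_mult: "a \<in> tvan P \<Longrightarrow> b * a \<in> tvan P"
  by (auto simp: tvan_def intro: tv_0 tv_add tv_mult)

lemma tvan_diff: "a \<in> tvan P \<Longrightarrow> b \<in> tvan P \<Longrightarrow> a - b \<in> tvan P"
  using tvan_add[OF _ tvan_mult, of a P b "- 1"] by simp

lemma tvan_tder: "D \<in> tder P \<Longrightarrow> a \<in> tvan P \<Longrightarrow> D a \<in> tvan P"
  unfolding tvan_def mem_Collect_eq by (metis tv.simps(2))

lemma lie_tvan:
  assumes "D \<in> tder P" "a \<in> tvan P"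
  shows "lie D a = 0"
proof (rule fps_ext)
  fix n
  have "(D ^^ n) a \<in> tvan P" by (induction n) (use assms tvan_tder in auto)
  then have "tv P 0 ((D ^^ n) a)" unfolding tvan_def by blast
  then show "fps_nth (lie D a) n = fps_nth 0 n" by (simp add: lie_nth)
qed

text \<open>The constant c absorbs the orders lost by derivations; it may depend on f but not on
  s.\<close>

definition tvan_err :: "'x::finite hser \<Rightarrow> (nat \<Rightarrow> nat) \<Rightarrow> (nat \<Rightarrow> 'x hser) set" where
  "tvan_err P N = {f. \<exists>c v u. \<forall>s. f s = v s + u s \<and> v s \<in> tvan P \<and> van (2 * N s - c) (u s)}"

lemma tvan_errI: "(\<And>s. v s \<in> tvan P) \<Longrightarrow> (\<And>s. van (2 * N s - c) (u s)) \<Longrightarrow> (\<lambda>s. v s + u s) \<in> tvan_err P N"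
  unfolding tvan_err_def by blast

lemma tvan_err_iff:
  "f \<in> tvan_err P N \<longleftrightarrow> (\<exists>c v u. f = (\<lambda>s. v s + u s) \<and> (\<forall>s. v s \<in> tvan P) \<and> (\<forall>s. van (2 * N s - c) (u s)))"
  unfolding tvan_err_def fun_eq_iff by blast

lemma tvan_errE:
  assumes "f \<in> tvan_err P N"
  obtains c v u where "f = (\<lambda>s. v s + u s)" "\<And>s. v s \<in> tvan P" "\<And>s. van (2 * N s - c) (u s)"
proof -
  obtain c v u where *: "\<forall>s. f s = v s + u s \<and> v s \<in> tvan P \<and> van (2 * N s - c) (u s)"
    using assms unfolding tvan_err_def by blast
  show thesis by (rule that[of v u c]) (use * in auto)
qed

lemma tvan_err_tder:
  assumes D: "D \<in> tder P" and "f \<in> tvan_err P N"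
  shows "(\<lambda>s. D (f s)) \<in> tvan_err P N"
  using assms(2)
proof (rule tvan_errE)
  fix c v u assume *: "f = (\<lambda>s. v s + u s)" "\<And>s. v s \<in> tvan P" "\<And>s. van (2 * N s - c) (u s)"
  have "van (2 * N s - Suc c) (D (u s))" for s using tder_van[OF D *(3), of s] by simp
  from tvan_errI[where v = "\<lambda>s. D (v s)", OF tvan_tder[OF D *(2)] this]
  show "(\<lambda>s. D (f s)) \<in> tvan_err P N" by (simp add: *(1) derivation_add[OF tder_derivation[OF D]])
qed

lemma err_space_tvan_err: "err_space (tvan_err P N)"
  unfolding err_space_def
proof (intro conjI ballI allI)
  show "(\<lambda>s. 0) \<in> tvan_err P N" using tvan_errI[of "\<lambda>s. 0" P N 0 "\<lambda>s. 0"] by (simp add: tvan_0)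
next
  fix f g assume "f \<in> tvan_err P N" "g \<in> tvan_err P N"
  obtain c v u where f: "f = (\<lambda>s. v s + u s)" "\<And>s. v s \<in> tvan P" "\<And>s. van (2 * N s - c) (u s)"
    using \<open>f \<in> _\<close> unfolding tvan_err_iff by blast
  obtain c' v' u' where g: "g = (\<lambda>s. v' s + u' s)" "\<And>s. v' s \<in> tvan P" "\<And>s. van (2 * N s - c') (u' s)"
    using \<open>g \<in> _\<close> unfolding tvan_err_iff by blast
  have "(\<lambda>s. (v s + v' s) + (u s + u' s)) \<in> tvan_err P N"
  proof (rule tvan_errI)
    show "v s + v' s \<in> tvan P" for s by (rule tvan_add[OF f(2) g(2)])
    show "van (2 * N s - (c + c')) (u s + u' s)" for s
      by (rule van_add[OF van_mono[OF f(3)] van_mono[OF g(3)]]) simp_all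
  qed
  then show "(\<lambda>s. f s + g s) \<in> tvan_err P N" by (simp add: f g add_ac)
next
  fix a f assume "f \<in> tvan_err P N"
  then show "(\<lambda>s. a * f s) \<in> tvan_err P N"
  proof (rule tvan_errE)
    fix c v u assume *: "f = (\<lambda>s. v s + u s)" "\<And>s. v s \<in> tvan P" "\<And>s. van (2 * N s - c) (u s)"
    from tvan_errI[where v = "\<lambda>s. a * v s", OF tvan_mult[OF *(2)] van_mult_left[OF *(3)]]
    show "(\<lambda>s. a * f s) \<in> tvan_err P N" by (simp add: *(1) distrib_left)
  qed
qed

text \<open>With q the quotient of the w-derivatives of f and r, the components g x of df - q dr
  vanish on the hypersurface again. A derivation D that kills the jet of r takes the same value on
  the jet of f whether computed from df or from df - q dr, so the induction applies to the g
  x.\<close>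

lemma jt_tvan:
  fixes \<rho> :: "complex ^ 'n \<Rightarrow> real"
  defines "r \<equiv> (\<lambda>z. complex_of_real (\<rho> z))"
  assumes U: "open U" "p \<in> U" and r: "smooth_on U r" and w: "\<And>z. z \<in> U \<Longrightarrow> pd (Inl w) r z \<noteq> 0"
    and p: "\<rho> p = 0" and f: "smooth_on U f" "\<And>z. z \<in> U \<Longrightarrow> \<rho> z = 0 \<Longrightarrow> f z = 0"
  shows "jt p f \<in> tvan (jt p r)"
proof -
  have "tv (jt p r) n (jt p f)" for n
    using f
  proof (induction n arbitrary: f)
    case 0
    then show ?case using U p by (simp add: coef_jt[OF U])
  next
    case (Suc n)
    define q where "q z = pd (Inl w) f z * inverse (pd (Inl w) r z)" for z
    have sq: "smooth_on U q" unfolding q_def[abs_def]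
      by (intro smooth_on_mult smooth_on_inverse smooth_on_pd U r Suc.prems w)
    define g where "g x z = pd x f z - q z * pd x r z" for x z
    have sg: "smooth_on U (g x)" for x unfolding g_def[abs_def]
      by (intro smooth_on_mult smooth_on_diff smooth_on_pd U r Suc.prems(1) sq)
    have g0: "g x z = 0" if z: "z \<in> U" "\<rho> z = 0" for x z
    proof -
      have "\<exists>c. \<forall>x. pd x f z = c * pd x (\<lambda>z. of_real (\<rho> z)) z"
        by (rule pd_proportional[OF U(1) z(1) r[unfolded r_def] smooth_on_differentiable[OF Suc.prems(1) z(1)] z(2) Suc.prems(2)])
          (use w[OF z(1)] in \<open>auto simp: r_def\<close>)
      then obtain c where c: "\<And>x. pd x f z = c * pd x r z" unfolding r_def by blast
      show ?thesis using w[OF z(1)] by (simp add: g_def q_def c)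
    qed
    have e: "jt p (g x) = dd x (jt p f) - jt p q * dd x (jt p r)" for x
      unfolding g_def[abs_def]
      by (simp add: jt_diff[OF U] jt_mult[OF U] jt_pd[OF U] smooth_on_mult[OF U(1)] smooth_on_pd sq r Suc.prems(1))
    have "tv (jt p r) n (D (jt p f))" if "D \<in> tder (jt p r)" for D
    proof -
      from that obtain \<alpha> where \<alpha>: "\<And>a. D a = (\<Sum>x\<in>UNIV. \<alpha> x * dd x a)" and D0: "D (jt p r) = 0" by (auto simp: tder_def)
      have "D (jt p f) - jt p q * D (jt p r) = (\<Sum>x\<in>UNIV. \<alpha> x * jt p (g x))"
        unfolding \<alpha> e sum_distrib_left sum_subtractf[symmetric] by (intro sum.cong refl) (simp add: algebra_simps)
      then have "D (jt p f) = (\<Sum>x\<in>UNIV. \<alpha> x * jt p (g x))" by (simp add: D0)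
      moreover have "tv (jt p r) n (\<Sum>x\<in>I. \<alpha> x * jt p (g x))" if "finite I" for I
        using that by (induction I) (simp_all add: tv_0 tv_add tv_mult Suc.IH sg g0)
      ultimately show ?thesis by simp
    qed
    then show ?case using U p Suc.prems by (simp add: coef_jt[OF U])
  qed
  then show ?thesis by (simp add: tvan_def)
qed

section \<open>Generic tangential derivations\<close>

inductive_set polf :: "(complex ^ 'm ^ 'l \<Rightarrow> complex) set" where
  const: "(\<lambda>\<xi>. c) \<in> polf"
| coord: "(\<lambda>\<xi>. \<xi> $ i $ j) \<in> polf"
| add: "f \<in> polf \<Longrightarrow> g \<in> polf \<Longrightarrow> (\<lambda>\<xi>. f \<xi> + g \<xi>) \<in> polf"
| mult: "f \<in> polf \<Longrightarrow> g \<in> polf \<Longrightarrow> (\<lambda>\<xi>. f \<xi> * g \<xi>) \<in> polf"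

lemma polf_sum: "(\<And>i. i \<in> I \<Longrightarrow> f i \<in> polf) \<Longrightarrow> (\<lambda>\<xi>. \<Sum>i\<in>I. f i \<xi>) \<in> polf"
  by (induction I rule: infinite_finite_induct) (auto intro: polf.intros)

lemma polf_diff: "f \<in> polf \<Longrightarrow> g \<in> polf \<Longrightarrow> (\<lambda>\<xi>. f \<xi> - g \<xi>) \<in> polf"
  using polf.add[OF _ polf.mult[OF polf.const[of "- 1"]], of f g] by simp

lemma polf_continuous: "f \<in> polf \<Longrightarrow> continuous_on UNIV f"
  by (induction rule: polf.induct) (auto intro!: continuous_intros)

lemma polf_line: "f \<in> polf \<Longrightarrow> \<exists>q. \<forall>t. f (\<chi> i j. \<xi> $ i $ j + t * \<eta> $ i $ j) = poly q t"
proof (induction rule: polf.induct)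
  case (const c)
  show ?case by (intro exI[of _ "[:c:]"]) simp
next
  case (coord i j)
  show ?case by (intro exI[of _ "[:\<xi> $ i $ j, \<eta> $ i $ j:]"]) simp
next
  case (add f g)
  then show ?case by (metis poly_add)
next
  case (mult f g)
  then show ?case by (metis poly_mult)
qed

text \<open>On the line from \<xi> to \<xi>0 the function is a nonzero polynomial in one variable
  and has only finitely many zeros.\<close>

lemma polf_dense:
  assumes f: "f \<in> polf" and 0: "f \<xi>0 \<noteq> 0"
  shows "closure {\<xi>. f \<xi> \<noteq> 0} = UNIV"
proof (intro equalityI subsetI UNIV_I)
  fix \<xi> :: "complex ^ 'a ^ 'b"
  show "\<xi> \<in> closure {\<xi>. f \<xi> \<noteq> 0}"
    unfolding closure_approachable
  proof (intro allI impI)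
    fix \<epsilon> :: real assume \<epsilon>: "\<epsilon> > 0"
    define y where "y t = (\<chi> i j. \<xi> $ i $ j + t * (\<xi>0 - \<xi>) $ i $ j)" for t
    obtain q where q: "\<And>t. f (y t) = poly q t" using polf_line[OF f, of \<xi> "\<xi>0 - \<xi>"] unfolding y_def by blast
    have "y 1 = \<xi>0" by (simp add: y_def vec_eq_iff)
    then have "q \<noteq> 0" using q[of 1] 0 by auto
    then have fin: "finite {t. poly q t = 0}" by (rule poly_roots_finite)
    define d where "d = \<epsilon> / (norm (\<xi>0 - \<xi>) + 1)"
    have np: "norm (\<xi>0 - \<xi>) + 1 > 0" by (simp add: add_nonneg_pos)
    have d: "d > 0" using \<epsilon> np by (simp add: d_def)
    have inf: "infinite (complex_of_real ` {0<..<d})"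
    proof
      assume "finite (complex_of_real ` {0<..<d})"
      from finite_imageD[OF this inj_on_subset[OF inj_of_real subset_UNIV]] show False using infinite_Ioo[OF d] by blast
    qed
    have "\<not> complex_of_real ` {0<..<d} \<subseteq> {t. poly q t = 0}"
    proof
      assume "complex_of_real ` {0<..<d} \<subseteq> {t. poly q t = 0}"
      from finite_subset[OF this fin] inf show False by contradiction
    qed
    then obtain t where t: "t \<in> {0<..<d}" "poly q (of_real t) \<noteq> 0" unfolding subset_iff image_iff mem_Collect_eq by blast
    have "y (of_real t) - \<xi> = t *\<^sub>R (\<xi>0 - \<xi>)" unfolding vec_eq_iff by (simp add: y_def) (simp add: scaleR_conv_of_real)
    then have "dist (y (of_real t)) \<xi> = t * norm (\<xi>0 - \<xi>)" using t(1) by (simp add: dist_norm)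
    also have "\<dots> \<le> t * (norm (\<xi>0 - \<xi>) + 1)" using t(1) by simp
    also have "\<dots> < d * (norm (\<xi>0 - \<xi>) + 1)" using t(1) np by (intro mult_strict_right_mono) auto
    also have "\<dots> = \<epsilon>" using np by (simp add: d_def)
    finally show "\<exists>y\<in>{\<xi>. f \<xi> \<noteq> 0}. dist y \<xi> < \<epsilon>" using t(2) q by (intro bexI[of _ "y (of_real t)"]) auto
  qed
qed

lemma polf_generic:
  fixes f :: "nat \<Rightarrow> complex ^ 'm ^ 'l \<Rightarrow> complex"
  assumes f: "\<And>n. f n \<in> polf" and 0: "\<And>n. \<exists>\<xi>. f n \<xi> \<noteq> 0"
  shows "\<exists>\<xi>. \<forall>n. f n \<xi> \<noteq> 0"
proof -
  have "UNIV \<subseteq> closure (\<Inter>(range (\<lambda>n. {\<xi>. f n \<xi> \<noteq> 0})))"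
  proof (rule Baire)
    fix T assume "T \<in> range (\<lambda>n. {\<xi>. f n \<xi> \<noteq> 0})"
    then obtain n where n: "T = {\<xi>. f n \<xi> \<noteq> 0}" by blast
    have "open T" unfolding n by (intro open_Collect_neq polf_continuous f continuous_on_const)
    moreover obtain \<xi> where "f n \<xi> \<noteq> 0" using 0 by blast
    ultimately show "openin (top_of_set UNIV) T \<and> UNIV \<subseteq> closure T" using polf_dense[OF f] n by simp
  qed simp_all
  then have "\<Inter>(range (\<lambda>n. {\<xi>. f n \<xi> \<noteq> 0})) \<noteq> {}" by (metis UNIV_not_empty closure_empty subset_empty)
  then show ?thesis by blast
qed

lemma polf_hmul: "(\<And>w. (\<lambda>\<xi>. f \<xi> w) \<in> polf) \<Longrightarrow> (\<lambda>\<xi>. hmul g (f \<xi>) w) \<in> polf"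
proof (induction w arbitrary: f g)
  case Nil
  then show ?case by (simp add: polf.mult polf.const)
next
  case (Cons x w)
  show ?case unfolding hmul.simps
  proof (rule polf.add)
    show "(\<lambda>\<xi>. hmul (\<lambda>u. g (x # u)) (f \<xi>) w) \<in> polf" by (rule Cons.IH[OF Cons.prems])
    show "(\<lambda>\<xi>. hmul g (\<lambda>u. f \<xi> (x # u)) w) \<in> polf" by (rule Cons.IH) (rule Cons.prems)
  qed
qed

text \<open>Combinations of the basic tangential fields with constant coefficients only: finitely
  many parameters \<xi>, in which every coefficient of every iterate is a polynomial, as
  \<open>polf_generic\<close> requires.\<close>

definition tW :: "('x::finite) hser \<Rightarrow> complex ^ 'x ^ 'x \<Rightarrow> 'x hser \<Rightarrow> 'x hser" where
  "tW P \<xi> a = (\<Sum>x\<in>UNIV. \<Sum>y\<in>UNIV. cst (\<xi> $ x $ y) * (dd x P * dd y a - dd y P * dd x a))"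

lemma tW_tder: "tW P \<xi> \<in> tder P"
  unfolding tW_def[abs_def] by (intro tder_sum tder_scale tder_basic) (rule mult.commute)

lemma polf_tW:
  assumes "\<And>w. (\<lambda>\<xi>. coef (a \<xi>) w) \<in> polf"
  shows "(\<lambda>\<xi>. coef (tW P \<xi> (a \<xi>)) w) \<in> polf"
  unfolding tW_def coef_sum coef_cst_mult
  unfolding coef_diff coef_mult coef_dd
  by (intro polf_sum polf.mult polf.coord polf_diff polf_hmul assms)

lemma polf_tW_funpow: "(\<lambda>\<xi>. coef ((tW P \<xi> ^^ n) a) w) \<in> polf"
proof (induction n arbitrary: w)
  case 0
  show ?case using polf.const by simp
next
  case (Suc n)
  show ?case using polf_tW[OF Suc] by simp
qed

text \<open>For suitable \<xi> the field acts on the lowest-order terms of a like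
  \<open>dv v\<close>. If all iterates vanished at the base point, so would all N-th powers of
  \<open>dv v\<close>, and polarization would raise the order of a above N.\<close>

lemma tW_leading:
  fixes P a :: "('n::finite + 'n) hser"
  assumes a: "van N a" "\<And>k. dd (Inr k) a = 0" "coef a u \<noteq> 0" "length u = N" and P: "coef (dd (Inr w) P) [] \<noteq> 0"
  shows "\<exists>\<xi>. coef ((tW P \<xi> ^^ N) a) [] \<noteq> 0"
proof (rule ccontr)
  assume *: "\<not> ?thesis"
  define c where "c = coef (dd (Inr w) P) []"
  have dvv: "van (K - 1) (dv v b)" if "van K b" for v b K
    unfolding dv_def by (intro van_sum van_mult_left van_dd that)
  have dvn: "van (N - n) ((dv v ^^ n) a)" for v n
  proof (induction n)
    case (Suc n)
    show ?case using dvv[OF Suc, of v] by simp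
  qed (use a in simp)
  have dvi: "dd (Inr k) ((dv v ^^ n) a) = 0" for v n k
  proof (induction n)
    case (Suc n)
    have "dd (Inr k) (dv v b) = dv v (dd (Inr k) b)" for b :: "('n + 'n) hser"
      unfolding dv_def
      by (simp add: derivation_sum[OF derivation_dd] derivation_mult[OF derivation_dd] dd_cst dd_commute[of "Inr k"])
    then show ?case by (simp add: Suc) (simp add: dv_def derivation_0[OF derivation_dd])
  qed (use a in simp)
  have "coef ((dv v ^^ N) a) [] = 0" for v
  proof -
    \<comment> \<open>Only the pairs (Inr w, Inl j) are used, scaled by the value c of the
      derivative of P at the base point. The other half of each field is a multiple of
      \<open>dd (Inr w)\<close> and kills holomorphic series.\<close>
    define \<xi> :: "complex ^ ('n + 'n) ^ ('n + 'n)" where "\<xi> = (\<chi> x y. case (x, y) of (Inr k, Inl j) \<Rightarrow> if k = w then v $ j / c else 0 | _ \<Rightarrow> 0)"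
    have W: "tW P \<xi> b = (\<Sum>j\<in>UNIV. cst (v $ j / c) * (dd (Inr w) P * dd (Inl j) b - dd (Inl j) P * dd (Inr w) b))" for b :: "('n + 'n) hser"
    proof -
      have "tW P \<xi> b = (\<Sum>k\<in>UNIV. \<Sum>j\<in>UNIV. cst (if k = w then v $ j / c else 0) * (dd (Inr k) P * dd (Inl j) b - dd (Inl j) P * dd (Inr k) b))"
        unfolding tW_def sum_UNIV_Plus by (simp add: \<xi>_def cst_0)
      also have "\<dots> = (\<Sum>k\<in>UNIV. if k = w then (\<Sum>j\<in>UNIV. cst (v $ j / c) * (dd (Inr k) P * dd (Inl j) b - dd (Inl j) P * dd (Inr k) b)) else 0)"
        by (intro sum.cong refl) (simp add: cst_0)
      finally show ?thesis by simp
    qed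
    have Wdv: "tW P \<xi> b - dv v b = (\<Sum>j\<in>UNIV. cst (v $ j / c) * ((dd (Inr w) P - cst c) * dd (Inl j) b))" if "\<And>k. dd (Inr k) b = 0" for b
    proof -
      have "cst (v $ j) = (cst (v $ j / c) * cst c :: ('n + 'n) hser)" for j using P by (simp add: cst_mult c_def)
      then show ?thesis unfolding W dv_def sum_subtractf[symmetric] that by (intro sum.cong refl) (simp add: algebra_simps)
    qed
    have v1: "van 1 (dd (Inr w) P - cst c)" by (simp add: van_def c_def coef_diff coef_cst)
    \<comment> \<open>The difference of the iterates always vanishes to one order more than the
      \<open>dv\<close>-iterate is known to; at n = N this says that their constant terms
      agree.\<close>
    have "van (Suc N - n) ((tW P \<xi> ^^ n) a - (dv v ^^ n) a)" if "n \<le> N" for n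
      using that
    proof (induction n)
      case (Suc n)
      define b where "b = (dv v ^^ n) a"
      have "(tW P \<xi> ^^ Suc n) a - (dv v ^^ Suc n) a = tW P \<xi> ((tW P \<xi> ^^ n) a - b) + (tW P \<xi> b - dv v b)"
        by (simp add: derivation_diff[OF tder_derivation[OF tW_tder]] b_def)
      moreover have "van (N - n) (tW P \<xi> ((tW P \<xi> ^^ n) a - b))"
        using tder_van[OF tW_tder Suc.IH] Suc.prems by (simp add: b_def Suc_diff_le)
      moreover have "van (N - n) (tW P \<xi> b - dv v b)"
      proof -
        have *: "van (1 + (N - n - 1)) ((dd (Inr w) P - cst c) * dd (Inl j) b)" for j
          by (rule van_mult[OF v1 van_dd]) (use dvn b_def in simp)
        have "van (1 + (N - n - 1)) (tW P \<xi> b - dv v b)"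
          unfolding Wdv[OF dvi, of n v, folded b_def] by (rule van_sum, rule van_mult_left, rule *)
        then show ?thesis using Suc.prems Suc_diff_Suc[of n N] by simp
      qed
      ultimately show ?case using van_add by fastforce
    qed simp
    from this[of N] have "van 1 ((tW P \<xi> ^^ N) a - (dv v ^^ N) a)" by simp
    then have "coef ((tW P \<xi> ^^ N) a - (dv v ^^ N) a) [] = 0" by (simp add: van_def)
    moreover have "coef ((tW P \<xi> ^^ N) a) [] = 0" using * by blast
    ultimately show ?thesis by (simp add: coef_diff)
  qed
  moreover have "coef ((dv v ^^ m) a) [] = 0" if "m < N" for m v using dvn[of m v] that by (simp add: van_def)
  ultimately have "van (Suc N) a" by (intro van_polarization a(2)) (metis less_Suc_eq)
  then show False using a(3,4) by (simp add: van_def)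
qed

section \<open>No sequence of approximate infinitesimal automorphisms\<close>

text \<open>The counterpart of \<^const>\<open>hpol\<close> for jets.\<close>

definition hlev :: "('n::finite + 'n) hser \<Rightarrow> 'n \<Rightarrow> 'n \<Rightarrow> 'n \<Rightarrow> ('n + 'n) hser" where
  "hlev P w i k =
     dd (Inl w) P * (dd (Inl i) (dd (Inr k) P) * dd (Inr w) P - dd (Inr k) P * dd (Inl i) (dd (Inr w) P))
   - dd (Inl i) P * (dd (Inl w) (dd (Inr k) P) * dd (Inr w) P - dd (Inr k) P * dd (Inl w) (dd (Inr w) P))"

lemma lie_power_nonzero:
  assumes W: "derivation W" and "lie W a \<noteq> 0"
  shows "lie W (a ^ m) \<noteq> 0"
proof (cases m)
  case 0
  have "lie W a = lie W 1 * lie W a" using lie_mult[OF W, of 1 a] by simp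
  then show ?thesis using 0 assms by auto
next
  case (Suc k)
  then show ?thesis using assms by (simp only: lie_power) simp
qed

text \<open>\<open>closed_system\<close> feeds \<open>no_flat_solution_sequence\<close> along a
  single field W. W has to meet countably many conditions: \<Delta> must not restrict to zero, and
  for each s some component of X must keep its exact order N s.\<close>

theorem no_infinitesimal_sequence:
  fixes P :: "('n::finite + 'n) hser" and X Y :: "'n \<Rightarrow> nat \<Rightarrow> ('n + 'n) hser" and N :: "nat \<Rightarrow> nat"
  assumes w: "w' \<noteq> w" and iw: "dd (Inl w) P * iw = 1" and it: "dd (Inr w) P * it = 1"
    and X: "\<And>i k s. dd (Inr k) (X i s) = 0" and Y: "\<And>i k s. dd (Inl k) (Y i s) = 0"
    and XY: "(\<lambda>s. \<Sum>i\<in>UNIV. dd (Inl i) P * X i s + dd (Inr i) P * Y i s) \<in> tvan_err P N"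
    and adj: "\<And>i c. (\<Sum>k\<in>UNIV. (hlev P w i k + (if i = w \<and> k = w then 1 else 0)) * \<kappa> k c) = (if i = c then \<Delta> else 0)"
      "\<And>i c. (\<Sum>j\<in>UNIV. \<kappa> c j * (hlev P w j i + (if j = w \<and> i = w then 1 else 0))) = (if i = c then \<Delta> else 0)"
    and \<Delta>: "lie (tW P \<xi>0) \<Delta> \<noteq> 0"
    and N: "\<And>s. s \<le> N s" and vX: "\<And>i s. van (N s) (X i s)"
    and nX: "\<And>s. \<exists>i u. length u = N s \<and> coef (X i s) u \<noteq> 0"
  shows False
proof -
  have 2: "(cst (1 / 2) :: ('n + 'n) hser) * 2 = 1" "(cst (1 / 3) :: ('n + 'n) hser) * 3 = 1"
  proof -
    have e: "2 = (cst 2 :: ('n + 'n) hser)" "3 = (cst 3 :: ('n + 'n) hser)"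
      using of_nat_hser[of 2, where 'x = "'n + 'n"] of_nat_hser[of 3, where 'x = "'n + 'n"] by simp_all
    show "(cst (1 / 2) :: ('n + 'n) hser) * 2 = 1" "(cst (1 / 3) :: ('n + 'n) hser) * 3 = 1"
      unfolding e cst_mult by (simp_all add: cst_1)
  qed
  interpret cr_operators "\<lambda>j. dd (Inl j)" "\<lambda>j. dd (Inr j)" P iw it "cst (1 / 2)" "cst (1 / 3)" w w'
    by unfold_locales (simp_all add: derivation_dd iw it 2 w, (rule dd_commute)+)
  define E where "E = tvan_err P N"
  have E: "err_space E" unfolding E_def by (rule err_space_tvan_err)
  have tL: "L j \<in> tder P" and tLb: "Lb j \<in> tder P" and tT: "T \<in> tder P" for j
  proof -
    have "(\<lambda>f. 1 * dd (Inl j) f - a j * dd (Inl w) f) \<in> tder P" by (rule tder_basic) (use L_rho[of j] in \<open>simp add: L_def\<close>)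
    then show "L j \<in> tder P" by (simp add: L_def[abs_def])
    have "(\<lambda>f. 1 * dd (Inr j) f - b j * dd (Inr w) f) \<in> tder P" by (rule tder_basic) (use Lb_rho[of j] in \<open>simp add: Lb_def\<close>)
    then show "Lb j \<in> tder P" by (simp add: Lb_def[abs_def])
    have "(\<lambda>f. 1 * dd (Inr w) f - kap * dd (Inl w) f) \<in> tder P" by (rule tder_basic) (use T_rho in \<open>simp add: T_def\<close>)
    then show "T \<in> tder P" by (simp add: T_def[abs_def])
  qed
  \<comment> \<open>The unit by which \<open>hlev\<close>, which is free of denominators, differs
    from the matrix h of the locale.\<close>
  define mm where "mm = - (dd (Inl w) P * dd (Inr w) P * dd (Inr w) P)"
  have hh: "hlev P w i k = mm * h i k" for i k
  proof -
    define q where "q = dd (Inr k) P"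
    have dit: "dd x it = - (it * it * dd x (dd (Inr w) P))" for x
    proof -
      have "dd x (dd (Inr w) P) * it + dd (Inr w) P * dd x it = 0"
        unfolding derivation_mult[OF derivation_dd, symmetric] it by (rule derivation_1[OF derivation_dd])
      then have "it * (dd x (dd (Inr w) P) * it) + (dd (Inr w) P * it) * dd x it = 0"
        by (metis distrib_left mult.assoc mult.commute mult_zero_right)
      then show ?thesis unfolding it by (simp add: algebra_simps eq_neg_iff_add_eq_0)
    qed
    have "mm * h i k = dd (Inl w) P * (dd (Inr w) P * (dd (Inr w) P * it) * dd (Inl i) q - (dd (Inr w) P * it) * (dd (Inr w) P * it) * q * dd (Inl i) (dd (Inr w) P))
      - (dd (Inl w) P * iw) * dd (Inl i) P * (dd (Inr w) P * (dd (Inr w) P * it) * dd (Inl w) q - (dd (Inr w) P * it) * (dd (Inr w) P * it) * q * dd (Inl w) (dd (Inr w) P))"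
      unfolding mm_def h_def L_def b_def a_def q_def[symmetric] derivation_mult[OF derivation_dd] dit
      by (simp add: algebra_simps)
    also have "\<dots> = hlev P w i k" unfolding it iw hlev_def q_def by (simp add: algebra_simps)
    finally show ?thesis ..
  qed
  have hw: "hlev P w w k = 0" "hlev P w i w = 0" for i k by (simp_all add: hlev_def algebra_simps)
  \<comment> \<open>As row and column w of \<open>hlev\<close> are zero, the adjugate identities at
    w force these entries to vanish; the auxiliary 1 at (w, w) then has no effect for c other than
    w.\<close>
  have \<kappa>w: "\<kappa> w c = 0" "\<kappa> c w = 0" if "c \<noteq> w" for c
    using adj(1)[of w c] adj(2)[of c w] that by (auto simp: hw if_distrib[of "\<lambda>u. u * _"] if_distrib[of "\<lambda>u. _ * u"] cong: if_cong)
  have adj2: "(\<Sum>k\<in>UNIV. h i k * (mm * \<kappa> k c)) = (if i = c then \<Delta> else 0)" if c: "c \<noteq> w" for i c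
  proof -
    have "(hlev P w i k + (if i = w \<and> k = w then 1 else 0)) * \<kappa> k c = h i k * (mm * \<kappa> k c)" for k
      using \<kappa>w(1)[OF c] by (simp add: hh mult_ac)
    then show ?thesis using adj(1)[of i c] by simp
  qed
  have adj1: "(\<Sum>j\<in>UNIV. (\<kappa> c j * mm) * h j i) = (if i = c then \<Delta> else 0)" if c: "c \<noteq> w" for i c
  proof -
    have "\<kappa> c j * (hlev P w j i + (if j = w \<and> i = w then 1 else 0)) = (\<kappa> c j * mm) * h j i" for j
      using \<kappa>w(2)[OF c] by (simp add: hh mult_ac)
    then show ?thesis using adj(2)[of c i] by simp
  qed
  define G where "G = (\<Union>i. {X i, (\<lambda>s. T (X i s)), (\<lambda>s. T (T (X i s)))})
      \<union> (\<Union>i. \<Union>j. {(\<lambda>s. L j (X i s)), (\<lambda>s. T (L j (X i s)))})"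
  have finG: "finite G" unfolding G_def by simp
  have closed: "(\<lambda>s. L j (f s)) \<in> cl E \<Delta> G" "(\<lambda>s. Lb j (f s)) \<in> cl E \<Delta> G" "(\<lambda>s. T (f s)) \<in> cl E \<Delta> G"
    if "f \<in> cl E \<Delta> G" for f j
    using closed_system[OF E _ _ _ X Y XY[folded E_def] adj1 adj2 G_def that]
      tvan_err_tder[OF tL, of _ N] tvan_err_tder[OF tLb, of _ N] tvan_err_tder[OF tT, of _ N]
    unfolding E_def by blast+
  obtain n0 where n0: "coef ((tW P \<xi>0 ^^ n0) \<Delta>) [] \<noteq> 0"
  proof (rule ccontr)
    assume "\<not> thesis"
    then have "lie (tW P \<xi>0) \<Delta> = 0" using that by (intro fps_ext) (auto simp: lie_nth)
    then show False using \<Delta> by simp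
  qed
  have "\<forall>s. \<exists>i u. length u = N s \<and> coef (X i s) u \<noteq> 0" using nX by blast
  then obtain \<iota> u0 where \<iota>: "\<And>s. length (u0 s) = N s" "\<And>s. coef (X (\<iota> s) s) (u0 s) \<noteq> 0" by metis
  have pt: "coef (dd (Inr w) P) [] \<noteq> 0"
  proof
    assume "coef (dd (Inr w) P) [] = 0"
    then have "coef (dd (Inr w) P * it) [] = 0" by (simp add: coef_mult)
    then show False unfolding it by (simp add: coef_1)
  qed
  \<comment> \<open>Index 0 carries the condition on \<Delta>, index Suc s the condition on X at
    s.\<close>
  define ff where "ff n \<xi> = (case n of 0 \<Rightarrow> coef ((tW P \<xi> ^^ n0) \<Delta>) [] | Suc s \<Rightarrow> coef ((tW P \<xi> ^^ N s) (X (\<iota> s) s)) [])" for n \<xi>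
  have "\<exists>\<xi>. \<forall>n. ff n \<xi> \<noteq> 0"
  proof (rule polf_generic)
    show "ff n \<in> polf" for n by (cases n) (simp_all add: ff_def[abs_def] polf_tW_funpow)
    show "\<exists>\<xi>. ff n \<xi> \<noteq> 0" for n
    proof (cases n)
      case 0
      then show ?thesis using n0 by (auto simp: ff_def)
    next
      case (Suc s)
      from tW_leading[OF vX X \<iota>(2) \<iota>(1) pt] show ?thesis by (simp add: ff_def Suc)
    qed
  qed
  then obtain \<xi> where \<xi>: "\<And>n. ff n \<xi> \<noteq> 0" by blast
  define W where "W = tW P \<xi>"
  have tW: "W \<in> tder P" unfolding W_def by (rule tW_tder)
  note dW = tder_derivation[OF tW]
  have WD: "lie W \<Delta> \<noteq> 0"
  proof
    assume "lie W \<Delta> = 0"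
    then have "fps_nth (lie W \<Delta>) n0 = 0" by simp
    then show False using \<xi>[of 0] by (simp add: lie_nth W_def ff_def)
  qed
  have WX: "fps_nth (lie W (X (\<iota> s) s)) (N s) \<noteq> 0" for s
    using \<xi>[of "Suc s"] by (simp add: lie_nth W_def ff_def)
  have Wcl: "(\<lambda>s. W (f s)) \<in> cl E \<Delta> G" if f: "f \<in> cl E \<Delta> G" for f
  proof -
    from tW obtain \<alpha> where \<alpha>: "\<And>a. W a = (\<Sum>x\<in>UNIV. \<alpha> x * dd x a)" and W0: "W P = 0" by (auto simp: tder_def)
    have "W g = (\<Sum>j\<in>UNIV. \<alpha> (Inl j) * L j g) + (\<Sum>j\<in>UNIV. \<alpha> (Inr j) * Lb j g) + (\<Sum>j\<in>UNIV. \<alpha> (Inr j) * b j) * T g" for g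
      by (rule tangential_decomposition[where D = W, OF _ W0]) (simp add: \<alpha> sum_UNIV_Plus)
    then show ?thesis by (simp only:) (intro cl.add cl_sum[OF E] cl.scale closed f)
  qed
  have "\<forall>g\<in>G. \<exists>m c e. e \<in> E \<and> (\<forall>s. \<Delta> ^ m * W (g s) = (\<Sum>g'\<in>G. c g' * g' s) + e s)"
  proof
    fix g assume "g \<in> G"
    from cl_normal_form[OF finG E Wcl[OF cl.base[OF this]]]
    show "\<exists>m c e. e \<in> E \<and> (\<forall>s. \<Delta> ^ m * W (g s) = (\<Sum>g'\<in>G. c g' * g' s) + e s)" .
  qed
  from bchoice[OF this] obtain m where "\<forall>g\<in>G. \<exists>c e. e \<in> E \<and> (\<forall>s. \<Delta> ^ m g * W (g s) = (\<Sum>g'\<in>G. c g' * g' s) + e s)" by blast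
  from bchoice[OF this] obtain c where "\<forall>g\<in>G. \<exists>e. e \<in> E \<and> (\<forall>s. \<Delta> ^ m g * W (g s) = (\<Sum>g'\<in>G. c g g' * g' s) + e s)" by blast
  from bchoice[OF this] obtain e where e: "\<And>g. g \<in> G \<Longrightarrow> e g \<in> E"
    and eq: "\<And>g s. g \<in> G \<Longrightarrow> \<Delta> ^ m g * W (g s) = (\<Sum>g'\<in>G. c g g' * g' s) + e g s" by blast
  have "\<forall>g\<in>G. \<exists>c. \<forall>s. flat (2 * N s - c) (lie W (e g s))"
  proof
    fix g assume "g \<in> G"
    from e[OF this, unfolded E_def] obtain c v u where *: "e g = (\<lambda>s. v s + u s)" "\<forall>s. v s \<in> tvan P" "\<forall>s. van (2 * N s - c) (u s)"
      unfolding tvan_err_iff by blast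
    have "flat (2 * N s - c) (lie W (e g s))" for s
    proof -
      have "lie W (e g s) = lie W (u s)" using * by (simp add: lie_add[OF dW] lie_tvan[OF tW])
      moreover have "flat (2 * N s - c) (lie W (u s))" by (rule flat_lie_van[OF tder_van[OF tW] *(3)[rule_format]])
      ultimately show ?thesis by simp
    qed
    then show "\<exists>c. \<forall>s. flat (2 * N s - c) (lie W (e g s))" by blast
  qed
  from bchoice[OF this] obtain cc where cc: "\<And>g s. g \<in> G \<Longrightarrow> flat (2 * N s - cc g) (lie W (e g s))" by blast
  define c0 where "c0 = (\<Sum>g\<in>G. cc g)"
  have c0: "cc g \<le> c0" if "g \<in> G" for g unfolding c0_def using finG that by (intro member_le_sum) auto
  have vG: "van (N s - 2) (g s)" if "g \<in> G" for g s
  proof -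
    have m: "van (N s - 2) a" if "van (N s - 1) a \<or> van (N s) a" for a :: "('n + 'n) hser"
      using that by (auto intro: van_mono)
    have TT: "van (N s - 2) (D (D' (X i s)))" if "D \<in> tder P" "D' \<in> tder P" for D D' i
      using tder_van[OF that(1) tder_van[OF that(2) vX[of s i]]] by (simp add: numeral_2_eq_2)
    from that show ?thesis
      unfolding G_def using vX tder_van[OF tT vX[of s]] tder_van[OF tL vX[of s]] TT tT tL by (auto intro: m)
  qed
  \<comment> \<open>The shift by c0 ensures that N (s + c0) is at least c0, so the subtractions of
    natural numbers below are not truncated.\<close>
  define u where "u s g = lie W (g (s + c0))" for s and g :: "nat \<Rightarrow> ('n + 'n) hser"
  have XG: "X (\<iota> s) \<in> G" for s unfolding G_def by blast
  \<comment> \<open>The common order of all generators at s. It lies between N - 2, because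
    generators contain at most two derivatives of X, and N, because some X keeps its order; errors
    of order 2 N - c0 thus exceed it by N - c0.\<close>
  define \<nu> where "\<nu> s = (LEAST n. \<exists>g\<in>G. fps_nth (u s g) n \<noteq> 0)" for s
  have ex: "\<exists>g\<in>G. fps_nth (u s g) (N (s + c0)) \<noteq> 0" for s
    using XG[of "s + c0"] WX[of "s + c0"] unfolding u_def by blast
  have \<nu>1: "\<exists>g\<in>G. fps_nth (u s g) (\<nu> s) \<noteq> 0" for s unfolding \<nu>_def by (rule LeastI, rule ex)
  have \<nu>2: "\<nu> s \<le> N (s + c0)" for s unfolding \<nu>_def by (rule Least_le) (rule ex)
  have \<nu>3: "N (s + c0) - 2 \<le> \<nu> s" for s
  proof (rule ccontr)
    assume less: "\<not> ?thesis"
    obtain g where g: "g \<in> G" "fps_nth (u s g) (\<nu> s) \<noteq> 0" using \<nu>1 by blast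
    have "flat (N (s + c0) - 2) (u s g)" unfolding u_def by (rule flat_lie_van[OF tder_van[OF tW] vG[OF g(1)]])
    then show False using g(2) less by (simp add: flat_def)
  qed
  show False
  proof (rule no_flat_solution_sequence[where G = G and u = u and \<nu> = \<nu> and B = "\<lambda>s. N (s + c0) - c0"
        and \<delta> = "\<lambda>g. lie W (\<Delta> ^ m g)" and A = "\<lambda>g g'. lie W (c g g')" and e = "\<lambda>s g. lie W (e g (s + c0))"])
    show "finite G" by (rule finG)
    show "lie W (\<Delta> ^ m g) \<noteq> 0" for g by (rule lie_power_nonzero[OF dW WD])
    show "lie W (\<Delta> ^ m g) * fps_deriv (u s g) = (\<Sum>g'\<in>G. lie W (c g g') * u s g') + lie W (e g (s + c0))" if "g \<in> G" for s g
      unfolding u_def lie_deriv lie_mult[OF dW, symmetric] eq[OF that] lie_add[OF dW] lie_sum[OF dW] ..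
    show "flat (\<nu> s) (u s g)" if "g \<in> G" for s g
      unfolding flat_def \<nu>_def using not_less_Least that by blast
    show "\<exists>g\<in>G. fps_nth (u s g) (\<nu> s) \<noteq> 0" for s by (rule \<nu>1)
    show "flat (\<nu> s + (N (s + c0) - c0)) (lie W (e g (s + c0)))" if "g \<in> G" for s g
    proof (rule flat_mono[OF cc[OF that]])
      have "c0 \<le> N (s + c0)" using N[of "s + c0"] by simp
      then show "\<nu> s + (N (s + c0) - c0) \<le> 2 * N (s + c0) - cc g" using \<nu>2[of s] c0[OF that] by linarith
    qed
    have f2: "filterlim (\<lambda>s::nat. s - 2) at_top sequentially" by (rule filterlim_minus_const_nat_at_top)
    show "filterlim \<nu> at_top sequentially"
    proof (rule filterlim_at_top_mono[OF f2], rule always_eventually, rule allI)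
      fix s show "s - 2 \<le> \<nu> s" using N[of "s + c0"] \<nu>3[of s] by linarith
    qed
    have f1: "filterlim (\<lambda>s::nat. s) at_top sequentially" by (rule filterlim_ident)
    show "filterlim (\<lambda>s. N (s + c0) - c0) at_top sequentially"
    proof (rule filterlim_at_top_mono[OF f1], rule always_eventually, rule allI)
      fix s show "s \<le> N (s + c0) - c0" using N[of "s + c0"] by linarith
    qed
  qed
qed

section \<open>Local automorphisms\<close>

lemma holomorphic_map_holo: "holomorphic_map_on F U \<Longrightarrow> holo U (\<lambda>z. F z $ j)"
  unfolding holomorphic_map_on_def holo_def
proof (elim conjE, intro conjI ballI)
  fix z assume "\<forall>z\<in>U. \<exists>D. (F has_derivative D) (at z) \<and> (\<forall>c v. D (c *s v) = c *s D v)" "z \<in> U"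
  then obtain D where D: "(F has_derivative D) (at z)" "\<And>c v. D (c *s v) = c *s D v" by blast
  from bounded_linear.has_derivative[OF bounded_linear_vec_nth D(1), of j] D(2)
  show "\<exists>D. ((\<lambda>z. F z $ j) has_derivative D) (at z) \<and> (\<forall>c v. D (c *s v) = c * D v)"
    by (intro exI[of _ "\<lambda>v. D v $ j"]) simp
qed

lemma holomorphic_map_isCont: "holomorphic_map_on F U \<Longrightarrow> z \<in> U \<Longrightarrow> isCont F z"
  unfolding holomorphic_map_on_def using has_derivative_continuous by blast

lemma holomorphic_map_comp:
  assumes F: "holomorphic_map_on F U" and G: "holomorphic_map_on G V" and FV: "\<And>z. z \<in> W \<Longrightarrow> z \<in> U \<and> F z \<in> V" and W: "open W"
  shows "holomorphic_map_on (\<lambda>z. G (F z)) W"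
  unfolding holomorphic_map_on_def
proof (intro conjI ballI W)
  fix z assume z: "z \<in> W"
  obtain D where D: "(F has_derivative D) (at z)" "\<And>c v. D (c *s v) = c *s D v"
    using F FV[OF z] unfolding holomorphic_map_on_def by blast
  obtain E where E: "(G has_derivative E) (at (F z))" "\<And>c v. E (c *s v) = c *s E v"
    using G FV[OF z] unfolding holomorphic_map_on_def by blast
  from diff_chain_at[OF D(1) E(1)] show "\<exists>D. ((\<lambda>z. G (F z)) has_derivative D) (at z) \<and> (\<forall>c v. D (c *s v) = c *s D v)"
    by (intro exI[of _ "E \<circ> D"]) (simp add: o_def D(2) E(2))
qed

lemma eventually_nhds_isCont:
  assumes "isCont F p" "\<forall>\<^sub>F y in nhds (F p). Q y"
  shows "\<forall>\<^sub>F z in nhds p. Q (F z)"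
  using assms(1)[unfolded isCont_def tendsto_at_iff_tendsto_nhds[of F p]] assms(2)
  by (auto simp: filterlim_iff)

lemma eventually_nhds_smooth:
  assumes "open U" "p \<in> U" "smooth_on U f" "\<forall>\<^sub>F y in nhds (f p). Q y"
  shows "\<forall>\<^sub>F z in nhds p. Q (f z)"
  by (rule eventually_nhds_isCont[OF differentiable_imp_continuous_within[OF smooth_on_differentiable[OF assms(3,2)]] assms(4)])

text \<open>\<open>Aut\<close> asks only that H maps M into M, while the quotient involves an
  inverse. \<sigma>, the composite of \<rho> with H, vanishes on M, and its differential at p is a
  nonzero multiple of that of \<rho>. So \<sigma> has at most one zero on each short line along e,
  and it is the zero of \<rho>.\<close>

lemma automorphism_reflects:
  fixes \<rho> :: "complex ^ 'n \<Rightarrow> real"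
  assumes D: "ldata M p \<rho> w e c r0" and B: "biholomorphic_near H p" and Hp: "H p = p"
    and ev: "\<forall>\<^sub>F z in nhds p. z \<in> M \<longrightarrow> H z \<in> M"
  shows "\<forall>\<^sub>F z in nhds p. H z \<in> M \<longrightarrow> z \<in> M"
proof -
  obtain U0 G where U0: "p \<in> U0" "holomorphic_map_on H U0" "holomorphic_map_on G (H ` U0)" "\<And>z. z \<in> U0 \<Longrightarrow> G (H z) = z"
    using B unfolding biholomorphic_near_def by blast
  have op: "open U0" "open (H ` U0)" using U0 by (auto simp: holomorphic_map_on_def)
  define r where "r = (\<lambda>z. complex_of_real (\<rho> z))"
  note r0 = ldataD(1)[OF D]
  have in0: "\<forall>\<^sub>F z in nhds p. z \<in> ball p r0" using r0 by (intro eventually_nhds_in_open) auto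
  have "\<forall>\<^sub>F z in nhds p. H z \<in> ball p r0"
    by (rule eventually_nhds_isCont[OF holomorphic_map_isCont[OF U0(2,1)]]) (simp only: Hp in0)
  then have "\<forall>\<^sub>F z in nhds p. z \<in> U0 \<and> z \<in> ball p r0 \<and> H z \<in> ball p r0 \<and> (z \<in> M \<longrightarrow> H z \<in> M)"
    using in0 ev eventually_nhds_in_open[OF op(1) U0(1)] by eventually_elim blast
  then obtain a where a: "a > 0" "\<And>z. dist z p < a \<Longrightarrow> z \<in> U0 \<and> z \<in> ball p r0 \<and> H z \<in> ball p r0 \<and> (z \<in> M \<longrightarrow> H z \<in> M)"
    unfolding eventually_nhds_metric by blast
  define A where "A = ball p a"
  have A: "open A" "p \<in> A" using a by (auto simp: A_def)
  have Ain: "z \<in> U0" "z \<in> ball p r0" "H z \<in> ball p r0" "z \<in> M \<longrightarrow> H z \<in> M" if "z \<in> A" for z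
    using a(2)[of z] that by (auto simp: A_def dist_commute)
  define \<sigma> where "\<sigma> z = \<rho> (H z)" for z
  have Hs: "smooth_on A (\<lambda>z. H z $ j)" for j
    by (rule smooth_on_subset[OF holo_smooth[OF holomorphic_map_holo[OF U0(2)]]]) (use Ain in blast)
  have sr: "smooth_on A r" unfolding r_def by (rule smooth_on_subset[OF ldataD(5)[OF D]]) (use Ain in blast)
  have s\<sigma>: "smooth_on A (\<lambda>z. complex_of_real (\<sigma> z))"
    unfolding \<sigma>_def by (rule smooth_on_comp[OF A(1) Hs _ ldataD(5)[OF D]]) (rule Ain)
  have \<sigma>0: "\<sigma> z = 0" if z: "z \<in> A" "\<rho> z = 0" for z
    using Ain[OF z(1)] z(2) ldataD(8)[OF D, of z] ldataD(8)[OF D, of "H z"] by (simp add: \<sigma>_def)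
  have "\<exists>l. \<forall>x. pd x (\<lambda>z. complex_of_real (\<sigma> z)) p = l * pd x (\<lambda>z. complex_of_real (\<rho> z)) p"
    by (rule pd_proportional[OF A sr[unfolded r_def] smooth_on_differentiable[OF s\<sigma> A(2)] ldataD(9)[OF D]])
      (use \<sigma>0 ldataD(6)[OF D, of p] r0 in auto)
  then obtain l where l: "\<And>x. pd x (\<lambda>z. complex_of_real (\<sigma> z)) p = l * pd x r p" unfolding r_def by blast
  \<comment> \<open>If l were 0, all first derivatives of \<sigma> at p would vanish, hence also
    those of \<rho>, which is \<sigma> composed with the local inverse G.\<close>
  have "l \<noteq> 0"
  proof
    assume "l = 0"
    have Gp: "G p = p" using U0(4)[OF U0(1)] Hp by simp
    have pV: "p \<in> H ` U0" using U0(1) Hp by (metis imageI)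
    have "pd (Inl w) r p = pd (Inl w) (\<lambda>z. complex_of_real (\<sigma> (G z))) p"
      by (rule pd_cong[OF op(2) pV]) (auto simp: r_def \<sigma>_def U0(4))
    also have "\<dots> = 0"
    proof (subst pd_comp[of "\<lambda>z. complex_of_real (\<sigma> z)" G p])
      show "(\<lambda>z. complex_of_real (\<sigma> z)) differentiable at (G p)" unfolding Gp by (rule smooth_on_differentiable[OF s\<sigma> A(2)])
      show "(\<lambda>z. G z $ j) differentiable at p" for j
        by (rule smooth_on_differentiable[OF holo_smooth[OF holomorphic_map_holo[OF U0(3)]] pV])
    qed (simp add: Gp l \<open>l = 0\<close>)
    finally show False using ldataD(6)[OF D, of p] r0 by (simp add: r_def)
  qed
  have "Re (dir e (\<lambda>z. complex_of_real (\<sigma> z)) p) \<noteq> 0"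
  proof
    assume 0: "Re (dir e (\<lambda>z. complex_of_real (\<sigma> z)) p) = 0"
    have "dir e (\<lambda>z. complex_of_real (\<sigma> z)) p = l * dir e r p" by (simp add: dir_xv l sum_distrib_left mult_ac)
    moreover have "dir e (\<lambda>z. complex_of_real (\<sigma> z)) p = of_real 0"
      using dir_of_real(1)[OF smooth_on_differentiable[OF s\<sigma> A(2)], of e] unfolding 0 .
    ultimately have "dir e r p = 0" using \<open>l \<noteq> 0\<close> by simp
    then show False using ldataD(7)[OF D, of p] ldataD(1,2)[OF D] by (simp add: r_def)
  qed
  then have n: "dir e (\<lambda>z. complex_of_real (\<sigma> z)) p \<in> {x. Re x \<noteq> 0}" by simp
  have "open {x. Re x \<noteq> 0}" by (intro open_Collect_neq continuous_intros)
  from eventually_nhds_smooth[OF A smooth_on_dir[OF A(1) s\<sigma>] eventually_nhds_in_open[OF this n]]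
  have "\<forall>\<^sub>F z in nhds p. Re (dir e (\<lambda>z. complex_of_real (\<sigma> z)) z) \<noteq> 0" by simp
  then obtain b0 where b0: "b0 > 0" "\<And>z. dist z p < b0 \<Longrightarrow> Re (dir e (\<lambda>z. complex_of_real (\<sigma> z)) z) \<noteq> 0"
    unfolding eventually_nhds_metric by blast
  define b where "b = min a b0"
  define B where "B = ball p b"
  have B: "b > 0" "convex B" "B \<subseteq> A" "\<And>z. z \<in> B \<Longrightarrow> Re (dir e (\<lambda>z. complex_of_real (\<sigma> z)) z) \<noteq> 0"
    using a b0 by (auto simp: b_def B_def A_def dist_commute)
  define \<delta> where "\<delta> = b / (2 * (norm e + 1))"
  have ne: "norm e + 1 > 0" by (simp add: add_nonneg_pos)
  have \<delta>: "\<delta> > 0" "\<delta> * norm e < b / 2"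
    using B(1) ne by (simp_all add: \<delta>_def field_simps)
  have cd: "c * \<delta> > 0" using \<delta> ldataD(2)[OF D] by simp
  have "r p \<in> ball 0 (c * \<delta>)" using cd ldataD(9)[OF D] by (simp add: r_def)
  from eventually_nhds_smooth[OF A sr eventually_nhds_in_open[OF open_ball this]]
  have near: "\<forall>\<^sub>F z in nhds p. \<bar>\<rho> z\<bar> < c * \<delta>" by (simp add: r_def)
  have "\<forall>\<^sub>F z in nhds p. z \<in> ball p (b / 2)" using B(1) by (intro eventually_nhds_in_open) auto
  with near show ?thesis
  proof eventually_elim
    case (elim z)
    show ?case
    proof
      assume HM: "H z \<in> M"
      have zB: "z + s *\<^sub>R e \<in> B" if "\<bar>s\<bar> \<le> \<delta>" for s
      proof -
        have "dist p (z + s *\<^sub>R e) \<le> dist p z + norm (s *\<^sub>R e)"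
          using dist_triangle[of p "z + s *\<^sub>R e" z] by (simp add: dist_norm)
        also have "\<dots> < b / 2 + b / 2"
        proof (rule add_strict_mono)
          show "dist p z < b / 2" using elim(2) by simp
          have "\<bar>s\<bar> * norm e \<le> \<delta> * norm e" using that by (intro mult_right_mono) auto
          then show "norm (s *\<^sub>R e) < b / 2" using \<delta>(2) by simp
        qed
        finally show ?thesis by (simp add: B_def)
      qed
      have zz: "z \<in> B" using zB[of 0] \<delta>(1) by simp
      have "\<exists>s. \<bar>s\<bar> \<le> \<delta> \<and> \<rho> (z + s *\<^sub>R e) = 0"
      proof (rule zero_along[OF B(2) smooth_on_subset[OF sr[unfolded r_def] B(3)] _ zB])
        show "c \<le> Re (dir e (\<lambda>z. complex_of_real (\<rho> z)) z)" if "z \<in> B" for z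
          using ldataD(7)[OF D Ain(2)] B(3) that by blast
      qed (use elim \<delta> in auto)
      then obtain s where s: "\<bar>s\<bar> \<le> \<delta>" "\<rho> (z + s *\<^sub>R e) = 0" by blast
      have s1: "\<sigma> (z + s *\<^sub>R e) = 0" using \<sigma>0 zB[OF s(1)] s(2) B(3) by blast
      have s2: "\<sigma> z = 0" using ldataD(8)[OF D Ain(3)] zz B(3) HM by (auto simp: \<sigma>_def)
      obtain \<xi> where \<xi>: "\<xi> \<in> closed_segment z (z + s *\<^sub>R e)"
        "\<sigma> (z + s *\<^sub>R e) - \<sigma> z = Re (dir (z + s *\<^sub>R e - z) (\<lambda>z. complex_of_real (\<sigma> z)) \<xi>)"
        using mvt_rho[OF B(2) smooth_on_subset[OF s\<sigma> B(3)] zz zB[OF s(1)]] by blast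
      have "\<xi> \<in> B" using \<xi>(1) closed_segment_subset[OF zz zB[OF s(1)] B(2)] by blast
      moreover have "s * Re (dir e (\<lambda>z. complex_of_real (\<sigma> z)) \<xi>) = 0" using \<xi>(2) s1 s2 by (simp add: dir_scaleR)
      ultimately have "s = 0" using B(4) by simp
      then have "\<rho> z = 0" using s(2) by simp
      then show "z \<in> M" using ldataD(8)[OF D Ain(2)] zz B(3) by blast
    qed
  qed
qed

lemma automorphism_quotient:
  fixes \<rho> :: "complex ^ 'n \<Rightarrow> real"
  assumes D: "ldata M p \<rho> w e c r0" and H: "H1 \<in> Aut M p" "H2 \<in> Aut M p" and j: "jet k p H1 = jet k p H2"
    and ne: "\<not> germ_eq p H1 H2"
  shows "\<exists>H b. b > 0 \<and> b \<le> r0 \<and> (\<forall>j. holo (ball p b) (\<lambda>z. H z $ j)) \<and> H p = p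
    \<and> (\<forall>z\<in>ball p b. H z \<in> ball p r0 \<and> (\<rho> z = 0 \<longrightarrow> \<rho> (H z) = 0))
    \<and> (\<forall>j. van (Suc k) (jt p (\<lambda>z. H z $ j - z $ j))) \<and> (\<exists>z\<in>ball p b. H z \<noteq> z)"
proof -
  have H1: "biholomorphic_near H1 p" "H1 p = p" "\<forall>\<^sub>F z in nhds p. z \<in> M \<longrightarrow> H1 z \<in> M"
    and H2: "biholomorphic_near H2 p" "H2 p = p" "\<forall>\<^sub>F z in nhds p. z \<in> M \<longrightarrow> H2 z \<in> M" using H by (auto simp: Aut_def)
  obtain U1 G where U1: "p \<in> U1" "holomorphic_map_on H1 U1" "holomorphic_map_on G (H1 ` U1)" "\<And>z. z \<in> U1 \<Longrightarrow> G (H1 z) = z"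
    using H1(1) unfolding biholomorphic_near_def by blast
  obtain U2 where U2: "p \<in> U2" "holomorphic_map_on H2 U2" using H2(1) unfolding biholomorphic_near_def by blast
  have op: "open U1" "open (H1 ` U1)" "open U2" using U1 U2 by (auto simp: holomorphic_map_on_def)
  have pV: "p \<in> H1 ` U1" using U1(1) H1(2) by (metis imageI)
  have Gp: "G p = p" using U1(4)[OF U1(1)] H1(2) by simp
  \<comment> \<open>G is a local inverse of H1, so this is the quotient of H2 by H1.\<close>
  define H where "H z = G (H2 z)" for z
  note refl = automorphism_reflects[OF D H1]
  have c2: "isCont H2 p" by (rule holomorphic_map_isCont[OF U2(2,1)])
  have cG: "isCont G (H2 p)" unfolding H2(2) by (rule holomorphic_map_isCont[OF U1(3) pV])
  have cH: "isCont H p" unfolding H_def[abs_def] by (rule isCont_o2[OF c2 cG])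
  have Hp: "H p = p" by (simp add: H_def H2(2) Gp)
  note r0 = ldataD(1)[OF D]
  have in0: "\<forall>\<^sub>F z in nhds p. z \<in> ball p r0" using r0 by (intro eventually_nhds_in_open) auto
  have "\<forall>\<^sub>F z in nhds p. H z \<in> ball p r0" by (rule eventually_nhds_isCont[OF cH]) (simp only: Hp in0)
  moreover have "\<forall>\<^sub>F z in nhds p. H1 (H z) \<in> M \<longrightarrow> H z \<in> M" by (rule eventually_nhds_isCont[OF cH]) (simp only: Hp refl)
  moreover have "\<forall>\<^sub>F z in nhds p. H2 z \<in> H1 ` U1"
    by (rule eventually_nhds_isCont[OF c2]) (simp only: H2(2) eventually_nhds_in_open[OF op(2) pV])
  ultimately have "\<forall>\<^sub>F z in nhds p. z \<in> U1 \<and> z \<in> U2 \<and> z \<in> ball p r0 \<and> H z \<in> ball p r0 \<and> H2 z \<in> H1 ` U1 \<and> (z \<in> M \<longrightarrow> H z \<in> M)"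
    using in0 H2(3) eventually_nhds_in_open[OF op(1) U1(1)] eventually_nhds_in_open[OF op(3) U2(1)]
  proof eventually_elim
    case (elim z)
    from elim(3) obtain u where u: "u \<in> U1" "H2 z = H1 u" by blast
    then have "H z = u" by (simp add: H_def U1(4))
    then show ?case using elim u by metis
  qed
  then obtain b0 where b0: "b0 > 0" "\<And>z. dist z p < b0 \<Longrightarrow>
      z \<in> U1 \<and> z \<in> U2 \<and> z \<in> ball p r0 \<and> H z \<in> ball p r0 \<and> H2 z \<in> H1 ` U1 \<and> (z \<in> M \<longrightarrow> H z \<in> M)"
    unfolding eventually_nhds_metric by blast
  define b where "b = min b0 r0"
  have bb: "z \<in> U1" "z \<in> U2" "z \<in> ball p r0" "H z \<in> ball p r0" "H2 z \<in> H1 ` U1" "z \<in> M \<longrightarrow> H z \<in> M" if "z \<in> ball p b" for z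
    using b0(2)[of z] that by (auto simp: b_def dist_commute)
  have U: "open (ball p b)" "p \<in> ball p b" using b0 r0 by (auto simp: b_def)
  have holoH: "holo (ball p b) (\<lambda>z. H z $ j)" for j
    by (rule holomorphic_map_holo) (unfold H_def, rule holomorphic_map_comp[OF U2(2) U1(3)], use bb in auto)
  have h1: "holo (ball p b) (\<lambda>z. H1 z $ j)" for j
    by (rule holo_subset[OF holomorphic_map_holo[OF U1(2)]]) (use bb in auto)
  have h2: "holo (ball p b) (\<lambda>z. H2 z $ j)" for j
    by (rule holo_subset[OF holomorphic_map_holo[OF U2(2)]]) (use bb in auto)
  have "van (Suc k) (jt p (\<lambda>z. H z $ j - z $ j))" for j
  proof -
    \<comment> \<open>The identity is written as G after H1, so that the equality of jets is
      transported through G.\<close>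
    have "vn (ball p b) p (Suc k) (\<lambda>z. G (H2 z) $ j - G (H1 z) $ j)"
    proof (rule vn_comp_diff[OF U, where V = "H1 ` U1" and ?H1.0 = H2 and ?H2.0 = H1 and s = "\<lambda>z. G z $ j"])
      show "smooth_on (ball p b) (\<lambda>z. H2 z $ i)" "smooth_on (ball p b) (\<lambda>z. H1 z $ i)" for i
        by (rule holo_smooth[OF h2] holo_smooth[OF h1])+
      show "H2 z \<in> H1 ` U1" "H1 z \<in> H1 ` U1" if "z \<in> ball p b" for z using bb[OF that] by auto
      show "H2 p = H1 p" using H1 H2 by simp
      show "vn (ball p b) p (Suc k) (\<lambda>z. H2 z $ i - H1 z $ i)" for i
        by (rule jet_eq_imp_vn[OF U h2 h1 j[symmetric]])
      show "smooth_on (H1 ` U1) (\<lambda>z. G z $ j)" by (rule holo_smooth[OF holomorphic_map_holo[OF U1(3)]])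
    qed
    from vn_cong[OF U this, of "\<lambda>z. H z $ j - z $ j"] have "vn (ball p b) p (Suc k) (\<lambda>z. H z $ j - z $ j)"
      using bb(1) U1(4) by (simp add: H_def)
    then show ?thesis by (simp add: vn_def[OF U])
  qed
  moreover have "\<exists>z\<in>ball p b. H z \<noteq> z"
  proof (rule ccontr)
    assume *: "\<not> ?thesis"
    have "H1 z = H2 z" if z: "z \<in> ball p b" for z
    proof -
      from bb(5)[OF z] obtain u where u: "u \<in> U1" "H2 z = H1 u" by blast
      have "H z = u" by (simp add: H_def u U1(4))
      moreover have "H z = z" using * z by blast
      ultimately show ?thesis using u by simp
    qed
    then have "germ_eq p H1 H2" unfolding germ_eq_def using eventually_nhds_in_open[OF U] by (auto elim: eventually_mono)
    then show False using ne by simp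
  qed
  moreover have "\<rho> (H z) = 0" if z: "z \<in> ball p b" "\<rho> z = 0" for z
    using bb[OF z(1)] z(2) ldataD(8)[OF D, of z] ldataD(8)[OF D, of "H z"] by simp
  moreover have "b > 0" "b \<le> r0" using U r0 by (auto simp: b_def)
  ultimately show ?thesis using holoH Hp bb(4) by (intro exI[of _ H] exI[of _ b]) auto
qed

section \<open>Finite jet determination\<close>

text \<open>\<open>B\<close> is the adjugate by Cramer's rule. The extra factor \<open>det A\<close> makes the singular case
  trivial, at the price of squaring the determinant.\<close>

lemma adjugate_identities:
  fixes A :: "complex ^ 'n ^ 'n"
  defines "B \<equiv> (\<lambda>k c. det (\<chi> i j. if j = k then (if i = c then 1 else 0) else A $ i $ j))"
  shows "(\<Sum>k\<in>UNIV. A $ i $ k * (det A * B k c)) = (if i = c then det A * det A else 0)"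
    and "(\<Sum>j\<in>UNIV. (det A * B c j) * A $ j $ i) = (if i = c then det A * det A else 0)"
proof -
  have "(\<Sum>k\<in>UNIV. A $ i $ k * (det A * B k c)) = (if i = c then det A * det A else 0)
    \<and> (\<Sum>j\<in>UNIV. (det A * B c j) * A $ j $ i) = (if i = c then det A * det A else 0)"
  proof (cases "det A = 0")
    case False
    then have "invertible A" by (simp add: invertible_det_nz)
    then obtain A' where A': "A ** A' = mat 1" "A' ** A = mat 1" unfolding invertible_def by blast
    have BA: "B k c = A' $ k $ c * det A" for k c
    proof -
      have "A *v column c A' = column c (A ** A')"
        by (simp add: vec_eq_iff column_def matrix_vector_mult_def matrix_matrix_mult_def)
      then have Ac: "(A *v column c A') $ i = (if i = c then 1 else 0)" for i
        by (simp add: A' column_def mat_def)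
      show ?thesis using cramer_lemma[where A = A and x = "column c A'" and k = k] unfolding Ac B_def by (simp add: column_def)
    qed
    have "(\<Sum>k\<in>UNIV. A $ i $ k * A' $ k $ c) = (if i = c then 1 else 0)"
      using A'(1) by (simp add: vec_eq_iff matrix_matrix_mult_def mat_def)
    moreover have "(\<Sum>k\<in>UNIV. A' $ c $ k * A $ k $ i) = (if c = i then 1 else 0)"
      using A'(2) by (simp add: vec_eq_iff matrix_matrix_mult_def mat_def)
    ultimately show ?thesis
      unfolding BA by (simp add: mult_ac sum_distrib_left[symmetric])
  qed simp
  then show "(\<Sum>k\<in>UNIV. A $ i $ k * (det A * B k c)) = (if i = c then det A * det A else 0)"
    and "(\<Sum>j\<in>UNIV. (det A * B c j) * A $ j $ i) = (if i = c then det A * det A else 0)" by blast+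
qed

lemma tang_sum:
  "tang r e v g z = (\<Sum>x\<in>UNIV. \<Sum>y\<in>UNIV. (xv e x * xv v y) * (pd x r z * pd y g z - pd y r z * pd x g z))"
proof -
  have "(\<Sum>x\<in>UNIV. \<Sum>y\<in>UNIV. (xv e x * xv v y) * (pd x r z * pd y g z - pd y r z * pd x g z))
    = (\<Sum>x\<in>UNIV. \<Sum>y\<in>UNIV. (xv e x * pd x r z) * (xv v y * pd y g z) - (xv e x * pd x g z) * (xv v y * pd y r z))"
    by (intro sum.cong refl) (simp add: algebra_simps)
  also have "\<dots> = dir e r z * dir v g z - dir e g z * dir v r z"
    unfolding dir_xv sum_subtractf sum_product ..
  finally show ?thesis by (simp add: tang_def mult.commute)
qed

lemma jt_tang:
  assumes U: "open U" "p \<in> U" and r: "smooth_on U r" and g: "smooth_on U g"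
  shows "smooth_on U ((tang r e v ^^ n) g)"
    "jt p ((tang r e v ^^ n) g) = (tW (jt p r) (\<chi> x y. xv e x * xv v y) ^^ n) (jt p g)"
proof -
  have st: "smooth_on U (tang r e v g)" if "smooth_on U g" for g
    unfolding tang_def[abs_def] by (intro smooth_on_diff smooth_on_mult smooth_on_dir U r that)
  show s: "smooth_on U ((tang r e v ^^ n) g)" for n by (induction n) (simp_all add: g st)
  show "jt p ((tang r e v ^^ n) g) = (tW (jt p r) (\<chi> x y. xv e x * xv v y) ^^ n) (jt p g)"
  proof (induction n)
    case (Suc n)
    define f where "f = (tang r e v ^^ n) g"
    have f: "smooth_on U f" unfolding f_def by (rule s)
    have d: "smooth_on U (\<lambda>z. pd x r z * pd y f z)" "smooth_on U (\<lambda>z. pd y r z * pd x f z)" for x y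
      by (intro smooth_on_mult smooth_on_pd U r f)+
    have d2: "smooth_on U (\<lambda>z. pd x r z * pd y f z - pd y r z * pd x f z)" for x y by (intro smooth_on_diff U d)
    have d3: "smooth_on U (\<lambda>z. (xv e x * xv v y) * (pd x r z * pd y f z - pd y r z * pd x f z))" for x y
      by (intro smooth_on_mult smooth_on_const U d2)
    have d4: "smooth_on U (\<lambda>z. \<Sum>y\<in>UNIV. (xv e x * xv v y) * (pd x r z * pd y f z - pd y r z * pd x f z))" for x
      by (intro smooth_on_sum U d3)
    have "jt p (tang r e v f) = tW (jt p r) (\<chi> x y. xv e x * xv v y) (jt p f)"
      unfolding tang_sum[abs_def] jt_sum[OF U d4] jt_sum[OF U d3] jt_mult[OF U smooth_on_const[OF U(1)] d2] jt_diff[OF U d]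
        jt_mult[OF U smooth_on_pd[OF r] smooth_on_pd[OF f]] jt_pd[OF U r] jt_pd[OF U f] jt_const[OF U] tW_def
      by simp
    then show ?case by (simp add: f_def Suc)
  qed simp
qed

lemma smooth_lmat:
  assumes "open U" "smooth_on U r"
  shows "smooth_on U (\<lambda>z. lmat r w z $ i $ k)"
  unfolding lmat_def hpol_def vec_lambda_beta
  by (intro smooth_on_add smooth_on_diff smooth_on_mult smooth_on_pd smooth_on_const assms)

lemma jt_lmat:
  assumes U: "open U" "p \<in> U" and r: "smooth_on U r"
  shows "jt p (\<lambda>z. lmat r w z $ i $ k) = hlev (jt p r) w i k + (if i = w \<and> k = w then 1 else 0)"
proof -
  have c: "jt p (\<lambda>z. if i = w \<and> k = w then 1 else 0) = (if i = w \<and> k = w then 1 else 0)"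
    by (simp add: jt_const[OF U] cst_1 cst_0)
  show ?thesis
    unfolding lmat_def hpol_def hlev_def vec_lambda_beta
    by (simp add: c jt_add[OF U] jt_diff[OF U] jt_mult[OF U] jt_pd[OF U] r smooth_on_pd smooth_on_mult[OF U(1)] smooth_on_diff[OF U(1)] smooth_on_const[OF U(1)])
qed

text \<open>The translation into jets: P is the jet of \<rho>, X that of H s - id, Y that of its
  conjugate, and N s the exact order of vanishing of X at s, which is at least s.\<close>

theorem no_quotient_sequence:
  fixes \<rho> :: "complex ^ 'n \<Rightarrow> real" and H :: "nat \<Rightarrow> complex ^ 'n \<Rightarrow> complex ^ 'n" and b :: "nat \<Rightarrow> real"
  assumes D: "ldata M p \<rho> w e c r0" and w': "w' \<noteq> w"
    and nf: "(tang (\<lambda>z. complex_of_real (\<rho> z)) e v ^^ n0) (ldet (\<lambda>z. complex_of_real (\<rho> z)) w) p \<noteq> 0"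
    and b: "\<And>s. b s > 0" "\<And>s. b s \<le> r0" and hol: "\<And>s j. holo (ball p (b s)) (\<lambda>z. H s z $ j)"
    and Hp: "\<And>s. H s p = p"
    and Hin: "\<And>s z. z \<in> ball p (b s) \<Longrightarrow> H s z \<in> ball p r0"
    and HM: "\<And>s z. z \<in> ball p (b s) \<Longrightarrow> \<rho> z = 0 \<Longrightarrow> \<rho> (H s z) = 0"
    and vH: "\<And>s j. van (Suc s) (jt p (\<lambda>z. H s z $ j - z $ j))"
    and nid: "\<And>s. \<exists>z\<in>ball p (b s). H s z \<noteq> z"
  shows False
proof -
  define r where "r = (\<lambda>z. complex_of_real (\<rho> z))"
  have U: "open (ball p r0)" "p \<in> ball p r0" using ldataD(1)[OF D] by auto
  have Ub: "open (ball p (b s))" "p \<in> ball p (b s)" for s using b by auto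
  have sub: "ball p (b s) \<subseteq> ball p r0" for s using b(2)[of s] by auto
  note sr = ldataD(5)[OF D, folded r_def]
  have srb: "smooth_on (ball p (b s)) r" for s by (rule smooth_on_subset[OF sr sub])
  have rw: "pd (Inl w) r z \<noteq> 0" "pd (Inr w) r z \<noteq> 0" if z: "z \<in> ball p r0" for z
    using ldataD(6)[OF D z] pd_Inr_real[OF smooth_on_differentiable[OF sr[unfolded r_def] z], of w]
    by (simp_all add: r_def)
  define P where "P = jt p r"
  have inv: "dd x P * jt p (\<lambda>z. inverse (pd x r z)) = 1" if x: "\<And>z. z \<in> ball p r0 \<Longrightarrow> pd x r z \<noteq> 0" for x
  proof -
    have si: "smooth_on (ball p r0) (\<lambda>z. inverse (pd x r z))" by (intro smooth_on_inverse U smooth_on_pd sr x)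
    have "dd x P * jt p (\<lambda>z. inverse (pd x r z)) = jt p (\<lambda>z. pd x r z * inverse (pd x r z))"
      by (simp add: P_def jt_mult[OF U] smooth_on_pd sr si jt_pd[OF U])
    also have "\<dots> = jt p (\<lambda>z. 1)"
      by (rule jt_cong[OF U]) (simp_all add: smooth_on_mult[OF U(1)] smooth_on_pd sr si x)
    finally show ?thesis by (simp add: jt_const[OF U] cst_1)
  qed
  define f where "f s i z = H s z $ i - z $ i" for s i z
  have hf: "holo (ball p (b s)) (f s i)" for s i
    unfolding holo_def
  proof (intro conjI ballI Ub)
    fix z assume "z \<in> ball p (b s)"
    then obtain D where D: "((\<lambda>z. H s z $ i) has_derivative D) (at z)" "\<And>c v. D (c *s v) = c * D v"
      using hol[of s i] unfolding holo_def by blast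
    have "(f s i has_derivative (\<lambda>v. D v - v $ i)) (at z)"
      unfolding f_def[abs_def] by (rule has_derivative_diff[OF D(1) has_derivative_coord])
    then show "\<exists>D. (f s i has_derivative D) (at z) \<and> (\<forall>c v. D (c *s v) = c * D v)"
      by (intro exI[of _ "\<lambda>v. D v - v $ i"]) (simp add: D(2) right_diff_distrib)
  qed
  note sf = holo_smooth[OF hf]
  note sH = holo_smooth[OF hol]
  have scf: "smooth_on (ball p (b s)) (\<lambda>z. cnj (f s i z))" for s i by (rule smooth_on_cnj[OF Ub(1) sf])
  define X where "X i s = jt p (f s i)" for i s
  define Y where "Y i s = jt p (\<lambda>z. cnj (f s i z))" for i s
  have X0: "dd (Inr k) (X i s) = 0" for k i s
  proof -
    have "dd (Inr k) (X i s) = jt p (pd (Inr k) (f s i))" by (simp add: X_def jt_pd[OF Ub sf])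
    also have "\<dots> = jt p (\<lambda>z. 0)" by (rule jt_cong[OF Ub smooth_on_pd[OF sf]]) (rule holo_pd_Inr[OF hf])
    finally show ?thesis by (simp add: jt_const[OF Ub] cst_0)
  qed
  have Y0: "dd (Inl k) (Y i s) = 0" for k i s
  proof -
    have "dd (Inl k) (Y i s) = jt p (pd (Inl k) (\<lambda>z. cnj (f s i z)))" by (simp add: Y_def jt_pd[OF Ub scf])
    also have "\<dots> = jt p (\<lambda>z. 0)"
    proof (rule jt_cong[OF Ub smooth_on_pd[OF scf]])
      fix z assume z: "z \<in> ball p (b s)"
      show "pd (Inl k) (\<lambda>z. cnj (f s i z)) z = 0"
        using pd_cnj[OF smooth_on_differentiable[OF sf z], of "Inl k"] holo_pd_Inr[OF hf z] by simp
    qed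
    finally show ?thesis by (simp add: jt_const[OF Ub] cst_0)
  qed
  define N where "N s = (LEAST m. \<exists>i u. length u = m \<and> coef (X i s) u \<noteq> 0)" for s
  \<comment> \<open>A holomorphic map with the full jet of the identity is the identity on the ball,
    so the minimum defining N exists.\<close>
  have exN: "\<exists>m i u. length u = m \<and> coef (X i s) u \<noteq> 0" for s
  proof (rule ccontr)
    assume *: "\<not> ?thesis"
    have "pds u (f s i) p = 0" for u i using * coef_jt[OF Ub sf, of s i u] by (simp add: X_def)
    from holo_eq_0_on_ball[OF hf this] have "f s i z = 0" if "z \<in> ball p (b s)" for i z using that .
    then have "H s z = z" if "z \<in> ball p (b s)" for z using that by (simp add: f_def vec_eq_iff)
    then show False using nid by blast
  qed
  have nX: "\<exists>i u. length u = N s \<and> coef (X i s) u \<noteq> 0" for s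
    unfolding N_def by (rule LeastI_ex[OF exN])
  have vX: "van (N s) (X i s)" for i s
    unfolding van_def N_def using not_less_Least by blast
  have Nge: "s \<le> N s" for s
  proof (rule ccontr)
    assume "\<not> s \<le> N s"
    moreover obtain i u where "length u = N s" "coef (X i s) u \<noteq> 0" using nX by blast
    ultimately show False using vH[of s i] by (simp add: van_def X_def f_def[abs_def])
  qed
  have XY: "(\<lambda>s. \<Sum>i\<in>UNIV. dd (Inl i) P * X i s + dd (Inr i) P * Y i s) \<in> tvan_err P N"
  proof -
    \<comment> \<open>The linear part in H s - id. Both r after H s and r itself vanish on M, so
      their jets lie in \<open>tvan\<close>; the rest is a remainder of order 2 N.\<close>
    define g where "g s z = (\<Sum>j\<in>UNIV. pd (Inl j) r z * f s j z + pd (Inr j) r z * cnj (f s j z))" for s z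
    define rem where "rem s z = r (H s z) - r z - g s z" for s z
    have sg1: "smooth_on (ball p (b s)) (\<lambda>z. pd (Inl j) r z * f s j z)" "smooth_on (ball p (b s)) (\<lambda>z. pd (Inr j) r z * cnj (f s j z))" for s j
      by (intro smooth_on_mult Ub smooth_on_pd srb sf scf)+
    have sg: "smooth_on (ball p (b s)) (g s)" for s
      unfolding g_def[abs_def] by (intro smooth_on_sum smooth_on_add Ub sg1)
    have srH: "smooth_on (ball p (b s)) (\<lambda>z. r (H s z))" for s by (rule smooth_on_comp[OF Ub(1) sH Hin sr])
    have jg: "jt p (g s) = (\<Sum>i\<in>UNIV. dd (Inl i) P * X i s + dd (Inr i) P * Y i s)" for s
      unfolding g_def[abs_def]
        jt_sum[OF Ub[of s] smooth_on_add[OF Ub(1)[of s] sg1[of s]]] jt_add[OF Ub[of s] sg1[of s]]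
        jt_mult[OF Ub[of s] smooth_on_pd[OF srb] sf] jt_mult[OF Ub[of s] smooth_on_pd[OF srb] scf] jt_pd[OF Ub[of s] srb]
        P_def X_def Y_def ..
    have jr: "jt p (rem s) = (jt p (\<lambda>z. r (H s z)) - P) - jt p (g s)" for s
      unfolding rem_def[abs_def] jt_diff[OF Ub[of s] smooth_on_diff[OF Ub(1)[of s] srH srb] sg] jt_diff[OF Ub[of s] srH srb] P_def ..
    have tv: "jt p (\<lambda>z. r (H s z)) - P \<in> tvan P" for s
      unfolding P_def
    proof (rule tvan_diff)
      show "jt p (\<lambda>z. r (H s z)) \<in> tvan (jt p r)"
        unfolding r_def
        by (rule jt_tvan[OF Ub srb[unfolded r_def] rw(1)[unfolded r_def] ldataD(9)[OF D] srH[unfolded r_def]])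
          (use HM b(2)[of s] in auto)
      show "jt p r \<in> tvan (jt p r)"
        unfolding r_def
        by (rule jt_tvan[OF U sr[unfolded r_def] rw(1)[unfolded r_def] ldataD(9)[OF D] sr[unfolded r_def]]) auto
    qed
    have vr: "van (2 * N s - 0) (- jt p (rem s))" for s
    proof -
      have "vn (ball p (b s)) p (2 * N s) (rem s)"
        unfolding rem_def[abs_def] g_def f_def
        by (rule vn_taylor2[OF Ub sH Hin sub U(1) Hp _ order_refl sr])
          (use sf vX in \<open>auto simp: vn_def[OF Ub] X_def f_def[abs_def]\<close>)
      then have "van (2 * N s) (0 - jt p (rem s))" by (intro van_diff van_zero) (simp add: vn_def[OF Ub])
      then show ?thesis by simp
    qed
    from tvan_errI[where v = "\<lambda>s. jt p (\<lambda>z. r (H s z)) - P" and u = "\<lambda>s. - jt p (rem s)" and N = N, OF tv vr] show ?thesis by (simp add: jr jg)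
  qed
  define adjf where "adjf k c z = ldet r w z * det (\<chi> i j. if j = k then (if i = c then 1 else 0) else lmat r w z $ i $ j)" for k c z
  have sl: "smooth_on (ball p r0) (\<lambda>z. lmat r w z $ i $ k)" for i k by (rule smooth_lmat[OF U(1) sr])
  have sld: "smooth_on (ball p r0) (ldet r w)"
    unfolding ldet_def[abs_def] det_def by (intro smooth_on_sum smooth_on_mult smooth_on_prod smooth_on_const U sl)
  have sa: "smooth_on (ball p r0) (adjf k c)" for k c
  proof -
    have "smooth_on (ball p r0) (\<lambda>z. if j = k then (if i = c then 1 else 0) else lmat r w z $ i $ j)" for i j
      by (cases "j = k") (simp_all add: smooth_on_const sl)
    then show ?thesis
      unfolding adjf_def[abs_def] det_def vec_lambda_beta by (intro smooth_on_mult smooth_on_sum smooth_on_prod smooth_on_const U sld)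
  qed
  \<comment> \<open>The square of the Levi determinant, as it comes out of
    \<open>adjugate_identities\<close>. It inherits nonflatness because \<open>lie\<close> is
    multiplicative.\<close>
  define \<Delta> where "\<Delta> = jt p (\<lambda>z. ldet r w z * ldet r w z)"
  have jif: "jt p (\<lambda>z. if i = c then ldet r w z * ldet r w z else 0) = (if i = c then \<Delta> else 0)" for i c :: 'n
    by (simp add: \<Delta>_def jt_const[OF U] cst_0)
  define \<kappa> where "\<kappa> k c = jt p (adjf k c)" for k c
  have adj1: "(\<Sum>k\<in>UNIV. (hlev P w i k + (if i = w \<and> k = w then 1 else 0)) * \<kappa> k c) = (if i = c then \<Delta> else 0)" for i c
  proof -
    have "jt p (\<lambda>z. \<Sum>k\<in>UNIV. lmat r w z $ i $ k * adjf k c z) = jt p (\<lambda>z. if i = c then ldet r w z * ldet r w z else 0)"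
    proof (rule jt_cong[OF U])
      show "smooth_on (ball p r0) (\<lambda>z. \<Sum>k\<in>UNIV. lmat r w z $ i $ k * adjf k c z)"
        by (intro smooth_on_sum smooth_on_mult U sl sa)
      show "(\<Sum>k\<in>UNIV. lmat r w z $ i $ k * adjf k c z) = (if i = c then ldet r w z * ldet r w z else 0)" for z
        unfolding adjf_def ldet_def by (rule adjugate_identities(1))
    qed
    then show ?thesis
      by (simp add: jif jt_sum[OF U] jt_mult[OF U] smooth_on_mult[OF U(1)] sl sa jt_lmat[OF U sr] \<kappa>_def P_def)
  qed
  have adj2: "(\<Sum>j\<in>UNIV. \<kappa> c j * (hlev P w j i + (if j = w \<and> i = w then 1 else 0))) = (if i = c then \<Delta> else 0)" for i c
  proof -
    have "jt p (\<lambda>z. \<Sum>j\<in>UNIV. adjf c j z * lmat r w z $ j $ i) = jt p (\<lambda>z. if i = c then ldet r w z * ldet r w z else 0)"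
    proof (rule jt_cong[OF U])
      show "smooth_on (ball p r0) (\<lambda>z. \<Sum>j\<in>UNIV. adjf c j z * lmat r w z $ j $ i)"
        by (intro smooth_on_sum smooth_on_mult U sl sa)
      show "(\<Sum>j\<in>UNIV. adjf c j z * lmat r w z $ j $ i) = (if i = c then ldet r w z * ldet r w z else 0)" for z
        unfolding adjf_def ldet_def by (rule adjugate_identities(2))
    qed
    then show ?thesis
      by (simp add: jif jt_sum[OF U] jt_mult[OF U] smooth_on_mult[OF U(1)] sl sa jt_lmat[OF U sr] \<kappa>_def P_def)
  qed
  \<comment> \<open>With this matrix \<open>tW\<close> is the field \<open>tang\<close> at the level
    of jets (\<open>jt_tang\<close>), so the hypothesis on its iterates says that the determinant
    does not restrict to zero.\<close>
  define \<xi>0 :: "complex ^ ('n + 'n) ^ ('n + 'n)" where "\<xi>0 = (\<chi> x y. xv e x * xv v y)"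
  have "lie (tW P \<xi>0) \<Delta> = lie (tW P \<xi>0) (jt p (ldet r w)) * lie (tW P \<xi>0) (jt p (ldet r w))"
    by (simp add: \<Delta>_def jt_mult[OF U] sld lie_mult[OF tder_derivation[OF tW_tder]])
  moreover have "lie (tW P \<xi>0) (jt p (ldet r w)) \<noteq> 0"
  proof
    assume "lie (tW P \<xi>0) (jt p (ldet r w)) = 0"
    then have "fps_nth (lie (tW P \<xi>0) (jt p (ldet r w))) n0 = 0" by simp
    then have "coef (jt p ((tang r e v ^^ n0) (ldet r w))) [] = 0"
      by (simp add: lie_nth jt_tang(2)[OF U sr sld] P_def \<xi>0_def)
    then have "(tang r e v ^^ n0) (ldet r w) p = 0" by (simp add: coef_jt[OF U jt_tang(1)[OF U sr sld]])
    then show False using nf by (simp add: r_def)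
  qed
  ultimately have \<Delta>0: "lie (tW P \<xi>0) \<Delta> \<noteq> 0" by simp
  show False
    by (rule no_infinitesimal_sequence[OF w' inv inv X0 Y0 XY adj1 adj2 \<Delta>0 Nge vX nX]) (rule rw, assumption)+
qed

theorem theorem1p2:
  fixes M :: "(complex ^ 'N) set" and n :: nat
  assumes "n \<ge> 1" and "CARD('N) = n + 1"
    and "real_analytic_hypersurface M" and "connected M"
    and "\<exists>q\<in>M. levi_nondegenerate_at M q"
  shows "\<forall>p\<in>M. \<exists>k. \<forall>H\<^sub>1\<in>Aut M p. \<forall>H\<^sub>2\<in>Aut M p.
           jet k p H\<^sub>1 = jet k p H\<^sub>2 \<longrightarrow> germ_eq p H\<^sub>1 H\<^sub>2"
proof (rule ballI, rule ccontr)
  fix p assume p: "p \<in> M"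
    and "\<nexists>k. \<forall>H\<^sub>1\<in>Aut M p. \<forall>H\<^sub>2\<in>Aut M p. jet k p H\<^sub>1 = jet k p H\<^sub>2 \<longrightarrow> germ_eq p H\<^sub>1 H\<^sub>2"
  then have neg: "\<exists>H1\<in>Aut M p. \<exists>H2\<in>Aut M p. jet k p H1 = jet k p H2 \<and> \<not> germ_eq p H1 H2" for k by blast
  obtain \<rho> w e c r0 where D: "ldata M p \<rho> w e c r0" using ldata_exists[OF assms(3) p] by blast
  obtain v n0 where nf: "(tang (\<lambda>z. complex_of_real (\<rho> z)) e v ^^ n0) (ldet (\<lambda>z. complex_of_real (\<rho> z)) w) p \<noteq> 0"
    using ldet_not_flat[OF assms(3,4,5) D] by blast
  \<comment> \<open>This is where n at least 1 enters: it provides the second coordinate index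
    required by \<open>cr_operators\<close>.\<close>
  have "\<exists>w'. w' \<noteq> w"
  proof (rule ccontr)
    assume "\<nexists>w'. w' \<noteq> w"
    then have "(UNIV :: 'N set) = {w}" by auto
    then have "CARD('N) = card {w}" by (rule arg_cong)
    then show False using assms(1,2) by simp
  qed
  then obtain w' where w': "w' \<noteq> w" by blast
  define Q where "Q k H b \<longleftrightarrow> b > 0 \<and> b \<le> r0 \<and> (\<forall>j. holo (ball p b) (\<lambda>z. H z $ j)) \<and> H p = p
    \<and> (\<forall>z\<in>ball p b. H z \<in> ball p r0 \<and> (\<rho> z = 0 \<longrightarrow> \<rho> (H z) = 0))
    \<and> (\<forall>j. van (Suc k) (jt p (\<lambda>z. H z $ j - z $ j))) \<and> (\<exists>z\<in>ball p b. H z \<noteq> z)" for k H b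
  have "\<forall>k. \<exists>H b. Q k H b"
  proof
    fix k
    obtain H1 H2 where "H1 \<in> Aut M p" "H2 \<in> Aut M p" "jet k p H1 = jet k p H2" "\<not> germ_eq p H1 H2" using neg by blast
    from automorphism_quotient[OF D this] show "\<exists>H b. Q k H b" unfolding Q_def .
  qed
  from choice[OF this] obtain H where "\<forall>k. \<exists>b. Q k (H k) b" by blast
  from choice[OF this] obtain b where Q: "\<And>k. Q k (H k) (b k)" by blast
  show False
    by (rule no_quotient_sequence[where H = H and b = b, OF D w' nf]) (use Q in \<open>auto simp: Q_def\<close>)
qed

end
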